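(* Let $G$ be a finite group, let $n\ge 0$ be an integer, let $\mathsf{Q}_n(G)$ be the Dowling geometry of rank $n$ associated to $G$, and let $\Gamma\subseteq\operatorname{Aut}(\mathsf{Q}_n(G))$ be the group described in the context. For every integer $i\ge 0$: (1) the coefficient of $t^i$ in the $\Gamma$-equivariant Kazhdan--Lusztig polynomial $P^{\Gamma}_{\mathsf{Q}_n(G)}(t)$ equals (the class of) the permutation representation of $\Gamma$ on the set $\mathcal{S}_G(n,n-i)$ of equivalence classes of $G$-labeled simple quasi series-parallel matroids on $[n]=\{1,\dots,n\}$ of rank $n-i$; (2) the coefficient of $t^i$ in the $\Gamma$-equivariant $Z$-polynomial $Z^{\Gamma}_{\mathsf{Q}_n(G)}(t)$ equals the permutation representation of $\Gamma$ on the set $\mathcal{A}_G(n,n-i)$ of equivalence classes of $G$-labeled quasi series-parallel matroids on $[n]$ of rank $n-i$.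
   Context: Dowling geometry. A partial $G$-partition of $[n]$ is a tuple $(S,f,A_1,\dots,A_k)$ where $S\subseteq[n]$, $f\colon S\to G$, and $S=A_1\sqcup\dots\sqcup A_k$ is a partition of $S$ into unordered nonempty blocks. Two partial $G$-partitions $(S,f,A_1,\dots,A_k)$ and $(T,h,B_1,\dots,B_\ell)$ are equivalent if $S=T$, the set partitions agree after relabeling blocks, and there are $g_1,\dots,g_k\in G$ with $f|_{A_i}=g_i\cdot h|_{A_i}$ for all $i$. One class refines another if the latter is equivalent to a partial $G$-partition obtained from the former by a sequence of merging blocks and deleting blocks. The resulting poset of equivalence classes is a geometric lattice (Dowling), and $\mathsf{Q}_n(G)$ is the simple matroid whose lattice of flats is this lattice; its ground set is the set of atoms (the $n$ classes with $n-1$ singleton blocks and the $|G|\binom n2$ classes with $n-2$ singleton blocks and one block of size 2), and the flat $(S,f,A_1,\dots,A_k)$ has rank $n-k$. The group $\Gamma$. Let $W=G^n\times\mathfrak{S}_n\times\operatorname{Aut}(G)$ with multiplication $((g_1,\dots,g_n),\sigma,\phi)\cdot((h_1,\dots,h_n),\tau,\psi)=((\phi(h_1)g_{\tau(1)},\dots,\phi(h_n)g_{\tau(n)}),\sigma\tau,\phi\psi)$ (the group $(G\wr\mathfrak{S}_n)\rtimes\operatorname{Aut}(G)$). It acts on functions $f$ (defined on subsets of $[n]$, with values in $G$) by $(((g_j),\sigma,\phi)\cdot f)(i)=\phi(f(\sigma^{-1}(i)))\,g_{\sigma^{-1}(i)}$, and on partial $G$-partitions by $(S,f,A_1,\dots,A_k)\mapsto(\sigma(S),((g_j),\sigma,\phi)\cdot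 f,\sigma(A_1),\dots,\sigma(A_k))$; this descends to an order-preserving action on equivalence classes, hence a homomorphism $W\to\operatorname{Aut}(\mathsf{Q}_n(G))$, and $\Gamma$ is its image. Quasi series-parallel matroids. $\mathsf{M}'$ is a parallel extension of $\mathsf{M}$ if there is an element $e$ of $\mathsf{M}'$ lying in a 2-element circuit with $\mathsf{M}'\setminus e=\mathsf{M}$; it is a series extension if there is $e$ lying in a 2-element cocircuit with $\mathsf{M}'/e=\mathsf{M}$. A series-parallel matroid is one obtained from a single loop or a single coloop by a finite (possibly empty) sequence of series and parallel extensions. A quasi series-parallel matroid is a matroid all of whose connected components are series-parallel. A matroid is simple if it has no loops and no 2-element circuits. $G$-labelings. A $G$-labeling of a matroid $\mathsf{M}$ on $E$ is a map $\psi\colon E\to G$; two labelings $\psi,\psi'$ are equivalent if for every connected component $C$ of $\mathsf{M}$ there is $g_C\in G$ with $\psi|_C=g_C\cdot\psi'|_C$. The group $W$ acts on pairs $(\mathsf{M},\psi)$ with $\mathsf{M}$ a matroid on $[n]$ by sending $\mathsf{M}$ to its image $\sigma(\mathsf{M})$ under $\sigma$ and $\psi$ to $((g_j),\sigma,\phi)\cdot\psi$ (formula above); this descends to an action of $\Gamma$ on equivalence classes of $G$-labeled matroids on $[n]$, preserving $\mathcal{S}_G(n,r)$ and $\mathcal{A}_G(n,r)$. Equivariant Kazhdan--Lusztig and $Z$-polynomials. For a finite group $H$ acting on a loopless matroid $\mathsf{M}$ (sending flats to flats), with $\operatorname{VRep}(H)$ the ring of virtual representations, $P^H_{\mathsf{M}}(t)\in\operatorname{VRep}(H)[t]$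 is the unique assignment such that: (i) if $\operatorname{rk}\mathsf{M}=0$ then $P^H_{\mathsf{M}}(t)$ is the trivial representation; (ii) if $\operatorname{rk}\mathsf{M}>0$ then $\deg P^H_{\mathsf{M}}<\tfrac12\operatorname{rk}\mathsf{M}$; (iii) $Z^H_{\mathsf{M}}(t)=\sum_{[F]\in\mathcal{L}(\mathsf{M})/H}t^{\operatorname{rk}F}\operatorname{Ind}_{H_F}^H P^{H_F}_{\mathsf{M}/F}(t)$ is palindromic of degree $\operatorname{rk}\mathsf{M}$, where $\mathcal{L}(\mathsf{M})/H$ is the set of $H$-orbits of flats and $H_F$ is the stabilizer of $F$ (acting on $\mathsf{M}/F$). *)

theory Defs
  imports
    Complex_Main
    "HOL-Library.Disjoint_Sets"
    "HOL-Library.FuncSet"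
    "HOL-Algebra.Bij"
    "HOL-Algebra.Group_Action"
    "HOL-Algebra.Left_Coset"
    "HOL-Algebra.Sym_Groups"
    "Jordan_Normal_Form.Matrix"
    "HOL-Algebra.UnivPoly"
begin

section \<open>Matroids\<close>

datatype 'a matroid = Matroid (ground: "'a set") (indeps: "'a set set")

definition is_matroid :: "'a matroid \<Rightarrow> bool" where
  "is_matroid M \<longleftrightarrow>
     finite (ground M) \<and> indeps M \<subseteq> Pow (ground M) \<and> {} \<in> indeps M \<and>
     (\<forall>I\<in>indeps M. \<forall>J. J \<subseteq> I \<longrightarrow> J \<in> indeps M) \<and>
     (\<forall>I\<in>indeps M. \<forall>J\<in>indeps M. card I < card J \<longrightarrow> (\<exists>e\<in>J - I. insert e I \<in> indeps M))"

definition bases :: "'a matroid \<Rightarrow> 'a set set" where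
  "bases M = {B \<in> indeps M. \<forall>I\<in>indeps M. B \<subseteq> I \<longrightarrow> I = B}"

definition circuits :: "'a matroid \<Rightarrow> 'a set set" where
  "circuits M = {C. C \<subseteq> ground M \<and> C \<notin> indeps M \<and> (\<forall>D. D \<subset> C \<longrightarrow> D \<in> indeps M)}"

definition rank_of :: "'a matroid \<Rightarrow> 'a set \<Rightarrow> nat" where
  "rank_of M X = Max (card ` {I \<in> indeps M. I \<subseteq> X})"

definition matroid_rank :: "'a matroid \<Rightarrow> nat" where
  "matroid_rank M = rank_of M (ground M)"

definition flats :: "'a matroid \<Rightarrow> 'a set set" where
  "flats M = {F. F \<subseteq> ground M \<and> (\<forall>e\<in>ground M - F. rank_of M F < rank_of M (insert e F))}"

definition loopless :: "'a matroid \<Rightarrow> bool" where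
  "loopless M \<longleftrightarrow> (\<forall>e\<in>ground M. {e} \<in> indeps M)"

definition simple_matroid :: "'a matroid \<Rightarrow> bool" where
  "simple_matroid M \<longleftrightarrow> loopless M \<and> (\<forall>C\<in>circuits M. card C \<noteq> 2)"

definition dual_matroid :: "'a matroid \<Rightarrow> 'a matroid" where
  "dual_matroid M = Matroid (ground M) {I. \<exists>B\<in>bases M. I \<subseteq> ground M - B}"

definition cocircuits :: "'a matroid \<Rightarrow> 'a set set" where
  "cocircuits M = circuits (dual_matroid M)"

definition restriction :: "'a matroid \<Rightarrow> 'a set \<Rightarrow> 'a matroid" where
  "restriction M X = Matroid X {I \<in> indeps M. I \<subseteq> X}"

definition deletion :: "'a matroid \<Rightarrow> 'a set \<Rightarrow> 'a matroid" where
  "deletion M X = restriction M (ground M - X)"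

definition contraction :: "'a matroid \<Rightarrow> 'a set \<Rightarrow> 'a matroid" where
  "contraction M X = dual_matroid (deletion (dual_matroid M) X)"

definition image_matroid :: "('a \<Rightarrow> 'b) \<Rightarrow> 'a matroid \<Rightarrow> 'b matroid" where
  "image_matroid s M = Matroid (s ` ground M) ((`) s ` indeps M)"

text \<open>Two distinct elements lie in the same connected component iff some circuit contains both.\<close>

definition connectivity_rel :: "'a matroid \<Rightarrow> ('a \<times> 'a) set" where
  "connectivity_rel M =
     {(e, f). e \<in> ground M \<and> f \<in> ground M \<and> (e = f \<or> (\<exists>C\<in>circuits M. e \<in> C \<and> f \<in> C))}"

definition components :: "'a matroid \<Rightarrow> 'a set set" where
  "components M = ground M // connectivity_rel M"

definition parallel_extension :: "'a matroid \<Rightarrow> 'a matroid \<Rightarrow> bool" where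
  "parallel_extension M' M \<longleftrightarrow>
     is_matroid M' \<and> (\<exists>e. (\<exists>C\<in>circuits M'. card C = 2 \<and> e \<in> C) \<and> deletion M' {e} = M)"

definition series_extension :: "'a matroid \<Rightarrow> 'a matroid \<Rightarrow> bool" where
  "series_extension M' M \<longleftrightarrow>
     is_matroid M' \<and> (\<exists>e. (\<exists>C\<in>cocircuits M'. card C = 2 \<and> e \<in> C) \<and> contraction M' {e} = M)"

inductive series_parallel :: "'a matroid \<Rightarrow> bool" where
  loop: "series_parallel (Matroid {e} {{}})"
| coloop: "series_parallel (Matroid {e} {{}, {e}})"
| parallel: "series_parallel M \<Longrightarrow> parallel_extension M' M \<Longrightarrow> series_parallel M'"
| series: "series_parallel M \<Longrightarrow> series_extension M' M \<Longrightarrow> series_parallel M'"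

definition quasi_series_parallel :: "'a matroid \<Rightarrow> bool" where
  "quasi_series_parallel M \<longleftrightarrow>
     is_matroid M \<and> (\<forall>C\<in>components M. series_parallel (restriction M C))"


section \<open>Virtual representations\<close>

text \<open>A finite-dimensional complex representation is given by its dimension and its matrices.\<close>

type_synonym 'h rep = "nat \<times> ('h \<Rightarrow> complex mat)"

definition GL :: "nat \<Rightarrow> complex mat monoid" where
  "GL d = units_of (ring_mat TYPE(complex) d ())"

definition reps :: "'h monoid \<Rightarrow> 'h rep set" where
  "reps H = {(d, \<rho>). \<rho> \<in> hom H (GL d)}"

definition rep_iso :: "'h monoid \<Rightarrow> 'h rep \<Rightarrow> 'h rep \<Rightarrow> bool" where
  "rep_iso H V W \<longleftrightarrow> (\<exists>P Q. \<forall>h\<in>carrier H. similar_mat_wit (snd V h) (snd W h) P Q)"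

definition zero_rep :: "'h rep" where
  "zero_rep = (0, \<lambda>h. 1\<^sub>m 0)"

definition trivial_rep :: "'h rep" where
  "trivial_rep = (1, \<lambda>h. 1\<^sub>m 1)"

definition sum_rep :: "'h rep \<Rightarrow> 'h rep \<Rightarrow> 'h rep" where
  "sum_rep V W = (fst V + fst W, \<lambda>h. diag_block_mat [snd V h, snd W h])"

definition tensor_rep :: "'h rep \<Rightarrow> 'h rep \<Rightarrow> 'h rep" where
  "tensor_rep V W =
     (let e = fst W; d = fst V * e
      in (d, \<lambda>h. mat d d (\<lambda>(i, j).
            snd V h $$ (i div e, j div e) * snd W h $$ (i mod e, j mod e))))"

text \<open>
  The Grothendieck ring of representations: the pair \<open>(V, W)\<close> stands for the formal difference
  of \<open>V\<close> and \<open>W\<close>.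
\<close>

definition vrep_rel :: "'h monoid \<Rightarrow> (('h rep \<times> 'h rep) \<times> ('h rep \<times> 'h rep)) set" where
  "vrep_rel H =
     {((V, W), (V', W')). V \<in> reps H \<and> W \<in> reps H \<and> V' \<in> reps H \<and> W' \<in> reps H \<and>
        (\<exists>U\<in>reps H. rep_iso H (sum_rep (sum_rep V W') U) (sum_rep (sum_rep V' W) U))}"

definition vrep_diff :: "'h monoid \<Rightarrow> 'h rep \<Rightarrow> 'h rep \<Rightarrow> ('h rep \<times> 'h rep) set" where
  "vrep_diff H V W = vrep_rel H `` {(V, W)}"

definition vrep_class :: "'h monoid \<Rightarrow> 'h rep \<Rightarrow> ('h rep \<times> 'h rep) set" where
  "vrep_class H V = vrep_diff H V zero_rep"

definition VRep :: "'h monoid \<Rightarrow> ('h rep \<times> 'h rep) set ring" where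
  "VRep H =
     \<lparr>carrier = (reps H \<times> reps H) // vrep_rel H,
      Group.monoid.mult = (\<lambda>X Y. \<Union>(V, W)\<in>X. \<Union>(V', W')\<in>Y.
        vrep_diff H (sum_rep (tensor_rep V V') (tensor_rep W W'))
                    (sum_rep (tensor_rep V W') (tensor_rep W V'))),
      one = vrep_class H trivial_rep,
      zero = vrep_class H zero_rep,
      add = (\<lambda>X Y. \<Union>(V, W)\<in>X. \<Union>(V', W')\<in>Y. vrep_diff H (sum_rep V V') (sum_rep W W'))\<rparr>"

text \<open>
  Induction from a subgroup \<open>K\<close>: with \<open>t\<^sub>0, t\<^sub>1, \<dots>\<close> representatives of the left cosets of \<open>K\<close>,
  the block in position \<open>(k, l)\<close> of the matrix of \<open>h\<close> is the matrix of \<open>t\<^sub>k\<^sup>-\<^sup>1 h t\<^sub>l\<close> if this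
  element lies in \<open>K\<close>, and zero otherwise.
\<close>

definition transversal :: "'h monoid \<Rightarrow> 'h set \<Rightarrow> 'h list" where
  "transversal H K =
     (SOME ts. set ts \<subseteq> carrier H \<and> distinct (map (\<lambda>t. t <#\<^bsub>H\<^esub> K) ts) \<and>
               set (map (\<lambda>t. t <#\<^bsub>H\<^esub> K) ts) = lcosets\<^bsub>H\<^esub> K)"

definition ind_rep :: "'h monoid \<Rightarrow> 'h set \<Rightarrow> 'h rep \<Rightarrow> 'h rep" where
  "ind_rep H K V =
     (let ts = transversal H K; d = fst V; m = length ts * d
      in (m, \<lambda>h. mat m m (\<lambda>(i, j).
            let x = inv\<^bsub>H\<^esub> (ts ! (i div d)) \<otimes>\<^bsub>H\<^esub> h \<otimes>\<^bsub>H\<^esub> (ts ! (j div d))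
            in if x \<in> K then snd V x $$ (i mod d, j mod d) else 0)))"

definition Ind :: "'h monoid \<Rightarrow> 'h set \<Rightarrow> ('h rep \<times> 'h rep) set \<Rightarrow> ('h rep \<times> 'h rep) set" where
  "Ind H K X = (\<Union>(V, W)\<in>X. vrep_diff H (ind_rep H K V) (ind_rep H K W))"

definition perm_rep :: "'x set \<Rightarrow> ('h \<Rightarrow> 'x \<Rightarrow> 'x) \<Rightarrow> 'h rep" where
  "perm_rep X a =
     (let xs = (SOME xs. distinct xs \<and> set xs = X)
      in (card X, \<lambda>h. mat (card X) (card X) (\<lambda>(i, j). if a h (xs ! j) = xs ! i then 1 else 0)))"


section \<open>Equivariant Kazhdan--Lusztig and Z-polynomials\<close>

text \<open>
  The extensionality condition makes an action of \<open>H\<close> a function on the carrier of \<open>H\<close> only, so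
  that the stabilizer of the empty flat is \<open>H\<close> together with the given action.
\<close>

definition matroid_action :: "'h monoid \<Rightarrow> 'a matroid \<Rightarrow> ('h \<Rightarrow> 'a \<Rightarrow> 'a) \<Rightarrow> bool" where
  "matroid_action H M a \<longleftrightarrow>
     group_action H (ground M) a \<and> a \<in> extensional (carrier H) \<and>
     (\<forall>h\<in>carrier H. \<forall>F\<in>flats M. a h ` F \<in> flats M)"

definition flat_action :: "'a matroid \<Rightarrow> ('h \<Rightarrow> 'a \<Rightarrow> 'a) \<Rightarrow> 'h \<Rightarrow> 'a set \<Rightarrow> 'a set" where
  "flat_action M a h = (\<lambda>F\<in>flats M. a h ` F)"

definition flat_stab :: "'a matroid \<Rightarrow> 'h monoid \<Rightarrow> ('h \<Rightarrow> 'a \<Rightarrow> 'a) \<Rightarrow> 'a set \<Rightarrow> 'h set" where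
  "flat_stab M H a F = stabilizer H (flat_action M a) F"

definition contraction_action ::
    "'a matroid \<Rightarrow> 'h monoid \<Rightarrow> ('h \<Rightarrow> 'a \<Rightarrow> 'a) \<Rightarrow> 'a set \<Rightarrow> 'h \<Rightarrow> 'a \<Rightarrow> 'a" where
  "contraction_action M H a F = (\<lambda>h\<in>flat_stab M H a F. restrict (a h) (ground M - F))"

text \<open>
  An assignment of a polynomial over the ring of virtual representations, represented by its
  coefficient function, to every equivariant matroid.
\<close>

type_synonym ('a, 'h) assignment =
  "'a matroid \<Rightarrow> 'h monoid \<Rightarrow> ('h \<Rightarrow> 'a \<Rightarrow> 'a) \<Rightarrow> nat \<Rightarrow> ('h rep \<times> 'h rep) set"

definition Z_of :: "('a, 'h) assignment \<Rightarrow> ('a, 'h) assignment" where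
  "Z_of P M H a = (\<lambda>i.
     \<Oplus>\<^bsub>VRep H\<^esub> X \<in> orbits H (flats M) (flat_action M a).
       let F = (SOME F. F \<in> X); K = flat_stab M H a F
       in if rank_of M F \<le> i
          then Ind H K (P (contraction M F) (H\<lparr>carrier := K\<rparr>) (contraction_action M H a F)
                          (i - rank_of M F))
          else \<zero>\<^bsub>VRep H\<^esub>)"

definition palindromic :: "('r, 's) ring_scheme \<Rightarrow> nat \<Rightarrow> (nat \<Rightarrow> 'r) \<Rightarrow> bool" where
  "palindromic R d p \<longleftrightarrow>
     p \<in> carrier (UP R) \<and> deg R p = d \<and>
     (\<forall>i\<le>d. coeff (UP R) p i = coeff (UP R) p (d - i))"

definition KL_assignment :: "('a, 'h) assignment \<Rightarrow> bool" where
  "KL_assignment P \<longleftrightarrow>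
     (\<forall>M H a. is_matroid M \<longrightarrow> loopless M \<longrightarrow> finite (carrier H) \<longrightarrow> matroid_action H M a \<longrightarrow>
        P M H a \<in> carrier (UP (VRep H)) \<and>
        (matroid_rank M = 0 \<longrightarrow> P M H a = \<one>\<^bsub>UP (VRep H)\<^esub>) \<and>
        (matroid_rank M > 0 \<longrightarrow> 2 * deg (VRep H) (P M H a) < matroid_rank M) \<and>
        palindromic (VRep H) (matroid_rank M) (Z_of P M H a))"

definition equivariant_KL :: "('a, 'h) assignment" where
  "equivariant_KL M H a = (THE p. \<exists>P. KL_assignment P \<and> p = P M H a)"

definition equivariant_Z :: "('a, 'h) assignment" where
  "equivariant_Z = Z_of equivariant_KL"


section \<open>Dowling geometries\<close>

text \<open>
  A partial \<open>G\<close>-partition \<open>(S, f, P)\<close>; the function \<open>f\<close> on \<open>S\<close> is represented by its extensional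
  extension.
\<close>

type_synonym 'g partial_partition = "nat set \<times> (nat \<Rightarrow> 'g) \<times> nat set set"

definition partial_partitions ::
    "('g, 'b) monoid_scheme \<Rightarrow> nat \<Rightarrow> 'g partial_partition set" where
  "partial_partitions G n =
     {(S, f, P). S \<subseteq> {1..n} \<and> f \<in> S \<rightarrow>\<^sub>E carrier G \<and> partition_on S P}"

definition partial_partition_rel ::
    "('g, 'b) monoid_scheme \<Rightarrow> nat \<Rightarrow> ('g partial_partition \<times> 'g partial_partition) set" where
  "partial_partition_rel G n =
     {((S, f, P), (T, h, Q)).
        (S, f, P) \<in> partial_partitions G n \<and> (T, h, Q) \<in> partial_partitions G n \<and>
        S = T \<and> P = Q \<and> (\<forall>A\<in>P. \<exists>g\<in>carrier G. \<forall>j\<in>A. f j = g \<otimes>\<^bsub>G\<^esub> h j)}"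

type_synonym 'g dowling_class = "'g partial_partition set"

definition dowling_classes :: "('g, 'b) monoid_scheme \<Rightarrow> nat \<Rightarrow> 'g dowling_class set" where
  "dowling_classes G n = partial_partitions G n // partial_partition_rel G n"

inductive coarsen :: "'g partial_partition \<Rightarrow> 'g partial_partition \<Rightarrow> bool" where
  merge: "A \<in> P \<Longrightarrow> B \<in> P \<Longrightarrow> A \<noteq> B \<Longrightarrow> coarsen (S, f, P) (S, f, insert (A \<union> B) (P - {A, B}))"
| delete: "A \<in> P \<Longrightarrow> coarsen (S, f, P) (S - A, restrict f (S - A), P - {A})"

definition dowling_le :: "'g dowling_class \<Rightarrow> 'g dowling_class \<Rightarrow> bool" where
  "dowling_le X Y \<longleftrightarrow> (\<exists>x\<in>X. \<exists>y\<in>Y. coarsen\<^sup>*\<^sup>* x y)"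

definition dowling_atoms :: "('g, 'b) monoid_scheme \<Rightarrow> nat \<Rightarrow> 'g dowling_class set" where
  "dowling_atoms G n =
     {X \<in> dowling_classes G n.
        \<exists>Z\<in>dowling_classes G n. (\<forall>Y\<in>dowling_classes G n. dowling_le Z Y) \<and> X \<noteq> Z \<and>
          (\<forall>Y\<in>dowling_classes G n. dowling_le Y X \<longrightarrow> Y = Z \<or> Y = X)}"

definition dowling_geometry :: "('g, 'b) monoid_scheme \<Rightarrow> nat \<Rightarrow> 'g dowling_class matroid" where
  "dowling_geometry G n =
     (THE M. is_matroid M \<and> simple_matroid M \<and> ground M = dowling_atoms G n \<and>
        flats M = (\<lambda>X. {A \<in> dowling_atoms G n. dowling_le A X}) ` dowling_classes G n)"


section \<open>The groups acting on Dowling geometries\<close>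

type_synonym 'g wreath = "(nat \<Rightarrow> 'g) \<times> (nat \<Rightarrow> nat) \<times> ('g \<Rightarrow> 'g)"

definition W_group :: "('g, 'b) monoid_scheme \<Rightarrow> nat \<Rightarrow> 'g wreath monoid" where
  "W_group G n =
     \<lparr>carrier = ({1..n} \<rightarrow>\<^sub>E carrier G) \<times> carrier (sym_group n) \<times> carrier (AutoGroup G),
      Group.monoid.mult = (\<lambda>(g, \<sigma>, \<phi>) (h, \<tau>, \<psi>).
        (\<lambda>j\<in>{1..n}. \<phi> (h j) \<otimes>\<^bsub>G\<^esub> g (\<tau> j), \<sigma> \<otimes>\<^bsub>sym_group n\<^esub> \<tau>, \<phi> \<otimes>\<^bsub>AutoGroup G\<^esub> \<psi>)),
      one = (\<lambda>j\<in>{1..n}. \<one>\<^bsub>G\<^esub>, \<one>\<^bsub>sym_group n\<^esub>, \<one>\<^bsub>AutoGroup G\<^esub>)\<rparr>"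

definition label_act ::
    "('g, 'b) monoid_scheme \<Rightarrow> 'g wreath \<Rightarrow> nat set \<Rightarrow> (nat \<Rightarrow> 'g) \<Rightarrow> nat \<Rightarrow> 'g" where
  "label_act G = (\<lambda>(g, \<sigma>, \<phi>) S f.
     \<lambda>i\<in>\<sigma> ` S. \<phi> (f (inv_into UNIV \<sigma> i)) \<otimes>\<^bsub>G\<^esub> g (inv_into UNIV \<sigma> i))"

definition partial_partition_act ::
    "('g, 'b) monoid_scheme \<Rightarrow> 'g wreath \<Rightarrow> 'g partial_partition \<Rightarrow> 'g partial_partition" where
  "partial_partition_act G = (\<lambda>(g, \<sigma>, \<phi>) (S, f, P).
     (\<sigma> ` S, label_act G (g, \<sigma>, \<phi>) S f, (`) \<sigma> ` P))"

definition dowling_hom ::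
    "('g, 'b) monoid_scheme \<Rightarrow> nat \<Rightarrow> 'g wreath \<Rightarrow> 'g dowling_class \<Rightarrow> 'g dowling_class" where
  "dowling_hom G n w = (\<lambda>X\<in>dowling_atoms G n. partial_partition_act G w ` X)"

definition Gamma ::
    "('g, 'b) monoid_scheme \<Rightarrow> nat \<Rightarrow> ('g dowling_class \<Rightarrow> 'g dowling_class) monoid" where
  "Gamma G n = BijGroup (dowling_atoms G n)\<lparr>carrier := dowling_hom G n ` carrier (W_group G n)\<rparr>"

definition Gamma_action :: "('g, 'b) monoid_scheme \<Rightarrow> nat \<Rightarrow>
    ('g dowling_class \<Rightarrow> 'g dowling_class) \<Rightarrow> 'g dowling_class \<Rightarrow> 'g dowling_class" where
  "Gamma_action G n = (\<lambda>\<gamma>\<in>carrier (Gamma G n). \<gamma>)"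


section \<open>Labeled matroids\<close>

type_synonym 'g labeled_matroid = "nat matroid \<times> (nat \<Rightarrow> 'g)"

definition labeling_rel ::
    "('g, 'b) monoid_scheme \<Rightarrow> ('g labeled_matroid \<times> 'g labeled_matroid) set" where
  "labeling_rel G =
     {((M, \<psi>), (M', \<psi>')). M = M' \<and>
        \<psi> \<in> ground M \<rightarrow>\<^sub>E carrier G \<and> \<psi>' \<in> ground M \<rightarrow>\<^sub>E carrier G \<and>
        (\<forall>C\<in>components M. \<exists>g\<in>carrier G. \<forall>j\<in>C. \<psi> j = g \<otimes>\<^bsub>G\<^esub> \<psi>' j)}"

text \<open>The rank is an integer, so that both sets below are empty for negative rank.\<close>

definition A_set :: "('g, 'b) monoid_scheme \<Rightarrow> nat \<Rightarrow> int \<Rightarrow> 'g labeled_matroid set set" where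
  "A_set G n r =
     {(M, \<psi>). quasi_series_parallel M \<and> ground M = {1..n} \<and> int (matroid_rank M) = r \<and>
        \<psi> \<in> {1..n} \<rightarrow>\<^sub>E carrier G} // labeling_rel G"

definition S_set :: "('g, 'b) monoid_scheme \<Rightarrow> nat \<Rightarrow> int \<Rightarrow> 'g labeled_matroid set set" where
  "S_set G n r =
     {(M, \<psi>). simple_matroid M \<and> quasi_series_parallel M \<and> ground M = {1..n} \<and>
        int (matroid_rank M) = r \<and> \<psi> \<in> {1..n} \<rightarrow>\<^sub>E carrier G} // labeling_rel G"

definition labeled_act ::
    "('g, 'b) monoid_scheme \<Rightarrow> 'g wreath \<Rightarrow> 'g labeled_matroid \<Rightarrow> 'g labeled_matroid" where
  "labeled_act G = (\<lambda>(g, \<sigma>, \<phi>) (M, \<psi>).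
     (image_matroid \<sigma> M, label_act G (g, \<sigma>, \<phi>) (ground M) \<psi>))"

text \<open>
  An element of \<open>\<Gamma>\<close> acts on equivalence classes through any of its preimages in \<open>W\<close>; the result
  does not depend on the preimage.
\<close>

definition Gamma_labeled_action :: "('g, 'b) monoid_scheme \<Rightarrow> nat \<Rightarrow>
    ('g dowling_class \<Rightarrow> 'g dowling_class) \<Rightarrow> 'g labeled_matroid set \<Rightarrow> 'g labeled_matroid set" where
  "Gamma_labeled_action G n \<gamma> X =
     labeled_act G (inv_into (carrier (W_group G n)) (dowling_hom G n) \<gamma>) ` X"

end

theory Submission
 imports Defs
begin

abbreviation (input) iff :: "bool => bool => bool" (infixr "<->" 25) where "P <-> Q == P = Q"

text \<open>
 A class of the Dowling lattice is recorded by its set of gains. A labeled quasi series-parallel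
 matroid determines such a set through its loops and parallel classes; those lying exactly over a flat \<open>F\<close>
 are, after identifying parallel elements, labeled simple matroids on the blocks of \<open>F\<close>. By
 induction on the rank of the contraction by \<open>F\<close>, its Kazhdan--Lusztig coefficients are the
 permutation representations on the matroids lying exactly over \<open>F\<close>: induced representations
 sum up to the set of all matroids lying above \<open>F\<close>, matroid duality on the blocks is an
 equivariant involution of this set exchanging the ranks \<open>r\<close> and \<open>d - r\<close>, which gives
 palindromicity, and a simple quasi series-parallel matroid on \<open>d > 0\<close> elements has rank greater
 than \<open>d / 2\<close>, which gives the degree bound.
\<close>

section \<open>Independence, rank and closure\<close>

text \<open>Gains make the lattice concrete: coarsening becomes inclusion, meets become
  intersections, corank is the number of blocks, and the wreath product acts by a formula on single
  triples. The induction cannot stay with \<open>Gamma\<close> and the empty flat: the term of a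
  flat in \<open>Z_of\<close> involves its stabilizer acting on a contraction, so the claim is made
  for every flat \<open>D\<close> and every subgroup of \<open>Gamma\<close> fixing
  \<open>D\<close>. Contractions are not identified with smaller Dowling geometries; all sets of
  labeled matroids are subsets of some \<open>A_set G n r\<close> with one common action, so that an
  induced representation is just the part lying over an orbit of flats. The delicate point is
  duality. The label of a loop is arbitrary within its class, but dualizing may turn loops into
  parallel elements, whose relative label matters. Hence the dual of a class is formed from a
  representative whose labels agree with \<open>D\<close> on loops too. The rank bound makes one of
  the two coefficients in each palindromic equation vanish; it rests on the fact that deleting one
  of two parallel elements keeps a matroid series-parallel.\<close>

lemma matroid_eqI: "ground M = ground N ==> indeps M = indeps N ==> M = N" by (cases M; cases N) simp

lemma is_matroidI:
 assumes "finite (ground M)" "!!I. I : indeps M ==> I <= ground M" "{} : indeps M"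
  "!!I J. I : indeps M ==> J <= I ==> J : indeps M"
  "!!I J. I : indeps M ==> J : indeps M ==> card I < card J ==> EX e:J - I. insert e I : indeps M"
 shows "is_matroid M" using assms unfolding is_matroid_def by blast

lemma finite_ground: "is_matroid M ==> finite (ground M)"
 and indep_ground: "is_matroid M ==> I : indeps M ==> I <= ground M"
 and empty_indep: "is_matroid M ==> {} : indeps M"
 and indep_mono: "is_matroid M ==> I : indeps M ==> J <= I ==> J : indeps M"
 and indep_augment: "is_matroid M ==> I : indeps M ==> J : indeps M ==> card I < card J ==>
  EX e:J - I. insert e I : indeps M" by (auto simp: is_matroid_def)

lemma finite_indep: "is_matroid M ==> I : indeps M ==> finite I"
 using finite_ground indep_ground finite_subset by metis

lemma finite_indeps: "is_matroid M ==> finite (indeps M)"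
 using finite_ground indep_ground by (metis PowI finite_Pow_iff finite_subset subsetI)

lemma indep_le_rank:
 assumes "is_matroid M" "I : indeps M" "I <= X"
 shows "card I <= rank_of M X"
 unfolding rank_of_def using assms finite_indeps[OF assms(1)] by (intro Max_ge) auto

lemma rank_attained:
 assumes "is_matroid M"
 obtains I where "I : indeps M" "I <= X" "card I = rank_of M X"
proof -
 have "rank_of M X : card ` {I : indeps M. I <= X}"
  unfolding rank_of_def using finite_indeps[OF assms] empty_indep[OF assms] by (intro Max_in) auto
 thus ?thesis using that by auto
qed

lemma indep_extend:
 assumes M: "is_matroid M" and "I : indeps M" "I <= X"
 obtains J where "J : indeps M" "I <= J" "J <= X" "card J = rank_of M X"
proof -
 obtain K where K: "K : indeps M" "K <= X" "card K = rank_of M X" using rank_attained[OF M] by blast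
 have "EX J:indeps M. I <= J & J <= X & card J = rank_of M X" using assms(2,3)
 proof (induction "rank_of M X - card I" arbitrary: I)
  case 0
  thus ?case using indep_le_rank[OF M 0(2,3)] by auto
 next
  case (Suc m)
  hence "card I < card K" using K by linarith
  then obtain e where e: "e : K - I" "insert e I : indeps M" using indep_augment[OF M Suc(3) K(1)] by blast
  have "m = rank_of M X - card (insert e I)" using Suc e finite_indep[OF M Suc(3)] by simp
  from Suc(1)[OF this e(2)] show ?case using e K Suc by auto
 qed
 thus ?thesis using that by blast
qed

lemma rank_mono: "is_matroid M ==> X <= Y ==> rank_of M X <= rank_of M Y"
 by (metis indep_le_rank rank_attained subset_trans)

lemma rank_indep: "is_matroid M ==> I : indeps M ==> rank_of M I = card I"
 by (metis indep_le_rank card_mono finite_indep le_antisym order_refl rank_attained)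

lemma rank_le_card: "is_matroid M ==> finite X ==> rank_of M X <= card X" by (metis card_mono rank_attained)

lemma rank_empty: "is_matroid M ==> rank_of M {} = 0" using rank_le_card[of M "{}"] by simp

lemma indep_iff_rank:
 assumes "is_matroid M" "finite X"
 shows "X : indeps M <-> rank_of M X = card X" by (metis assms card_subset_eq rank_attained rank_indep)

lemma rank_Int_ground: "is_matroid M ==> rank_of M (X Int ground M) = rank_of M X" unfolding rank_of_def
 by (rule arg_cong[where f = "%S. Max (card ` S)"]) (use indep_ground in blast)

lemma rank_le_matroid_rank: "is_matroid M ==> rank_of M X <= matroid_rank M"
 unfolding matroid_rank_def by (metis Int_lower2 rank_Int_ground rank_mono)

text \<open>Closure, phrased with independent subsets so that monotonicity is visible;
  \<open>span_iff_rank\<close> supplies the usual description by rank.\<close>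

definition span_of :: "'a matroid => 'a set => 'a set" where
 "span_of M X = {e : ground M. e : X | (EX I:indeps M. I <= X & insert e I ~: indeps M)}"

lemma span_mono: "X <= Y ==> span_of M X <= span_of M Y" unfolding span_of_def by blast

lemma span_superset: "X <= ground M ==> X <= span_of M X" unfolding span_of_def by blast

lemma span_iff_rank:
 assumes M: "is_matroid M" and e: "e : ground M"
 shows "e : span_of M X <-> rank_of M (insert e X) = rank_of M X"
proof
 assume "e : span_of M X"
 then consider "e : X" | I where "I : indeps M" "I <= X" "insert e I ~: indeps M"
  unfolding span_of_def by blast
 thus "rank_of M (insert e X) = rank_of M X"
 proof cases
  case 1
  thus ?thesis by (simp add: insert_absorb)
 next
  case 2
  obtain J where J: "J : indeps M" "I <= J" "J <= X" "card J = rank_of M X"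
   using indep_extend[OF M 2(1,2)] by blast
  obtain K where K: "K : indeps M" "K <= insert e X" "card K = rank_of M (insert e X)"
   using rank_attained[OF M] by blast
  show ?thesis
  proof (rule ccontr)
   assume "rank_of M (insert e X) ~= rank_of M X"
   hence "card J < card K" using J K rank_mono[OF M subset_insertI, of X e] by linarith
   \<comment> \<open>\<open>x\<close> is not \<open>e\<close>, since \<open>insert e J\<close>
     contains the dependent set \<open>insert e I\<close>; so \<open>insert x J\<close> lies in
     \<open>X\<close> and is too large.\<close>
   then obtain x where x: "x : K - J" "insert x J : indeps M" using indep_augment[OF M J(1) K(1)] by blast
   have "x ~= e" using x 2 J indep_mono[OF M x(2), of "insert e I"] by auto
   hence "card (insert x J) <= rank_of M X" using indep_le_rank[OF M x(2), of X] x K J by auto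
   thus False using J x finite_indep[OF M J(1)] by simp
  qed
 qed
next
 assume r: "rank_of M (insert e X) = rank_of M X"
 show "e : span_of M X"
 proof (rule ccontr)
  assume "e ~: span_of M X"
  hence n: "e ~: X" "!!I. I : indeps M ==> I <= X ==> insert e I : indeps M"
   using e unfolding span_of_def by blast+
  obtain J where J: "J : indeps M" "J <= X" "card J = rank_of M X" using rank_attained[OF M] by blast
  have "card (insert e J) <= rank_of M (insert e X)" using indep_le_rank[OF M n(2)[OF J(1,2)]] J by blast
  thus False using r J n(1) finite_indep[OF M J(1)] by (metis card_insert_disjoint
   in_mono not_less_eq_eq order_refl)
 qed
qed

lemma rank_Un_span:
 assumes M: "is_matroid M" and Z: "Z <= span_of M X"
 shows "rank_of M (X Un Z) = rank_of M X"
proof (rule ccontr)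
 assume c: "rank_of M (X Un Z) ~= rank_of M X"
 obtain I where I: "I : indeps M" "I <= X" "card I = rank_of M X" using rank_attained[OF M] by blast
 obtain J where J: "J : indeps M" "J <= X Un Z" "card J = rank_of M (X Un Z)"
  using rank_attained[OF M] by blast
 have "card I < card J" using c I J rank_mono[OF M, of X "X Un Z"] by auto
 then obtain z where z: "z : J - I" "insert z I : indeps M" using indep_augment[OF M I(1) J(1)] by blast
 have "rank_of M (insert z X) = rank_of M X"
 proof (cases "z : X")
  case False
  hence "z : span_of M X" using z J Z by blast
  thus ?thesis using span_iff_rank[OF M] unfolding span_of_def by blast
 qed (simp add: insert_absorb)
 moreover have "card (insert z I) <= rank_of M (insert z X)" using indep_le_rank[OF M z(2)] I by blast
 ultimately show False using z I finite_indep[OF M I(1)] by simp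
qed

lemma span_trans:
 assumes M: "is_matroid M" and Z: "Z <= span_of M X" and e: "e : span_of M (X Un Z)"
 shows "e : span_of M X"
proof -
 have eg: "e : ground M" using e unfolding span_of_def by blast
 have "rank_of M (insert e X) <= rank_of M (insert e (X Un Z))" by (rule rank_mono[OF M]) blast
 also have "... = rank_of M (X Un Z)" using span_iff_rank[OF M eg] e by blast
 also have "... = rank_of M X" by (rule rank_Un_span[OF M Z])
 finally show ?thesis using span_iff_rank[OF M eg] rank_mono[OF M, of X "insert e X"] by fastforce
qed

lemma flats_iff_span:
 assumes "is_matroid M"
 shows "F : flats M <-> F <= ground M & span_of M F = F"
proof -
 have "rank_of M F < rank_of M (insert e F) <-> e ~: span_of M F" if "e : ground M" for e
  using span_iff_rank[OF assms that, of F] rank_mono[OF assms, of F "insert e F"] by force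
 thus ?thesis unfolding flats_def using span_superset[of F M] by (auto simp: span_of_def)
qed

lemma indep_iff_span:
 assumes M: "is_matroid M" and "I <= ground M"
 shows "I : indeps M <-> (ALL e:I. e ~: span_of M (I - {e}))"
proof
 assume I: "I : indeps M"
 show "ALL e:I. e ~: span_of M (I - {e})"
 proof
  fix e assume "e : I"
  have "rank_of M (insert e (I - {e})) = card I" "rank_of M (I - {e}) = card (I - {e})"
   using \<open>e : I\<close> I rank_indep[OF M] indep_mono[OF M I, of "I - {e}"] by (auto simp: insert_absorb)
  thus "e ~: span_of M (I - {e})"
   using span_iff_rank[OF M, of e "I - {e}"] \<open>e : I\<close> assms(2) finite_indep[OF M I]
    card_Diff1_less[of I e] by auto
 qed
next
 assume a: "ALL e:I. e ~: span_of M (I - {e})"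
 obtain J where J: "J : indeps M" "J <= I" "card J = rank_of M I" using rank_attained[OF M] by blast
 have "J = I"
 proof (rule ccontr)
  assume "J ~= I"
  then obtain e where e: "e : I" "e ~: J" using J by blast
  hence "rank_of M (insert e (I - {e})) ~= rank_of M (I - {e})" using a span_iff_rank[OF M] assms(2) by blast
  moreover have "rank_of M I <= rank_of M (I - {e})" using indep_le_rank[OF M J(1), of "I - {e}"] J e by auto
  ultimately show False using rank_mono[OF M, of "I - {e}" I] e by (simp add: insert_absorb)
 qed
 thus "I : indeps M" using J by simp
qed

lemma span_is_flat:
 assumes M: "is_matroid M" and "X <= ground M"
 shows "span_of M X : flats M"
proof -
 have "span_of M (span_of M X) <= span_of M X"
 by (metis M Submission.span_superset Submission.span_trans assms(2) subsetI subset_Un_eq)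
 moreover have "span_of M X <= ground M" unfolding span_of_def by blast
 ultimately show ?thesis using flats_iff_span[OF M] span_superset[of "span_of M X" M] by blast
qed

lemma span_eq_Inter_flats:
 assumes M: "is_matroid M" and X: "X <= ground M"
 shows "span_of M X = \<Inter>{F : flats M. X <= F}"
proof
 show "span_of M X <= \<Inter>{F : flats M. X <= F}"
 by (metis (lifting) Inter_greatest M Submission.span_mono flats_iff_span mem_Collect_eq)
 show "\<Inter>{F : flats M. X <= F} <= span_of M X" using span_is_flat[OF assms] span_superset[OF X] by blast
qed

text \<open>Flats determine closure, as an intersection, and closure determines independence. This
  gives the uniqueness behind the definite description in \<open>dowling_geometry\<close>.\<close>

lemma matroid_determined_by_flats:
 assumes "is_matroid M" "is_matroid N" "ground M = ground N" "flats M = flats N"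
 shows "M = N"
proof (rule matroid_eqI)
 have "I : indeps M <-> I : indeps N" if "I <= ground M" for I
 proof -
  have "span_of M (I - {e}) = span_of N (I - {e})" for e
  proof -
   have 1: "I - {e} <= ground M" "I - {e} <= ground N" using that assms(3) by auto
   show ?thesis
    unfolding span_eq_Inter_flats[OF assms(1) 1(1)] span_eq_Inter_flats[OF assms(2) 1(2)] assms(4) ..
  qed
  thus ?thesis using indep_iff_span[OF assms(1) that] indep_iff_span[OF assms(2), of I]
    that assms(3) by auto
 qed
 thus "indeps M = indeps N" using indep_ground[OF assms(1)] indep_ground[OF assms(2)] assms(3) by blast
qed (rule assms(3))

section \<open>Bases and duality\<close>

lemma bases_iff:
 assumes M: "is_matroid M"
 shows "B : bases M <-> B : indeps M & card B = matroid_rank M"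
by (smt (verit, ccfv_SIG) assms bases_def indep_le_rank card_seteq finite_indep indep_extend indep_ground matroid_rank_def mem_Collect_eq)

lemma indep_iff_basis:
 assumes M: "is_matroid M"
 shows "I : indeps M <-> (EX B:bases M. I <= B)"
proof
 assume I: "I : indeps M"
 show "EX B:bases M. I <= B" using indep_extend[OF M I indep_ground[OF M I]] bases_iff[OF M]
  unfolding matroid_rank_def by metis
qed (use indep_mono[OF M] bases_iff[OF M] in blast)

lemma basis_within:
 assumes M: "is_matroid M" and "I : indeps M" "I <= X" "rank_of M X = matroid_rank M"
 obtains B where "B : bases M" "I <= B" "B <= X"
 using indep_extend[OF assms(1-3)] bases_iff[OF M] assms(4) by metis

lemma coindep_iff_rank:
 assumes M: "is_matroid M" and "I <= ground M"
 shows "I : indeps (dual_matroid M) <-> rank_of M (ground M - I) = matroid_rank M"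
proof
 assume "I : indeps (dual_matroid M)"
 then obtain B where B: "B : bases M" "I <= ground M - B" unfolding dual_matroid_def by auto
 hence "B <= ground M - I" using bases_iff[OF M] indep_ground[OF M, of B] by blast
 hence "matroid_rank M <= rank_of M (ground M - I)" using indep_le_rank[OF M, of B] B bases_iff[OF M] by metis
 thus "rank_of M (ground M - I) = matroid_rank M" using rank_le_matroid_rank[OF M] le_antisym by blast
next
 assume "rank_of M (ground M - I) = matroid_rank M"
 then obtain B where "B : bases M" "B <= ground M - I"
  using basis_within[OF M empty_indep[OF M] empty_subsetI] by metis
 thus "I : indeps (dual_matroid M)" unfolding dual_matroid_def using assms(2) by auto
qed

lemma ground_dual [simp]: "ground (dual_matroid M) = ground M" by (simp add: dual_matroid_def)

text \<open>For augmentation, a basis \<open>BJ\<close> missing \<open>J\<close> is traded for a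
  basis \<open>B\<close> missing \<open>I\<close> with \<open>BJ - I <= B\<close>. If
  \<open>B\<close> contained \<open>J - I\<close>, it would be larger than \<open>BJ\<close>,
  because at most \<open>card (I - J)\<close> elements of \<open>BJ\<close> lie in \<open>I\<close>.
  So some element of \<open>J - I\<close> is outside \<open>B\<close> and can be added to
  \<open>I\<close>.\<close>

lemma dual_is_matroid:
 assumes M: "is_matroid M"
 shows "is_matroid (dual_matroid M)"
proof (rule is_matroidI)
 show "finite (ground (dual_matroid M))" using finite_ground[OF M] by simp
 show "{} : indeps (dual_matroid M)" using coindep_iff_rank[OF M, of "{}"] by (simp add: matroid_rank_def)
 fix I assume I: "I : indeps (dual_matroid M)"
 thus Ig: "I <= ground (dual_matroid M)" by (auto simp: dual_matroid_def)
 show "J : indeps (dual_matroid M)" if "J <= I" for J using I that by (auto simp: dual_matroid_def)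
 fix J assume J: "J : indeps (dual_matroid M)" and less: "card I < card J"
 hence Jg: "J <= ground M" by (auto simp: dual_matroid_def)
 obtain BJ where BJ: "BJ : bases M" "J <= ground M - BJ" using J by (auto simp: dual_matroid_def)
 have fin: "finite I" "finite J" using Ig Jg finite_ground[OF M] finite_subset by auto
 have BJi: "BJ : indeps M" "card BJ = matroid_rank M" using BJ bases_iff[OF M] by auto
 note fBJ = finite_indep[OF M BJi(1)]
 have "BJ - I : indeps M" "BJ - I <= ground M - I"
  using indep_mono[OF M BJi(1)] indep_ground[OF M BJi(1)] by auto
 then obtain B where B: "B : bases M" "BJ - I <= B" "B <= ground M - I"
  using basis_within[OF M] coindep_iff_rank[OF M, of I] I Ig by (metis ground_dual)
 have fB: "finite B" and cB: "card B = matroid_rank M" using B(1) bases_iff[OF M] finite_indep[OF M] by auto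
 have "\<not> J - I <= B"
 proof
  assume s: "J - I <= B"
  have "card (BJ - I) + card (J - I) = card ((BJ - I) Un (J - I))"
   using BJ(2) fBJ fin by (subst card_Un_disjoint) auto
  also have "... <= card B" using s B(2) fB by (intro card_mono) auto
  finally have 1: "card (BJ - I) + card (J - I) <= card BJ" using cB BJi by simp
  have 2: "card BJ = card (BJ - I) + card (BJ Int I)" using card_Int_Diff[OF fBJ, of I] by simp
  have 3: "card (BJ Int I) <= card (I - J)" using BJ(2) fin by (intro card_mono) auto
  have "card I = card (I - J) + card (I Int J)" "card J = card (J - I) + card (I Int J)"
   using card_Int_Diff[OF fin(1), of J] card_Int_Diff[OF fin(2), of I] by (auto simp: Int_commute)
  thus False using 1 2 3 less by linarith
 qed
 then obtain e where e: "e : J - I" "e ~: B" by blast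
 hence "insert e I <= ground M - B" using B Jg Ig by auto
 hence "insert e I : indeps (dual_matroid M)" unfolding dual_matroid_def using B by auto
 thus "EX e:J - I. insert e I : indeps (dual_matroid M)" using e by blast
qed

lemma basis_subset_ground: "is_matroid M ==> B : bases M ==> B <= ground M"
 using bases_iff indep_ground by blast

lemma basis_exists: "is_matroid M ==> EX B. B : bases M" using indep_iff_basis empty_indep by metis

lemma bases_dual:
 assumes M: "is_matroid M"
 shows "bases (dual_matroid M) = (%B. ground M - B) ` bases M"
proof -
 have c: "card (ground M - B) = card (ground M) - matroid_rank M" if "B : bases M" for B
  using that bases_iff[OF M] card_Diff_subset finite_indep[OF M] indep_ground[OF M] by metis
 show ?thesis
 proof (intro Set.set_eqI iffI)
  fix X assume X: "X : bases (dual_matroid M)"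
  then obtain B where B: "B : bases M" "X <= ground M - B" unfolding bases_def dual_matroid_def by auto
  hence "ground M - B : indeps (dual_matroid M)" by (auto simp: dual_matroid_def)
  hence "X = ground M - B" using X B(2) unfolding bases_def by auto
  thus "X : (%B. ground M - B) ` bases M" using B by blast
 next
  fix X assume "X : (%B. ground M - B) ` bases M"
  then obtain B where B: "B : bases M" "X = ground M - B" by blast
  have "I = X" if I: "I : indeps (dual_matroid M)" "X <= I" for I
  proof -
   obtain B' where B': "B' : bases M" "I <= ground M - B'" using I by (auto simp: dual_matroid_def)
   have "X = ground M - B'" using c[OF B(1)] c[OF B'(1)] B(2) I(2) B'(2) finite_ground[OF M]
    by (metis card_subset_eq finite_Diff subset_trans)
   thus ?thesis using I(2) B'(2) by blast
  qed
  moreover have "X : indeps (dual_matroid M)" using B by (auto simp: dual_matroid_def)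
  ultimately show "X : bases (dual_matroid M)" unfolding bases_def by blast
 qed
qed

lemma dual_dual:
 assumes M: "is_matroid M"
 shows "dual_matroid (dual_matroid M) = M"
proof (rule matroid_eqI)
 have "indeps (dual_matroid (dual_matroid M)) = {I. EX B:bases M. I <= ground M - (ground M - B)}"
  unfolding dual_matroid_def[of "dual_matroid M"] using bases_dual[OF M] by auto
 also have "... = {I. EX B:bases M. I <= B}" using basis_subset_ground[OF M] by (auto simp: double_diff)
 also have "... = indeps M" using indep_iff_basis[OF M] by blast
 finally show "indeps (dual_matroid (dual_matroid M)) = indeps M" .
qed simp

lemma matroid_rank_dual:
 assumes M: "is_matroid M"
 shows "matroid_rank (dual_matroid M) + matroid_rank M = card (ground M)"
proof -
 obtain B where B: "B : bases M" using basis_exists[OF M] by blast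
 hence "ground M - B : bases (dual_matroid M)" using bases_dual[OF M] by blast
 hence "card (ground M - B) = matroid_rank (dual_matroid M)"
  using bases_iff[OF dual_is_matroid[OF M]] by blast
 moreover have "card (ground M - B) = card (ground M) - matroid_rank M"
  using B bases_iff[OF M] card_Diff_subset finite_indep[OF M] indep_ground[OF M] by metis
 moreover have "matroid_rank M <= card (ground M)"
  unfolding matroid_rank_def by (rule rank_le_card[OF M finite_ground[OF M]])
 ultimately show ?thesis by simp
qed

section \<open>Minors\<close>

lemma ground_restriction [simp]: "ground (restriction M X) = X"
 and indeps_restriction: "indeps (restriction M X) = {I : indeps M. I <= X}" by (auto simp: restriction_def)

lemma ground_deletion [simp]: "ground (deletion M X) = ground M - X" by (simp add: deletion_def)

lemma restriction_is_matroid: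
 assumes M: "is_matroid M" and "X <= ground M"
 shows "is_matroid (restriction M X)"
proof (rule is_matroidI)
 show "finite (ground (restriction M X))" using assms finite_ground[OF M] finite_subset by auto
qed (use empty_indep[OF M] indep_mono[OF M] indep_augment[OF M] in \<open>auto simp: indeps_restriction\<close>,
 metis (no_types, lifting) DiffD1 DiffI subsetD)

lemma deletion_is_matroid: "is_matroid M ==> is_matroid (deletion M X)"
 unfolding deletion_def by (rule restriction_is_matroid) auto

lemma indeps_deletion: "is_matroid M ==> indeps (deletion M X) = {I : indeps M. I Int X = {}}"
 unfolding deletion_def indeps_restriction using indep_ground by blast

lemma rank_restriction: "Y <= X ==> rank_of (restriction M X) Y = rank_of M Y"
 unfolding rank_of_def indeps_restriction by (rule arg_cong[where f = "%S. Max (card ` S)"]) blast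

lemma ground_contraction [simp]: "ground (contraction M X) = ground M - X" by (simp add: contraction_def)

lemma contraction_is_matroid: "is_matroid M ==> is_matroid (contraction M X)"
 unfolding contraction_def by (intro dual_is_matroid deletion_is_matroid)

lemma deletion_empty: "is_matroid M ==> deletion M {} = M" by (rule matroid_eqI) (auto simp: indeps_deletion)

lemma contraction_empty: "is_matroid M ==> contraction M {} = M"
 unfolding contraction_def by (simp add: deletion_empty dual_is_matroid dual_dual)

lemma deletion_deletion: "is_matroid M ==> deletion (deletion M X) Y = deletion M (X Un Y)"
 by (rule matroid_eqI) (auto simp: indeps_deletion deletion_is_matroid)

lemma contraction_contraction:
 assumes M: "is_matroid M"
 shows "contraction (contraction M X) Y = contraction M (X Un Y)" unfolding contraction_def
 by (simp add: dual_dual[OF deletion_is_matroid[OF dual_is_matroid[OF M]]]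
   deletion_deletion[OF dual_is_matroid[OF M]])

lemma dual_contraction: "is_matroid M ==> dual_matroid (contraction M X) = deletion (dual_matroid M) X"
 unfolding contraction_def by (intro dual_dual deletion_is_matroid dual_is_matroid)

lemma dual_deletion: "is_matroid M ==> dual_matroid (deletion M X) = contraction (dual_matroid M) X"
 unfolding contraction_def by (simp add: dual_dual)

text \<open>\<open>contraction\<close> is defined through the dual; this recovers the usual
  description relative to a maximal independent subset \<open>Y\<close> of \<open>X\<close>, from
  which rank and flats of a contraction follow.\<close>

lemma indeps_contraction:
 assumes M: "is_matroid M" and X: "X <= ground M"
  and Y: "Y : indeps M" "Y <= X" "card Y = rank_of M X"
 shows "indeps (contraction M X) = {I. I Int X = {} & I Un Y : indeps M}"
proof -
 let ?D = "deletion (dual_matroid M) X"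
 have Dm: "is_matroid ?D" by (intro deletion_is_matroid dual_is_matroid M)
 have IC: "indeps (contraction M X) = {I. EX C:bases ?D. I <= ground M - X - C}"
  unfolding contraction_def dual_matroid_def[of ?D] by simp
 have YX: "B Int X = Y" if "B : indeps M" "Y <= B" for B
 proof -
  have "card (B Int X) <= card Y" using indep_le_rank[OF M, of "B Int X" X] indep_mono[OF M that(1)] Y by simp
  thus ?thesis using Y that finite_indep[OF M that(1)] by (metis card_seteq finite_Int le_inf_iff)
 qed
 show ?thesis
 proof (intro Set.set_eqI iffI)
  fix I assume "I : indeps (contraction M X)"
  then obtain C where C: "C : bases ?D" "I <= ground M - X - C" using IC by blast
  hence Ci: "C : indeps (dual_matroid M)" "C Int X = {}"
   unfolding bases_def using indeps_deletion[OF dual_is_matroid[OF M]] by auto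
  have CE: "C <= ground M" using indep_ground[OF dual_is_matroid[OF M] Ci(1)] by simp
  have "Y <= ground M - C" using Y X Ci by blast
  then obtain B where B: "B : bases M" "Y <= B" "B <= ground M - C"
   using basis_within[OF M Y(1)] coindep_iff_rank[OF M CE] Ci(1) by metis
  hence Bi: "B : indeps M" using bases_iff[OF M] by blast
  have "ground M - X - B : indeps ?D"
   using B(1) indeps_deletion[OF dual_is_matroid[OF M]] by (auto simp: dual_matroid_def)
  moreover have "C <= ground M - X - B" using B CE Ci by blast
  ultimately have "ground M - X - B = C" using C(1) unfolding bases_def by blast
  hence "I Un Y <= B" using C(2) B(2) by blast
  hence "I Un Y : indeps M" using indep_mono[OF M Bi] by blast
  thus "I : {I. I Int X = {} & I Un Y : indeps M}" using C(2) by blast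
 next
  fix I assume "I : {I. I Int X = {} & I Un Y : indeps M}"
  hence I: "I Int X = {}" "I Un Y : indeps M" by auto
  obtain B where B: "B : bases M" "I Un Y <= B" using indep_iff_basis[OF M] I(2) by blast
  hence Bi: "B : indeps M" "card B = matroid_rank M" using bases_iff[OF M] by auto
  let ?C = "ground M - X - B"
  have Ci: "?C : indeps ?D"
   using B(1) indeps_deletion[OF dual_is_matroid[OF M]] by (auto simp: dual_matroid_def)
  \<comment> \<open>A larger set \<open>J\<close> would avoid a basis \<open>B'\<close> with fewer
    elements than \<open>B\<close> outside \<open>X\<close>. Inside \<open>X\<close> it has at most
    \<open>card Y\<close> elements, so \<open>B'\<close> would be too small.\<close>
  have "J = ?C" if J: "J : indeps ?D" "?C <= J" for J
  proof (rule ccontr)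
   assume "J ~= ?C"
   have J': "J : indeps (dual_matroid M)" "J Int X = {}"
    using J(1) indeps_deletion[OF dual_is_matroid[OF M]] by auto
   then obtain B' where B': "B' : bases M" "J <= ground M - B'" by (auto simp: dual_matroid_def)
   obtain e where e: "e : J" "e ~: ?C" using J(2) \<open>J ~= ?C\<close> by blast
   have eB: "e : B - X" using e J' B' by blast
   have "B' - X <= B - X - {e}" using B'(2) J(2) e basis_subset_ground[OF M B'(1)] by blast
   hence 1: "card (B' - X) < card (B - X)" using eB finite_indep[OF M Bi(1)]
    by (meson card_Diff1_less card_mono finite_Diff le_less_trans)
   have B'i: "B' : indeps M" "card B' = matroid_rank M" using B' bases_iff[OF M] by auto
   have "card (B' Int X) <= card Y"
    using indep_le_rank[OF M, of "B' Int X" X] indep_mono[OF M B'i(1)] Y by simp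
   moreover have "B Int X = Y" using YX[OF Bi(1)] B by blast
   ultimately show False using 1 card_Int_Diff[OF finite_indep[OF M Bi(1)], of X]
     card_Int_Diff[OF finite_indep[OF M B'i(1)], of X] Bi B'i by simp
  qed
  hence "?C : bases ?D" using Ci unfolding bases_def by blast
  moreover have "I <= ground M - X - ?C" using I B basis_subset_ground[OF M B(1)] by blast
  ultimately show "I : indeps (contraction M X)" using IC by blast
 qed
qed

lemma rank_contraction:
 assumes M: "is_matroid M" and X: "X <= ground M" and "Z Int X = {}"
 shows "rank_of (contraction M X) Z + rank_of M X = rank_of M (Z Un X)"
proof -
 note CM = contraction_is_matroid[OF M, of X]
 obtain Y where Y: "Y : indeps M" "Y <= X" "card Y = rank_of M X" using rank_attained[OF M] by blast
 note ind = indeps_contraction[OF M X Y]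
 show ?thesis
 proof (rule antisym)
  obtain I where I: "I : indeps (contraction M X)" "I <= Z" "card I = rank_of (contraction M X) Z"
   using rank_attained[OF CM] by blast
  have i: "I Un Y : indeps M" "I Int Y = {}" using I(1) ind Y(2) by auto
  have "card I + card Y = card (I Un Y)" using i finite_indep[OF M i(1)] by (simp add: card_Un_disjoint)
  also have "... <= rank_of M (Z Un X)" using indep_le_rank[OF M i(1)] I Y by blast
  finally show "rank_of (contraction M X) Z + rank_of M X <= rank_of M (Z Un X)" using I Y by simp
 next
  obtain J where J: "J : indeps M" "Y <= J" "J <= Z Un X" "card J = rank_of M (Z Un X)"
   using indep_extend[OF M Y(1), of "Z Un X"] Y(2) by auto
  have JX: "J Int X = Y"
   using indep_le_rank[OF M, of "J Int X" X] indep_mono[OF M J(1)] J Y finite_indep[OF M J(1)]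
   by (metis card_seteq finite_Int inf_le1 inf_le2 le_inf_iff)
  have "J - X : indeps (contraction M X)" using ind indep_mono[OF M J(1), of "J - X Un Y"] J(2) by auto
  hence "card (J - X) <= rank_of (contraction M X) Z" using indep_le_rank[OF CM] J(3) by blast
  moreover have "card J = card Y + card (J - X)"
   using card_Int_Diff[OF finite_indep[OF M J(1)], of X] JX by simp
  ultimately show "rank_of M (Z Un X) <= rank_of (contraction M X) Z + rank_of M X" using J Y by simp
 qed
qed

lemma matroid_rank_contraction:
 assumes "is_matroid M" "X <= ground M"
 shows "matroid_rank (contraction M X) + rank_of M X = matroid_rank M"
 using rank_contraction[OF assms, of "ground M - X"] assms(2) by (auto simp: matroid_rank_def Un_absorb2)

lemma flats_contraction:
 assumes M: "is_matroid M" and X: "X <= ground M"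
 shows "F : flats (contraction M X) <-> F Int X = {} & F Un X : flats M"
proof -
 have "rank_of (contraction M X) F < rank_of (contraction M X) (insert e F) <->
   rank_of M (F Un X) < rank_of M (insert e (F Un X))" if "F Int X = {}" "e ~: X" for e
 proof -
  have "insert e F Int X = {}" using that by blast
  from rank_contraction[OF M X this] rank_contraction[OF M X that(1)] show ?thesis
   by (simp only: Un_insert_left) linarith
 qed
 thus ?thesis unfolding flats_def using X by auto
qed

lemma loopless_contraction:
 assumes M: "is_matroid M" and F: "F : flats M"
 shows "loopless (contraction M F)" unfolding loopless_def
proof
 fix e assume e: "e : ground (contraction M F)"
 have FE: "F <= ground M" using F unfolding flats_def by blast
 have "rank_of M F < rank_of M (insert e F)" using F e unfolding flats_def by auto
 hence "0 < rank_of (contraction M F) {e}" using rank_contraction[OF M FE, of "{e}"] e by simp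
 thus "{e} : indeps (contraction M F)" using indep_iff_rank[OF contraction_is_matroid[OF M], of "{e}"]
   rank_le_card[OF contraction_is_matroid[OF M], of "{e}" F] by simp
qed

lemma indeps_contraction_single:
 assumes M: "is_matroid M" and "{x} : indeps M"
 shows "indeps (contraction M {x}) = {I. x ~: I & insert x I : indeps M}"
 using indeps_contraction[OF M, of "{x}" "{x}"] indep_ground[OF assms] assms
  rank_indep[OF assms] by auto

section \<open>Circuits and connectivity\<close>

lemma circuitD:
 assumes "C : circuits M"
 shows "C <= ground M" "C ~: indeps M" "D < C ==> D : indeps M" using assms unfolding circuits_def by auto

lemma circuit_remove: "C : circuits M ==> e : C ==> C - {e} : indeps M" by (rule circuitD(3)) auto

lemma finite_circuit: "is_matroid M ==> C : circuits M ==> finite C"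
 using circuitD(1) finite_ground finite_subset by metis

lemma dependent_has_circuit:
 assumes M: "is_matroid M" and "X <= ground M" "X ~: indeps M"
 obtains C where "C : circuits M" "C <= X"
proof -
 have "finite X" using assms finite_ground finite_subset by metis
 hence "EX C:circuits M. C <= X" using assms(2,3)
 proof (induction X rule: finite_psubset_induct)
  case (psubset X)
  show ?case
  proof (cases "X : circuits M")
   case False
   then obtain D where "D < X" "D ~: indeps M" using psubset unfolding circuits_def by blast
   thus ?thesis using psubset(2)[of D] psubset(3) by blast
  qed auto
 qed
 thus ?thesis using that by blast
qed

lemma circuit_subset_eq: "C : circuits M ==> D : circuits M ==> C <= D ==> C = D"
 unfolding circuits_def by blast

lemma circuit_span: "C : circuits M ==> e : C ==> e : span_of M (C - {e})"
 using circuit_remove[of C M e] circuitD(1,2)[of C M] unfolding span_of_def by (auto simp: insert_absorb)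

lemma span_circuit:
 assumes M: "is_matroid M" and e: "e : span_of M Y" "e ~: Y"
 obtains C where "C : circuits M" "e : C" "C <= insert e Y"
proof -
 obtain I where I: "I : indeps M" "I <= Y" "insert e I ~: indeps M" "e : ground M"
  using e unfolding span_of_def by blast
 then obtain C where C: "C : circuits M" "C <= insert e I"
  using dependent_has_circuit[OF M, of "insert e I"] indep_ground[OF M I(1)] by auto
 have "e : C" using C I(1) indep_mono[OF M I(1), of C] circuitD(2)[OF C(1)] by blast
 thus ?thesis using that C I(2) by blast
qed

text \<open>Closure does the work: \<open>x\<close> lies in the closure of the rest of
  \<open>C\<^sub>2\<close>, so it may be dropped from a set that spans \<open>e\<close>, and a
  circuit through \<open>e\<close> is found inside what remains.\<close>

lemma strong_circuit_elimination:
 assumes M: "is_matroid M" and C: "C\<^sub>1 : circuits M" "C\<^sub>2 : circuits M"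
  and x: "x : C\<^sub>1 Int C\<^sub>2" and e: "e : C\<^sub>1 - C\<^sub>2"
 obtains D where "D : circuits M" "e : D" "D <= C\<^sub>1 Un C\<^sub>2 - {x}"
proof -
 let ?Y = "C\<^sub>1 Un C\<^sub>2 - {x, e}"
 have "C\<^sub>2 - {x} <= ?Y" using e by blast
 hence x: "x : span_of M ?Y" using circuit_span[OF C(2), of x] span_mono x by blast
 have "e : span_of M (C\<^sub>1 - {e})" using circuit_span[OF C(1)] e by blast
 moreover have "C\<^sub>1 - {e} <= ?Y Un {x}" by blast
 ultimately have "e : span_of M (?Y Un {x})" using span_mono by blast
 hence "e : span_of M ?Y" using span_trans[OF M, of "{x}" ?Y e] x by blast
 then obtain D where "D : circuits M" "e : D" "D <= insert e ?Y" using span_circuit[OF M] by blast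
 thus ?thesis using that e assms(4) by blast
qed

text \<open>Induction on the size of the union. Eliminating a common element \<open>f\<close> gives
  a circuit \<open>C\<^sub>3\<close> through \<open>e\<close> and a circuit \<open>C\<^sub>4\<close>
  through \<open>g\<close>, both missing \<open>f\<close>; either \<open>C\<^sub>3\<close> and
  \<open>C\<^sub>2\<close> or \<open>C\<^sub>3\<close> and \<open>C\<^sub>4\<close> meet and have a
  smaller union.\<close>

lemma connectivity_circuit_trans:
 assumes M: "is_matroid M" and "C\<^sub>1 : circuits M" "C\<^sub>2 : circuits M" "C\<^sub>1 Int C\<^sub>2 ~= {}"
  "e : C\<^sub>1" "g : C\<^sub>2"
 shows "EX C:circuits M. e : C & g : C" using assms(2-)
proof (induction "card (C\<^sub>1 Un C\<^sub>2)" arbitrary: C\<^sub>1 C\<^sub>2 rule: less_induct)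
 case less
 note H = less.prems
 show ?case
 proof (cases "g : C\<^sub>1 | e : C\<^sub>2")
  case True
  thus ?thesis using H by blast
 next
  case False
  have fin: "finite (C\<^sub>1 Un C\<^sub>2)" using finite_circuit[OF M] H by blast
  obtain f where f: "f : C\<^sub>1 Int C\<^sub>2" using H by blast
  obtain C\<^sub>3 where C3: "C\<^sub>3 : circuits M" "e : C\<^sub>3" "C\<^sub>3 <= C\<^sub>1 Un C\<^sub>2 - {f}"
   using strong_circuit_elimination[OF M H(1,2) f, of e] H False by blast
  have fb: "f : C\<^sub>2 Int C\<^sub>1" using f by blast
  obtain C\<^sub>4 where C4: "C\<^sub>4 : circuits M" "g : C\<^sub>4" "C\<^sub>4 <= C\<^sub>2 Un C\<^sub>1 - {f}"
   using strong_circuit_elimination[OF M H(2,1) fb, of g] H False by blast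
  have "\<not> C\<^sub>3 <= C\<^sub>1" using C3(3) f circuit_subset_eq[OF C3(1) H(1)] by blast
  hence m3: "C\<^sub>3 Int (C\<^sub>2 - C\<^sub>1) ~= {}" using C3(3) by blast
  have "\<not> C\<^sub>4 <= C\<^sub>2" using C4(3) f circuit_subset_eq[OF C4(1) H(2)] by blast
  hence m4: "C\<^sub>4 Int (C\<^sub>1 - C\<^sub>2) ~= {}" using C4(3) by blast
  show ?thesis
  proof (cases "C\<^sub>3 Un C\<^sub>2 = C\<^sub>1 Un C\<^sub>2")
   case False
   hence "C\<^sub>3 Un C\<^sub>2 < C\<^sub>1 Un C\<^sub>2" using C3(3) by blast
   hence "card (C\<^sub>3 Un C\<^sub>2) < card (C\<^sub>1 Un C\<^sub>2)" by (rule psubset_card_mono[OF fin])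
   from less.hyps[OF this C3(1) H(2) _ C3(2) H(5)] m3 show ?thesis by blast
  next
   case True
   \<comment> \<open>Here \<open>C\<^sub>3\<close> contains \<open>C\<^sub>1 - C\<^sub>2\<close>,
     which \<open>C\<^sub>4\<close> meets; the union is smaller because both circuits miss
     \<open>f\<close>.\<close>
   have "C\<^sub>3 Int C\<^sub>4 ~= {}" using True m4 by blast
   moreover have "C\<^sub>3 Un C\<^sub>4 < C\<^sub>1 Un C\<^sub>2" using C3(3) C4(3) f by blast
   hence "card (C\<^sub>3 Un C\<^sub>4) < card (C\<^sub>1 Un C\<^sub>2)" by (rule psubset_card_mono[OF fin])
   ultimately show ?thesis using less.hyps[OF _ C3(1) C4(1) _ C3(2) C4(2)] by blast
  qed
 qed
qed

lemma equiv_connectivity: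
 assumes M: "is_matroid M"
 shows "equiv (ground M) (connectivity_rel M)"
proof (rule equivI)
 show "connectivity_rel M <= ground M \<times> ground M" unfolding connectivity_rel_def by auto
 show "refl_on (ground M) (connectivity_rel M)" unfolding refl_on_def connectivity_rel_def by auto
 show "sym (connectivity_rel M)" unfolding sym_def connectivity_rel_def by auto
 show "trans (connectivity_rel M)"
 proof (rule transI)
  fix x y z assume xy: "(x, y) : connectivity_rel M" and yz: "(y, z) : connectivity_rel M"
  show "(x, z) : connectivity_rel M"
  proof (cases "x = y | y = z")
   case False
   then obtain C D where "C : circuits M" "D : circuits M" "x : C" "y : C" "y : D" "z : D"
    using xy yz unfolding connectivity_rel_def by auto
   hence "EX C:circuits M. x : C & z : C" using connectivity_circuit_trans[OF M, of C D x z] by blast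
   thus ?thesis using xy yz unfolding connectivity_rel_def by auto
  qed (use xy yz in auto)
 qed
qed

lemma component_ground: "is_matroid M ==> C : components M ==> C <= ground M"
 unfolding components_def using equiv_connectivity in_quotient_imp_subset by metis

lemma Union_components: "is_matroid M ==> \<Union>(components M) = ground M"
 unfolding components_def by (rule Union_quotient[OF equiv_connectivity])

lemma components_disjoint:
 "is_matroid M ==> C : components M ==> D : components M ==> C = D | C Int D = {}"
 unfolding components_def using quotient_disj[OF equiv_connectivity] .

lemma in_component_iff:
 assumes M: "is_matroid M" and "C : components M" "x : C"
 shows "y : C <-> (x, y) : connectivity_rel M"
proof -
 obtain z where z: "C = connectivity_rel M `` {z}" using assms(2) unfolding components_def by (rule quotientE)
 hence "(z, x) : connectivity_rel M" using assms(3) by simp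
 hence "C = connectivity_rel M `` {x}" using z equiv_class_eq[OF equiv_connectivity[OF M]] by simp
 thus ?thesis by simp
qed

lemma component_cover:
 assumes "is_matroid M" "x : ground M"
 obtains C where "C : components M" "x : C" using Union_components[OF assms(1)] assms(2) by blast

lemma circuit_component:
 assumes M: "is_matroid M" and "C : components M" "D : circuits M" "x : C" "x : D"
 shows "D <= C"
proof
 fix y assume "y : D"
 hence "(x, y) : connectivity_rel M"
  unfolding connectivity_rel_def using assms circuitD(1)[OF assms(3)] by blast
 thus "y : C" using in_component_iff[OF M assms(2,4)] by blast
qed

section \<open>Separators and connectivity of the dual\<close>

definition separator :: "'a matroid => 'a set => bool" where
 "separator M X <-> X <= ground M & (ALL C:circuits M. C <= X | C Int X = {})"

lemma component_separator: "is_matroid M ==> C : components M ==> separator M C"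
 unfolding separator_def using component_ground[of M C] circuit_component[of M C] by (meson disjoint_iff)

lemma indep_separator:
 assumes M: "is_matroid M" and X: "separator M X" and "I : indeps M" "I <= X"
  "J : indeps M" "J Int X = {}"
 shows "I Un J : indeps M"
proof (rule ccontr)
 assume "I Un J ~: indeps M"
 moreover have "I Un J <= ground M" using indep_ground[OF M] assms by blast
 ultimately obtain C where C: "C : circuits M" "C <= I Un J" using dependent_has_circuit[OF M] by blast
 hence "C <= X | C Int X = {}" using X unfolding separator_def by blast
 hence "C <= I | C <= J" using C(2) assms by blast
 thus False using C(1) circuitD(2) indep_mono[OF M] assms by metis
qed

text \<open>Both mixtures of \<open>B\<close> and \<open>B'\<close> along \<open>X\<close> are
  independent, and their sizes add up to twice the rank, so neither can fall short.\<close>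

lemma basis_exchange_separator:
 assumes M: "is_matroid M" and X: "separator M X" and B: "B : bases M" "B' : bases M"
 shows "(B Int X) Un (B' - X) : bases M"
proof -
 have Bi: "B : indeps M" "B' : indeps M" using B bases_iff[OF M] by auto
 have un: "(U Int X) Un (V - X) : indeps M" if "U : indeps M" "V : indeps M" for U V
  using indep_separator[OF M X, of "U Int X" "V - X"] indep_mono[OF M] that by blast
 have c: "card ((U Int X) Un (V - X)) = card (U Int X) + card (V - X)"
  if "U : indeps M" "V : indeps M" for U V using that finite_indep[OF M] by (subst card_Un_disjoint) auto
 have le: "card ((U Int X) Un (V - X)) <= matroid_rank M" if "U : indeps M" "V : indeps M" for U V
  using un[OF that] indep_le_rank[OF M] indep_ground[OF M] matroid_rank_def by metis
 have "card (B Int X) + card (B' - X) + (card (B' Int X) + card (B - X)) = card B + card B'"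
  using card_Int_Diff[OF finite_indep[OF M Bi(1)], of X]
   card_Int_Diff[OF finite_indep[OF M Bi(2)], of X] by simp
 hence "card ((B Int X) Un (B' - X)) = matroid_rank M"
  using le[OF Bi] le[OF Bi(2,1)] c[OF Bi] c[OF Bi(2,1)] B bases_iff[OF M] by force
 thus ?thesis using un[OF Bi] bases_iff[OF M] by blast
qed

text \<open>A cocircuit crossing \<open>X\<close> would split into two coindependent parts; bases
  avoiding the parts mix along \<open>X\<close> into a basis avoiding the whole cocircuit.\<close>

lemma separator_dual:
 assumes M: "is_matroid M" and X: "separator M X"
 shows "separator (dual_matroid M) X" unfolding separator_def
proof (intro conjI ballI)
 show "X <= ground (dual_matroid M)" using X unfolding separator_def by simp
 fix D assume D: "D : circuits (dual_matroid M)"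
 show "D <= X | D Int X = {}"
 proof (rule ccontr)
  assume "\<not> (D <= X | D Int X = {})"
  hence "D Int X < D" "D - X < D" by auto
  hence "D Int X : indeps (dual_matroid M)" "D - X : indeps (dual_matroid M)" using circuitD(3)[OF D] by auto
  then obtain B B' where B: "B : bases M" "D Int X <= ground M - B"
    "B' : bases M" "D - X <= ground M - B'" unfolding dual_matroid_def by auto
  hence "D <= ground M - ((B Int X) Un (B' - X))" by blast
  hence "D : indeps (dual_matroid M)"
   using basis_exchange_separator[OF M X B(1,3)] unfolding dual_matroid_def by auto
  thus False using circuitD(2)[OF D] by blast
 qed
qed

text \<open>A cocircuit stays inside a component of \<open>M\<close>, because components are
  separators and these survive dualizing. Applied to the dual as well, this gives equality.\<close>

lemma connectivity_dual_subset:
 assumes M: "is_matroid M"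
 shows "connectivity_rel (dual_matroid M) <= connectivity_rel M"
proof
 fix p assume p: "p : connectivity_rel (dual_matroid M)"
 obtain x y where xy: "p = (x, y)" by fastforce
 hence g: "x : ground M" "y : ground M" using p unfolding connectivity_rel_def by auto
 show "p : connectivity_rel M"
 proof (cases "x = y")
  case True
  thus ?thesis using g xy unfolding connectivity_rel_def by auto
 next
  case False
  then obtain D where D: "D : circuits (dual_matroid M)" "x : D" "y : D"
   using p xy unfolding connectivity_rel_def by auto
  obtain C where C: "C : components M" "x : C" using component_cover[OF M g(1)] .
  have "D <= C" using separator_dual[OF M component_separator[OF M C(1)]] D C unfolding separator_def by blast
  thus ?thesis using in_component_iff[OF M C] D xy by blast
 qed
qed

lemma connectivity_dual: "is_matroid M ==> connectivity_rel (dual_matroid M) = connectivity_rel M"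
 using connectivity_dual_subset[of M] connectivity_dual_subset[OF dual_is_matroid, of M]
 by (simp add: dual_dual)

lemma components_dual: "is_matroid M ==> components (dual_matroid M) = components M"
 unfolding components_def by (simp add: connectivity_dual)

text \<open>Bases of the restriction to a separator are exactly the traces of bases of
  \<open>M\<close>; \<open>b1\<close> and \<open>b2\<close> are the two inclusions. This reduces
  duality of quasi series-parallel matroids to one component at a time.\<close>

lemma restriction_dual_separator:
 assumes M: "is_matroid M" and X: "separator M X"
 shows "restriction (dual_matroid M) X = dual_matroid (restriction M X)"
proof (rule matroid_eqI)
 have XE: "X <= ground M" using X unfolding separator_def by blast
 note RM = restriction_is_matroid[OF M XE]
 obtain B0 where B0: "B0 : bases M" using basis_exists[OF M] by blast
 have b1: "B Int X : bases (restriction M X)" if B: "B : bases M" for B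
 proof -
  have Bi: "B : indeps M" using B bases_iff[OF M] by blast
  have "J = B Int X" if J: "J : indeps M" "J <= X" "B Int X <= J" for J
  proof -
   have "J Un (B - X) : indeps M"
    using indep_separator[OF M X J(1,2), of "B - X"] indep_mono[OF M Bi] by blast
   moreover have "B <= J Un (B - X)" using J by blast
   ultimately have "J Un (B - X) = B" using B unfolding bases_def by blast
   thus ?thesis using J by blast
  qed
  thus ?thesis unfolding bases_def indeps_restriction using indep_mono[OF M Bi] by auto
 qed
 have b2: "EX B:bases M. B Int X = B'" if B': "B' : bases (restriction M X)" for B'
 proof -
  have B'i: "B' : indeps M" "B' <= X" using B' unfolding bases_def indeps_restriction by auto
  obtain B where B: "B : bases M" "B' <= B" using indep_iff_basis[OF M] B'i by blast
  have "B Int X : indeps (restriction M X)" using b1[OF B(1)] unfolding bases_def by blast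
  moreover have "B' <= B Int X" using B B'i by blast
  ultimately have "B Int X = B'" using B' unfolding bases_def by simp
  thus ?thesis using B by blast
 qed
 show "indeps (restriction (dual_matroid M) X) = indeps (dual_matroid (restriction M X))"
 proof (intro Set.set_eqI iffI)
  fix I assume "I : indeps (restriction (dual_matroid M) X)"
  then obtain B where B: "B : bases M" "I <= ground M - B" "I <= X"
   unfolding indeps_restriction dual_matroid_def by auto
  hence "I <= X - (B Int X)" by blast
  thus "I : indeps (dual_matroid (restriction M X))" using b1[OF B(1)] unfolding dual_matroid_def by auto
 next
  fix I assume "I : indeps (dual_matroid (restriction M X))"
  then obtain B' where B': "B' : bases (restriction M X)" "I <= X - B'" unfolding dual_matroid_def by auto
  then obtain B where "B : bases M" "B Int X = B'" using b2 by blast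
  hence "B : bases M" "I <= ground M - B" "I <= X" using B'(2) XE by blast+
  thus "I : indeps (restriction (dual_matroid M) X)" unfolding indeps_restriction dual_matroid_def by auto
 qed
qed simp

section \<open>Series-parallel matroids\<close>

lemma series_parallel_matroid: "series_parallel M ==> is_matroid M"
proof (induction rule: series_parallel.induct)
 case (loop e)
 show ?case by (rule is_matroidI) auto
next
 case (coloop e)
 show ?case by (rule is_matroidI) auto
qed (auto simp: parallel_extension_def series_extension_def)

lemma loop_dual: "dual_matroid (Matroid {e} {{}}) = Matroid {e} {{}, {e}}"
 unfolding dual_matroid_def bases_def by auto

lemma coloop_dual: "dual_matroid (Matroid {e} {{}, {e}}) = Matroid {e} {{}}"
 unfolding dual_matroid_def bases_def by auto

lemma series_parallel_dual: "series_parallel M ==> series_parallel (dual_matroid M)"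
proof (induction rule: series_parallel.induct)
 case (parallel M M')
 hence M': "is_matroid M'" unfolding parallel_extension_def by blast
 have "series_extension (dual_matroid M') (dual_matroid M)"
  using parallel(2) unfolding series_extension_def parallel_extension_def cocircuits_def
  by (metis dual_deletion dual_dual dual_is_matroid)
 thus ?case using series_parallel.series[OF parallel(3)] by blast
next
 case (series M M')
 hence M': "is_matroid M'" unfolding series_extension_def by blast
 have "parallel_extension (dual_matroid M') (dual_matroid M)"
  using series(2) unfolding series_extension_def parallel_extension_def cocircuits_def
  by (metis dual_contraction dual_is_matroid)
 thus ?case using series_parallel.parallel[OF series(3)] by blast
qed (auto simp: loop_dual coloop_dual intro: series_parallel.intros)

lemma quasi_series_parallel_dual:
 assumes "quasi_series_parallel M"
 shows "quasi_series_parallel (dual_matroid M)"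
by (metis assms component_separator components_dual dual_is_matroid quasi_series_parallel_def restriction_dual_separator series_parallel_dual)

lemma pair_circuit_iff:
 assumes M: "is_matroid M" and "e ~= f"
 shows "{e, f} : circuits M <-> {e} : indeps M & {f} : indeps M & {e, f} ~: indeps M"
proof -
 have "D < {e, f} <-> D = {} | D = {e} | D = {f}" for D using assms(2) by auto
 thus ?thesis unfolding circuits_def using empty_indep[OF M] indep_ground[OF M, of "{e}"]
   indep_ground[OF M, of "{f}"] by simp metis
qed

lemma circuit_card_2:
 assumes "C : circuits M" "card C = 2" "e : C"
 obtains f where "f ~= e" "{e, f} : circuits M" "C = {e, f}"
 using assms by (metis card_2_iff doubleton_eq_iff insertE singletonD)

lemma parallel_extension_iff:
 "parallel_extension M' M <->
   is_matroid M' & (EX e f. e ~= f & {e, f} : circuits M' & deletion M' {e} = M)"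
by (metis card_2_iff circuit_card_2 insert_iff parallel_extension_def)

lemma series_extension_iff:
 "series_extension M' M <->
   is_matroid M' & (EX e f. e ~= f & {e, f} : cocircuits M' & contraction M' {e} = M)"
proof
 assume "series_extension M' M"
 thus "is_matroid M' & (EX e f. e ~= f & {e, f} : cocircuits M' & contraction M' {e} = M)"
  unfolding series_extension_def cocircuits_def by (metis circuit_card_2)
next
 assume "is_matroid M' & (EX e f. e ~= f & {e, f} : cocircuits M' & contraction M' {e} = M)"
 thus "series_extension M' M" unfolding series_extension_def by (metis card_2_iff insertI1)
qed

text \<open>If \<open>x\<close> were the only common element, \<open>C - {x}\<close> would lie
  outside \<open>D\<close> and span \<open>x\<close>. But \<open>D - {x}\<close> is coindependent
  and \<open>D\<close> is not, so adding \<open>x\<close> to the complement of \<open>D\<close>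
  raises the rank.\<close>

lemma orthogonality:
 assumes M: "is_matroid M" and C: "C : circuits M" and D: "D : cocircuits M"
 shows "C Int D ~= {x}"
proof
 assume x: "C Int D = {x}"
 have D': "D : circuits (dual_matroid M)" using D unfolding cocircuits_def .
 have DE: "D <= ground M" using circuitD(1)[OF D'] by simp
 have 1: "rank_of M (ground M - D) ~= matroid_rank M"
  using coindep_iff_rank[OF M DE] circuitD(2)[OF D'] by blast
 have "D - {x} : indeps (dual_matroid M)" using circuit_remove[OF D'] x by blast
 hence "rank_of M (ground M - (D - {x})) = matroid_rank M"
  using coindep_iff_rank[OF M, of "D - {x}"] DE by blast
 moreover have "ground M - (D - {x}) = insert x (ground M - D)" using DE x by blast
 moreover have "x : span_of M (ground M - D)"
 proof -
  have "C - {x} <= ground M - D" using x circuitD(1)[OF C] by blast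
  thus ?thesis using circuit_span[OF C, of x] x span_mono by blast
 qed
 hence "rank_of M (insert x (ground M - D)) = rank_of M (ground M - D)"
  using span_iff_rank[OF M, of x] DE x by blast
 ultimately show False using 1 by simp
qed

lemma cocircuit_nonloop:
 assumes M: "is_matroid M" and D: "D : cocircuits M" "x : D"
 shows "{x} : indeps M"
proof (rule ccontr)
 assume n: "{x} ~: indeps M"
 have "x : ground M" using D circuitD(1) unfolding cocircuits_def by fastforce
 hence "{x} : circuits M"
  using n empty_indep[OF M] unfolding circuits_def by (auto simp: psubset_eq subset_singleton_iff)
 thus False using orthogonality[OF M _ D(1), of "{x}" x] D by blast
qed

lemma cocircuit_pair_iff:
 assumes M: "is_matroid M" and "e ~= f" "e : ground M" "f : ground M"
 shows "{e, f} : cocircuits M <-> rank_of M (ground M - {e}) = matroid_rank M \<and>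
  rank_of M (ground M - {f}) = matroid_rank M & rank_of M (ground M - {e, f}) ~= matroid_rank M"
 unfolding cocircuits_def pair_circuit_iff[OF dual_is_matroid[OF M] assms(2)]
 using coindep_iff_rank[OF M] assms by auto

lemma parallel_span:
 assumes M: "is_matroid M" and "e ~= f" "{e, f} : circuits M" "f : X"
 shows "e : span_of M X"
proof -
 have "{e, f} - {e} = {f}" using assms(2) by blast
 thus ?thesis using circuit_span[OF assms(3), of e] span_mono[of "{f}" X M] assms(4) by auto
qed

lemma parallel_exchange:
 assumes M: "is_matroid M" and ef: "e ~= f" "{e, f} : circuits M"
  and I: "insert e I : indeps M" "e ~: I" "f ~: I"
 shows "insert f I : indeps M"
proof -
 have g: "e : ground M" "f : ground M" using circuitD(1)[OF ef(2)] by auto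
 have fin: "finite I" using finite_indep[OF M I(1)] by simp
 have "e : span_of M (insert f I)" using parallel_span[OF M ef, of "insert f I"] by blast
 hence "rank_of M (insert e (insert f I)) = rank_of M (insert f I)" using span_iff_rank[OF M g(1)] by blast
 moreover have "rank_of M (insert e I) <= rank_of M (insert e (insert f I))" by (rule rank_mono[OF M]) blast
 moreover have "rank_of M (insert e I) = Suc (card I)" using rank_indep[OF M I(1)] I fin by simp
 moreover have "rank_of M (insert f I) <= card (insert f I)" using rank_le_card[OF M] fin by blast
 ultimately show ?thesis using indep_iff_rank[OF M, of "insert f I"] fin I by simp
qed

lemma parallel_trans:
 assumes M: "is_matroid M" and "e ~= f" "{e, f} : circuits M" "f ~= g" "{f, g} : circuits M" "e ~= g"
 shows "{e, g} : circuits M"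
proof -
 have "{e, g} ~: indeps M"
  using parallel_exchange[OF M assms(2,3), of "{g}"] assms circuitD(2)[OF assms(5)] by auto
 thus ?thesis using assms pair_circuit_iff[OF M] by metis
qed

lemma circuits_restriction: "X <= ground M ==> circuits (restriction M X) = {C : circuits M. C <= X}"
 unfolding circuits_def indeps_restriction by (auto; blast)

lemma circuits_deletion: "circuits (deletion M X) = {C : circuits M. C Int X = {}}"
 unfolding deletion_def circuits_restriction[OF Diff_subset] using circuitD(1) by blast

section \<open>Images of matroids\<close>

lemma inj_on_image_subset_iff:
 "inj_on f C ==> A <= C ==> B <= C ==> f ` A <= f ` B <-> A <= B" by (auto simp: inj_on_def) blast

lemma ground_image [simp]: "ground (image_matroid s M) = s ` ground M"
 and indeps_image: "indeps (image_matroid s M) = (`) s ` indeps M" by (auto simp: image_matroid_def)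

lemma image_indep_iff:
 assumes M: "is_matroid M" and s: "inj_on s (ground M)" and X: "X <= ground M"
 shows "s ` X : indeps (image_matroid s M) <-> X : indeps M"
by (metis M Pow_iff X indeps_image inj_on_image_Pow inj_on_image_mem_iff is_matroid_def s)

lemma image_is_matroid:
 assumes M: "is_matroid M" and s: "inj_on s (ground M)"
 shows "is_matroid (image_matroid s M)"
proof (rule is_matroidI)
 fix I J assume I: "I : indeps (image_matroid s M)"
 then obtain I' where I': "I = s ` I'" "I' : indeps M" by (auto simp: indeps_image)
 thus "I <= ground (image_matroid s M)" using indep_ground[OF M] by auto
 { assume "J <= I"
  then obtain J' where "J' <= I'" "J = s ` J'" using I' by (metis subset_image_iff)
  thus "J : indeps (image_matroid s M)" using indep_mono[OF M I'(2)] by (auto simp: indeps_image) }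
 { assume "J : indeps (image_matroid s M)" and c: "card I < card J"
  then obtain J' where J': "J = s ` J'" "J' : indeps M" by (auto simp: indeps_image)
  have inj: "inj_on s I'" "inj_on s J'" using inj_on_subset[OF s] indep_ground[OF M] I' J' by auto
  hence "card I' < card J'" using c I' J' by (simp add: card_image)
  then obtain e where e: "e : J' - I'" "insert e I' : indeps M" using indep_augment[OF M I'(2) J'(2)] by blast
  have "s e ~: I" using e I' s indep_ground[OF M e(2)] unfolding inj_on_def by blast
  moreover have "insert (s e) I : indeps (image_matroid s M)"
   using e(2) I'(1) unfolding indeps_image by (metis image_eqI image_insert)
  ultimately show "EX e:J - I. insert e I : indeps (image_matroid s M)" using e J' by blast }
qed (use finite_ground[OF M] empty_indep[OF M] in \<open>auto simp: indeps_image\<close>)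

lemma circuits_image:
 assumes M: "is_matroid M" and s: "inj_on s (ground M)"
 shows "circuits (image_matroid s M) = (`) s ` circuits M"
proof -
 have iff: "s ` C : circuits (image_matroid s M) <-> C : circuits M" if C: "C <= ground M" for C
 proof -
  have "(ALL D. D < s ` C --> D : indeps (image_matroid s M)) <-> (ALL D. D < C --> D : indeps M)"
  proof (intro iffI allI impI)
   fix D assume a: "ALL D. D < s ` C --> D : indeps (image_matroid s M)" and D: "D < C"
   hence "s ` D < s ` C" using s C inj_on_image_eq_iff[OF s, of D C] by blast
   thus "D : indeps M" using a image_indep_iff[OF M s, of D] C D by blast
  next
   fix D assume a: "ALL D. D < C --> D : indeps M" and D: "D < s ` C"
   then obtain D' where D': "D' <= C" "D = s ` D'" by (metis psubset_imp_subset subset_image_iff)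
   hence "D' < C" using D by blast
   thus "D : indeps (image_matroid s M)" using a D'(2) unfolding indeps_image by blast
  qed
  thus ?thesis unfolding circuits_def using image_indep_iff[OF M s C] C by auto
 qed
 show ?thesis
 proof (intro Set.set_eqI iffI)
  fix C assume C: "C : circuits (image_matroid s M)"
  then obtain C' where C': "C' <= ground M" "C = s ` C'"
   using circuitD(1)[OF C] by (auto simp: subset_image_iff)
  thus "C : (`) s ` circuits M" using C iff[OF C'(1)] by simp
 next
  fix C assume "C : (`) s ` circuits M"
  thus "C : circuits (image_matroid s M)" using iff[OF circuitD(1)] by auto
 qed
qed

lemma dual_image:
 assumes M: "is_matroid M" and s: "inj_on s (ground M)"
 shows "dual_matroid (image_matroid s M) = image_matroid s (dual_matroid M)"
proof (rule matroid_eqI)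
 have bs: "bases (image_matroid s M) = (`) s ` bases M"
 proof (intro Set.set_eqI iffI)
  fix B assume B: "B : bases (image_matroid s M)"
  then obtain B' where B': "B = s ` B'" "B' : indeps M" unfolding bases_def indeps_image by auto
  have "I = B'" if "I : indeps M" "B' <= I" for I
  proof -
   have "s ` I : indeps (image_matroid s M)" "B <= s ` I" using that B'(1) by (auto simp: indeps_image)
   hence "s ` I = B" using B unfolding bases_def by blast
   thus ?thesis using inj_on_image_eq_iff[OF s] B' that indep_ground[OF M] by metis
  qed
  thus "B : (`) s ` bases M" using B' unfolding bases_def by blast
 next
  fix B assume "B : (`) s ` bases M"
  then obtain B' where B': "B = s ` B'" "B' : bases M" by blast
  hence B'i: "B' : indeps M" unfolding bases_def by blast
  have "I = B" if I: "I : indeps (image_matroid s M)" "B <= I" for I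
  proof -
   obtain I' where I': "I = s ` I'" "I' : indeps M" using I(1) by (auto simp: indeps_image)
   have "B' <= I'" using I(2) I' B'(1) indep_ground[OF M I'(2)] indep_ground[OF M B'i]
     inj_on_image_subset_iff[OF s] by blast
   hence "I' = B'" using B'(2) I' unfolding bases_def by blast
   thus ?thesis using I' B' by simp
  qed
  moreover have "B : indeps (image_matroid s M)" using B'(1) B'i unfolding indeps_image by blast
  ultimately show "B : bases (image_matroid s M)" unfolding bases_def by blast
 qed
 have df: "s ` (ground M - B) = s ` ground M - s ` B" if "B : bases M" for B
  using inj_on_image_set_diff[OF s, of "ground M" B] basis_subset_ground[OF M that] by auto
 show "indeps (dual_matroid (image_matroid s M)) = indeps (image_matroid s (dual_matroid M))"
 proof (intro Set.set_eqI iffI)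
  fix I assume "I : indeps (dual_matroid (image_matroid s M))"
  then obtain B where B: "B : bases M" "I <= s ` (ground M - B)"
   unfolding dual_matroid_def using bs df by auto
  then obtain I' where "I' <= ground M - B" "I = s ` I'" by (metis subset_image_iff)
  thus "I : indeps (image_matroid s (dual_matroid M))" using B unfolding indeps_image dual_matroid_def by auto
 next
  fix I assume "I : indeps (image_matroid s (dual_matroid M))"
  then obtain I' B where I': "I = s ` I'" "B : bases M" "I' <= ground M - B"
   unfolding indeps_image dual_matroid_def by auto
  hence "I <= s ` ground M - s ` B" using df by blast
  thus "I : indeps (dual_matroid (image_matroid s M))" unfolding dual_matroid_def using bs I' by auto
 qed
qed simp

lemma restriction_image:
 assumes M: "is_matroid M" and s: "inj_on s (ground M)" and X: "X <= ground M"
 shows "restriction (image_matroid s M) (s ` X) = image_matroid s (restriction M X)"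
proof (rule matroid_eqI)
 have "s ` I <= s ` X <-> I <= X" if "I : indeps M" for I
  using inj_on_image_subset_iff[OF s indep_ground[OF M that] X] .
 thus "indeps (restriction (image_matroid s M) (s ` X)) =
   indeps (image_matroid s (restriction M X))" unfolding indeps_image indeps_restriction by auto
qed simp

lemma deletion_image:
 assumes M: "is_matroid M" and s: "inj_on s (ground M)" and X: "X <= ground M"
 shows "deletion (image_matroid s M) (s ` X) = image_matroid s (deletion M X)" unfolding deletion_def
 using restriction_image[OF M s, of "ground M - X"] inj_on_image_set_diff[OF s, of "ground M" X] X by auto

lemma contraction_image:
 assumes M: "is_matroid M" and s: "inj_on s (ground M)" and X: "X <= ground M"
 shows "contraction (image_matroid s M) (s ` X) = image_matroid s (contraction M X)"
by (simp add: M X contraction_def deletion_image deletion_is_matroid dual_image dual_is_matroid inj_on_diff s)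

lemma rank_image:
 assumes M: "is_matroid M" and s: "inj_on s (ground M)" and X: "X <= ground M"
 shows "rank_of (image_matroid s M) (s ` X) = rank_of M X"
proof -
 have "card ` {I : indeps (image_matroid s M). I <= s ` X} = card ` {I : indeps M. I <= X}"
 proof -
  have "{I : indeps (image_matroid s M). I <= s ` X} = (`) s ` {I : indeps M. I <= X}"
   using inj_on_image_subset_iff[OF s indep_ground[OF M] X] by (auto simp: indeps_image)
  moreover have "card (s ` I) = card I" if "I : indeps M" for I
   using inj_on_subset[OF s indep_ground[OF M that]] by (rule card_image)
  ultimately show ?thesis by (force simp: image_image)
 qed
 thus ?thesis unfolding rank_of_def by simp
qed

lemma matroid_rank_image:
 "is_matroid M ==> inj_on s (ground M) ==> matroid_rank (image_matroid s M) = matroid_rank M"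
 unfolding matroid_rank_def using rank_image[of M s "ground M"] by simp

lemma connectivity_image:
 assumes M: "is_matroid M" and s: "inj_on s (ground M)"
  and "x : ground M" "y : ground M"
 shows "(s x, s y) : connectivity_rel (image_matroid s M) <-> (x, y) : connectivity_rel M"
proof -
 have "s z : s ` C <-> z : C" if "C : circuits M" "z : ground M" for z C
  using inj_on_image_mem_iff[OF s that(2) circuitD(1)[OF that(1)]] .
 thus ?thesis unfolding connectivity_rel_def using assms circuits_image[OF M s] inj_on_eq_iff[OF s] by auto
qed

lemma components_image:
 assumes M: "is_matroid M" and s: "inj_on s (ground M)"
 shows "components (image_matroid s M) = (`) s ` components M"
proof -
 have "connectivity_rel (image_matroid s M) `` {s x} = s ` (connectivity_rel M `` {x})"
  if x: "x : ground M" for x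
 proof (intro Set.set_eqI iffI)
  fix y assume y: "y : connectivity_rel (image_matroid s M) `` {s x}"
  then obtain z where z: "y = s z" "z : ground M" unfolding connectivity_rel_def by auto
  thus "y : s ` (connectivity_rel M `` {x})" using y connectivity_image[OF M s x z(2)] by auto
 next
  fix y assume "y : s ` (connectivity_rel M `` {x})"
  then obtain z where z: "y = s z" "(x, z) : connectivity_rel M" by auto
  hence "z : ground M" unfolding connectivity_rel_def by auto
  thus "y : connectivity_rel (image_matroid s M) `` {s x}" using z connectivity_image[OF M s x] by auto
 qed
 thus ?thesis unfolding components_def quotient_def by auto
qed

lemma series_parallel_image:
 assumes "series_parallel M" "inj_on s (ground M)"
 shows "series_parallel (image_matroid s M)" using assms
proof (induction rule: series_parallel.induct)
 case (loop e)
 thus ?case unfolding image_matroid_def by (auto intro: series_parallel.loop)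
next
 case (coloop e)
 thus ?case unfolding image_matroid_def by (auto intro: series_parallel.coloop)
next
 case (parallel M M')
 then obtain e f where e: "is_matroid M'" "e ~= f" "{e, f} : circuits M'" "deletion M' {e} = M"
  unfolding parallel_extension_iff by blast
 hence g: "e : ground M'" "f : ground M'" using circuitD(1)[OF e(3)] by auto
 have "series_parallel (image_matroid s M)" using parallel.IH parallel.prems e(4) inj_on_subset by fastforce
 moreover have "parallel_extension (image_matroid s M') (image_matroid s M)" unfolding parallel_extension_iff
 proof (intro conjI exI)
  show "is_matroid (image_matroid s M')" using image_is_matroid[OF e(1) parallel.prems] .
  show "s e ~= s f" using e(2) g inj_on_eq_iff[OF parallel.prems] by blast
  show "{s e, s f} : circuits (image_matroid s M')"
   unfolding circuits_image[OF e(1) parallel.prems] using e(3) by (auto intro: image_eqI[of _ _ "{e, f}"])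
  show "deletion (image_matroid s M') {s e} = image_matroid s M"
   using deletion_image[OF e(1) parallel.prems, of "{e}"] g e(4) by simp
 qed
 ultimately show ?case by (rule series_parallel.parallel)
next
 case (series M M')
 then obtain e f where e: "is_matroid M'" "e ~= f" "{e, f} : cocircuits M'" "contraction M' {e} = M"
  unfolding series_extension_iff by blast
 hence g: "e : ground M'" "f : ground M'" using circuitD(1) unfolding cocircuits_def by fastforce+
 have "series_parallel (image_matroid s M)" using series.IH series.prems e(4) inj_on_subset by fastforce
 moreover have "series_extension (image_matroid s M') (image_matroid s M)" unfolding series_extension_iff
 proof (intro conjI exI)
  show "is_matroid (image_matroid s M')" using image_is_matroid[OF e(1) series.prems] .
  show "s e ~= s f" using e(2) g inj_on_eq_iff[OF series.prems] by blast
  show "{s e, s f} : cocircuits (image_matroid s M')"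
   unfolding cocircuits_def dual_image[OF e(1) series.prems]
   using circuits_image[OF dual_is_matroid[OF e(1)], of s] series.prems e(3)
   unfolding cocircuits_def by (auto intro: image_eqI[of _ _ "{e, f}"])
  show "contraction (image_matroid s M') {s e} = image_matroid s M"
   using contraction_image[OF e(1) series.prems, of "{e}"] g e(4) by simp
 qed
 ultimately show ?case by (rule series_parallel.series)
qed

lemma image_image_matroid: "image_matroid t (image_matroid s M) = image_matroid (t \<circ> s) M"
 unfolding image_matroid_def by (simp add: image_comp comp_def image_image)

lemma image_matroid_cong:
 assumes "is_matroid M" "!!x. x : ground M ==> s x = t x"
 shows "image_matroid s M = image_matroid t M"
proof -
 have "s ` I = t ` I" if "I <= ground M" for I using assms(2) that by (intro image_cong) auto
 thus ?thesis unfolding image_matroid_def using indep_ground[OF assms(1)] by (auto intro!: image_cong)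
qed

lemma image_matroid_id: "image_matroid (%x. x) M = M" unfolding image_matroid_def by (cases M) auto

lemma quasi_series_parallel_image:
 assumes "quasi_series_parallel M" "inj_on s (ground M)"
 shows "quasi_series_parallel (image_matroid s M)"
proof -
 have M: "is_matroid M" using assms unfolding quasi_series_parallel_def by blast
 have "series_parallel (restriction (image_matroid s M) (s ` C))" if C: "C : components M" for C
 by (metis assms(1,2) component_ground ground_restriction inj_on_subset quasi_series_parallel_def restriction_image series_parallel_image that)
 thus ?thesis unfolding quasi_series_parallel_def components_image[OF M assms(2)]
  using image_is_matroid[OF M assms(2)] by blast
qed

section \<open>Deleting parallel elements of series-parallel matroids\<close>

text \<open>Parallel elements are interchangeable in independent sets, so deleting either of them
  gives the same matroid up to renaming; the renaming is injective once \<open>e\<close> is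
  gone.\<close>

lemma parallel_deletions_isomorphic:
 assumes M: "is_matroid M" and ef: "e ~= f" "{e, f} : circuits M"
 shows "image_matroid (id(f := e)) (deletion M {e}) = deletion M {f}"
proof (rule matroid_eqI)
 have g: "e : ground M" "f : ground M" using circuitD(1)[OF ef(2)] by auto
 have fe: "f ~= e" "{f, e} : circuits M" using ef by (auto simp: insert_commute)
 show "ground (image_matroid (id(f := e)) (deletion M {e})) = ground (deletion M {f})"
  using g ef by (auto simp: image_iff)
 show "indeps (image_matroid (id(f := e)) (deletion M {e})) = indeps (deletion M {f})"
 proof (intro Set.set_eqI iffI)
  fix I assume "I : indeps (image_matroid (id(f := e)) (deletion M {e}))"
  then obtain J where J: "I = id(f := e) ` J" "J : indeps M" "e ~: J"
   unfolding indeps_image indeps_deletion[OF M] by auto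
  show "I : indeps (deletion M {f})"
  proof (cases "f : J")
   case True
   hence "I = insert e (J - {f})" using J ef(1) by (auto simp: image_iff)
   moreover have "insert e (J - {f}) : indeps M"
    using parallel_exchange[OF M fe, of "J - {f}"] J True by (auto simp: insert_absorb)
   ultimately show ?thesis using ef(1) by (auto simp: indeps_deletion[OF M])
  next
   case False
   hence "I = J" using J by (auto simp: image_iff)
   thus ?thesis using J False by (auto simp: indeps_deletion[OF M])
  qed
 next
  fix I assume "I : indeps (deletion M {f})"
  hence I: "I : indeps M" "f ~: I" by (auto simp: indeps_deletion[OF M])
  define J where "J = (if e : I then insert f (I - {e}) else I)"
  have "J : indeps M"
   unfolding J_def using parallel_exchange[OF M ef, of "I - {e}"] I by (auto simp: insert_absorb)
  moreover have "e ~: J" "I = id(f := e) ` J" unfolding J_def using ef(1) I by (auto simp: image_iff)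
  ultimately show "I : indeps (image_matroid (id(f := e)) (deletion M {e}))"
   unfolding indeps_image indeps_deletion[OF M] by auto
 qed
qed

text \<open>An extension pairs its new element with another nonloop. A loop therefore comes from the
  initial matroid, and nothing can ever have been added next to it.\<close>

lemma series_parallel_loop:
 assumes "series_parallel M" "l : ground M" "{l} ~: indeps M"
 shows "ground M = {l}" using assms
proof (induction rule: series_parallel.induct)
 case (parallel M M')
 then obtain e f where e: "is_matroid M'" "e ~= f" "{e, f} : circuits M'" "deletion M' {e} = M"
  unfolding parallel_extension_iff by blast
 have nl: "{e} : indeps M'" "{f} : indeps M'" using pair_circuit_iff[OF e(1,2)] e(3) by auto
 hence "l : ground M" using parallel.prems e(4) by auto
 moreover have "{l} ~: indeps M" using parallel.prems e(4) indeps_deletion[OF e(1), of "{e}"] by auto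
 ultimately have "ground M = {l}" using parallel.IH by blast
 moreover have "f : ground M" using e circuitD(1)[OF e(3)] by auto
 ultimately have "f = l" by simp
 thus ?case using nl(2) parallel.prems(2) by simp
next
 case (series M M')
 then obtain e f where e: "is_matroid M'" "e ~= f" "{e, f} : cocircuits M'" "contraction M' {e} = M"
  unfolding series_extension_iff by blast
 hence g: "e : ground M'" "f : ground M'" using circuitD(1) unfolding cocircuits_def by fastforce+
 have nl: "{e} : indeps M'" "{f} : indeps M'" using cocircuit_nonloop[OF e(1,3)] by auto
 hence le: "l ~= e" "l ~= f" using series.prems by auto
 have "{l} ~: indeps M" using indeps_contraction_single[OF e(1) nl(1)] e(4) series.prems(2)
   indep_mono[OF e(1), of "{e, l}" "{l}"] by auto
 moreover have "l : ground M" using series.prems(1) le e(4) by auto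
 ultimately have "ground M = {l}" using series.IH by blast
 moreover have "f : ground M" using g e by auto
 ultimately have "f = l" by simp
 thus ?case using le by simp
qed auto

text \<open>\<open>series_parallel\<close> only builds upwards, while the rank bound and the passage
  to blocks have to remove parallel elements. The deletion is moved past the last extension; the
  cases where the parallel pair meets the pair of that extension are the ones with an argument of
  their own.\<close>

lemma delete_parallel:
 assumes "series_parallel M" "e ~= f" "{e, f} : circuits M"
 shows "series_parallel (deletion M {e})" using assms
proof (induction arbitrary: e f rule: series_parallel.induct)
 case (loop x)
 thus ?case using circuitD(1)[of "{e, f}"] by fastforce
next
 case (coloop x)
 thus ?case using circuitD(1)[of "{e, f}"] by fastforce
next
 case (parallel M M')
 obtain x y where x: "is_matroid M'" "x ~= y" "{x, y} : circuits M'" "deletion M' {x} = M"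
  using parallel.hyps(2) unfolding parallel_extension_iff by blast
 have g: "x : ground M'" "y : ground M'" using circuitD(1)[OF x(3)] by auto
 consider "e = x" | "e = y" | "e ~= x" "e ~= y" by blast
 thus ?case
 proof cases
  case 1
  thus ?thesis using x parallel.hyps by simp
 next
  case 2
  \<comment> \<open>Deleting \<open>y\<close> instead of the added element \<open>x\<close> gives a
    renamed copy of \<open>M\<close>.\<close>
  have "inj_on (id(y := x)) (ground M)" using x(4) by (auto simp: inj_on_def)
  hence "series_parallel (image_matroid (id(y := x)) M)" using series_parallel_image parallel.hyps(1) by blast
  thus ?thesis using parallel_deletions_isomorphic[OF x(1-3)] x(4) 2 by simp
 next
  case 3
  \<comment> \<open>The partner of \<open>e\<close> must survive the deletion of \<open>x\<close>:
    if \<open>f = x\<close>, it is replaced by \<open>y\<close>, which is parallel to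
    \<open>x\<close>.\<close>
  have "EX f'. f' ~= x & f' ~= e & {e, f'} : circuits M'"
  by (metis "3"(2) parallel.prems(1,2) parallel_trans x(1,2,3))
  then obtain f' where f': "f' ~= x" "f' ~= e" "{e, f'} : circuits M'" by blast
  hence "{e, f'} : circuits M" using x(4) 3 circuits_deletion[of M' "{x}"] by auto
  hence sp: "series_parallel (deletion M {e})" using parallel.IH[of e f'] f' by blast
  have "parallel_extension (deletion M' {e}) (deletion M {e})" unfolding parallel_extension_iff
  proof (intro conjI exI)
   show "{x, y} : circuits (deletion M' {e})" using x 3 by (auto simp: circuits_deletion)
   show "deletion (deletion M' {e}) {x} = deletion M {e}"
    using x(1,4) by (auto simp: deletion_deletion insert_commute)
  qed (use x deletion_is_matroid in auto)
  thus ?thesis using series_parallel.parallel[OF sp] by blast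
 qed
next
 case (series M M')
 obtain x y where x: "is_matroid M'" "x ~= y" "{x, y} : cocircuits M'" "contraction M' {x} = M"
  using series.hyps(2) unfolding series_extension_iff by blast
 have g: "x : ground M'" "y : ground M'" using x circuitD(1) unfolding cocircuits_def by fastforce+
 have nl: "{x} : indeps M'" "{y} : indeps M'" using cocircuit_nonloop[OF x(1,3)] by auto
 note IM = indeps_contraction_single[OF x(1) nl(1), unfolded x(4)]
 have ge: "e : ground M'" "f : ground M'" using circuitD(1)[OF series.prems(2)] by auto
 have ne: "{e} : indeps M'" "{f} : indeps M'" "{e, f} ~: indeps M'"
  using pair_circuit_iff[OF x(1) series.prems(1)] series.prems(2) by auto
 have orth: "{e, f} Int {x, y} ~= {z}" for z using orthogonality[OF x(1) series.prems(2) x(3)] .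
 show ?case
 proof (cases "{e, f} = {x, y}")
  case True
  \<comment> \<open>Contracting \<open>x\<close> turns its parallel partner \<open>y\<close> into a
    loop, so \<open>M\<close> is that single loop and \<open>M'\<close> consists of two parallel
    elements; deleting one leaves a coloop.\<close>
  have "{y} ~: indeps M" using IM ne(3) True by auto
  hence "ground M = {y}" using series_parallel_loop[OF series.hyps(1), of y] g x(2,4) by auto
  hence "ground M' - {x} = {y}" using ground_contraction[of M' "{x}"] x(4) by simp
  hence "ground M' = {x, y}" using g(1) by blast
  hence "ground (deletion M' {e}) = {f}" using True series.prems(1) by auto
  moreover have "indeps (deletion M' {e}) = {{}, {f}}"
  proof -
   have "I <= {f}" if "I : indeps (deletion M' {e})" for I
    using indep_ground[OF deletion_is_matroid[OF x(1)] that] calculation by simp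
   moreover have "{} : indeps (deletion M' {e})" "{f} : indeps (deletion M' {e})"
    using empty_indep[OF x(1)] ne series.prems(1) by (auto simp: indeps_deletion[OF x(1)])
   ultimately show ?thesis by blast
  qed
  ultimately have "deletion M' {e} = Matroid {f} {{}, {f}}" by (intro matroid_eqI) auto
  thus ?thesis using series_parallel.coloop by metis
 next
  case False
  hence disj: "e ~= x" "e ~= y" "f ~= x" "f ~= y" using orth[of x] orth[of y] x(2) series.prems(1) by blast+
  \<comment> \<open>A loop \<open>a\<close> of the contraction would give a circuit
    \<open>{x, a}\<close> meeting the cocircuit in \<open>x\<close> alone.\<close>
  have nx: "{a} : indeps M" if a: "a : {e, f}" for a
  proof (rule ccontr)
   assume "{a} ~: indeps M"
   hence "{x, a} ~: indeps M'" using IM a disj by auto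
   hence "{x, a} : circuits M'" using pair_circuit_iff[OF x(1), of x a] nl ne a disj by auto
   moreover have "{x, a} Int {x, y} = {x}" using a disj by auto
   ultimately show False using orthogonality[OF x(1) _ x(3)] by metis
  qed
  have "{e, f} ~: indeps M" using IM ne(3) indep_mono[OF x(1), of "{x, e, f}" "{e, f}"] by auto
  hence "{e, f} : circuits M"
   using pair_circuit_iff[OF series_parallel_matroid[OF series.hyps(1)] series.prems(1)] nx by blast
  hence sp: "series_parallel (deletion M {e})" using series.IH[of e f] series.prems by blast
  let ?N = "deletion M' {e}"
  have N: "is_matroid ?N" using deletion_is_matroid[OF x(1)] .
  \<comment> \<open>As long as \<open>f\<close> is present, removing \<open>e\<close> does not
    change the rank, so \<open>{x, y}\<close> is still a cocircuit after the deletion.\<close>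
  have rk: "rank_of ?N (ground ?N - Y) = rank_of M' (ground M' - Y)" if "f ~: Y" "e ~: Y" for Y
  proof -
   have "e : span_of M' (ground M' - Y - {e})"
    using parallel_span[OF x(1) series.prems] ge series.prems(1) that by auto
   hence "rank_of M' (insert e (ground M' - Y - {e})) = rank_of M' (ground M' - Y - {e})"
    using span_iff_rank[OF x(1) ge(1)] by blast
   moreover have "insert e (ground M' - Y - {e}) = ground M' - Y" using ge that by blast
   moreover have "rank_of ?N (ground ?N - Y) = rank_of M' (ground M' - Y - {e})" unfolding deletion_def
    by (subst rank_restriction) (auto intro: arg_cong[where f = "rank_of M'"])
   ultimately show ?thesis by simp
  qed
  have "matroid_rank ?N = matroid_rank M'" unfolding matroid_rank_def using rk[of "{}"] by simp
  hence coc: "{x, y} : cocircuits ?N"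
   using x(3) cocircuit_pair_iff[OF x(1,2) g] cocircuit_pair_iff[OF N x(2)] g disj
    rk[of "{x}"] rk[of "{y}"] rk[of "{x, y}"] by auto
  have "contraction ?N {x} = deletion M {e}"
  proof (rule matroid_eqI)
   have nN: "{x} : indeps ?N" using nl disj by (auto simp: indeps_deletion[OF x(1)])
   show "indeps (contraction ?N {x}) = indeps (deletion M {e})" unfolding indeps_contraction_single[OF N nN]
    using disj IM by (auto simp: indeps_deletion[OF x(1)]
      indeps_deletion[OF series_parallel_matroid[OF series.hyps(1)]])
  qed (use x(4) in auto)
  hence "series_extension ?N (deletion M {e})" unfolding series_extension_iff using N x(2) coc by blast
  thus ?thesis using series_parallel.series[OF sp] by blast
 qed
qed

section \<open>The rank of a simple quasi series-parallel matroid\<close>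

lemma simple_matroid_iff:
 assumes "is_matroid M"
 shows "simple_matroid M <-> (ALL e:ground M. ALL f:ground M. {e, f} : indeps M)"
proof
 assume s: "simple_matroid M"
 show "ALL e:ground M. ALL f:ground M. {e, f} : indeps M"
 proof (intro ballI)
  fix e f assume "e : ground M" "f : ground M"
  hence nl: "{e} : indeps M" "{f} : indeps M" using s unfolding simple_matroid_def loopless_def by auto
  show "{e, f} : indeps M"
  proof (cases "e = f")
   case False
   hence "{e, f} ~: circuits M" using s unfolding simple_matroid_def by fastforce
   thus ?thesis using pair_circuit_iff[OF assms False] nl by blast
  qed (use nl in simp)
 qed
next
 assume a: "ALL e:ground M. ALL f:ground M. {e, f} : indeps M"
 have "card C ~= 2" if "C : circuits M" for C using circuitD(1,2)[OF that] a by (auto simp: card_2_iff)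
 moreover have "{e} : indeps M" if "e : ground M" for e using a that by fastforce
 ultimately show "simple_matroid M" unfolding simple_matroid_def loopless_def by blast
qed

text \<open>Apart from a single coloop, a simple series-parallel matroid ends with a series
  extension. Contracting \<open>x\<close> lowers size and rank by one; if the result is not simple,
  all its parallel pairs contain \<open>y\<close>, and deleting \<open>y\<close> as well removes two
  elements in all while the rank has dropped by at least one.\<close>

lemma simple_series_parallel_bound:
 assumes "series_parallel M" "simple_matroid M"
 shows "card (ground M) < 2 * matroid_rank M" using assms
proof (induction "card (ground M)" arbitrary: M rule: less_induct)
 case less
 have M: "is_matroid M" using series_parallel_matroid[OF less.prems(1)] .
 note si = less.prems(2)[unfolded simple_matroid_iff[OF M]]
 from less.prems(1) show ?case
 proof (cases rule: series_parallel.cases)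
  case (loop e)
  thus ?thesis using si by simp
 next
  case (coloop e)
  hence "{e} : indeps M" by simp
  from indep_le_rank[OF M this, of "ground M"] show ?thesis using coloop by (simp add: matroid_rank_def)
 next
  case (parallel M0)
  then obtain e f where "e ~= f" "{e, f} : circuits M" unfolding parallel_extension_iff by blast
  thus ?thesis using si circuitD(1,2)[of "{e, f}" M] by auto
 next
  case (series M0)
  then obtain x y where x: "x ~= y" "{x, y} : cocircuits M" "contraction M {x} = M0"
   unfolding series_extension_iff by blast
  have g: "x : ground M" "y : ground M" using x circuitD(1) unfolding cocircuits_def by fastforce+
  have nl: "{x} : indeps M" using cocircuit_nonloop[OF M x(2)] by auto
  have M0: "is_matroid M0" using series_parallel_matroid[OF series(1)] .
  have g0: "ground M0 = ground M - {x}" using x by auto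
  have cM: "card (ground M) = Suc (card (ground M0))"
   using g0 card_Suc_Diff1[OF finite_ground[OF M] g(1)] by simp
  note IM = indeps_contraction_single[OF M nl, unfolded x(3)]
  have rM: "matroid_rank M = Suc (matroid_rank M0)"
   using matroid_rank_contraction[OF M, of "{x}"] g x(3) rank_indep[OF M nl] by simp
  have nl0: "{a} : indeps M0" if "a : ground M0" for a using IM that g0 si g by auto
  show ?thesis
  proof (cases "simple_matroid M0")
   case True
   hence "card (ground M0) < 2 * matroid_rank M0" using less.hyps[of M0] cM series(1) by simp
   thus ?thesis using cM rM by simp
  next
   case False
   then obtain a b where ab: "a : ground M0" "b : ground M0" "{a, b} ~: indeps M0"
    using simple_matroid_iff[OF M0] by blast
   \<comment> \<open>A dependence of \<open>{a, b}\<close> after contracting \<open>x\<close> lifts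
     to a circuit through \<open>x\<close> inside \<open>{x, a, b}\<close>; by orthogonality with
     \<open>{x, y}\<close> it must contain \<open>y\<close>.\<close>
   have ally: "y : {a, b}" if ab: "a : ground M0" "b : ground M0" "{a, b} ~: indeps M0" for a b
   proof (rule ccontr)
    assume ny: "y ~: {a, b}"
    have d: "a ~= x" "b ~= x" "a ~= b" using ab g0 nl0 by auto
    have "{x, a, b} ~: indeps M" using ab IM d by auto
    then obtain C where C: "C : circuits M" "C <= {x, a, b}"
     using dependent_has_circuit[OF M, of "{x, a, b}"] ab g0 g by auto
    have "x : C"
    by (metis C(1,2) DiffE circuitD(2) g0 indep_mono local.series(2) series_extension_iff si subset_insert_iff that(1,2))
    hence "C Int {x, y} = {x}" using C ny x(1) by auto
    thus False using orthogonality[OF M C(1) x(2)] by blast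
   qed
   obtain z where z: "z ~= y" "{y, z} : circuits M0"
   by (smt (verit, ccfv_SIG) ab(1,2,3) ally empty_iff insertCI insertE insert_absorb insert_commute local.series(1) nl0 pair_circuit_iff series_parallel_matroid)
   let ?N = "deletion M0 {y}"
   have zg: "y : ground M0" "z : ground M0" using circuitD(1)[OF z(2)] by auto
   have sp: "series_parallel ?N" using delete_parallel[OF series(1) z(1)[symmetric] z(2)] .
   have N: "is_matroid ?N" using deletion_is_matroid[OF M0] .
   have "simple_matroid ?N"
    unfolding simple_matroid_iff[OF N] using ally by (auto simp: indeps_deletion[OF M0])
   moreover have cN: "card (ground M0) = Suc (card (ground ?N))"
    using card_Suc_Diff1[OF finite_ground[OF M0] zg(1)] by simp
   ultimately have "card (ground ?N) < 2 * matroid_rank ?N" using less.hyps[of ?N] sp cM by simp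
   moreover have "matroid_rank ?N <= matroid_rank M0" unfolding matroid_rank_def deletion_def
    by (subst rank_restriction) (auto intro: rank_mono[OF M0])
   ultimately show ?thesis using cM cN rM by simp
  qed
 qed
qed

lemma finite_components: "is_matroid M ==> finite (components M)"
 by (meson PowI component_ground finite_Pow_iff finite_ground finite_subset subsetI)

text \<open>Independent sets of distinct components can be united, since each component is a
  separator.\<close>

lemma matroid_rank_components_ge:
 assumes M: "is_matroid M"
 shows "(\<Sum>C\<in>components M. rank_of M C) <= matroid_rank M"
proof -
 have "ALL C. EX I. I : indeps M & I <= C & card I = rank_of M C" using rank_attained[OF M] by metis
 then obtain I where I: "!!C. I C : indeps M" "!!C. I C <= C" "!!C. card (I C) = rank_of M C" by metis
 have "finite S ==> S <= components M ==>
   \<Union>(I ` S) : indeps M & card (\<Union>(I ` S)) = (\<Sum>C\<in>S. rank_of M C)" for S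
 proof (induction S rule: finite_induct)
  case empty
  thus ?case using empty_indep[OF M] by simp
 next
  case (insert C S)
  have "\<Union>S Int C = {}" using components_disjoint[OF M, of C] insert by blast
  hence d: "\<Union>(I ` S) Int C = {}" using I(2) by blast
  have "I C Un \<Union>(I ` S) : indeps M"
   using indep_separator[OF M component_separator[OF M, of C], of "I C" "\<Union>(I ` S)"] I insert d by blast
  moreover have "card (I C Un \<Union>(I ` S)) = card (I C) + card (\<Union>(I ` S))"
   using d I(2) insert finite_indep[OF M] I(1) by (intro card_Un_disjoint) blast+
  ultimately show ?case using insert I(3) by simp
 qed
 from this[OF finite_components[OF M] order_refl] show ?thesis
  using rank_indep[OF M] rank_le_matroid_rank[OF M] by metis
qed

lemma simple_bound:
 assumes "quasi_series_parallel M" "simple_matroid M" "ground M ~= {}"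
 shows "card (ground M) < 2 * matroid_rank M"
proof -
 have M: "is_matroid M" using assms unfolding quasi_series_parallel_def by blast
 have "card C < 2 * rank_of M C" if C: "C : components M" for C
 proof -
  have CE: "C <= ground M" using component_ground[OF M C] .
  have "simple_matroid (restriction M C)" using assms(2) CE
   unfolding simple_matroid_iff[OF M] simple_matroid_iff[OF restriction_is_matroid[OF M CE]]
   by (auto simp: indeps_restriction)
  hence "card (ground (restriction M C)) < 2 * matroid_rank (restriction M C)"
   using simple_series_parallel_bound assms(1) C unfolding quasi_series_parallel_def by blast
  thus ?thesis by (simp add: matroid_rank_def rank_restriction)
 qed
 moreover have "components M ~= {}" using assms(3) Union_components[OF M] by auto
 ultimately have "(\<Sum>C\<in>components M. card C) < (\<Sum>C\<in>components M. 2 * rank_of M C)"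
  using finite_components[OF M] by (intro sum_strict_mono) auto
 moreover have "(\<Sum>C\<in>components M. card C) = card (ground M)"
 proof -
  have "card (\<Union>(components M)) = (\<Sum>C\<in>components M. card C)"
   using components_disjoint[OF M] finite_subset[OF component_ground[OF M] finite_ground[OF M]]
   by (intro card_Union_disjoint) (auto simp: pairwise_def disjnt_def)
  thus ?thesis using Union_components[OF M] by simp
 qed
 ultimately show ?thesis using matroid_rank_components_ge[OF M] by (simp add: sum_distrib_left[symmetric])
qed

section \<open>Blowing up the elements of a matroid\<close>

text \<open>
 The elements of \<open>S\<close> with the same value of \<open>b\<close> become parallel (or loops), those of \<open>U - S\<close>
 become loops.
\<close>

definition pull_matroid :: "('a => 'b) => 'a set => 'a set => 'b matroid => 'a matroid" where
 "pull_matroid b S U N = Matroid U {I. I <= S & inj_on b I & b ` I : indeps N}"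

text \<open>Identifies the elements of each fibre of \<open>b\<close> and forgets what is outside
  \<open>S\<close>; it undoes \<open>pull_matroid\<close> and is undone by it on the matroids
  described by \<open>block_compatible\<close>.\<close>

definition push_matroid :: "('a => 'b) => 'a set => 'a matroid => 'b matroid" where
 "push_matroid b S M = Matroid (b ` S) {b ` I |I. I : indeps M & I <= S}"

text \<open>Outside \<open>S\<close> there are only loops, and a fibre consists of loops or of
  pairwise parallel elements; asking for dependent pairs covers both. These are the matroids
  obtained by blowing up, by \<open>pull_push\<close> and
  \<open>block_compatible_pull\<close>.\<close>

definition block_compatible :: "('a => 'b) => 'a set => 'a matroid => bool" where
 "block_compatible b S M <-> S <= ground M & (ALL i:ground M - S. {i} ~: indeps M) \<and>
   (ALL i:S. ALL j:S. b i = b j --> ({i} : indeps M <-> {j} : indeps M) \<and>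
    (i ~= j --> {i, j} ~: indeps M))"

lemma ground_pull [simp]: "ground (pull_matroid b S U N) = U"
 and indeps_pull: "indeps (pull_matroid b S U N) = {I. I <= S & inj_on b I & b ` I : indeps N}"
 by (auto simp: pull_matroid_def)

lemma ground_push [simp]: "ground (push_matroid b S M) = b ` S"
 and indeps_push: "indeps (push_matroid b S M) = {b ` I |I. I : indeps M & I <= S}"
 by (auto simp: push_matroid_def)

lemma pull_is_matroid:
 assumes N: "is_matroid N" and "finite U" "S <= U"
 shows "is_matroid (pull_matroid b S U N)"
proof (rule is_matroidI)
 fix I J assume I: "I : indeps (pull_matroid b S U N)"
 { assume "J <= I"
  thus "J : indeps (pull_matroid b S U N)"
   using I indep_mono[OF N, of "b ` I" "b ` J"] by (auto simp: indeps_pull intro: inj_on_subset) }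
 assume J: "J : indeps (pull_matroid b S U N)" and c: "card I < card J"
 hence "card (b ` I) < card (b ` J)" using I J by (simp add: indeps_pull card_image)
 moreover have "b ` I : indeps N" "b ` J : indeps N" using I J by (auto simp: indeps_pull)
 ultimately obtain x where x: "x : b ` J - b ` I" "insert x (b ` I) : indeps N"
  using indep_augment[OF N] by blast
 then obtain e where e: "e : J" "x = b e" by blast
 hence "e ~: I" "insert e I : indeps (pull_matroid b S U N)"
  using x I J by (auto simp: indeps_pull inj_on_insert)
 thus "EX e:J - I. insert e I : indeps (pull_matroid b S U N)" using e by blast
qed (use assms empty_indep[OF N] in \<open>auto simp: indeps_pull\<close>)

lemma indep_inj_on_blocks:
 assumes M: "is_matroid M" and c: "block_compatible b S M" and I: "I : indeps M"
 shows "I <= S" "inj_on b I"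
proof -
 have "{i} : indeps M" if "i : I" for i using indep_mono[OF M I, of "{i}"] that by auto
 thus S: "I <= S" using c indep_ground[OF M I] unfolding block_compatible_def by blast
 show "inj_on b I"
 proof (rule inj_onI, rule ccontr)
  fix i j assume ij: "i : I" "j : I" "b i = b j" "i ~= j"
  have "{i, j} : indeps M" using indep_mono[OF M I, of "{i, j}"] ij by auto
  thus False using c S ij unfolding block_compatible_def by blast
 qed
qed

text \<open>Two sets meeting the same blocks span each other, so their ranks agree; as
  \<open>b\<close> is injective on both, so do their sizes.\<close>

lemma indep_same_blocks:
 assumes M: "is_matroid M" and c: "block_compatible b S M" and I: "I : indeps M"
  and J: "J <= S" "inj_on b J" "b ` J = b ` I"
 shows "J : indeps M"
proof -
 note II = indep_inj_on_blocks[OF M c I]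
 have JE: "J <= ground M" using J c unfolding block_compatible_def by blast
 have p: "{i} : indeps M & {j} : indeps M & (i ~= j --> {i, j} ~: indeps M)"
  if "i : I" "j : J" "b i = b j" for i j
  using c that J II indep_mono[OF M I, of "{i}"] unfolding block_compatible_def by blast
 have "J <= span_of M I"
 proof
  fix j assume j: "j : J"
  then obtain i where i: "i : I" "b i = b j" using J by (metis imageE imageI)
  show "j : span_of M I"
  by (smt (verit, ccfv_SIG) I II(1) M Submission.span_superset assms(4) block_compatible_def c i(1,2) in_mono indep_ground j p pair_circuit_iff parallel_span)
 qed
 hence 1: "rank_of M (I Un J) = rank_of M I" by (rule rank_Un_span[OF M])
 have "I <= span_of M J"
 proof
  fix i assume i: "i : I"
  then obtain j where j: "j : J" "b i = b j" using J by (metis imageE imageI)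
  show "i : span_of M J"
  by (smt (verit, ccfv_SIG) JE M Submission.span_superset i in_mono j(1,2) p pair_circuit_iff parallel_span)
 qed
 hence "rank_of M (J Un I) = rank_of M J" by (rule rank_Un_span[OF M])
 hence "rank_of M J = card I" using 1 rank_indep[OF M I] by (simp add: Un_commute)
 also have "card I = card J" using J II(2) card_image by metis
 finally show ?thesis using indep_iff_rank[OF M] JE finite_ground[OF M] finite_subset by metis
qed

lemma push_is_matroid:
 assumes M: "is_matroid M" and c: "block_compatible b S M"
 shows "is_matroid (push_matroid b S M)"
proof (rule is_matroidI)
 have "finite S" using c finite_ground[OF M] finite_subset unfolding block_compatible_def by blast
 thus "finite (ground (push_matroid b S M))" by simp
 fix X Y assume "X : indeps (push_matroid b S M)"
 then obtain I where I: "I : indeps M" "I <= S" "X = b ` I" by (auto simp: indeps_push)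
 thus "X <= ground (push_matroid b S M)" by auto
 { assume "Y <= X"
  then obtain J where "J <= I" "Y = b ` J" using I by (metis subset_image_iff)
  thus "Y : indeps (push_matroid b S M)" using indep_mono[OF M I(1)] I(2) by (auto simp: indeps_push) }
 assume "Y : indeps (push_matroid b S M)" and less: "card X < card Y"
 then obtain J where J: "J : indeps M" "J <= S" "Y = b ` J" by (auto simp: indeps_push)
 have "card I < card J" using less indep_inj_on_blocks(2)[OF M c] I J by (simp add: card_image)
 then obtain e where e: "e : J - I" "insert e I : indeps M" using indep_augment[OF M I(1) J(1)] by blast
 have "b e ~: X" using indep_inj_on_blocks(2)[OF M c e(2)] e(1) I(3) by (auto simp: inj_on_def)
 moreover have "insert (b e) X : indeps (push_matroid b S M)"
 proof -
  have "insert (b e) X = b ` insert e I" using I by simp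
  thus ?thesis using e J I unfolding indeps_push by blast
 qed
 ultimately show "EX x:Y - X. insert x X : indeps (push_matroid b S M)" using e J by blast
qed (use empty_indep[OF M] in \<open>auto simp: indeps_push\<close>)

lemma pull_push:
 assumes M: "is_matroid M" and c: "block_compatible b S M"
 shows "pull_matroid b S (ground M) (push_matroid b S M) = M"
proof (rule matroid_eqI)
 show "indeps (pull_matroid b S (ground M) (push_matroid b S M)) = indeps M"
 proof (intro Set.set_eqI iffI)
  fix I assume "I : indeps (pull_matroid b S (ground M) (push_matroid b S M))"
  then obtain J where "I <= S" "inj_on b I" "J : indeps M" "b ` I = b ` J"
   by (auto simp: indeps_pull indeps_push)
  thus "I : indeps M" using indep_same_blocks[OF M c] by blast
 next
  fix I assume "I : indeps M"
  thus "I : indeps (pull_matroid b S (ground M) (push_matroid b S M))"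
   using indep_inj_on_blocks[OF M c] unfolding indeps_pull indeps_push by blast
 qed
qed simp

lemma push_pull:
 assumes N: "is_matroid N" and "b ` S = ground N"
 shows "push_matroid b S (pull_matroid b S U N) = N"
proof (rule matroid_eqI)
 show "indeps (push_matroid b S (pull_matroid b S U N)) = indeps N"
 proof (intro Set.set_eqI iffI)
  fix X assume X: "X : indeps N"
  hence "X <= b ` S" using indep_ground[OF N] assms(2) by blast
  then obtain I where "I <= S" "inj_on b I" "X = b ` I" by (metis subset_image_inj)
  thus "X : indeps (push_matroid b S (pull_matroid b S U N))"
   using X unfolding indeps_push indeps_pull by blast
 qed (auto simp: indeps_push indeps_pull)
qed (use assms in simp)

lemma pull_singleton: "{i} : indeps (pull_matroid b S U N) <-> i : S & {b i} : indeps N"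
 by (auto simp: indeps_pull)

lemma block_compatible_pull:
 assumes "S <= U"
 shows "block_compatible b S (pull_matroid b S U N)"
 using assms unfolding block_compatible_def by (auto simp: indeps_pull inj_on_def)

lemma matroid_rank_pull:
 assumes N: "is_matroid N" and "finite U" "S <= U" "b ` S = ground N"
 shows "matroid_rank (pull_matroid b S U N) = matroid_rank N"
proof -
 note P = pull_is_matroid[OF N assms(2,3), of b]
 show ?thesis
 proof (rule antisym)
  obtain I where I: "I : indeps (pull_matroid b S U N)" "card I = matroid_rank (pull_matroid b S U N)"
   using rank_attained[OF P] unfolding matroid_rank_def by metis
  hence "card I = card (b ` I)" "b ` I : indeps N" by (auto simp: indeps_pull card_image)
  thus "matroid_rank (pull_matroid b S U N) <= matroid_rank N"
   using I rank_indep[OF N] rank_le_matroid_rank[OF N] by metis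
 next
  obtain X where X: "X : indeps N" "card X = matroid_rank N"
   using rank_attained[OF N] unfolding matroid_rank_def by metis
  hence "X <= b ` S" using indep_ground[OF N] assms(4) by blast
  then obtain I where I: "I <= S" "inj_on b I" "X = b ` I" by (metis subset_image_inj)
  hence "I : indeps (pull_matroid b S U N)" "card I = card X" using X by (auto simp: indeps_pull card_image)
  thus "matroid_rank N <= matroid_rank (pull_matroid b S U N)"
   using X rank_indep[OF P] rank_le_matroid_rank[OF P] by metis
 qed
qed

lemma pair_circuit_pull:
 assumes N: "is_matroid N" and "finite U" "S <= U" "i : S" "j : S" "i ~= j" "b i = b j"
  "{b i} : indeps N"
 shows "{i, j} : circuits (pull_matroid b S U N)"
 unfolding pair_circuit_iff[OF pull_is_matroid[OF assms(1-3)] assms(6)]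
 using assms by (auto simp: indeps_pull)

text \<open>A circuit of the blow-up with at least two elements is either a parallel pair within one
  fibre or a lift, one element per fibre, of a circuit of \<open>N\<close>. Loops are isolated,
  hence the conditions on \<open>{b i}\<close> and \<open>{b j}\<close>.\<close>

lemma connectivity_pull:
 assumes N: "is_matroid N" and U: "finite U" "S <= U" and b: "b ` S = ground N"
 shows "(i, j) : connectivity_rel (pull_matroid b S U N) <-> i : U & j : U \<and>
  (i = j | i : S & j : S & {b i} : indeps N & {b j} : indeps N \<and>
    (b i, b j) : connectivity_rel N)"
proof (cases "i = j")
 case True
 thus ?thesis by (auto simp: connectivity_rel_def)
next
 case False
 note P = pull_is_matroid[OF N U, of b]
 show ?thesis
 proof
  assume "(i, j) : connectivity_rel (pull_matroid b S U N)"
  then obtain C where C: "C : circuits (pull_matroid b S U N)" "i : C" "j : C"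
   and ij: "i : U" "j : U" using False by (auto simp: connectivity_rel_def)
  have sing: "{x} : indeps (pull_matroid b S U N)" if x: "x : C" for x
   using circuitD(3)[OF C(1), of "{x}"] C False x by auto
  hence CS: "C <= S" using pull_singleton[of _ b S U N] by blast
  have nl: "{b i} : indeps N" "{b j} : indeps N" using sing C pull_singleton[of _ b S U N] by auto
  have "(b i, b j) : connectivity_rel N"
  proof (cases "inj_on b C")
   case True
   have "b ` C : circuits N" unfolding circuits_def
   proof (intro CollectI conjI allI impI)
    show "b ` C <= ground N" using CS b by blast
    show "b ` C ~: indeps N" using circuitD(2)[OF C(1)] True CS by (auto simp: indeps_pull)
    fix D assume D: "D < b ` C"
    then obtain C' where C': "C' <= C" "D = b ` C'" by (metis psubset_imp_subset subset_image_iff)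
    hence "C' < C" using D by blast
    thus "D : indeps N" using circuitD(3)[OF C(1), of C'] C' by (simp add: indeps_pull)
   qed
   thus ?thesis unfolding connectivity_rel_def using C circuitD(1)[of "b ` C" N] by auto
  next
   case False
   then obtain x y where xy: "x : C" "y : C" "x ~= y" "b x = b y" unfolding inj_on_def by blast
   \<comment> \<open>Two members of one fibre already form a circuit, so \<open>C\<close> is that
     pair.\<close>
   have "{b x} : indeps N" using sing[OF xy(1)] by (simp add: pull_singleton)
   hence "{x, y} : circuits (pull_matroid b S U N)" using pair_circuit_pull[OF N U] xy CS by blast
   hence "C = {x, y}" using circuit_subset_eq[OF _ C(1)] xy by blast
   hence "b i = b j" using C xy by auto
   thus ?thesis unfolding connectivity_rel_def using C CS b by blast
  qed
  thus "i : U & j : U & (i = j | i : S & j : S & {b i} : indeps N & {b j} : indeps N \<and>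
    (b i, b j) : connectivity_rel N)" using ij nl C CS by blast
 next
  assume "i : U & j : U & (i = j | i : S & j : S & {b i} : indeps N & {b j} : indeps N \<and>
    (b i, b j) : connectivity_rel N)"
  hence ij: "i : U" "j : U" "i : S" "j : S" "{b i} : indeps N" "{b j} : indeps N"
   "(b i, b j) : connectivity_rel N" using False by auto
  have "EX C:circuits (pull_matroid b S U N). i : C & j : C"
  proof (cases "b i = b j")
   case True
   thus ?thesis using pair_circuit_pull[OF N U ij(3,4) False] ij by blast
  next
   case nb: False
   then obtain D where D: "D : circuits N" "b i : D" "b j : D"
    using ij(7) by (auto simp: connectivity_rel_def)
   \<comment> \<open>Over the remaining points of \<open>D\<close> one preimage each is chosen; over
     \<open>b i\<close> and \<open>b j\<close> the preimages have to be the given \<open>i\<close>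
     and \<open>j\<close>.\<close>
   have "D - {b i, b j} <= b ` S" using circuitD(1)[OF D(1)] b by blast
   then obtain J where J: "J <= S" "inj_on b J" "D - {b i, b j} = b ` J" by (metis subset_image_inj)
   define C where "C = insert i (insert j J)"
   have bi: "b i ~: b ` J" "b j ~: b ` J" using J(3) by auto
   have inj: "inj_on b C" unfolding C_def using J(2) bi nb by (auto simp: inj_on_insert)
   have bC: "b ` C = D" unfolding C_def using J(3) D by auto
   have CS: "C <= S" unfolding C_def using J ij by auto
   have "C : circuits (pull_matroid b S U N)" unfolding circuits_def
   proof (intro CollectI conjI allI impI)
    show "C <= ground (pull_matroid b S U N)" using CS U by auto
    show "C ~: indeps (pull_matroid b S U N)" using bC circuitD(2)[OF D(1)] by (simp add: indeps_pull)
    fix E assume E: "E < C"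
    hence "b ` E < D" using bC inj inj_on_image_eq_iff[OF inj, of E C] by blast
    thus "E : indeps (pull_matroid b S U N)"
     using circuitD(3)[OF D(1)] E CS inj_on_subset[OF inj, of E] by (auto simp: indeps_pull)
   qed
   thus ?thesis unfolding C_def by blast
  qed
  thus "(i, j) : connectivity_rel (pull_matroid b S U N)" unfolding connectivity_rel_def using ij by auto
 qed
qed

lemma connectivity_nonloop:
 assumes M: "is_matroid M" and "(x, y) : connectivity_rel M" "{x} : indeps M"
 shows "{y} : indeps M"
proof (cases "x = y")
 case False
 then obtain C where C: "C : circuits M" "x : C" "y : C" using assms(2) unfolding connectivity_rel_def by auto
 thus ?thesis using circuitD(3)[OF C(1), of "{y}"] False by auto
qed (use assms in simp)

text \<open>Shrinking the fibres one element at a time undoes parallel extensions, since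
  looplessness of \<open>N\<close> makes two members of a fibre really parallel. The direction from
  the blow-up to \<open>N\<close> is where \<open>delete_parallel\<close> enters; for injective
  \<open>b\<close> the two matroids are isomorphic.\<close>

lemma series_parallel_pull:
 assumes N: "is_matroid N" "loopless N" and "finite U" "b ` U = ground N"
 shows "series_parallel (pull_matroid b U U N) <-> series_parallel N" using assms(3,4)
proof (induction "card U" arbitrary: U rule: less_induct)
 case less
 show ?case
 proof (cases "inj_on b U")
  case True
  let ?P = "pull_matroid b U U N"
  have P: "is_matroid ?P" using pull_is_matroid[OF N(1) less.prems(1)] by blast
  have 1: "image_matroid b ?P = N"
  proof (rule matroid_eqI)
   show "indeps (image_matroid b ?P) = indeps N"
   proof (intro Set.set_eqI iffI)
    fix X assume X: "X : indeps N"
    hence "X <= b ` U" using indep_ground[OF N(1)] less.prems by blast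
    then obtain I where "I <= U" "X = b ` I" by (metis subset_image_iff)
    thus "X : indeps (image_matroid b ?P)"
     using X inj_on_subset[OF True] by (auto simp: indeps_image indeps_pull)
   qed (auto simp: indeps_image indeps_pull)
  qed (use less.prems in simp)
  have "image_matroid (inv_into U b) N = image_matroid (inv_into U b \<circ> b) ?P"
   using 1 image_image_matroid by metis
  also have "... = image_matroid (%x. x) ?P"
   using image_matroid_cong[OF P, of "inv_into U b \<circ> b" "%x. x"] True by simp
  finally have 2: "image_matroid (inv_into U b) N = ?P" by (simp add: image_matroid_id)
  have "inj_on (inv_into U b) (ground N)" using less.prems(2) by (simp add: inj_on_inv_into)
  thus ?thesis using series_parallel_image[of ?P b] series_parallel_image[of N "inv_into U b"]
    1 2 True by auto
 next
  case False
  then obtain e f where ef: "e : U" "f : U" "e ~= f" "b e = b f" unfolding inj_on_def by blast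
  have "{b e} : indeps N" using N(2) less.prems ef unfolding loopless_def by blast
  hence circ: "{e, f} : circuits (pull_matroid b U U N)"
   using pair_circuit_pull[OF N(1) less.prems(1) order_refl] ef by blast
  have P: "is_matroid (pull_matroid b U U N)" using pull_is_matroid[OF N(1) less.prems(1)] by blast
  have del: "deletion (pull_matroid b U U N) {e} = pull_matroid b (U - {e}) (U - {e}) N"
   by (rule matroid_eqI) (auto simp: indeps_deletion[OF P] indeps_pull)
  have bU: "b ` (U - {e}) = ground N" using ef less.prems(2) by (metis image_insert insert_Diff
     insert_absorb imageI DiffI singletonD)
  have "card (U - {e}) < card U" by (rule card_Diff1_less[OF less.prems(1) ef(1)])
  hence IH: "series_parallel (pull_matroid b (U - {e}) (U - {e}) N) <-> series_parallel N"
   using less.hyps[of "U - {e}"] less.prems(1) bU by blast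
  have "parallel_extension (pull_matroid b U U N) (deletion (pull_matroid b U U N) {e})"
   unfolding parallel_extension_iff using P ef circ by blast
  thus ?thesis using IH del series_parallel.parallel delete_parallel[OF _ ef(3) circ] by metis
 qed
qed

lemma component_pull_nonloop:
 assumes N: "is_matroid N" and U: "finite U" "S <= U" and b: "b ` S = ground N"
  and i: "i : S" "{b i} : indeps N" and C: "C : components N" "b i : C"
 shows "connectivity_rel (pull_matroid b S U N) `` {i} = {j : S. b j : C}"
proof -
 have "(b i, x) : connectivity_rel N ==> {x} : indeps N" for x
  using connectivity_nonloop[OF N _ i(2)] by blast
 moreover have "(b i, x) : connectivity_rel N <-> x : C" for x using in_component_iff[OF N C] by blast
 ultimately show ?thesis using i U(2) C(2) by (auto simp: connectivity_pull[OF N U b])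
qed

lemma component_pull_loop:
 assumes N: "is_matroid N" and U: "finite U" "S <= U" and b: "b ` S = ground N"
  and i: "i : U" "i ~: S | {b i} ~: indeps N"
 shows "connectivity_rel (pull_matroid b S U N) `` {i} = {i}"
 using i by (auto simp: connectivity_pull[OF N U b])

lemma loop_restriction:
 assumes "is_matroid M" "{l} ~: indeps M"
 shows "restriction M {l} = Matroid {l} {{}}" by (rule matroid_eqI)
  (use assms empty_indep[OF assms(1)] in \<open>auto simp: indeps_restriction subset_singleton_iff\<close>)

lemma restriction_pull:
 assumes N: "is_matroid N"
 shows "restriction (pull_matroid b S U N) {j : S. b j : C} =
  pull_matroid b {j : S. b j : C} {j : S. b j : C} (restriction N C)"
 by (rule matroid_eqI) (auto simp: indeps_restriction indeps_pull)

text \<open>Components of the blow-up are single loops and the preimages of the components of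
  \<open>N\<close> made of nonloops. A component of \<open>N\<close> containing a loop is just this
  loop, which is series-parallel by itself.\<close>

lemma quasi_series_parallel_pull:
 assumes N: "is_matroid N" and U: "finite U" "S <= U" and b: "b ` S = ground N"
 shows "quasi_series_parallel (pull_matroid b S U N) <-> quasi_series_parallel N"
proof -
 let ?P = "pull_matroid b S U N"
 note P = pull_is_matroid[OF N U, of b]
 have sp: "series_parallel (restriction ?P {j : S. b j : C}) <-> series_parallel (restriction N C)"
  if C: "C : components N" and nl: "x : C" "{x} : indeps N" for C x
 proof -
  have CE: "C <= ground N" using component_ground[OF N C] .
  have "{y} : indeps N" if "y : C" for y
   using connectivity_nonloop[OF N _ nl(2)] in_component_iff[OF N C nl(1)] that by blast
  hence "loopless (restriction N C)" unfolding loopless_def by (simp add: indeps_restriction)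
  moreover have "b ` {j : S. b j : C} = ground (restriction N C)" using CE b by auto
  moreover have "finite {j : S. b j : C}" using U finite_subset by fastforce
  ultimately show ?thesis unfolding restriction_pull[OF N]
   using series_parallel_pull[OF restriction_is_matroid[OF N CE]] by blast
 qed
 show ?thesis
 proof
  assume q: "quasi_series_parallel ?P"
  have "series_parallel (restriction N C)" if C: "C : components N" for C
  proof -
   obtain x where x: "x : C" "x : ground N"
    using C in_quotient_imp_non_empty[OF equiv_connectivity[OF N]] component_ground[OF N C]
    unfolding components_def by blast
   show ?thesis
   proof (cases "{x} : indeps N")
    case True
    have "x : b ` S" using x(2) b by simp
    then obtain i where i: "i : S" "b i = x" by blast
    have "connectivity_rel ?P `` {i} = {j : S. b j : C}"
     using component_pull_nonloop[OF N U b i(1) _ C] True i x by simp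
    moreover have "i : ground ?P" using i(1) U(2) by auto
    ultimately have "{j : S. b j : C} : components ?P" unfolding components_def by (metis quotientI)
    thus ?thesis using q sp[OF C x(1) True] unfolding quasi_series_parallel_def by blast
   next
    case False
    have "C = {x}"
    proof -
     have "y = x" if "y : C" for y
     proof (rule ccontr)
      assume "y ~= x"
      have "(x, y) : connectivity_rel N" using in_component_iff[OF N C x(1)] that by simp
      then obtain D where D: "D : circuits N" "x : D" "y : D"
       using \<open>y ~= x\<close> unfolding connectivity_rel_def by auto
      thus False using circuitD(3)[OF D(1), of "{x}"] False \<open>y ~= x\<close> by auto
     qed
     thus ?thesis using x by blast
    qed
    thus ?thesis using loop_restriction[OF N False] series_parallel.loop by metis
   qed
  qed
  thus "quasi_series_parallel N" unfolding quasi_series_parallel_def using N by blast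
 next
  assume q: "quasi_series_parallel N"
  have "series_parallel (restriction ?P D)" if D: "D : components ?P" for D
  proof -
   obtain i where i: "i : U" "D = connectivity_rel ?P `` {i}"
    using D unfolding components_def by (auto elim: quotientE)
   show ?thesis
   proof (cases "i : S & {b i} : indeps N")
    case True
    then obtain C where C: "C : components N" "b i : C" using component_cover[OF N, of "b i"] b by blast
    have "D = {j : S. b j : C}" using component_pull_nonloop[OF N U b _ _ C] True i by simp
    thus ?thesis using sp[OF C] True q C unfolding quasi_series_parallel_def by metis
   next
    case False
    hence "D = {i}" using component_pull_loop[OF N U b i(1)] i(2) by blast
    thus ?thesis using loop_restriction[OF P, of i] pull_singleton[of i b S U N] False
      series_parallel.loop by metis
   qed
  qed
  thus "quasi_series_parallel ?P" unfolding quasi_series_parallel_def using P by blast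
 qed
qed

section \<open>Representations up to isomorphism\<close>

text \<open>Units of the matrix ring are traded for plain matrix equations: the matrix of the
  inverse group element is the inverse matrix.\<close>

lemma mem_reps_iff:
 assumes "group H"
 shows "(d, rho) : reps H <-> (ALL h:carrier H. rho h : carrier_mat d d) \<and>
  (ALL g:carrier H. ALL h:carrier H. rho (g \<otimes>\<^bsub>H\<^esub> h) = rho g * rho h) & rho \<one>\<^bsub>H\<^esub> = 1\<^sub>m d"
  (is "_ <-> ?R")
proof -
 interpret H: group H by fact
 let ?M = "ring_mat TYPE(complex) d ()"
 interpret M: ring ?M by (rule ring_mat)
 have GL: "group (GL d)" unfolding GL_def by (rule M.units_group)
 have s: "Group.monoid.mult (GL d) = (*)" "one (GL d) = 1\<^sub>m d" "carrier (GL d) = Units ?M"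
  by (simp_all add: GL_def units_of_def ring_mat_simps)
 show ?thesis
 proof
  assume "(d, rho) : reps H"
  hence hom: "rho : hom H (GL d)" by (simp add: reps_def)
  then interpret gh: group_hom H "GL d" rho by (simp add: group_hom_def group_hom_axioms_def H.is_group GL)
  have "rho h : carrier_mat d d" if "h : carrier H" for h
   using gh.hom_closed[OF that] s(3) M.Units_closed by (auto simp: ring_mat_simps)
  thus ?R using gh.hom_mult gh.hom_one s by auto
 next
  assume R: ?R
  have "rho h : Units ?M" if h: "h : carrier H" for h
  proof -
   have "rho h * rho (inv\<^bsub>H\<^esub> h) = 1\<^sub>m d" "rho (inv\<^bsub>H\<^esub> h) * rho h = 1\<^sub>m d"
    using R h by (metis H.inv_closed H.r_inv, metis H.inv_closed H.l_inv)
   thus ?thesis using R h unfolding Units_def by (auto simp: ring_mat_simps)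
  qed
  thus "(d, rho) : reps H" using R s by (auto simp: reps_def hom_def)
 qed
qed

lemma rep_carrier: "group H ==> V : reps H ==> h : carrier H ==> snd V h : carrier_mat (fst V) (fst V)"
 by (cases V) (simp add: mem_reps_iff)

lemma rep_mult:
 "group H ==> V : reps H ==> g : carrier H ==> h : carrier H ==>
   snd V (g \<otimes>\<^bsub>H\<^esub> h) = snd V g * snd V h" by (cases V) (simp add: mem_reps_iff)

lemma rep_one: "group H ==> V : reps H ==> snd V \<one>\<^bsub>H\<^esub> = 1\<^sub>m (fst V)"
 by (cases V) (simp add: mem_reps_iff)

lemma rep_iso_refl: "group H ==> V : reps H ==> rep_iso H V V"
 unfolding rep_iso_def using similar_mat_wit_refl[OF rep_carrier[of H V]] by blast

lemma rep_iso_sym: "rep_iso H V W ==> rep_iso H W V" unfolding rep_iso_def using similar_mat_wit_sym by blast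

lemma rep_iso_trans: "rep_iso H V W ==> rep_iso H W U ==> rep_iso H V U"
 unfolding rep_iso_def using similar_mat_wit_trans by blast

lemma rep_iso_dim:
 assumes "group H" "V : reps H" "W : reps H" "rep_iso H V W"
 shows "fst V = fst W"
proof -
 have 1: "\<one>\<^bsub>H\<^esub> : carrier H" using group.is_monoid[OF assms(1)] monoid.one_closed by blast
 then obtain P Q where "similar_mat_wit (snd V \<one>\<^bsub>H\<^esub>) (snd W \<one>\<^bsub>H\<^esub>) P Q"
  using assms(4) unfolding rep_iso_def by blast
 thus ?thesis using similar_mat_witD2[OF rep_carrier[OF assms(1,2) 1]] rep_carrier[OF assms(1,3) 1]
  by (metis carrier_matD(1))
qed

lemma permutation_mat_mult:
 assumes p: "!!i. i < d ==> p i < d" and A: "A : carrier_mat d d"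
 shows "mat d d (%(i, j). if j = p i then 1 else 0) * A = mat d d (%(i, j). A $$ (p i, j))"
  (is "?P * A = ?B")
  and "A * mat d d (%(i, j). if i = p j then 1 else 0) = mat d d (%(i, j). (A :: complex mat) $$ (i, p j))"
  (is "A * ?Q = ?C")
proof -
 show "?P * A = ?B"
 proof (rule eq_matI)
  fix i j assume "i < dim_row ?B" "j < dim_col ?B"
  hence ij: "i < d" "j < d" by auto
  have "(?P * A) $$ (i, j) = (\<Sum>k<d. (if k = p i then 1 else 0) * A $$ (k, j))"
   using ij A by (simp add: scalar_prod_def lessThan_atLeast0)
  also have "... = (\<Sum>k<d. if k = p i then A $$ (k, j) else 0)" by (rule sum.cong) auto
  also have "... = A $$ (p i, j)" using p[OF ij(1)] by simp
  finally show "(?P * A) $$ (i, j) = ?B $$ (i, j)" using ij by simp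
 qed (use A in auto)
 show "A * ?Q = ?C"
 proof (rule eq_matI)
  fix i j assume "i < dim_row ?C" "j < dim_col ?C"
  hence ij: "i < d" "j < d" by auto
  have "(A * ?Q) $$ (i, j) = (\<Sum>k<d. A $$ (i, k) * (if k = p j then 1 else 0))"
   using ij A by (simp add: scalar_prod_def lessThan_atLeast0)
  also have "... = (\<Sum>k<d. if k = p j then A $$ (i, k) else 0)" by (rule sum.cong) auto
  also have "... = A $$ (i, p j)" using p[OF ij(2)] by simp
  finally show "(A * ?Q) $$ (i, j) = ?C $$ (i, j)" using ij by simp
 qed (use A in auto)
qed

lemma rep_iso_permutation:
 assumes H: "group H" and V: "V : reps H" "W : reps H" and d: "fst V = d" "fst W = d"
  and p: "bij_betw p {..<d} {..<d}"
  and e: "!!h i j. h : carrier H ==> i < d ==> j < d ==> snd V h $$ (i, j) = snd W h $$ (p i, p j)"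
 shows "rep_iso H V W"
proof -
 let ?P = "mat d d (%(i, j). if j = p i then 1 else 0) :: complex mat"
 let ?Q = "mat d d (%(i, j). if i = p j then 1 else 0) :: complex mat"
 have pl: "p i < d" if "i < d" for i using p that by (auto simp: bij_betw_def)
 have pinj: "p i = p j <-> i = j" if "i < d" "j < d" for i j
  using p that by (auto simp: bij_betw_def inj_on_eq_iff)
 have PQ: "?P * ?Q = 1\<^sub>m d" by (subst permutation_mat_mult(1)) (auto simp: pl pinj intro!: eq_matI)
 let ?q = "inv_into {..<d} p"
 have ql: "?q i < d & p (?q i) = i" if "i < d" for i
  using p that inv_into_into[of i p "{..<d}"] f_inv_into_f[of i p "{..<d}"] by (auto simp: bij_betw_def)
 have "?Q = mat d d (%(i, j). if j = ?q i then 1 else 0)" using ql pinj pl by (intro eq_matI) (auto, metis)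
 hence "?Q * ?P = mat d d (%(i, j). ?P $$ (?q i, j))" using permutation_mat_mult(1)[of d ?q ?P] ql by simp
 also have "... = 1\<^sub>m d" using ql by (auto intro!: eq_matI)
 finally have QP: "?Q * ?P = 1\<^sub>m d" .
 have "similar_mat_wit (snd V h) (snd W h) ?P ?Q" if h: "h : carrier H" for h
 proof (rule similar_mat_witI[OF PQ QP])
  show c: "snd V h : carrier_mat d d" "snd W h : carrier_mat d d"
   using rep_carrier[OF H V(1) h] rep_carrier[OF H V(2) h] d by auto
  have "?P * snd W h = mat d d (%(i, j). snd W h $$ (p i, j))" using permutation_mat_mult(1)[OF pl c(2)] .
  hence "?P * snd W h * ?Q = mat d d (%(i, j). snd W h $$ (p i, p j))"
   using permutation_mat_mult(2)[OF pl, where A = "?P * snd W h"] pl by (auto intro!: eq_matI)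
  also have "... = snd V h" using c e[OF h] by (auto intro!: eq_matI)
  finally show "snd V h = ?P * snd W h * ?Q" ..
 qed auto
 thus ?thesis unfolding rep_iso_def by blast
qed

text \<open>Many isomorphisms below only relabel a basis. It is enough to index both bases by a
  common set \<open>I\<close> so that the matrices have the same entries \<open>E\<close>; the
  permutation is then read off.\<close>

lemma rep_iso_reindex:
 assumes H: "group H" and V: "V : reps H" "W : reps H"
  and f: "bij_betw f {..<fst V} I" and g: "bij_betw g {..<fst W} I"
  and eV: "!!h i j. h : carrier H ==> i < fst V ==> j < fst V ==> snd V h $$ (i, j) = E h (f i) (f j)"
  and eW: "!!h i j. h : carrier H ==> i < fst W ==> j < fst W ==> snd W h $$ (i, j) = E h (g i) (g j)"
 shows "rep_iso H V W"
proof -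
 have d: "fst W = fst V" using bij_betw_same_card[OF f] bij_betw_same_card[OF g] by simp
 let ?p = "inv_into {..<fst W} g \<circ> f"
 have p: "bij_betw ?p {..<fst V} {..<fst V}" using bij_betw_trans[OF f bij_betw_inv_into[OF g]] d by simp
 have "?p i < fst W & g (?p i) = f i" if "i < fst V" for i
 proof -
  have "f i : g ` {..<fst W}" using that f g by (auto simp: bij_betw_def)
  thus ?thesis using f_inv_into_f[of "f i" g "{..<fst W}"] inv_into_into[of "f i" g "{..<fst W}"] by auto
 qed
 hence "snd V h $$ (i, j) = snd W h $$ (?p i, ?p j)"
  if "h : carrier H" "i < fst V" "j < fst V" for h i j using eV[OF that] eW[OF that(1)] that by simp
 from rep_iso_permutation[OF H V refl d p this] show ?thesis .
qed

lemma sum_rep_eq: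
 assumes "A : carrier_mat d d" "B : carrier_mat e e"
 shows "diag_block_mat [A, B] = four_block_mat A (0\<^sub>m d e) (0\<^sub>m e d) B"
 using assms by (simp add: Let_def) (auto intro!: eq_matI)

lemma fst_sum_rep [simp]: "fst (sum_rep V W) = fst V + fst W" by (simp add: sum_rep_def)

lemma snd_sum_rep:
 assumes "group H" "V : reps H" "W : reps H" "h : carrier H"
 shows "snd (sum_rep V W) h =
  four_block_mat (snd V h) (0\<^sub>m (fst V) (fst W)) (0\<^sub>m (fst W) (fst V)) (snd W h)"
 unfolding sum_rep_def snd_conv
 by (rule sum_rep_eq[OF rep_carrier[OF assms(1,2,4)] rep_carrier[OF assms(1,3,4)]])

lemma sum_rep_index:
 assumes "group H" "V : reps H" "W : reps H" "h : carrier H" "i < fst V + fst W" "j < fst V + fst W"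
 shows "snd (sum_rep V W) h $$ (i, j) =
  (if i < fst V then if j < fst V then snd V h $$ (i, j) else 0
   else if j < fst V then 0 else snd W h $$ (i - fst V, j - fst V))" unfolding snd_sum_rep[OF assms(1-4)]
 using rep_carrier[OF assms(1,2,4)] rep_carrier[OF assms(1,3,4)] assms(5,6) by auto

lemma sum_rep_closed:
 assumes H: "group H" and V: "V : reps H" "W : reps H"
 shows "sum_rep V W : reps H"
proof -
 interpret group H by fact
 note c = rep_carrier[OF H V(1)] rep_carrier[OF H V(2)]
 have "(fst V + fst W, snd (sum_rep V W)) : reps H" unfolding mem_reps_iff[OF H]
 proof (intro conjI ballI)
  fix g h assume gh: "g : carrier H" "h : carrier H"
  show "snd (sum_rep V W) h : carrier_mat (fst V + fst W) (fst V + fst W)"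
   unfolding snd_sum_rep[OF H V gh(2)] using c[OF gh(2)] by simp
  have "snd (sum_rep V W) g * snd (sum_rep V W) h =
    four_block_mat (snd V g * snd V h) (0\<^sub>m (fst V) (fst W)) (0\<^sub>m (fst W) (fst V)) (snd W g * snd W h)"
   unfolding snd_sum_rep[OF H V gh(1)] snd_sum_rep[OF H V gh(2)]
   by (subst mult_four_block_mat[OF c(1)[OF gh(1)] zero_carrier_mat zero_carrier_mat c(2)[OF gh(1)]
      c(1)[OF gh(2)] zero_carrier_mat zero_carrier_mat c(2)[OF gh(2)]])
    (use c[OF gh(1)] c[OF gh(2)] in \<open>auto intro!: cong_four_block_mat\<close>)
  thus "snd (sum_rep V W) (g \<otimes>\<^bsub>H\<^esub> h) = snd (sum_rep V W) g * snd (sum_rep V W) h"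
   using snd_sum_rep[OF H V m_closed[OF gh]] rep_mult[OF H V(1) gh] rep_mult[OF H V(2) gh] by simp
 next
  show "snd (sum_rep V W) \<one>\<^bsub>H\<^esub> = 1\<^sub>m (fst V + fst W)"
   using snd_sum_rep[OF H V one_closed] rep_one[OF H V(1)] rep_one[OF H V(2)] by simp
 qed
 thus ?thesis by (simp add: sum_rep_def)
qed

lemma sum_rep_cong:
 assumes H: "group H" and V: "V : reps H" "V' : reps H" and W: "W : reps H" "W' : reps H"
  and "rep_iso H V V'" "rep_iso H W W'"
 shows "rep_iso H (sum_rep V W) (sum_rep V' W')"
proof -
 obtain P Q where PQ: "!!h. h : carrier H ==> similar_mat_wit (snd V h) (snd V' h) P Q"
  using assms(6) unfolding rep_iso_def by blast
 obtain R S where RS: "!!h. h : carrier H ==> similar_mat_wit (snd W h) (snd W' h) R S"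
  using assms(7) unfolding rep_iso_def by blast
 have d: "fst V' = fst V" "fst W' = fst W"
  using rep_iso_dim[OF H V assms(6)] rep_iso_dim[OF H W assms(7)] by auto
 let ?B = "%A D. four_block_mat A (0\<^sub>m (fst V) (fst W)) (0\<^sub>m (fst W) (fst V)) D :: complex mat"
 have mul: "?B A D * ?B A' D' = ?B (A * A') (D * D')"
  if "A : carrier_mat (fst V) (fst V)" "A' : carrier_mat (fst V) (fst V)"
   "D : carrier_mat (fst W) (fst W)" "D' : carrier_mat (fst W) (fst W)" for A A' D D'
  by (subst mult_four_block_mat[OF that(1) zero_carrier_mat zero_carrier_mat that(3)
      that(2) zero_carrier_mat zero_carrier_mat that(4)])
   (use that in \<open>auto intro!: cong_four_block_mat\<close>)
 have "similar_mat_wit (snd (sum_rep V W) h) (snd (sum_rep V' W') h) (?B P R) (?B Q S)"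
  if h: "h : carrier H" for h
 proof -
  note p = similar_mat_witD2[OF rep_carrier[OF H V(1) h] PQ[OF h]]
  note r = similar_mat_witD2[OF rep_carrier[OF H W(1) h] RS[OF h]]
  have e: "snd (sum_rep V W) h = ?B (snd V h) (snd W h)" "snd (sum_rep V' W') h = ?B (snd V' h) (snd W' h)"
   using snd_sum_rep[OF H V(1) W(1) h] snd_sum_rep[OF H V(2) W(2) h] d by auto
  have m: "?B P R * ?B (snd V' h) (snd W' h) = ?B (P * snd V' h) (R * snd W' h)"
   by (rule mul) (use p r in auto)
  show ?thesis
  proof (rule similar_mat_witI)
   show "?B P R * ?B Q S = 1\<^sub>m (fst V + fst W)" using mul[OF p(6,7) r(6,7)] p(1) r(1) by simp
   show "?B Q S * ?B P R = 1\<^sub>m (fst V + fst W)" using mul[OF p(7,6) r(7,6)] p(2) r(2) by simp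
   have "?B (P * snd V' h) (R * snd W' h) * ?B Q S = ?B (P * snd V' h * Q) (R * snd W' h * S)"
    by (rule mul) (use p r in auto)
   thus "snd (sum_rep V W) h = ?B P R * snd (sum_rep V' W') h * ?B Q S" unfolding e m using p(3) r(3) by simp
  qed (use p r e in auto)
 qed
 thus ?thesis unfolding rep_iso_def by blast
qed

lemma zero_rep_closed: "group H ==> zero_rep : reps H" unfolding zero_rep_def by (simp add: mem_reps_iff)

lemma trivial_rep_closed: "group H ==> trivial_rep : reps H"
 unfolding trivial_rep_def by (simp add: mem_reps_iff)

lemma sum_rep_zero:
 assumes H: "group H" and V: "V : reps H"
 shows "rep_iso H (sum_rep zero_rep V) V"
proof (rule rep_iso_permutation[where p = id and d = "fst V"])
 show "sum_rep zero_rep V : reps H" by (rule sum_rep_closed[OF H zero_rep_closed[OF H] V])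
 fix h i j assume "h : carrier H" "i < fst V" "j < fst V"
 thus "snd (sum_rep zero_rep V) h $$ (i, j) = snd V h $$ (id i, id j)"
  using sum_rep_index[OF H zero_rep_closed[OF H] V, of h i j] by (simp add: zero_rep_def)
qed (use assms in \<open>auto simp: zero_rep_def\<close>)

lemma sum_rep_commute:
 assumes H: "group H" and V: "V : reps H" "W : reps H"
 shows "rep_iso H (sum_rep V W) (sum_rep W V)"
proof (rule rep_iso_permutation)
 let ?p = "%i. if i < fst V then i + fst W else i - fst V"
 show "sum_rep V W : reps H" "sum_rep W V : reps H" by (auto intro: sum_rep_closed[OF H] V)
 show "bij_betw ?p {..<fst V + fst W} {..<fst V + fst W}"
 proof (rule bij_betw_byWitness[where f' = "%i. if i < fst W then i + fst V else i - fst W"])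
 qed auto
 fix h i j assume "h : carrier H" "i < fst V + fst W" "j < fst V + fst W"
 thus "snd (sum_rep V W) h $$ (i, j) = snd (sum_rep W V) h $$ (?p i, ?p j)"
  using sum_rep_index[OF H V, of h i j] sum_rep_index[OF H V(2,1), of h "?p i" "?p j"] by auto
qed (use H in auto)

lemma sum_rep_assoc:
 assumes H: "group H" and V: "V : reps H" "W : reps H" "U : reps H"
 shows "rep_iso H (sum_rep (sum_rep V W) U) (sum_rep V (sum_rep W U))"
proof (rule rep_iso_permutation[where p = id])
 note VW = sum_rep_closed[OF H V(1,2)] and WU = sum_rep_closed[OF H V(2,3)]
 show "sum_rep (sum_rep V W) U : reps H" "sum_rep V (sum_rep W U) : reps H"
  by (auto intro: sum_rep_closed[OF H] V)
 fix h i j assume a: "h : carrier H" "i < fst V + fst W + fst U" "j < fst V + fst W + fst U"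
 have l: "snd (sum_rep (sum_rep V W) U) h $$ (i, j) =
   (if i < fst V + fst W then if j < fst V + fst W then snd (sum_rep V W) h $$ (i, j) else 0
    else if j < fst V + fst W then 0 else snd U h $$ (i - (fst V + fst W), j - (fst V + fst W)))"
  using sum_rep_index[OF H VW V(3) a(1), of i j] a by simp
 have r: "snd (sum_rep V (sum_rep W U)) h $$ (i, j) =
   (if i < fst V then if j < fst V then snd V h $$ (i, j) else 0
    else if j < fst V then 0 else snd (sum_rep W U) h $$ (i - fst V, j - fst V))"
  using sum_rep_index[OF H V(1) WU a(1), of i j] a by simp
 show "snd (sum_rep (sum_rep V W) U) h $$ (i, j) = snd (sum_rep V (sum_rep W U)) h $$ (id i, id j)"
  using l r sum_rep_index[OF H V(1,2) a(1), of i j] sum_rep_index[OF H V(2,3) a(1), of "i - fst V" "j - fst V"] a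
  by auto
qed (use H in auto)

section \<open>Isomorphism classes under direct sum\<close>

definition iso_class :: "'h monoid => 'h rep => 'h rep set" where
 "iso_class H V = {W : reps H. rep_iso H V W}"

text \<open>Turns computations with formal differences into rewriting in a commutative monoid, in
  place of chains of isomorphisms.\<close>

definition rep_monoid :: "'h monoid => 'h rep set monoid" where
 "rep_monoid H = \<lparr>carrier = iso_class H ` reps H,
   Group.monoid.mult = (%X Y. iso_class H (sum_rep (SOME V. V : X) (SOME W. W : Y))),
   one = iso_class H zero_rep\<rparr>"

lemma iso_class_eq_iff:
 assumes "group H" "V : reps H" "W : reps H"
 shows "iso_class H V = iso_class H W <-> rep_iso H V W"
proof
 assume "iso_class H V = iso_class H W"
 moreover have "W : iso_class H W" unfolding iso_class_def using rep_iso_refl assms by blast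
 ultimately show "rep_iso H V W" unfolding iso_class_def by blast
next
 assume "rep_iso H V W"
 thus "iso_class H V = iso_class H W" unfolding iso_class_def using rep_iso_sym rep_iso_trans by blast
qed

context
 fixes H :: "'h monoid"
begin

private abbreviation "RM \<equiv> rep_monoid H"
private abbreviation "ic \<equiv> iso_class H"
private abbreviation rmult (infixl "\<boxplus>" 70) where "x \<boxplus> y \<equiv> x \<otimes>\<^bsub>RM\<^esub> y"

lemma iso_class_closed: "V : reps H ==> ic V : carrier RM" by (simp add: rep_monoid_def)

lemma iso_class_sum:
 assumes H: "group H" and V: "V : reps H" "W : reps H"
 shows "ic V \<boxplus> ic W = ic (sum_rep V W)"
proof -
 have some: "(SOME U. U : ic X) : reps H & rep_iso H X (SOME U. U : ic X)"
  if "X : reps H" for X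
 proof -
  have "X : ic X" unfolding iso_class_def using that rep_iso_refl[OF H] by blast
  hence "(SOME U. U : ic X) : ic X" by (rule someI)
  thus ?thesis by (simp add: iso_class_def)
 qed
 have "rep_iso H (sum_rep V W) (sum_rep (SOME U. U : ic V) (SOME U. U : ic W))"
  using some[OF V(1)] some[OF V(2)] by (intro sum_rep_cong[OF H]) (use V in auto)
 hence "ic (sum_rep V W) =
   ic (sum_rep (SOME U. U : ic V) (SOME U. U : ic W))"
  using iso_class_eq_iff[OF H] sum_rep_closed[OF H] some V by blast
 thus ?thesis by (simp add: rep_monoid_def)
qed

lemma comm_monoid_rep_monoid:
 assumes H: "group H"
 shows "comm_monoid RM"
proof (rule comm_monoidI)
 have cl: "!!x. x : carrier RM ==> EX V:reps H. x = ic V" by (auto simp: rep_monoid_def)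
 have one: "\<one>\<^bsub>rep_monoid H\<^esub> = ic zero_rep" by (simp add: rep_monoid_def)
 show "\<one>\<^bsub>rep_monoid H\<^esub> : carrier RM"
  unfolding one by (rule iso_class_closed[OF zero_rep_closed[OF H]])
 fix x y assume "x : carrier RM" "y : carrier RM"
 then obtain V W where V: "V : reps H" "x = ic V" and W: "W : reps H" "y = ic W" using cl by metis
 show "x \<boxplus> y : carrier RM"
  using V W iso_class_sum[OF H V(1) W(1)] iso_class_closed[OF sum_rep_closed[OF H V(1) W(1)]] by simp
 show "x \<boxplus> y = y \<boxplus> x"
  using iso_class_sum[OF H] iso_class_eq_iff[OF H] sum_rep_commute[OF H] sum_rep_closed[OF H] V W by metis
 show "\<one>\<^bsub>rep_monoid H\<^esub> \<boxplus> x = x"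
  unfolding one using iso_class_sum[OF H zero_rep_closed[OF H]] iso_class_eq_iff[OF H]
   sum_rep_zero[OF H] sum_rep_closed[OF H zero_rep_closed[OF H]] V by metis
 fix z assume "z : carrier RM"
 then obtain U where U: "U : reps H" "z = ic U" using cl by metis
 show "x \<boxplus> y \<boxplus> z = x \<boxplus> (y \<boxplus> z)"
  using V W U iso_class_sum[OF H] iso_class_eq_iff[OF H] sum_rep_assoc[OF H V(1) W(1) U(1)]
   sum_rep_closed[OF H] by simp
qed

section \<open>The group of virtual representations\<close>

lemma vrep_rel_iff:
 assumes H: "group H"
 shows "((V, W), (V', W')) : vrep_rel H <->
  V : reps H & W : reps H & V' : reps H & W' : reps H \<and>
  (EX u:carrier RM. ic V \<boxplus> ic W' \<boxplus> u =
    ic V' \<boxplus> ic W \<boxplus> u)"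
proof -
 have "rep_iso H (sum_rep (sum_rep V W') U) (sum_rep (sum_rep V' W) U) <->
   ic V \<boxplus> ic W' \<boxplus> ic U =
   ic V' \<boxplus> ic W \<boxplus> ic U"
  if "V : reps H" "W : reps H" "V' : reps H" "W' : reps H" "U : reps H" for U
  using that iso_class_sum[OF H] iso_class_eq_iff[OF H] sum_rep_closed[OF H] by simp
 moreover have "carrier RM = ic ` reps H" by (simp add: rep_monoid_def)
 ultimately show ?thesis unfolding vrep_rel_def by auto
qed

lemma equiv_vrep_rel:
 assumes H: "group H"
 shows "equiv (reps H \<times> reps H) (vrep_rel H)"
proof (rule equivI)
 interpret R: comm_monoid RM by (rule comm_monoid_rep_monoid[OF H])
 note cl = iso_class_closed
 show "vrep_rel H <= (reps H \<times> reps H) \<times> (reps H \<times> reps H)" unfolding vrep_rel_def by auto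
 show "refl_on (reps H \<times> reps H) (vrep_rel H)"
  using R.one_closed by (auto simp: refl_on_def vrep_rel_iff[OF H])
 show "sym (vrep_rel H)" by (auto simp: sym_def vrep_rel_iff[OF H])
 show "trans (vrep_rel H)"
 proof (rule transI)
  fix x y z assume "(x, y) : vrep_rel H" "(y, z) : vrep_rel H"
  moreover obtain V W V' W' V'' W'' where e: "x = (V, W)" "y = (V', W')" "z = (V'', W'')" by (metis surj_pair)
  ultimately have r: "V : reps H" "W : reps H" "V' : reps H" "W' : reps H" "V'' : reps H" "W'' : reps H"
   and "EX u:carrier RM. ic V \<boxplus> ic W' \<boxplus> u =
     ic V' \<boxplus> ic W \<boxplus> u"
   and "EX u:carrier RM. ic V' \<boxplus> ic W'' \<boxplus> u =
     ic V'' \<boxplus> ic W' \<boxplus> u" by (auto simp: vrep_rel_iff[OF H])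
  then obtain u t where u: "u : carrier RM" "t : carrier RM"
   "ic V \<boxplus> ic W' \<boxplus> u =
     ic V' \<boxplus> ic W \<boxplus> u"
   "ic V' \<boxplus> ic W'' \<boxplus> t =
     ic V'' \<boxplus> ic W' \<boxplus> t" by blast
  note c = cl[OF r(1)] cl[OF r(2)] cl[OF r(3)] cl[OF r(4)] cl[OF r(5)] cl[OF r(6)] u(1,2)
  \<comment> \<open>The relation cancels only up to a common summand. Adding the middle pair and
    both stabilizing summands \<open>u\<close> and \<open>t\<close> lets both equations be
    substituted.\<close>
  let ?w = "ic V' \<boxplus> ic W' \<boxplus> u \<boxplus> t"
  have "ic V \<boxplus> ic W'' \<boxplus> ?w =
    (ic V \<boxplus> ic W' \<boxplus> u) \<boxplus>
    (ic V' \<boxplus> ic W'' \<boxplus> t)" using c by (simp add: R.m_ac)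
  also have "... = ic V'' \<boxplus> ic W \<boxplus> ?w" unfolding u(3,4) using c by (simp add: R.m_ac)
  finally show "(x, z) : vrep_rel H" unfolding e vrep_rel_iff[OF H] using r c by blast
 qed
qed

lemma vrep_diff_eq_iff:
 assumes H: "group H" and "V : reps H" "W : reps H" "V' : reps H" "W' : reps H"
 shows "vrep_diff H V W = vrep_diff H V' W' <-> ((V, W), (V', W')) : vrep_rel H"
 unfolding vrep_diff_def using eq_equiv_class_iff[OF equiv_vrep_rel[OF H]] assms by blast

lemma vrep_diff_closed: "V : reps H ==> W : reps H ==> vrep_diff H V W : carrier (VRep H)"
 unfolding vrep_diff_def VRep_def by (auto intro: quotientI)

lemma vrep_diff_cases:
 assumes "X : carrier (VRep H)"
 obtains V W where "V : reps H" "W : reps H" "X = vrep_diff H V W"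
 using assms unfolding VRep_def vrep_diff_def by (auto elim!: quotientE)

lemma vrep_diff_cong:
 assumes H: "group H" and "V : reps H" "W : reps H" "V' : reps H" "W' : reps H"
  and "rep_iso H V V'" "rep_iso H W W'"
 shows "vrep_diff H V W = vrep_diff H V' W'"
proof -
 interpret R: comm_monoid RM by (rule comm_monoid_rep_monoid[OF H])
 have "ic V = ic V'" "ic W = ic W'" using iso_class_eq_iff[OF H] assms by auto
 thus ?thesis using vrep_diff_eq_iff[OF assms(1-5)] vrep_rel_iff[OF H] assms R.one_closed by metis
qed

lemma vrep_class_cong:
 "group H ==> V : reps H ==> V' : reps H ==> rep_iso H V V' ==> vrep_class H V = vrep_class H V'"
 unfolding vrep_class_def by (rule vrep_diff_cong) (auto intro: zero_rep_closed rep_iso_refl)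

lemma vrep_diff_self:
 assumes "X : vrep_diff H V W"
 shows "fst X : reps H" "snd X : reps H" "((V, W), X) : vrep_rel H"
 using assms unfolding vrep_diff_def by (auto simp: vrep_rel_def)

text \<open>Operations on classes are written as unions over representatives; when the value does
  not depend on the representative, such a union collapses to a single value.\<close>

lemma vrep_diff_UN:
 assumes H: "group H" and V: "V : reps H" "W : reps H"
  and F: "!!V' W'. ((V, W), (V', W')) : vrep_rel H ==> F V' W' = F V W"
 shows "(\<Union>(V', W')\<in>vrep_diff H V W. F V' W') = F V W"
proof -
 have "(V, W) : vrep_diff H V W"
  unfolding vrep_diff_def by (rule equiv_class_self[OF equiv_vrep_rel[OF H]]) (use V in simp)
 moreover have "F (fst p) (snd p) = F V W" if "p : vrep_diff H V W" for p
  using F[of "fst p" "snd p"] vrep_diff_self(3)[OF that] by simp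
 ultimately show ?thesis by (auto simp: case_prod_beta)
qed

lemma add_vrep_diff:
 assumes H: "group H" and V: "V : reps H" "W : reps H" "V' : reps H" "W' : reps H"
 shows "vrep_diff H V W \<oplus>\<^bsub>VRep H\<^esub> vrep_diff H V' W' = vrep_diff H (sum_rep V V') (sum_rep W W')"
proof -
 interpret R: comm_monoid RM by (rule comm_monoid_rep_monoid[OF H])
 note cl = iso_class_closed
 \<comment> \<open>Change of representative in the first argument; \<open>key'\<close> obtains the
   second argument from it by commutativity.\<close>
 have key: "vrep_diff H (sum_rep A C) (sum_rep B D) = vrep_diff H (sum_rep A' C) (sum_rep B' D)"
  if "((A, B), (A', B')) : vrep_rel H" "C : reps H" "D : reps H" for A B A' B' C D
 proof -
  have r: "A : reps H" "B : reps H" "A' : reps H" "B' : reps H"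
   and "EX u:carrier RM. ic A \<boxplus> ic B' \<boxplus> u =
     ic A' \<boxplus> ic B \<boxplus> u" using that(1) by (auto simp: vrep_rel_iff[OF H])
  then obtain u where u: "u : carrier RM"
   "ic A \<boxplus> ic B' \<boxplus> u =
     ic A' \<boxplus> ic B \<boxplus> u" by blast
  note c = cl[OF r(1)] cl[OF r(2)] cl[OF r(3)] cl[OF r(4)] cl[OF that(2)] cl[OF that(3)] u(1)
  have "ic A \<boxplus> ic C \<boxplus>
     (ic B' \<boxplus> ic D) \<boxplus> u =
    (ic A \<boxplus> ic B' \<boxplus> u) \<boxplus>
    (ic C \<boxplus> ic D)" using c by (simp add: R.m_ac)
  also have "... = ic A' \<boxplus> ic C \<boxplus>
     (ic B \<boxplus> ic D) \<boxplus> u" unfolding u(2) using c by (simp add: R.m_ac)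
  finally have "((sum_rep A C, sum_rep B D), (sum_rep A' C, sum_rep B' D)) : vrep_rel H"
   unfolding vrep_rel_iff[OF H] iso_class_sum[OF H r(1) that(2), symmetric]
    iso_class_sum[OF H r(4) that(3), symmetric] iso_class_sum[OF H r(3) that(2), symmetric]
    iso_class_sum[OF H r(2) that(3), symmetric]
   using sum_rep_closed[OF H r(1) that(2)] sum_rep_closed[OF H r(2) that(3)]
    sum_rep_closed[OF H r(3) that(2)] sum_rep_closed[OF H r(4) that(3)] u(1) by blast
  thus ?thesis using vrep_diff_eq_iff[OF H sum_rep_closed[OF H r(1) that(2)] sum_rep_closed[OF H r(2) that(3)]
    sum_rep_closed[OF H r(3) that(2)] sum_rep_closed[OF H r(4) that(3)]] by blast
 qed
 have comm: "vrep_diff H (sum_rep A C) (sum_rep B D) = vrep_diff H (sum_rep C A) (sum_rep D B)"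
  if "A : reps H" "B : reps H" "C : reps H" "D : reps H" for A B C D
  by (rule vrep_diff_cong[OF H]) (auto intro: sum_rep_closed[OF H] sum_rep_commute[OF H] that)
 have key': "vrep_diff H (sum_rep C A) (sum_rep D B) = vrep_diff H (sum_rep C A') (sum_rep D B')"
  if "((A, B), (A', B')) : vrep_rel H" "C : reps H" "D : reps H" for A B A' B' C D
 by (metis H comm key that(1,2,3) vrep_rel_iff)
 have "(\<Union>(B, D)\<in>vrep_diff H V' W'. vrep_diff H (sum_rep A B) (sum_rep C D)) =
   vrep_diff H (sum_rep A V') (sum_rep C W')" if "A : reps H" "C : reps H" for A C
  by (rule vrep_diff_UN[OF H V(3,4)]) (use key'[OF _ that] in simp)
 hence "(\<Union>(A, C)\<in>vrep_diff H V W. \<Union>(B, D)\<in>vrep_diff H V' W'. vrep_diff H (sum_rep A B) (sum_rep C D)) =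
   (\<Union>(A, C)\<in>vrep_diff H V W. vrep_diff H (sum_rep A V') (sum_rep C W'))"
  using vrep_diff_self[of _ V W] by (intro SUP_cong refl) (metis (no_types, lifting) case_prod_beta)
 also have "... = vrep_diff H (sum_rep V V') (sum_rep W W')"
  by (rule vrep_diff_UN[OF H V(1,2)]) (use key[OF _ V(3,4)] in simp)
 finally show ?thesis by (simp add: VRep_def)
qed

end

lemma zero_VRep: "\<zero>\<^bsub>VRep H\<^esub> = vrep_diff H zero_rep zero_rep"
 by (simp add: VRep_def vrep_class_def)

lemma one_VRep: "\<one>\<^bsub>VRep H\<^esub> = vrep_class H trivial_rep" by (simp add: VRep_def)

lemma group_VRep:
 assumes H: "group H"
 shows "abelian_group (VRep H)"
proof (rule abelian_groupI)
 note z = zero_rep_closed[OF H] and sc = sum_rep_closed[OF H]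
 note ad = add_vrep_diff[OF H] and cg = vrep_diff_cong[OF H]
 show "\<zero>\<^bsub>VRep H\<^esub> : carrier (VRep H)" unfolding zero_VRep by (rule vrep_diff_closed[OF z z])
 fix x y assume "x : carrier (VRep H)" "y : carrier (VRep H)"
 then obtain A B C D where x: "A : reps H" "B : reps H" "x = vrep_diff H A B"
  and y: "C : reps H" "D : reps H" "y = vrep_diff H C D" by (metis vrep_diff_cases)
 show "x \<oplus>\<^bsub>VRep H\<^esub> y : carrier (VRep H)"
  unfolding x y ad[OF x(1,2) y(1,2)] by (intro vrep_diff_closed sc x y)
 show "x \<oplus>\<^bsub>VRep H\<^esub> y = y \<oplus>\<^bsub>VRep H\<^esub> x"
  unfolding x y ad[OF x(1,2) y(1,2)] ad[OF y(1,2) x(1,2)] by (intro cg sc sum_rep_commute[OF H] x y)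
 show "\<zero>\<^bsub>VRep H\<^esub> \<oplus>\<^bsub>VRep H\<^esub> x = x"
  unfolding x zero_VRep ad[OF z z x(1,2)] by (intro cg sc sum_rep_zero[OF H] x z)
 have "vrep_diff H (sum_rep B A) (sum_rep A B) = vrep_diff H zero_rep zero_rep"
 proof -
  have "iso_class H (sum_rep B A) = iso_class H (sum_rep A B)"
   using iso_class_eq_iff[OF H sc[OF x(2,1)] sc[OF x(1,2)]] sum_rep_commute[OF H x(2,1)] by blast
  moreover interpret R: comm_monoid "rep_monoid H" by (rule comm_monoid_rep_monoid[OF H])
  have "iso_class H (sum_rep A B) \<otimes>\<^bsub>rep_monoid H\<^esub> iso_class H zero_rep =
    iso_class H zero_rep \<otimes>\<^bsub>rep_monoid H\<^esub> iso_class H (sum_rep A B)"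
   by (rule R.m_comm) (intro iso_class_closed sc x z)+
  ultimately show ?thesis unfolding vrep_diff_eq_iff[OF H sc[OF x(2,1)] sc[OF x(1,2)] z z] vrep_rel_iff[OF H]
   using sc[OF x(2,1)] sc[OF x(1,2)] z R.one_closed by metis
 qed
 thus "EX y:carrier (VRep H). y \<oplus>\<^bsub>VRep H\<^esub> x = \<zero>\<^bsub>VRep H\<^esub>"
  using ad[OF x(2,1,1,2)] vrep_diff_closed[OF x(2,1)] x(3) zero_VRep by metis
 fix w assume "w : carrier (VRep H)"
 then obtain E F where w: "E : reps H" "F : reps H" "w = vrep_diff H E F" by (metis vrep_diff_cases)
 show "x \<oplus>\<^bsub>VRep H\<^esub> y \<oplus>\<^bsub>VRep H\<^esub> w = x \<oplus>\<^bsub>VRep H\<^esub> (y \<oplus>\<^bsub>VRep H\<^esub> w)"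
  unfolding x y w ad[OF x(1,2) y(1,2)] ad[OF y(1,2) w(1,2)]
   ad[OF sc[OF x(1) y(1)] sc[OF x(2) y(2)] w(1,2)] ad[OF x(1,2) sc[OF y(1) w(1)] sc[OF y(2) w(2)]]
  by (intro cg sc sum_rep_assoc[OF H] x y w)
qed

lemma vrep_class_closed: "group H ==> V : reps H ==> vrep_class H V : carrier (VRep H)"
 unfolding vrep_class_def by (intro vrep_diff_closed zero_rep_closed)

lemma vrep_class_sum:
 assumes H: "group H" and V: "V : reps H" "W : reps H"
 shows "vrep_class H (sum_rep V W) = vrep_class H V \<oplus>\<^bsub>VRep H\<^esub> vrep_class H W"
by (metis (no_types, lifting) H add_vrep_diff assms(2,3) rep_iso_refl sum_rep_closed sum_rep_zero vrep_class_def vrep_diff_cong zero_rep_closed)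

text \<open>Adding a common summand cannot make dimensions 1 and 0 equal. This fixes the degree of
  the Z-polynomial, whose top coefficient is one.\<close>

lemma VRep_one_not_zero:
 assumes H: "group H"
 shows "\<one>\<^bsub>VRep H\<^esub> ~= \<zero>\<^bsub>VRep H\<^esub>"
proof
 note z = zero_rep_closed[OF H] and t = trivial_rep_closed[OF H] and sc = sum_rep_closed[OF H]
 assume "\<one>\<^bsub>VRep H\<^esub> = \<zero>\<^bsub>VRep H\<^esub>"
 hence "vrep_diff H trivial_rep zero_rep = vrep_diff H zero_rep zero_rep"
  by (simp add: one_VRep vrep_class_def zero_VRep)
 hence "((trivial_rep, zero_rep), (zero_rep, zero_rep)) : vrep_rel H"
  using vrep_diff_eq_iff[OF H t z z z] by blast
 then obtain U where U: "U : reps H"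
  "rep_iso H (sum_rep (sum_rep trivial_rep zero_rep) U) (sum_rep (sum_rep zero_rep zero_rep) U)"
  unfolding vrep_rel_def by blast
 hence "fst (sum_rep (sum_rep trivial_rep zero_rep) U) = fst (sum_rep (sum_rep zero_rep zero_rep) U)"
  by (intro rep_iso_dim[OF H _ _ U(2)] sc t z U(1))
 thus False by (simp add: trivial_rep_def zero_rep_def)
qed

section \<open>Induction\<close>

lemma bij_betw_div_mod: "bij_betw (%i. (i div d, i mod d)) {..<m * d} ({..<m} \<times> {..<d :: nat})"
proof (rule bij_betw_byWitness[where f' = "%(k, a). k * d + a"])
 have "k * d + a < m * d" if "k < m" "a < d" for k a
 proof -
  have "k * d + a < Suc k * d" using that by simp
  also have "... <= m * d" using that by (intro mult_le_mono1) simp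
  finally show ?thesis .
 qed
 thus "(%(k, a). k * d + a) ` ({..<m} \<times> {..<d}) <= {..<m * d}" by auto
 have "i div d < m & i mod d < d" if "i < m * d" for i
  using that by (cases "d = 0") (auto simp: less_mult_imp_div_less)
 thus "(%i. (i div d, i mod d)) ` {..<m * d} <= {..<m} \<times> {..<d}" by auto
qed auto

lemma div_mod_less: "i < m * d ==> i div d < m" "i < m * d ==> i mod d < (d :: nat)"
 by (auto simp: less_mult_imp_div_less) (cases "d = 0"; auto)

lemma sum_div_mod: "(\<Sum>i<m * d. f (i div d) (i mod d)) = (\<Sum>k<m. \<Sum>a<(d :: nat). f k a)"
 using sum.reindex_bij_betw[OF bij_betw_div_mod[of d m], of "%(k, a). f k a"]
 by (simp add: sum.cartesian_product)

lemma bij_betw_append: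
 fixes p q :: nat
 assumes f: "bij_betw f {..<p} A" and g: "bij_betw g {..<q} B" and "A Int B = {}"
 shows "bij_betw (%i. if i < p then f i else g (i - p)) {..<p + q} (A Un B)"
proof -
 have "bij_betw (%i. if i < p then f i else g (i - p)) {..<p} A"
  by (rule bij_betw_cong[THEN iffD1, OF _ f]) simp
 moreover have "bij_betw (%i. i - p) {p..<p + q} {..<q}"
  by (rule bij_betw_byWitness[where f' = "%i. i + p"]) auto
 from bij_betw_trans[OF this g] have "bij_betw (%i. if i < p then f i else g (i - p)) {p..<p + q} B"
  by (rule bij_betw_cong[THEN iffD1, rotated]) simp
 ultimately have "bij_betw (%i. if i < p then f i else g (i - p)) ({..<p} Un {p..<p + q}) (A Un B)"
  by (rule bij_betw_combine) (rule assms(3))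
 moreover have "{..<p} Un {p..<p + q} = {..<p + q}" by auto
 ultimately show ?thesis by simp
qed

definition block_mat :: "nat => nat => (nat => nat => complex mat) => complex mat" where
 "block_mat m d F = mat (m * d) (m * d) (%(i, j). F (i div d) (j div d) $$ (i mod d, j mod d))"

lemma block_mat_carrier [simp]: "block_mat m d F : carrier_mat (m * d) (m * d)" by (simp add: block_mat_def)

lemma block_mat_cong:
 "(!!k l. k < m ==> l < m ==> F k l = G k l) ==> block_mat m d F = block_mat m d G"
 unfolding block_mat_def by (auto intro!: eq_matI simp: div_mod_less)

text \<open>In each block position only one intermediate index contributes. This covers induced
  representations, with at most one nonzero block per block column, and block-diagonal
  matrices.\<close>

lemma block_mat_mult:
 assumes F: "!!k l. k < m ==> l < m ==> F k l : carrier_mat d d"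
  and G: "!!k l. k < m ==> l < m ==> G k l : carrier_mat d d"
  and E: "!!k l. k < m ==> l < m ==>
   EX q<m. F k q * G q l = E k l & (ALL p<m. p ~= q --> F k p * G p l = 0\<^sub>m d d)"
 shows "block_mat m d F * block_mat m d G = block_mat m d E"
proof (rule eq_matI)
 fix i j assume "i < dim_row (block_mat m d E)" "j < dim_col (block_mat m d E)"
 hence ij: "i < m * d" "j < m * d" by (auto simp: block_mat_def)
 define k l a b where "k = i div d" and "l = j div d" and "a = i mod d" and "b = j mod d"
 have kl: "k < m" "l < m" "a < d" "b < d" using ij div_mod_less by (auto simp: k_def l_def a_def b_def)
 obtain q where q: "q < m" "F k q * G q l = E k l" "!!p. p < m ==> p ~= q ==> F k p * G p l = 0\<^sub>m d d"
  using E[OF kl(1,2)] by blast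
 have "(block_mat m d F * block_mat m d G) $$ (i, j) =
   (\<Sum>p<m * d. F k (p div d) $$ (a, p mod d) * G (p div d) l $$ (p mod d, b))"
  using ij by (simp add: block_mat_def scalar_prod_def lessThan_atLeast0 k_def l_def a_def b_def)
 also have "... = (\<Sum>p<m. \<Sum>c<d. F k p $$ (a, c) * G p l $$ (c, b))"
  by (rule sum_div_mod[of "%p c. F k p $$ (a, c) * G p l $$ (c, b)"])
 also have "... = (\<Sum>p<m. (F k p * G p l) $$ (a, b))"
 proof (rule sum.cong[OF refl])
  fix p assume "p : {..<m}"
  hence "F k p : carrier_mat d d" "G p l : carrier_mat d d" using F G kl by auto
  thus "(\<Sum>c<d. F k p $$ (a, c) * G p l $$ (c, b)) = (F k p * G p l) $$ (a, b)"
   using kl by (simp add: scalar_prod_def lessThan_atLeast0)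
 qed
 also have "... = (\<Sum>p<m. if p = q then (F k p * G p l) $$ (a, b) else 0)"
  using q(3) kl by (intro sum.cong) auto
 also have "... = E k l $$ (a, b)" using q by simp
 finally show "(block_mat m d F * block_mat m d G) $$ (i, j) = block_mat m d E $$ (i, j)"
  using ij by (simp add: block_mat_def k_def l_def a_def b_def)
qed (auto simp: block_mat_def)

lemma block_mat_one: "block_mat m d (%k l. if k = l then 1\<^sub>m d else 0\<^sub>m d d) = 1\<^sub>m (m * d)"
proof (rule eq_matI)
 fix i j assume "i < dim_row (1\<^sub>m (m * d) :: complex mat)" "j < dim_col (1\<^sub>m (m * d) :: complex mat)"
 hence ij: "i < m * d" "j < m * d" by auto
 have "i = j <-> i div d = j div d & i mod d = j mod d" by (metis div_mult_mod_eq)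
 thus "block_mat m d (%k l. if k = l then 1\<^sub>m d else 0\<^sub>m d d) $$ (i, j) = 1\<^sub>m (m * d) $$ (i, j)"
  using ij div_mod_less[of i m d] div_mod_less[of j m d] by (auto simp: block_mat_def)
qed (auto simp: block_mat_def)

lemma l_coset_eq_iff:
 assumes H: "group H" and K: "subgroup K H" and th: "t : carrier H" "h : carrier H"
 shows "t <#\<^bsub>H\<^esub> K = h <#\<^bsub>H\<^esub> K <-> inv\<^bsub>H\<^esub> t \<otimes>\<^bsub>H\<^esub> h : K"
proof -
 interpret group H by fact
 interpret K: subgroup K H by fact
 show ?thesis
 by (metis K K.lcos_module_imp K.lcos_module_rev group.lcos_self is_group l_repr_independence th(1,2))
qed

lemma transversal_spec:
 assumes H: "group H" and fin: "finite (carrier H)" and K: "subgroup K H"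
 shows "set (transversal H K) <= carrier H"
  and "h : carrier H ==> EX k<length (transversal H K). inv\<^bsub>H\<^esub> (transversal H K ! k) \<otimes>\<^bsub>H\<^esub> h : K"
  and "k < length (transversal H K) ==> l < length (transversal H K) ==>
   inv\<^bsub>H\<^esub> (transversal H K ! k) \<otimes>\<^bsub>H\<^esub> (transversal H K ! l) : K ==> k = l"
proof -
 interpret group H by fact
 have "finite (lcosets\<^bsub>H\<^esub> K)"
  using lcosets_subset_PowG[OF K] fin by (meson finite_Pow_iff finite_subset)
 then obtain cs where cs: "distinct cs" "set cs = lcosets\<^bsub>H\<^esub> K" using finite_distinct_list by metis
 have "ALL C:set cs. EX t:carrier H. t <#\<^bsub>H\<^esub> K = C" using cs(2) by (auto simp: LCOSETS_def)
 then obtain r where r: "ALL C:set cs. r C : carrier H & r C <#\<^bsub>H\<^esub> K = C" by metis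
 have "map (%t. t <#\<^bsub>H\<^esub> K) (map r cs) = cs" using r by (auto simp: comp_def intro!: map_idI)
 hence "EX ts. set ts <= carrier H & distinct (map (%t. t <#\<^bsub>H\<^esub> K) ts) \<and>
   set (map (%t. t <#\<^bsub>H\<^esub> K) ts) = lcosets\<^bsub>H\<^esub> K"
  using cs r by (intro exI[of _ "map r cs"]) auto
 from someI_ex[OF this] have t: "set (transversal H K) <= carrier H"
  "distinct (map (%t. t <#\<^bsub>H\<^esub> K) (transversal H K))"
  "set (map (%t. t <#\<^bsub>H\<^esub> K) (transversal H K)) = lcosets\<^bsub>H\<^esub> K"
  unfolding transversal_def by auto
 show "set (transversal H K) <= carrier H" by (rule t)
 { assume h: "h : carrier H"
  hence "h <#\<^bsub>H\<^esub> K : set (map (%t. t <#\<^bsub>H\<^esub> K) (transversal H K))"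
   unfolding t(3) by (auto simp: LCOSETS_def)
  then obtain k where "k < length (transversal H K)" "transversal H K ! k <#\<^bsub>H\<^esub> K = h <#\<^bsub>H\<^esub> K"
   by (auto simp: in_set_conv_nth)
  thus "EX k<length (transversal H K). inv\<^bsub>H\<^esub> (transversal H K ! k) \<otimes>\<^bsub>H\<^esub> h : K"
   using l_coset_eq_iff[OF H K _ h] t(1) nth_mem by blast }
 assume kl: "k < length (transversal H K)" "l < length (transversal H K)"
  "inv\<^bsub>H\<^esub> (transversal H K ! k) \<otimes>\<^bsub>H\<^esub> (transversal H K ! l) : K"
 hence "transversal H K ! k <#\<^bsub>H\<^esub> K = transversal H K ! l <#\<^bsub>H\<^esub> K"
  using l_coset_eq_iff[OF H K] t(1) nth_mem by blast
 thus "k = l" using t(2) kl by (auto simp: distinct_conv_nth)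
qed

locale finite_group_subgroup =
 fixes H :: "'h monoid" and K :: "'h set"
 assumes group_H: "group H" and finite_H: "finite (carrier H)" and subgroup_K: "subgroup K H"
begin

sublocale group H by (rule group_H)

abbreviation "HK \<equiv> H\<lparr>carrier := K\<rparr>"

lemma group_HK: "group HK" using subgroup_K by (rule subgroup_imp_group)

definition ts :: "'h list" where "ts = transversal H K"

definition conj :: "'h => nat => nat => 'h" where
 "conj h k l = inv\<^bsub>H\<^esub> (ts ! k) \<otimes>\<^bsub>H\<^esub> h \<otimes>\<^bsub>H\<^esub> (ts ! l)"

lemma ts_closed: "k < length ts ==> ts ! k : carrier H"
 using transversal_spec(1)[OF group_H finite_H subgroup_K] unfolding ts_def by auto

lemma ts_exists: "h : carrier H ==> EX k<length ts. inv\<^bsub>H\<^esub> (ts ! k) \<otimes>\<^bsub>H\<^esub> h : K"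
 using transversal_spec(2)[OF group_H finite_H subgroup_K] unfolding ts_def by blast

lemma ts_unique:
 "k < length ts ==> l < length ts ==> inv\<^bsub>H\<^esub> (ts ! k) \<otimes>\<^bsub>H\<^esub> (ts ! l) : K ==> k = l"
 using transversal_spec(3)[OF group_H finite_H subgroup_K] unfolding ts_def by blast

lemma K_closed: "x : K ==> x : carrier H" using subgroup.mem_carrier[OF subgroup_K] .

lemma conj_closed: "h : carrier H ==> k < length ts ==> l < length ts ==> conj h k l : carrier H"
 unfolding conj_def by (simp add: ts_closed)

lemma conj_mult:
 assumes "g : carrier H" "h : carrier H" "k < length ts" "l < length ts" "q < length ts"
 shows "conj g k q \<otimes>\<^bsub>H\<^esub> conj h q l = conj (g \<otimes>\<^bsub>H\<^esub> h) k l"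
by (smt (verit) assms(1,2,3,4,5) conj_def inv_solve_left m_assoc subgroupE(3,4) subgroup_self ts_closed)

lemma conj_one_mem_iff:
 assumes "k < length ts" "l < length ts"
 shows "conj \<one>\<^bsub>H\<^esub> k l : K <-> k = l"
 using assms ts_unique[of k l] ts_closed subgroup.one_closed[OF subgroup_K] by (auto simp: conj_def)

lemma conj_exists:
 assumes "h : carrier H" "l < length ts"
 shows "EX q<length ts. conj h q l : K"
proof -
 have "h \<otimes>\<^bsub>H\<^esub> ts ! l : carrier H" using assms ts_closed by simp
 then obtain q where "q < length ts" "inv\<^bsub>H\<^esub> (ts ! q) \<otimes>\<^bsub>H\<^esub> (h \<otimes>\<^bsub>H\<^esub> ts ! l) : K" using ts_exists by blast
 thus ?thesis unfolding conj_def using assms ts_closed by (auto simp: m_assoc)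
qed

lemma conj_unique:
 assumes h: "h : carrier H" and l: "l < length ts" and q: "q < length ts" "p < length ts"
  and c: "conj h q l : K" "conj h p l : K"
 shows "p = q"
proof (rule ts_unique[OF q(2,1)])
 interpret K: subgroup K H by (rule subgroup_K)
 have "conj h p l \<otimes>\<^bsub>H\<^esub> inv\<^bsub>H\<^esub> (conj h q l) : K" using c by simp
 moreover have "inv\<^bsub>H\<^esub> (conj h q l) = conj (inv\<^bsub>H\<^esub> h) l q"
  unfolding conj_def using h l q ts_closed by (simp add: inv_mult_group m_assoc)
 ultimately have "conj \<one>\<^bsub>H\<^esub> p q : K" using conj_mult[of h "inv\<^bsub>H\<^esub> h" p q l] h l q by simp
 thus "inv\<^bsub>H\<^esub> (ts ! p) \<otimes>\<^bsub>H\<^esub> (ts ! q) : K" using ts_closed q by (simp add: conj_def)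
qed

definition blk :: "'h rep => 'h => nat => nat => complex mat" where
 "blk V h k l = (if conj h k l : K then snd V (conj h k l) else 0\<^sub>m (fst V) (fst V))"

lemma fst_ind_rep: "fst (ind_rep H K V) = length ts * fst V" by (simp add: ind_rep_def Let_def ts_def)

lemma snd_ind_rep: "snd (ind_rep H K V) h = block_mat (length ts) (fst V) (blk V h)" unfolding block_mat_def
 by (auto simp: ind_rep_def Let_def ts_def[symmetric] conj_def[symmetric] blk_def div_mod_less
   intro!: eq_matI)

lemma ind_rep_index:
 assumes "i < length ts * fst V" "j < length ts * fst V"
 shows "snd (ind_rep H K V) h $$ (i, j) =
  (if conj h (i div fst V) (j div fst V) : K
   then snd V (conj h (i div fst V) (j div fst V)) $$ (i mod fst V, j mod fst V) else 0)"
 using assms by (simp add: ind_rep_def Let_def ts_def[symmetric] conj_def)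

lemma blk_carrier: "V : reps HK ==> blk V h k l : carrier_mat (fst V) (fst V)"
 unfolding blk_def using rep_carrier[OF group_HK, of V] by auto

lemma ind_rep_closed:
 assumes V: "V : reps HK"
 shows "ind_rep H K V : reps H"
proof -
 interpret K: subgroup K H by (rule subgroup_K)
 let ?m = "length ts" and ?d = "fst V"
 have "(?m * ?d, snd (ind_rep H K V)) : reps H" unfolding mem_reps_iff[OF group_H]
 proof (intro conjI ballI)
  fix g h assume gh: "g : carrier H" "h : carrier H"
  show "snd (ind_rep H K V) h : carrier_mat (?m * ?d) (?m * ?d)" by (simp add: snd_ind_rep)
  have "block_mat ?m ?d (blk V g) * block_mat ?m ?d (blk V h) = block_mat ?m ?d (blk V (g \<otimes>\<^bsub>H\<^esub> h))"
  proof (rule block_mat_mult)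
   fix k l assume kl: "k < ?m" "l < ?m"
   show "blk V g k l : carrier_mat ?d ?d" "blk V h k l : carrier_mat ?d ?d" using blk_carrier[OF V] by auto
   \<comment> \<open>\<open>q\<close> is the coset of \<open>h\<close> times the representative
     numbered \<open>l\<close>; by \<open>conj_unique\<close> all other terms of the block product
     vanish.\<close>
   obtain q where q: "q < ?m" "conj h q l : K" using conj_exists[OF gh(2) kl(2)] by blast
   have "blk V g k p * blk V h p l = 0\<^sub>m ?d ?d" if "p < ?m" "p ~= q" for p
   by (metis V blk_carrier blk_def finite_group_subgroup.conj_unique finite_group_subgroup_axioms gh(2) kl(2) q(1,2) right_mult_zero_mat that(1,2))
   moreover have "blk V g k q * blk V h q l = blk V (g \<otimes>\<^bsub>H\<^esub> h) k l"
   proof -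
    note m = conj_mult[OF gh kl q(1)]
    note cc = conj_closed[OF gh(1) kl(1) q(1)]
    have iff: "conj g k q : K <-> conj (g \<otimes>\<^bsub>H\<^esub> h) k l : K"
    by (smt (verit) K.m_closed K.m_inv_closed K_closed cc l_cancel_one' m m_assoc q(2) r_inv)
    show ?thesis
    proof (cases "conj g k q : K")
     case True
     thus ?thesis
      using rep_mult[OF group_HK V, of "conj g k q" "conj h q l"] q(2) iff m by (simp add: blk_def)
    next
     case False
     thus ?thesis using iff blk_carrier[OF V, of h q l] by (simp add: blk_def)
    qed
   qed
   ultimately show "EX q<?m. blk V g k q * blk V h q l = blk V (g \<otimes>\<^bsub>H\<^esub> h) k l \<and>
     (ALL p<?m. p ~= q --> blk V g k p * blk V h p l = 0\<^sub>m ?d ?d)" using q(1) by blast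
  qed
  thus "snd (ind_rep H K V) (g \<otimes>\<^bsub>H\<^esub> h) = snd (ind_rep H K V) g * snd (ind_rep H K V) h"
   by (simp add: snd_ind_rep)
 next
  have "blk V \<one>\<^bsub>H\<^esub> k l = (if k = l then 1\<^sub>m ?d else 0\<^sub>m ?d ?d)" if "k < ?m" "l < ?m" for k l
  proof -
   have "conj \<one>\<^bsub>H\<^esub> k k = \<one>\<^bsub>H\<^esub>" unfolding conj_def using that ts_closed by simp
   thus ?thesis unfolding blk_def conj_one_mem_iff[OF that] using rep_one[OF group_HK V]
    by (cases "k = l") auto
  qed
  hence "block_mat ?m ?d (blk V \<one>\<^bsub>H\<^esub>) = 1\<^sub>m (?m * ?d)"
   unfolding block_mat_one[symmetric] by (rule block_mat_cong)
  thus "snd (ind_rep H K V) \<one>\<^bsub>H\<^esub> = 1\<^sub>m (?m * ?d)" by (simp add: snd_ind_rep)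
 qed
 thus ?thesis using fst_ind_rep[of V] by (metis prod.collapse)
qed

text \<open>The isomorphism is conjugation by the block-diagonal matrices with all diagonal blocks
  equal to \<open>P\<close> and \<open>Q\<close>.\<close>

lemma ind_rep_cong:
 assumes V: "V : reps HK" "W : reps HK" and iso: "rep_iso HK V W"
 shows "rep_iso H (ind_rep H K V) (ind_rep H K W)"
proof -
 let ?m = "length ts" and ?d = "fst V"
 have d: "fst W = ?d" using rep_iso_dim[OF group_HK V iso] by simp
 obtain P Q where PQ: "!!h. h : K ==> similar_mat_wit (snd V h) (snd W h) P Q"
  using iso unfolding rep_iso_def by auto
 have one: "\<one>\<^bsub>H\<^esub> : K" using subgroup.one_closed[OF subgroup_K] .
 have vc: "snd V h : carrier_mat ?d ?d" if "h : K" for h using rep_carrier[OF group_HK V(1)] that by simp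
 note p = similar_mat_witD2[OF vc[OF one] PQ[OF one]]
 let ?D = "%A k l. if k = (l :: nat) then A else 0\<^sub>m ?d ?d :: complex mat"
 have inv: "block_mat ?m ?d (?D A) * block_mat ?m ?d (?D B) = 1\<^sub>m (?m * ?d)"
  if "A : carrier_mat ?d ?d" "B : carrier_mat ?d ?d" "A * B = 1\<^sub>m ?d" for A B
  unfolding block_mat_one[symmetric] by (rule block_mat_mult) (use that in \<open>auto intro!: exI\<close>)
 have "similar_mat_wit (snd (ind_rep H K V) h) (snd (ind_rep H K W) h)
   (block_mat ?m ?d (?D P)) (block_mat ?m ?d (?D Q))" if h: "h : carrier H" for h
 proof (rule similar_mat_witI[OF inv[OF p(6,7,1)] inv[OF p(7,6,2)]])
  have bc: "blk W h k l : carrier_mat ?d ?d" for k l using blk_carrier[OF V(2)] d by simp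
  have "block_mat ?m ?d (?D P) * block_mat ?m ?d (blk W h) = block_mat ?m ?d (%k l. P * blk W h k l)"
  proof (rule block_mat_mult)
   fix k l assume kl: "k < ?m" "l < ?m"
   show "EX q<?m. ?D P k q * blk W h q l = P * blk W h k l \<and>
     (ALL p<?m. p ~= q --> ?D P k p * blk W h p l = 0\<^sub>m ?d ?d)"
    using kl bc by (intro exI[of _ k]) (auto simp: left_mult_zero_mat[OF bc])
  qed (use p bc in auto)
  hence "block_mat ?m ?d (?D P) * block_mat ?m ?d (blk W h) * block_mat ?m ?d (?D Q) =
    block_mat ?m ?d (%k l. P * blk W h k l) * block_mat ?m ?d (?D Q)" by simp
  also have "... = block_mat ?m ?d (blk V h)"
  proof (rule block_mat_mult)
   fix k l assume kl: "k < ?m" "l < ?m"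
   have "P * blk W h k l * Q = blk V h k l"
   proof (cases "conj h k l : K")
    case True
    thus ?thesis using similar_mat_witD2(3)[OF vc[OF True] PQ[OF True]] by (simp add: blk_def)
   next
    case False
    thus ?thesis using p d by (simp add: blk_def)
   qed
   thus "EX q<?m. P * blk W h k q * ?D Q q l = blk V h k l \<and>
     (ALL p<?m. p ~= q --> P * blk W h k p * ?D Q p l = 0\<^sub>m ?d ?d)"
    using kl p bc by (intro exI[of _ l]) (auto simp: mult_carrier_mat[OF p(6) bc])
  qed (use p bc in auto)
  finally show "snd (ind_rep H K V) h =
    block_mat ?m ?d (?D P) * snd (ind_rep H K W) h * block_mat ?m ?d (?D Q)" unfolding snd_ind_rep d by simp
 qed (use d in \<open>auto simp: snd_ind_rep\<close>)
 thus ?thesis unfolding rep_iso_def by blast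
qed

lemma ind_rep_sum:
 assumes V: "V : reps HK" "W : reps HK"
 shows "rep_iso H (ind_rep H K (sum_rep V W)) (sum_rep (ind_rep H K V) (ind_rep H K W))"
proof -
 let ?m = "length ts" and ?d = "fst V" and ?e = "fst W"
 let ?I = "{..<?m} \<times> {..<?d + ?e}"
 let ?E = "%h p q. if conj h (fst p) (fst q) : K
  then snd (sum_rep V W) (conj h (fst p) (fst q)) $$ (snd p, snd q) else 0"
 let ?f = "%i. (i div (?d + ?e), i mod (?d + ?e))"
 \<comment> \<open>Coordinates of the second summand are shifted by \<open>?d\<close>, so that both
   bases are indexed by pairs of a coset and a coordinate of the direct sum.\<close>
 let ?g = "%i. if i < ?m * ?d then (i div ?d, i mod ?d)
  else ((i - ?m * ?d) div ?e, ?d + (i - ?m * ?d) mod ?e)"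
 note ic = ind_rep_closed[OF V(1)] ind_rep_closed[OF V(2)]
 show ?thesis
 proof (rule rep_iso_reindex[where f = ?f and g = ?g and I = ?I and E = ?E])
  show "group H" by (rule group_H)
  show "ind_rep H K (sum_rep V W) : reps H" by (intro ind_rep_closed sum_rep_closed[OF group_HK] V)
  show "sum_rep (ind_rep H K V) (ind_rep H K W) : reps H" by (rule sum_rep_closed[OF group_H ic])
  show "bij_betw ?f {..<fst (ind_rep H K (sum_rep V W))} ?I"
   using bij_betw_div_mod[of "?d + ?e" ?m] by (simp add: fst_ind_rep)
  have "bij_betw (%(k, a). (k, ?d + a)) ({..<?m} \<times> {..<?e}) ({..<?m} \<times> {?d..<?d + ?e})"
   by (rule bij_betw_byWitness[where f' = "%(k, a). (k, a - ?d)"]) auto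
  from bij_betw_trans[OF bij_betw_div_mod this]
  have "bij_betw (%i. (i div ?e, ?d + i mod ?e)) {..<?m * ?e} ({..<?m} \<times> {?d..<?d + ?e})"
   by (simp add: comp_def)
  from bij_betw_append[OF bij_betw_div_mod[of ?d ?m] this]
  have "bij_betw ?g {..<?m * ?d + ?m * ?e} ({..<?m} \<times> {..<?d} Un {..<?m} \<times> {?d..<?d + ?e})"
   by fastforce
  moreover have "{..<?m} \<times> {..<?d} Un {..<?m} \<times> {?d..<?d + ?e} = ?I" by auto
  ultimately show "bij_betw ?g {..<fst (sum_rep (ind_rep H K V) (ind_rep H K W))} ?I"
   by (simp add: fst_ind_rep)
 next
  fix h i j assume "i < fst (ind_rep H K (sum_rep V W))" "j < fst (ind_rep H K (sum_rep V W))"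
  thus "snd (ind_rep H K (sum_rep V W)) h $$ (i, j) = ?E h (?f i) (?f j)"
   using ind_rep_index[of i "sum_rep V W" j h] by (simp add: fst_ind_rep)
 next
  fix h i j assume h: "h : carrier H" and "i < fst (sum_rep (ind_rep H K V) (ind_rep H K W))"
   "j < fst (sum_rep (ind_rep H K V) (ind_rep H K W))"
  hence ij: "i < ?m * ?d + ?m * ?e" "j < ?m * ?d + ?m * ?e" by (auto simp: fst_ind_rep)
  have si: "snd (sum_rep V W) x $$ (a, b) =
    (if a < ?d then if b < ?d then snd V x $$ (a, b) else 0
     else if b < ?d then 0 else snd W x $$ (a - ?d, b - ?d))"
   if "x : K" "a < ?d + ?e" "b < ?d + ?e" for x a b using sum_rep_index[OF group_HK V, of x a b] that by simp
  have lt: "n div ?d < ?m & n mod ?d < ?d & n mod ?d < ?d + ?e" if "n < ?m * ?d" for n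
   using div_mod_less[OF that] by simp
  have ge: "n - ?m * ?d < ?m * ?e & (n - ?m * ?d) mod ?e < ?e"
   if "\<not> n < ?m * ?d" "n < ?m * ?d + ?m * ?e" for n
   using that div_mod_less(2)[of "n - ?m * ?d" ?m ?e] by auto
  show "snd (sum_rep (ind_rep H K V) (ind_rep H K W)) h $$ (i, j) = ?E h (?g i) (?g j)"
  proof (cases "i < ?m * ?d"; cases "j < ?m * ?d")
   assume c: "i < ?m * ?d" "j < ?m * ?d"
   thus ?thesis using sum_rep_index[OF group_H ic h, of i j] lt[of i] lt[of j] ind_rep_index[of i V j h]
    by (simp add: fst_ind_rep si)
  next
   assume c: "i < ?m * ?d" "\<not> j < ?m * ?d"
   thus ?thesis using sum_rep_index[OF group_H ic h, of i j] ij lt[of i] ge[of j]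
    by (simp add: fst_ind_rep si)
  next
   assume c: "\<not> i < ?m * ?d" "j < ?m * ?d"
   thus ?thesis using sum_rep_index[OF group_H ic h, of i j] ij lt[of j] ge[of i]
    by (simp add: fst_ind_rep si)
  next
   assume c: "\<not> i < ?m * ?d" "\<not> j < ?m * ?d"
   thus ?thesis using sum_rep_index[OF group_H ic h, of i j] ij ge[of i] ge[of j]
     ind_rep_index[of "i - ?m * ?d" W "j - ?m * ?d" h] by (simp add: fst_ind_rep si)
  qed
 qed
qed

lemma Ind_diff:
 assumes V: "V : reps HK" "W : reps HK"
 shows "Ind H K (vrep_diff HK V W) = vrep_diff H (ind_rep H K V) (ind_rep H K W)" unfolding Ind_def
proof (rule vrep_diff_UN[OF group_HK V])
 fix V' W' assume r: "((V, W), (V', W')) : vrep_rel HK"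
 hence V': "V' : reps HK" "W' : reps HK" unfolding vrep_rel_def by auto
 obtain U where U: "U : reps HK"
  "rep_iso HK (sum_rep (sum_rep V W') U) (sum_rep (sum_rep V' W) U)" using r unfolding vrep_rel_def by auto
 note sc = sum_rep_closed[OF group_HK] and ic = ind_rep_closed and sc' = sum_rep_closed[OF group_H]
 have split: "rep_iso H (ind_rep H K (sum_rep (sum_rep A B) U))
   (sum_rep (sum_rep (ind_rep H K A) (ind_rep H K B)) (ind_rep H K U))"
  if "A : reps HK" "B : reps HK" for A B by (rule rep_iso_trans[OF ind_rep_sum[OF sc[OF that] U(1)]])
   (intro sum_rep_cong[OF group_H] ic sc sc' that U(1) ind_rep_sum rep_iso_refl[OF group_H])
 have "rep_iso H (ind_rep H K (sum_rep (sum_rep V W') U)) (ind_rep H K (sum_rep (sum_rep V' W) U))"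
  by (intro ind_rep_cong sc V V' U)
 hence "rep_iso H (sum_rep (sum_rep (ind_rep H K V) (ind_rep H K W')) (ind_rep H K U))
   (sum_rep (sum_rep (ind_rep H K V') (ind_rep H K W)) (ind_rep H K U))"
  using split[OF V(1) V'(2)] split[OF V'(1) V(2)] rep_iso_sym rep_iso_trans by metis
 hence "((ind_rep H K V, ind_rep H K W), (ind_rep H K V', ind_rep H K W')) : vrep_rel H"
  unfolding vrep_rel_def using ic[OF V(1)] ic[OF V(2)] ic[OF V'(1)] ic[OF V'(2)] ic[OF U(1)] by blast
 thus "vrep_diff H (ind_rep H K V') (ind_rep H K W') = vrep_diff H (ind_rep H K V) (ind_rep H K W)"
  using vrep_diff_eq_iff[OF group_H ic[OF V(1)] ic[OF V(2)] ic[OF V'(1)] ic[OF V'(2)]] by simp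
qed

lemma Ind_closed: "X : carrier (VRep HK) ==> Ind H K X : carrier (VRep H)"
 by (elim vrep_diff_cases) (simp add: Ind_diff vrep_diff_closed ind_rep_closed)

lemma Ind_class:
 assumes V: "V : reps HK"
 shows "Ind H K (vrep_class HK V) = vrep_class H (ind_rep H K V)"
proof -
 note z = zero_rep_closed[OF group_HK] and z' = zero_rep_closed[OF group_H]
 have "rep_iso H (ind_rep H K zero_rep) zero_rep" by (rule rep_iso_permutation[where d = 0 and p = id])
   (use group_H ind_rep_closed[OF z] z' in \<open>auto simp: fst_ind_rep zero_rep_def\<close>)
 thus ?thesis unfolding vrep_class_def Ind_diff[OF V z]
  by (intro vrep_diff_cong[OF group_H] ind_rep_closed V z z' rep_iso_refl[OF group_H])
qed

end

text \<open>Used for the empty flat, whose stabilizer is the whole group. The transversal consists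
  of one unspecified element, so the induced representation is only conjugate to the original, by
  the matrix of that element.\<close>

lemma Ind_self:
 assumes H: "group (H :: 'h monoid)" and fin: "finite (carrier H)" and X: "X : carrier (VRep H)"
 shows "Ind H (carrier H) X = X"
proof -
 interpret group H by fact
 interpret S: finite_group_subgroup H "carrier H" by unfold_locales (use fin subgroup_self in auto)
 have HK: "H\<lparr>carrier := carrier H\<rparr> = H" by simp
 have len: "length S.ts = 1"
 proof -
  have "0 < length S.ts" using S.ts_exists[OF one_closed] by auto
  moreover have "\<not> 1 < length S.ts"
  proof
   assume l: "1 < length S.ts"
   have "(0 :: nat) = 1" by (rule S.ts_unique) (use l in \<open>auto intro!: m_closed inv_closed S.ts_closed\<close>)
   thus False by simp
  qed
  ultimately show ?thesis by linarith
 qed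
 hence t: "S.ts ! 0 : carrier H" using S.ts_closed by simp
 have iso: "rep_iso H (ind_rep H (carrier H) V) V" if V: "V : reps H" for V
 proof -
  let ?t = "S.ts ! 0"
  have it: "inv\<^bsub>H\<^esub> ?t : carrier H" using t by simp
  note c = rep_carrier[OF H V]
  have PQ: "snd V (inv\<^bsub>H\<^esub> ?t) * snd V ?t = 1\<^sub>m (fst V)" "snd V ?t * snd V (inv\<^bsub>H\<^esub> ?t) = 1\<^sub>m (fst V)"
   using rep_mult[OF H V it t] rep_mult[OF H V t it] rep_one[OF H V] t by auto
  have "similar_mat_wit (snd (ind_rep H (carrier H) V) h) (snd V h) (snd V (inv\<^bsub>H\<^esub> ?t)) (snd V ?t)"
   if h: "h : carrier H" for h
  proof (rule similar_mat_witI[OF PQ])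
   have "snd (ind_rep H (carrier H) V) h = snd V (inv\<^bsub>H\<^esub> ?t \<otimes>\<^bsub>H\<^esub> h \<otimes>\<^bsub>H\<^esub> ?t)"
    unfolding S.snd_ind_rep block_mat_def len
    using h t c[of "inv\<^bsub>H\<^esub> ?t \<otimes>\<^bsub>H\<^esub> h \<otimes>\<^bsub>H\<^esub> ?t"]
    by (auto simp: S.blk_def S.conj_def intro!: eq_matI)
   also have "... = snd V (inv\<^bsub>H\<^esub> ?t) * snd V h * snd V ?t"
    using rep_mult[OF H V] h t it by simp
   finally show "snd (ind_rep H (carrier H) V) h = snd V (inv\<^bsub>H\<^esub> ?t) * snd V h * snd V ?t" .
   thus "snd (ind_rep H (carrier H) V) h : carrier_mat (fst V) (fst V)" using c[OF it] c[OF h] c[OF t] by simp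
  qed (use c h t it in auto)
  thus ?thesis unfolding rep_iso_def by blast
 qed
 obtain V W where V: "V : reps H" "W : reps H" "X = vrep_diff H V W" using X by (rule vrep_diff_cases)
 have "Ind H (carrier H) X = vrep_diff H (ind_rep H (carrier H) V) (ind_rep H (carrier H) W)"
  using S.Ind_diff V by simp
 also have "... = X" unfolding V(3) using S.ind_rep_closed V(1,2) iso by (intro vrep_diff_cong[OF H]) auto
 finally show ?thesis .
qed

section \<open>Permutation representations\<close>

text \<open>Constrains \<open>a\<close> only on \<open>X\<close>, so that one map, such as
  \<open>Gamma_labeled_action\<close>, can act on many invariant subsets and be restricted to
  subgroups.\<close>

definition acts_on :: "'h monoid => 'x set => ('h => 'x => 'x) => bool" where
 "acts_on H X a <-> finite X & (ALL h:carrier H. ALL x:X. a h x : X) & (ALL x:X. a \<one>\<^bsub>H\<^esub> x = x) \<and>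
   (ALL g:carrier H. ALL h:carrier H. ALL x:X. a (g \<otimes>\<^bsub>H\<^esub> h) x = a g (a h x))"

definition enum :: "'x set => 'x list" where
 "enum X = (SOME xs. distinct xs & set xs = X)"

lemma enum_spec:
 assumes "finite X"
 shows "bij_betw (%i. enum X ! i) {..<card X} X"
proof -
 have "EX xs. distinct xs & set xs = X" using finite_distinct_list[OF assms] by blast
 from someI_ex[OF this] have "distinct (enum X)" "set (enum X) = X" unfolding enum_def by auto
 thus ?thesis using bij_betw_nth[of "enum X" "{..<card X}" X] distinct_card by force
qed

lemma enum_mem: "finite X ==> i < card X ==> enum X ! i : X"
 using enum_spec[of X] by (auto simp: bij_betw_def)

lemma fst_perm_rep [simp]: "fst (perm_rep X a) = card X" by (simp add: perm_rep_def Let_def)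

lemma snd_perm_rep: "snd (perm_rep X a) h =
  mat (card X) (card X) (%(i, j). if a h (enum X ! j) = enum X ! i then 1 else 0)"
 by (simp add: perm_rep_def Let_def enum_def)

lemma perm_rep_closed:
 assumes H: "group H" and a: "acts_on H X a"
 shows "perm_rep X a : reps H"
proof -
 have fin: "finite X" using a unfolding acts_on_def by blast
 note e = enum_spec[OF fin]
 have inj: "enum X ! i = enum X ! j <-> i = j" if "i < card X" "j < card X" for i j
  using e that by (auto simp: bij_betw_def inj_on_eq_iff)
 have "(card X, snd (perm_rep X a)) : reps H" unfolding mem_reps_iff[OF H]
 proof (intro conjI ballI)
  fix g h assume gh: "g : carrier H" "h : carrier H"
  show "snd (perm_rep X a) h : carrier_mat (card X) (card X)" by (simp add: snd_perm_rep)
  show "snd (perm_rep X a) (g \<otimes>\<^bsub>H\<^esub> h) = snd (perm_rep X a) g * snd (perm_rep X a) h"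
  proof (rule eq_matI)
   fix i j assume "i < dim_row (snd (perm_rep X a) g * snd (perm_rep X a) h)"
    "j < dim_col (snd (perm_rep X a) g * snd (perm_rep X a) h)"
   hence ij: "i < card X" "j < card X" by (auto simp: snd_perm_rep)
   let ?x = "enum X ! i" and ?y = "enum X ! j"
   have y: "?y : X" using enum_mem[OF fin ij(2)] .
   have "(snd (perm_rep X a) g * snd (perm_rep X a) h) $$ (i, j) =
     (\<Sum>k<card X. (if a g (enum X ! k) = ?x then 1 else 0) * (if a h ?y = enum X ! k then 1 else 0))"
    using ij by (simp add: snd_perm_rep scalar_prod_def lessThan_atLeast0)
   also have "... = (\<Sum>z\<in>X. (if a g z = ?x then 1 else 0) * (if a h ?y = z then 1 else 0))"
    by (rule sum.reindex_bij_betw[OF e])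
   also have "... = (\<Sum>z\<in>X. if z = a h ?y then (if a g z = ?x then 1 else 0) else 0)"
    by (rule sum.cong) auto
   also have "... = (if a g (a h ?y) = ?x then 1 else 0)" using fin a gh y by (simp add: acts_on_def)
   finally show "snd (perm_rep X a) (g \<otimes>\<^bsub>H\<^esub> h) $$ (i, j) =
     (snd (perm_rep X a) g * snd (perm_rep X a) h) $$ (i, j)"
    using ij a gh y by (simp add: snd_perm_rep acts_on_def)
  qed (auto simp: snd_perm_rep)
 next
  show "snd (perm_rep X a) \<one>\<^bsub>H\<^esub> = 1\<^sub>m (card X)"
   unfolding snd_perm_rep using a enum_mem[OF fin] inj by (auto simp: acts_on_def intro!: eq_matI)
 qed
 thus ?thesis by (metis fst_perm_rep prod.collapse)
qed

lemma perm_rep_iso: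
 assumes H: "group H" and a: "acts_on H X a" "acts_on H Y b"
  and f: "bij_betw f X Y" "!!h x. h : carrier H ==> x : X ==> f (a h x) = b h (f x)"
 shows "rep_iso H (perm_rep X a) (perm_rep Y b)"
proof (rule rep_iso_reindex[where f = "%i. f (enum X ! i)" and g = "%i. enum Y ! i" and I = Y
   and E = "%h x y. if b h y = x then 1 else 0"])
 have fin: "finite X" "finite Y" using a unfolding acts_on_def by auto
 show "bij_betw (%i. f (enum X ! i)) {..<fst (perm_rep X a)} Y"
  using bij_betw_trans[OF enum_spec[OF fin(1)] f(1)] by (simp add: comp_def)
 show "bij_betw (%i. enum Y ! i) {..<fst (perm_rep Y b)} Y" using enum_spec[OF fin(2)] by simp
 fix h i j
 { assume "h : carrier H" "i < fst (perm_rep X a)" "j < fst (perm_rep X a)"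
  hence h: "h : carrier H" and ij: "i < card X" "j < card X" by auto
  have m: "enum X ! i : X" "enum X ! j : X" "a h (enum X ! j) : X"
   using enum_mem[OF fin(1)] ij a(1) h unfolding acts_on_def by auto
  have "a h (enum X ! j) = enum X ! i <-> b h (f (enum X ! j)) = f (enum X ! i)"
   using f(2)[OF h m(2)] f(1) m unfolding bij_betw_def by (metis inj_on_eq_iff)
  thus "snd (perm_rep X a) h $$ (i, j) = (if b h (f (enum X ! j)) = f (enum X ! i) then 1 else 0)"
   using ij by (simp add: snd_perm_rep) }
 assume "i < fst (perm_rep Y b)" "j < fst (perm_rep Y b)"
 thus "snd (perm_rep Y b) h $$ (i, j) = (if b h (enum Y ! j) = enum Y ! i then 1 else 0)"
  by (simp add: snd_perm_rep)
qed (use H a perm_rep_closed in auto)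

definition perm_class :: "'h monoid => 'x set => ('h => 'x => 'x) => ('h rep \<times> 'h rep) set" where
 "perm_class H X a = vrep_class H (perm_rep X a)"

lemma perm_class_closed: "group H ==> acts_on H X a ==> perm_class H X a : carrier (VRep H)"
 unfolding perm_class_def by (intro vrep_class_closed perm_rep_closed)

lemma perm_class_bij:
 assumes H: "group H" and a: "acts_on H X a" "acts_on H Y b"
  and f: "bij_betw f X Y" "!!h x. h : carrier H ==> x : X ==> f (a h x) = b h (f x)"
 shows "perm_class H X a = perm_class H Y b"
by (metis H assms(2,3) f(1,2) perm_class_def perm_rep_closed perm_rep_iso vrep_class_cong)

lemma perm_class_Un:
 assumes H: "group H" and a: "acts_on H X a" "acts_on H Y a" and disj: "X Int Y = {}"
 shows "perm_class H (X Un Y) a = perm_class H X a \<oplus>\<^bsub>VRep H\<^esub> perm_class H Y a"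
proof -
 have fin: "finite X" "finite Y" using a unfolding acts_on_def by auto
 have aU: "acts_on H (X Un Y) a" using a unfolding acts_on_def by auto
 have card: "card (X Un Y) = card X + card Y" using fin disj by (rule card_Un_disjoint)
 note pc = perm_rep_closed[OF H a(1)] perm_rep_closed[OF H a(2)]
 let ?g = "%i. if i < card X then enum X ! i else enum Y ! (i - card X)"
 have "rep_iso H (perm_rep (X Un Y) a) (sum_rep (perm_rep X a) (perm_rep Y a))"
 proof (rule rep_iso_reindex[where f = "%i. enum (X Un Y) ! i" and g = ?g and I = "X Un Y"
    and E = "%h x y. if a h y = x then 1 else 0"])
  show "bij_betw (%i. enum (X Un Y) ! i) {..<fst (perm_rep (X Un Y) a)} (X Un Y)"
   using enum_spec[of "X Un Y"] fin by simp
  show "bij_betw ?g {..<fst (sum_rep (perm_rep X a) (perm_rep Y a))} (X Un Y)"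
   using bij_betw_append[OF enum_spec[OF fin(1)] enum_spec[OF fin(2)] disj] by simp
  show "sum_rep (perm_rep X a) (perm_rep Y a) : reps H" by (rule sum_rep_closed[OF H pc])
  fix h i j
  { assume "i < fst (perm_rep (X Un Y) a)" "j < fst (perm_rep (X Un Y) a)"
   thus "snd (perm_rep (X Un Y) a) h $$ (i, j) =
     (if a h (enum (X Un Y) ! j) = enum (X Un Y) ! i then 1 else 0)" by (simp add: snd_perm_rep) }
  assume h: "h : carrier H" and "i < fst (sum_rep (perm_rep X a) (perm_rep Y a))"
   "j < fst (sum_rep (perm_rep X a) (perm_rep Y a))"
  hence ij: "i < card X + card Y" "j < card X + card Y" by auto
  have mX: "enum X ! k : X & a h (enum X ! k) : X" if "k < card X" for k
   using enum_mem[OF fin(1) that] a(1) h unfolding acts_on_def by auto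
  have mY: "enum Y ! k : Y & a h (enum Y ! k) : Y" if "k < card Y" for k
   using enum_mem[OF fin(2) that] a(2) h unfolding acts_on_def by auto
  have "\<not> i < card X ==> i - card X < card Y" "\<not> j < card X ==> j - card X < card Y" using ij by auto
  thus "snd (sum_rep (perm_rep X a) (perm_rep Y a)) h $$ (i, j) =
    (if a h (?g j) = ?g i then 1 else 0)"
   using sum_rep_index[OF H pc h, of i j] ij mX[of i] mX[of j] mY[of "i - card X"] mY[of "j - card X"] disj
   by (auto simp: snd_perm_rep)
 qed (use H aU perm_rep_closed in auto)
 hence "vrep_class H (perm_rep (X Un Y) a) = vrep_class H (sum_rep (perm_rep X a) (perm_rep Y a))"
  by (rule vrep_class_cong[OF H perm_rep_closed[OF H aU] sum_rep_closed[OF H pc]])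
 thus ?thesis unfolding perm_class_def using vrep_class_sum[OF H pc] by simp
qed

lemma acts_on_empty: "acts_on H {} a" by (simp add: acts_on_def)

lemma perm_class_empty:
 assumes H: "group H"
 shows "perm_class H {} a = \<zero>\<^bsub>VRep H\<^esub>"
proof -
 have "rep_iso H (perm_rep {} a) zero_rep" by (rule rep_iso_permutation[where d = 0 and p = id])
   (use H zero_rep_closed perm_rep_closed[OF H acts_on_empty] in \<open>auto simp: zero_rep_def\<close>)
 thus ?thesis unfolding perm_class_def
  by (simp add: VRep_def vrep_class_cong[OF H perm_rep_closed[OF H acts_on_empty] zero_rep_closed[OF H]])
qed

lemma perm_class_singleton:
 assumes H: "group H" and a: "acts_on H {x} a"
 shows "perm_class H {x} a = \<one>\<^bsub>VRep H\<^esub>"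
proof -
 have e: "enum {x} ! 0 = x" using enum_mem[of "{x}" 0] by simp
 have "rep_iso H (perm_rep {x} a) trivial_rep"
 proof (rule rep_iso_permutation[where d = 1 and p = id])
  fix h and i j :: nat assume "h : carrier H" "i < 1" "j < (1 :: nat)"
  thus "snd (perm_rep {x} a) h $$ (i, j) = snd trivial_rep h $$ (id i, id j)"
   using a e by (simp add: snd_perm_rep trivial_rep_def acts_on_def)
 qed (use H trivial_rep_closed perm_rep_closed[OF H a] in \<open>auto simp: trivial_rep_def\<close>)
 thus ?thesis unfolding perm_class_def one_VRep
  by (rule vrep_class_cong[OF H perm_rep_closed[OF H a] trivial_rep_closed[OF H]])
qed

lemma acts_on_UN:
 assumes "finite I" "!!i. i : I ==> acts_on H (X i) a"
 shows "acts_on H (\<Union>i\<in>I. X i) a" unfolding acts_on_def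
proof (intro conjI ballI)
 show "finite (\<Union>i\<in>I. X i)" using assms unfolding acts_on_def by blast
 fix x assume "x : (\<Union>i\<in>I. X i)"
 then obtain i where i: "i : I" "x : X i" by blast
 note a = assms(2)[OF i(1), unfolded acts_on_def]
 show "a \<one>\<^bsub>H\<^esub> x = x" using a i by blast
 fix h assume h: "h : carrier H"
 show "a h x : (\<Union>i\<in>I. X i)" using a i h by blast
 show "a (g \<otimes>\<^bsub>H\<^esub> h) x = a g (a h x)" if "g : carrier H" for g using a i h that by blast
qed

lemma perm_class_Union:
 assumes H: "group H" and "finite I" "!!i. i : I ==> acts_on H (X i) a"
  "!!i j. i : I ==> j : I ==> i ~= j ==> X i Int X j = {}"
 shows "perm_class H (\<Union>i\<in>I. X i) a = (\<Oplus>\<^bsub>VRep H\<^esub>i\<in>I. perm_class H (X i) a)"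
 using assms(2-)
proof (induction I rule: finite_induct)
 case empty
 interpret abelian_group "VRep H" by (rule group_VRep[OF H])
 show ?case by (simp add: perm_class_empty[OF H])
next
 case (insert i I)
 interpret abelian_group "VRep H" by (rule group_VRep[OF H])
 have act: "acts_on H (\<Union>i\<in>I. X i) a" using insert.hyps insert.prems(1) by (intro acts_on_UN) auto
 have disj: "X i Int (\<Union>i\<in>I. X i) = {}" using insert.prems(2)[of i] insert.hyps by blast
 have "perm_class H (\<Union>i\<in>insert i I. X i) a = perm_class H (X i Un (\<Union>i\<in>I. X i)) a" by simp
 also have "... = perm_class H (X i) a \<oplus>\<^bsub>VRep H\<^esub> perm_class H (\<Union>i\<in>I. X i) a"
  by (rule perm_class_Un[OF H insert.prems(1) act disj]) simp
 also have "... = perm_class H (X i) a \<oplus>\<^bsub>VRep H\<^esub> (\<Oplus>\<^bsub>VRep H\<^esub>i\<in>I. perm_class H (X i) a)"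
  using insert by simp
 also have "... = (\<Oplus>\<^bsub>VRep H\<^esub>i\<in>insert i I. perm_class H (X i) a)"
  using insert.hyps insert.prems(1) by (subst finsum_insert) (auto intro!: perm_class_closed[OF H])
 finally show ?case .
qed

text \<open>By the assumption on \<open>K\<close>, the translates of \<open>Y\<close> by coset
  representatives tile \<open>Z\<close>. A basis vector of the induced representation is a pair of a
  coset and a point of \<open>Y\<close>, that is, a point of \<open>Z\<close>.\<close>

lemma (in finite_group_subgroup) Ind_perm_class:
 assumes Z: "acts_on H Z a" and YZ: "Y <= Z"
  and Y: "!!h y. h : carrier H ==> y : Y ==> a h y : Y <-> h : K"
  and cover: "!!z. z : Z ==> EX h:carrier H. EX y:Y. z = a h y"
 shows "Ind H K (perm_class HK Y a) = perm_class H Z a"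
proof -
 have finY: "finite Y" using Z YZ finite_subset unfolding acts_on_def by blast
 have aY: "acts_on HK Y a" using Z YZ Y finY K_closed unfolding acts_on_def by (auto simp: subset_iff)
 note pr = perm_rep_closed[OF group_HK aY] and pz = perm_rep_closed[OF group_H Z]
 have m: "a (g \<otimes>\<^bsub>H\<^esub> h) z = a g (a h z)" "a h z : Z" "a \<one>\<^bsub>H\<^esub> z = z"
  if "g : carrier H" "h : carrier H" "z : Z" for g h z using Z that unfolding acts_on_def by auto
 have move: "a (inv\<^bsub>H\<^esub> g) (a g z) = z" if "g : carrier H" "z : Z" for g z
  using m(1)[of "inv\<^bsub>H\<^esub> g" g z] m(3)[of g g z] that by simp
 let ?t = "%p. a (ts ! fst p) (snd p)"
 have bt: "bij_betw ?t ({..<length ts} \<times> Y) Z"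
 proof (intro bij_betw_imageI inj_onI)
  fix p q assume p: "p : {..<length ts} \<times> Y" and q: "q : {..<length ts} \<times> Y" and e: "?t p = ?t q"
  have t: "ts ! fst p : carrier H" "ts ! fst q : carrier H" "snd p : Y" "snd q : Y"
   "fst p < length ts" "fst q < length ts" using p q ts_closed by auto
  have "snd p = a (inv\<^bsub>H\<^esub> (ts ! fst p)) (?t q)" using move[OF t(1)] t(3) YZ e[symmetric] by auto
  also have "... = a (inv\<^bsub>H\<^esub> (ts ! fst p) \<otimes>\<^bsub>H\<^esub> ts ! fst q) (snd q)" using m(1) t YZ by auto
  finally have "a (inv\<^bsub>H\<^esub> (ts ! fst p) \<otimes>\<^bsub>H\<^esub> ts ! fst q) (snd q) : Y" using t(3) by simp
  hence "inv\<^bsub>H\<^esub> (ts ! fst p) \<otimes>\<^bsub>H\<^esub> ts ! fst q : K" using Y[OF _ t(4)] t(1,2) by simp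
  hence 1: "fst p = fst q" using ts_unique t by blast
  have "snd p : Z" "snd q : Z" using t YZ by auto
  hence "snd p = snd q" using move[OF t(1)] move[OF t(2)] 1 e by metis
  thus "p = q" using 1 by (simp add: prod_eq_iff)
 next
  show "?t ` ({..<length ts} \<times> Y) = Z"
  proof (intro subset_antisym subsetI)
   fix z assume "z : ?t ` ({..<length ts} \<times> Y)"
   thus "z : Z" using m(2)[of "\<one>\<^bsub>H\<^esub>"] ts_closed YZ by auto
  next
   fix z assume "z : Z"
   then obtain h y where h: "h : carrier H" "y : Y" "z = a h y" using cover by blast
   obtain k where k: "k < length ts" "inv\<^bsub>H\<^esub> (ts ! k) \<otimes>\<^bsub>H\<^esub> h : K" using ts_exists[OF h(1)] by blast
   let ?y = "a (inv\<^bsub>H\<^esub> (ts ! k) \<otimes>\<^bsub>H\<^esub> h) y"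
   have "?y : Y" using Y[OF K_closed[OF k(2)] h(2)] k by blast
   moreover have "?t (k, ?y) = a (ts ! k \<otimes>\<^bsub>H\<^esub> (inv\<^bsub>H\<^esub> (ts ! k) \<otimes>\<^bsub>H\<^esub> h)) y"
    using m(1)[of "ts ! k" "inv\<^bsub>H\<^esub> (ts ! k) \<otimes>\<^bsub>H\<^esub> h" y] ts_closed[OF k(1)] h YZ by auto
   hence "?t (k, ?y) = z" using ts_closed[OF k(1)] h by (simp add: m_assoc[symmetric])
   ultimately show "z : ?t ` ({..<length ts} \<times> Y)" using k(1)
    by (intro image_eqI[where x = "(k, ?y)"]) auto
  qed
 qed
 let ?f = "%i. a (ts ! (i div card Y)) (enum Y ! (i mod card Y))"
 have "rep_iso H (ind_rep H K (perm_rep Y a)) (perm_rep Z a)"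
 proof (rule rep_iso_reindex[where f = ?f and g = "%i. enum Z ! i" and I = Z
    and E = "%h x y. if a h y = x then 1 else 0"])
  show "ind_rep H K (perm_rep Y a) : reps H" by (rule ind_rep_closed[OF pr])
  let ?u = "%p. (fst p, enum Y ! snd p)" and ?v = "%i. (i div card Y, i mod card Y)"
  have "bij_betw ?u ({..<length ts} \<times> {..<card Y}) ({..<length ts} \<times> Y)"
   using bij_betw_map_prod[OF bij_betw_id enum_spec[OF finY], of "{..<length ts}"]
   by (simp add: map_prod_def case_prod_beta')
  hence "bij_betw (?u \<circ> ?v) {..<length ts * card Y} ({..<length ts} \<times> Y)"
   by (rule bij_betw_trans[OF bij_betw_div_mod])
  hence "bij_betw (?t \<circ> (?u \<circ> ?v)) {..<length ts * card Y} Z" by (rule bij_betw_trans[OF _ bt])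
  moreover have "?t \<circ> (?u \<circ> ?v) = ?f" by (rule ext) simp
  ultimately show "bij_betw ?f {..<fst (ind_rep H K (perm_rep Y a))} Z" by (simp only: fst_ind_rep fst_perm_rep)
  show "bij_betw (%i. enum Z ! i) {..<fst (perm_rep Z a)} Z" using enum_spec Z unfolding acts_on_def by auto
  fix h i j
  { assume "i < fst (perm_rep Z a)" "j < fst (perm_rep Z a)"
   thus "snd (perm_rep Z a) h $$ (i, j) = (if a h (enum Z ! j) = enum Z ! i then 1 else 0)"
    by (simp add: snd_perm_rep) }
  assume h: "h : carrier H" and "i < fst (ind_rep H K (perm_rep Y a))"
   "j < fst (ind_rep H K (perm_rep Y a))"
  hence ij: "i < length ts * card Y" "j < length ts * card Y" by (auto simp: fst_ind_rep)
  define k l y y' where "k = i div card Y" and "l = j div card Y"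
   and "y = enum Y ! (i mod card Y)" and "y' = enum Y ! (j mod card Y)"
  have kl: "k < length ts" "l < length ts" "y : Y" "y' : Y"
   using div_mod_less[OF ij(1)] div_mod_less[OF ij(2)] enum_mem[OF finY]
   by (auto simp: k_def l_def y_def y'_def)
  note tc = ts_closed[OF kl(1)] ts_closed[OF kl(2)]
  have cj: "a (ts ! k) (a (conj h k l) y') = a h (a (ts ! l) y')"
  proof -
   have "a (ts ! k) (a (conj h k l) y') = a (ts ! k \<otimes>\<^bsub>H\<^esub> conj h k l) y'"
    using m(1)[OF tc(1) conj_closed[OF h kl(1,2)], of y'] kl YZ by auto
   also have "ts ! k \<otimes>\<^bsub>H\<^esub> conj h k l = h \<otimes>\<^bsub>H\<^esub> ts ! l"
    unfolding conj_def using tc h by (simp add: m_assoc[symmetric])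
   also have "a (h \<otimes>\<^bsub>H\<^esub> ts ! l) y' = a h (a (ts ! l) y')" using m(1)[OF h tc(2)] kl YZ by auto
   finally show ?thesis .
  qed
  have "conj h k l : K & a (conj h k l) y' = y <-> a h (a (ts ! l) y') = a (ts ! k) y"
  proof
   assume "conj h k l : K & a (conj h k l) y' = y"
   thus "a h (a (ts ! l) y') = a (ts ! k) y" using cj by simp
  next
   assume e: "a h (a (ts ! l) y') = a (ts ! k) y"
   have "a (conj h k l) y' : Z" using m(2)[OF tc(1) conj_closed[OF h kl(1,2)]] kl YZ by auto
   hence "a (conj h k l) y' = y"
    using move[OF tc(1), of "a (conj h k l) y'"] move[OF tc(1), of y] cj e kl YZ by auto
   thus "conj h k l : K & a (conj h k l) y' = y" using Y[OF conj_closed[OF h kl(1,2)] kl(4)] kl by auto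
  qed
  thus "snd (ind_rep H K (perm_rep Y a)) h $$ (i, j) = (if a h (?f j) = ?f i then 1 else 0)"
   using ind_rep_index[of i "perm_rep Y a" j h] ij div_mod_less[OF ij(1)] div_mod_less[OF ij(2)]
   by (auto simp: snd_perm_rep k_def l_def y_def y'_def)
 qed (use group_H pz in auto)
 hence "vrep_class H (ind_rep H K (perm_rep Y a)) = vrep_class H (perm_rep Z a)"
  by (rule vrep_class_cong[OF group_H ind_rep_closed[OF pr] pz])
 thus ?thesis unfolding perm_class_def Ind_class[OF pr] .
qed

section \<open>Group actions on matroids\<close>

lemma (in finite_group_subgroup) Ind_zero: "Ind H K \<zero>\<^bsub>VRep HK\<^esub> = \<zero>\<^bsub>VRep H\<^esub>"
by (metis (lifting) Ind_perm_class acts_on_empty empty_iff empty_subsetI group_HK is_group perm_class_empty)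

definition equivariant_matroid :: "'a matroid => 'h monoid => ('h => 'a => 'a) => bool" where
 "equivariant_matroid M H a <->
   is_matroid M & loopless M & finite (carrier H) & matroid_action H M a"

locale eq_matroid =
 fixes M :: "'a matroid" and H :: "'h monoid" and a :: "'h => 'a => 'a"
 assumes equivariant: "equivariant_matroid M H a"
begin

lemma M: "is_matroid M" and loopless: "loopless M" and finite_H: "finite (carrier H)"
 and act: "matroid_action H M a" using equivariant unfolding equivariant_matroid_def by auto

lemma group_hom_a: "group_hom H (BijGroup (ground M)) a"
 using act unfolding matroid_action_def group_action_def by blast

sublocale group H using group_hom_a unfolding group_hom_def by blast

lemma group_H: "group H" by (rule is_group)

lemma a_Bij: "h : carrier H ==> a h : Bij (ground M)"
 using group_hom.hom_closed[OF group_hom_a] by (simp add: BijGroup_def)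

lemma a_bij: "h : carrier H ==> bij_betw (a h) (ground M) (ground M)" using a_Bij by (simp add: Bij_def)

lemma a_ext: "h : carrier H ==> a h : extensional (ground M)" using a_Bij by (simp add: Bij_def)

lemma a_mult:
 assumes "g : carrier H" "h : carrier H"
 shows "a (g \<otimes>\<^bsub>H\<^esub> h) = compose (ground M) (a g) (a h)"
 using group_hom.hom_mult[OF group_hom_a assms] a_Bij assms by (simp add: BijGroup_def)

lemma a_one: "a \<one>\<^bsub>H\<^esub> = (\<lambda>x\<in>ground M. x)"
 using group_hom.hom_one[OF group_hom_a] by (simp add: BijGroup_def)

lemma a_extensional: "a : extensional (carrier H)" using act unfolding matroid_action_def by blast

lemma a_flat: "h : carrier H ==> F : flats M ==> a h ` F : flats M"
 using act unfolding matroid_action_def by blast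

lemma flat_ground: "F : flats M ==> F <= ground M" unfolding flats_def by blast

lemma image_mult:
 assumes "g : carrier H" "h : carrier H" "F <= ground M"
 shows "a (g \<otimes>\<^bsub>H\<^esub> h) ` F = a g ` a h ` F"
 using a_mult[OF assms(1,2)] assms(3) by (force simp: compose_def)

lemma image_one: "F <= ground M ==> a \<one>\<^bsub>H\<^esub> ` F = F" unfolding a_one by force

lemma flat_stab_iff: "F : flats M ==> h : flat_stab M H a F <-> h : carrier H & a h ` F = F"
 unfolding flat_stab_def stabilizer_def flat_action_def by auto

lemma subgroup_stab:
 assumes F: "F : flats M"
 shows "subgroup (flat_stab M H a F) H"
proof (rule subgroupI)
 note FE = flat_ground[OF F]
 show "flat_stab M H a F <= carrier H" using flat_stab_iff[OF F] by blast
 have "\<one>\<^bsub>H\<^esub> : flat_stab M H a F" using flat_stab_iff[OF F] image_one[OF FE] by blast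
 thus "flat_stab M H a F ~= {}" by blast
 fix g assume g: "g : flat_stab M H a F"
 hence g': "g : carrier H" "a g ` F = F" using flat_stab_iff[OF F] by auto
 have "a (inv\<^bsub>H\<^esub> g) ` F = a (inv\<^bsub>H\<^esub> g) ` a g ` F" using g' by simp
 also have "... = F" using image_mult[OF inv_closed[OF g'(1)] g'(1) FE] image_one[OF FE] g' by simp
 finally show "inv\<^bsub>H\<^esub> g : flat_stab M H a F" using flat_stab_iff[OF F] g' by simp
 fix h assume h: "h : flat_stab M H a F"
 hence "a (g \<otimes>\<^bsub>H\<^esub> h) ` F = F"
  using image_mult[OF g'(1) _ FE, of h] g' flat_stab_iff[OF F] by simp
 thus "g \<otimes>\<^bsub>H\<^esub> h : flat_stab M H a F" using flat_stab_iff[OF F] g' h by simp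
qed

lemma stab_locale: "F : flats M ==> finite_group_subgroup H (flat_stab M H a F)"
 by (intro finite_group_subgroup.intro group_H finite_H subgroup_stab)

text \<open>Keeps the recursion over contractions inside the class of equivariant matroids;
  looplessness of the contraction comes from \<open>F\<close> being a flat.\<close>

lemma equivariant_contraction:
 assumes F: "F : flats M"
 shows "equivariant_matroid (contraction M F) (H\<lparr>carrier := flat_stab M H a F\<rparr>) (contraction_action M H a F)"
proof -
 let ?K = "flat_stab M H a F" and ?E = "ground M - F" and ?c = "contraction_action M H a F"
 note FE = flat_ground[OF F]
 have K: "h : carrier H" "a h ` F = F" if "h : ?K" for h using that flat_stab_iff[OF F] by auto
 have c: "?c h = restrict (a h) ?E" if "h : ?K" for h unfolding contraction_action_def using that by simp
 have bij: "bij_betw (a h) ?E ?E" if h: "h : ?K" for h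
 by (metis FE assms bij_betw_DiffI bij_betw_subset eq_matroid.a_bij eq_matroid_axioms flat_stab_iff that)
 have cB: "?c h : Bij ?E" if "h : ?K" for h
  unfolding c[OF that] Bij_def using bij[OF that] bij_betw_cong[of ?E "restrict (a h) ?E" "a h"] by simp
 have sub: "subgroup ?K H" by (rule subgroup_stab[OF F])
 have gK: "group (H\<lparr>carrier := ?K\<rparr>)" using sub by (rule subgroup_imp_group)
 have hom: "?c : hom (H\<lparr>carrier := ?K\<rparr>) (BijGroup ?E)"
 proof (rule homI)
  fix g h assume "g : carrier (H\<lparr>carrier := ?K\<rparr>)" "h : carrier (H\<lparr>carrier := ?K\<rparr>)"
  hence gh: "g : ?K" "h : ?K" by auto
  hence ghK: "g \<otimes>\<^bsub>H\<^esub> h : ?K" using subgroup.m_closed[OF sub] by blast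
  have "a h x : ?E" if "x : ?E" for x using bij[OF gh(2)] that by (auto simp: bij_betw_def)
  hence "?c (g \<otimes>\<^bsub>H\<^esub> h) = compose ?E (?c g) (?c h)"
   unfolding c[OF gh(1)] c[OF gh(2)] c[OF ghK] a_mult[OF K(1)[OF gh(1)] K(1)[OF gh(2)]]
   by (auto simp: compose_def restrict_def fun_eq_iff)
  thus "?c (g \<otimes>\<^bsub>H\<lparr>carrier := ?K\<rparr>\<^esub> h) = ?c g \<otimes>\<^bsub>BijGroup ?E\<^esub> ?c h"
   using cB gh by (simp add: BijGroup_def)
 qed (use cB in \<open>auto simp: BijGroup_def\<close>)
 have fl: "?c h ` F' : flats (contraction M F)" if h: "h : ?K" and F': "F' : flats (contraction M F)" for h F'
 proof -
  have f: "F' Int F = {}" "F' Un F : flats M" using flats_contraction[OF M FE] F' by auto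
  have "F' <= ?E" using f flat_ground[OF f(2)] by blast
  hence im: "?c h ` F' = a h ` F'" unfolding c[OF h] by force
  have "a h ` F' <= ?E" using bij[OF h] \<open>F' <= ?E\<close> by (auto simp: bij_betw_def)
  hence "a h ` F' Int F = {}" by blast
  moreover have "a h ` F' Un F = a h ` (F' Un F)" using K(2)[OF h] by (simp add: image_Un)
  hence "a h ` F' Un F : flats M" using a_flat[OF K(1)[OF h] f(2)] by simp
  ultimately show ?thesis unfolding im using flats_contraction[OF M FE] by blast
 qed
 have "finite ?K" using finite_H flat_stab_iff[OF F] by (metis finite_subset subsetI)
 moreover have "matroid_action (H\<lparr>carrier := ?K\<rparr>) (contraction M F) ?c"
  unfolding matroid_action_def group_action_def group_hom_def group_hom_axioms_def
  using gK group_BijGroup hom fl by (auto simp: contraction_action_def)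
 ultimately show ?thesis unfolding equivariant_matroid_def
  using contraction_is_matroid[OF M] loopless_contraction[OF M F] by simp
qed

lemma empty_flat: "{} : flats M" unfolding flats_def
using M finite.emptyI loopless loopless_def rank_empty rank_indep by force

lemma stab_empty: "flat_stab M H a {} = carrier H" using flat_stab_iff[OF empty_flat] by auto

text \<open>As \<open>a\<close> is extensional in the group element and each \<open>a h\<close> on
  the ground set, this is an equality of functions; hence the term of the empty flat in
  \<open>Z_of\<close> involves literally \<open>P M H a\<close>.\<close>

lemma contraction_action_empty: "contraction_action M H a {} = a"
proof
 fix h
 show "contraction_action M H a {} h = a h"
 by (metis (no_types, lifting) Diff_empty a_ext a_extensional contraction_action_def extensional_restrict restrict_apply stab_empty)
qed

lemma ground_flat: "ground M : flats M" unfolding flats_def by simp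

lemma finite_flats: "finite (flats M)"
 using flat_ground finite_ground[OF M] by (meson PowI finite_Pow_iff finite_subset subsetI)

lemma rank_flat_pos: "F : flats M ==> F ~= {} ==> 0 < rank_of M F"
proof -
 assume F: "F : flats M" "F ~= {}"
 then obtain e where e: "e : F" by blast
 hence "{e} : indeps M" using loopless flat_ground[OF F(1)] unfolding loopless_def by blast
 thus ?thesis using indep_le_rank[OF M, of "{e}" F] e by simp
qed

lemma rank_flat_less: "F : flats M ==> F ~= ground M ==> rank_of M F < matroid_rank M"
proof -
 assume F: "F : flats M" "F ~= ground M"
 then obtain e where e: "e : ground M - F" using flat_ground by blast
 hence "rank_of M F < rank_of M (insert e F)" using F unfolding flats_def by blast
 thus ?thesis using rank_le_matroid_rank[OF M, of "insert e F"] by simp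
qed

abbreviation "orbs \<equiv> orbits H (flats M) (flat_action M a)"

lemma orbit_eq: "F : flats M ==> orbit H (flat_action M a) F = (%h. a h ` F) ` carrier H"
 unfolding orbit_def flat_action_def by auto

lemma orbs_eq: "orbs = (%F. (%h. a h ` F) ` carrier H) ` flats M"
proof -
 have "orbs = orbit H (flat_action M a) ` flats M" unfolding orbits_def by auto
 also have "... = (%F. (%h. a h ` F) ` carrier H) ` flats M" by (rule image_cong[OF refl orbit_eq])
 finally show ?thesis .
qed

lemma finite_orbs: "finite orbs" unfolding orbs_eq using finite_flats by simp

lemma orbs_subset: "X : orbs ==> X <= flats M" unfolding orbs_eq using a_flat by auto

lemma flat_in_orbit: "F : flats M ==> F : (%h. a h ` F) ` carrier H"
 using image_one[OF flat_ground] one_closed by (metis image_eqI)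

lemma orbs_some: "X : orbs ==> (SOME F. F : X) : X"
proof -
 assume "X : orbs"
 then obtain F where "F : flats M" "X = (%h. a h ` F) ` carrier H" unfolding orbs_eq by blast
 hence "F : X" using flat_in_orbit by simp
 thus ?thesis by (rule someI)
qed

lemma orbs_some_flat: "X : orbs ==> (SOME F. F : X) : flats M" using orbs_some orbs_subset by blast

text \<open>Any member can serve as base point of its orbit, whichever flat \<open>SOME\<close>
  picks in \<open>Z_of\<close>.\<close>

lemma orbs_transitive:
 assumes X: "X : orbs" and F: "F : X"
 shows "X = (%h. a h ` F) ` carrier H"
proof -
 obtain F0 where F0: "F0 : flats M" "X = (%h. a h ` F0) ` carrier H" using X unfolding orbs_eq by blast
 then obtain g where g: "g : carrier H" "F = a g ` F0" using F by blast
 note E = flat_ground[OF F0(1)]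
 have 1: "a h ` F = a (h \<otimes>\<^bsub>H\<^esub> g) ` F0" if "h : carrier H" for h
  using image_mult[OF that g(1) E] g by simp
 have 2: "a h ` F0 = a (h \<otimes>\<^bsub>H\<^esub> inv\<^bsub>H\<^esub> g) ` F" if "h : carrier H" for h
  using 1[of "h \<otimes>\<^bsub>H\<^esub> inv\<^bsub>H\<^esub> g"] that g by (simp add: m_assoc)
 show ?thesis
 proof (intro subset_antisym subsetI)
  fix Y assume "Y : X"
  then obtain h where "h : carrier H" "Y = a h ` F0" using F0 by blast
  thus "Y : (%h. a h ` F) ` carrier H"
   using 2[of h] g(1) by (intro image_eqI[where x = "h \<otimes>\<^bsub>H\<^esub> inv\<^bsub>H\<^esub> g"]) auto
 next
  fix Y assume "Y : (%h. a h ` F) ` carrier H"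
  then obtain h where "h : carrier H" "Y = a h ` F" by blast
  thus "Y : X"
   unfolding F0(2) using 1[of h] g(1) by (intro image_eqI[where x = "h \<otimes>\<^bsub>H\<^esub> g"]) auto
 qed
qed

lemma orbs_empty_iff: "X : orbs ==> {} : X <-> X = {{}}" using orbs_transitive[of X "{}"] one_closed by auto

lemma empty_orbit: "{{}} : orbs" unfolding orbs_eq using empty_flat one_closed by force

lemma ground_orbit: "{ground M} : orbs"
proof -
 have "(%h. a h ` ground M) ` carrier H = {ground M}" using a_bij one_closed by (auto simp: bij_betw_def)
 thus ?thesis unfolding orbs_eq using ground_flat by (metis image_eqI)
qed

lemma orbs_disjoint: "X : orbs ==> Y : orbs ==> F : X ==> F : Y ==> X = Y" using orbs_transitive by metis

lemma orbs_cover: "F : flats M ==> EX X:orbs. F : X" unfolding orbs_eq using flat_in_orbit by blast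

end

section \<open>Existence and uniqueness of equivariant Kazhdan--Lusztig polynomials\<close>

definition Z_term :: "('a, 'h) assignment => 'a matroid => 'h monoid => ('h => 'a => 'a) => nat =>
  'a set set => ('h rep \<times> 'h rep) set" where
 "Z_term P M H a i X =
   (let F = (SOME F. F : X); K = flat_stab M H a F
   in if rank_of M F <= i
     then Ind H K (P (contraction M F) (H\<lparr>carrier := K\<rparr>) (contraction_action M H a F)
             (i - rank_of M F))
     else \<zero>\<^bsub>VRep H\<^esub>)"

text \<open>
 The sum of the terms of the nonempty flats; the guard makes the summand independent of the
 values of \<open>P\<close> at equivariant matroids that are not contractions by nonempty flats.
\<close>

definition Z_rest :: "('a, 'h) assignment => ('a, 'h) assignment" where
 "Z_rest P M H a i =
   (\<Oplus>\<^bsub>VRep H\<^esub> X \<in> orbits H (flats M) (flat_action M a) - {{{}}}.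
    if X : orbits H (flats M) (flat_action M a) - {{{}}} then Z_term P M H a i X else \<zero>\<^bsub>VRep H\<^esub>)"

text \<open>With \<open>d\<close> the rank and \<open>R\<close> the sum over nonempty flats,
  palindromicity reads \<open>P i + R i = P (d - i) + R (d - i)\<close>. For
  \<open>2 * i < d\<close> the degree bound removes \<open>P (d - i)\<close>, and the equation is
  solved for \<open>P i\<close>.\<close>

definition KL_step :: "('a, 'h) assignment => ('a, 'h) assignment" where
 "KL_step P M H a i =
   (if matroid_rank M = 0 then if i = 0 then \<one>\<^bsub>VRep H\<^esub> else \<zero>\<^bsub>VRep H\<^esub>
   else if 2 * i < matroid_rank M
   then Z_rest P M H a (matroid_rank M - i) \<ominus>\<^bsub>VRep H\<^esub> Z_rest P M H a i
   else \<zero>\<^bsub>VRep H\<^esub>)"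

lemma Z_of_eq: "Z_of P M H a i = (\<Oplus>\<^bsub>VRep H\<^esub> X \<in> orbits H (flats M) (flat_action M a). Z_term P M H a i X)"
 unfolding Z_of_def Z_term_def by simp

context eq_matroid
begin

interpretation V: abelian_group "VRep H" by (rule group_VRep[OF group_H])

abbreviation "at_flat P F \<equiv> P (contraction M F) (H\<lparr>carrier := flat_stab M H a F\<rparr>) (contraction_action M H a F)"

lemma rank_contraction_flat:
 "F : flats M ==> matroid_rank (contraction M F) + rank_of M F = matroid_rank M"
 using matroid_rank_contraction[OF M flat_ground] .

lemma Z_rest_cong:
 assumes "!!F. F : flats M ==> F ~= {} ==>
  at_flat P F =
  at_flat Q F"
 shows "Z_rest P M H a i = Z_rest Q M H a i"
proof -
 have "(if X : orbs - {{{}}} then Z_term P M H a i X else \<zero>\<^bsub>VRep H\<^esub>) =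
   (if X : orbs - {{{}}} then Z_term Q M H a i X else \<zero>\<^bsub>VRep H\<^esub>)" for X
 proof (cases "X : orbs - {{{}}}")
  case True
  hence "(SOME F. F : X) : flats M" "(SOME F. F : X) ~= {}"
   using orbs_some_flat orbs_empty_iff orbs_some[of X] by auto
  from assms[OF this] show ?thesis unfolding Z_term_def Let_def by simp
 qed auto
 thus ?thesis unfolding Z_rest_def by presburger
qed

lemma Z_rest_closed:
 assumes P: "!!F j. F : flats M ==> F ~= {} ==>
  at_flat P F j
   : carrier (VRep (H\<lparr>carrier := flat_stab M H a F\<rparr>))"
 shows "X : orbs - {{{}}} ==> Z_term P M H a i X : carrier (VRep H)"
  and "Z_rest P M H a i : carrier (VRep H)"
  and "Z_rest P M H a i = (\<Oplus>\<^bsub>VRep H\<^esub> X \<in> orbs - {{{}}}. Z_term P M H a i X)"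
proof -
 have t: "Z_term P M H a i X : carrier (VRep H)" if X: "X : orbs - {{{}}}" for X
 proof -
  have F: "(SOME F. F : X) : flats M" "(SOME F. F : X) ~= {}"
   using orbs_some_flat orbs_empty_iff orbs_some[of X] X by auto
  interpret S: finite_group_subgroup H "flat_stab M H a (SOME F. F : X)" by (rule stab_locale[OF F(1)])
  show ?thesis unfolding Z_term_def Let_def using S.Ind_closed[OF P[OF F]] by simp
 qed
 thus "X : orbs - {{{}}} ==> Z_term P M H a i X : carrier (VRep H)" .
 show "Z_rest P M H a i : carrier (VRep H)" unfolding Z_rest_def using t by (intro V.finsum_closed) auto
 show "Z_rest P M H a i = (\<Oplus>\<^bsub>VRep H\<^esub> X \<in> orbs - {{{}}}. Z_term P M H a i X)"
  unfolding Z_rest_def using t by (intro V.finsum_cong') auto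
qed

lemma Z_of_split:
 assumes P: "!!F j. F : flats M ==>
  at_flat P F j
   : carrier (VRep (H\<lparr>carrier := flat_stab M H a F\<rparr>))"
 shows "P M H a i : carrier (VRep H)" "Z_of P M H a i = P M H a i \<oplus>\<^bsub>VRep H\<^esub> Z_rest P M H a i"
proof -
 show Pc: "P M H a i : carrier (VRep H)"
  using P[OF empty_flat] by (simp add: stab_empty contraction_empty[OF M] contraction_action_empty)
 have t0: "Z_term P M H a i {{}} = P M H a i" unfolding Z_term_def Let_def
  by (simp add: stab_empty contraction_empty[OF M] contraction_action_empty rank_empty[OF M]
    Ind_self[OF group_H finite_H Pc])
 have "orbs = insert {{}} (orbs - {{{}}})" using empty_orbit by blast
 hence "Z_of P M H a i = (\<Oplus>\<^bsub>VRep H\<^esub> X \<in> insert {{}} (orbs - {{{}}}). Z_term P M H a i X)"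
  unfolding Z_of_eq by simp
 also have "... = Z_term P M H a i {{}} \<oplus>\<^bsub>VRep H\<^esub> (\<Oplus>\<^bsub>VRep H\<^esub> X \<in> orbs - {{{}}}. Z_term P M H a i X)"
  using finite_orbs Z_rest_closed(1)[OF P] t0 Pc by (intro V.finsum_insert) auto
 finally show "Z_of P M H a i = P M H a i \<oplus>\<^bsub>VRep H\<^esub> Z_rest P M H a i"
  unfolding t0 using Z_rest_closed(3)[of P i] P by simp
qed

end

text \<open>The recursion passes to other matroids, groups and actions, so it is run with a step
  counter. Contraction by a nonempty flat lowers the rank, hence the value is settled once the
  counter exceeds the rank (\<open>KL_approx_stable\<close>).\<close>

primrec KL_approx :: "nat => ('a, 'h) assignment" where
 "KL_approx 0 = (%M H a i. \<zero>\<^bsub>VRep H\<^esub>)"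
| "KL_approx (Suc s) = KL_step (KL_approx s)"

definition KL_rec :: "('a, 'h) assignment" where
 "KL_rec M H a = KL_approx (Suc (matroid_rank M)) M H a"

lemma KL_approx_stable:
 "equivariant_matroid M H a ==> matroid_rank M < s ==> matroid_rank M < t ==>
  KL_approx s M H a = KL_approx t M H a"
proof (induction s arbitrary: t M H a)
 case (Suc s)
 then obtain t' where t': "t = Suc t'" by (cases t) auto
 interpret eq_matroid M H a by unfold_locales (rule Suc.prems)
 have "KL_approx s (contraction M F) (H\<lparr>carrier := flat_stab M H a F\<rparr>) (contraction_action M H a F) =
   KL_approx t' (contraction M F) (H\<lparr>carrier := flat_stab M H a F\<rparr>) (contraction_action M H a F)"
  if F: "F : flats M" "F ~= {}" for F
  using Suc.IH[OF equivariant_contraction[OF F(1)], of t'] rank_contraction_flat[OF F(1)]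
   rank_flat_pos[OF F] Suc.prems t' by simp
 hence "Z_rest (KL_approx s) M H a i = Z_rest (KL_approx t') M H a i" for i by (rule Z_rest_cong)
 thus ?case unfolding t' by (auto simp: KL_step_def fun_eq_iff)
qed simp

lemma KL_rec_step:
 assumes "equivariant_matroid M H a"
 shows "KL_rec M H a i = KL_step KL_rec M H a i"
proof -
 interpret eq_matroid M H a by unfold_locales (rule assms)
 have "KL_approx (matroid_rank M) (contraction M F) (H\<lparr>carrier := flat_stab M H a F\<rparr>) (contraction_action M H a F) =
   at_flat KL_rec F"
  if F: "F : flats M" "F ~= {}" for F unfolding KL_rec_def
  by (rule KL_approx_stable[OF equivariant_contraction[OF F(1)]])
   (use rank_contraction_flat[OF F(1)] rank_flat_pos[OF F] in auto)
 hence "Z_rest (KL_approx (matroid_rank M)) M H a i = Z_rest KL_rec M H a i" for i by (rule Z_rest_cong)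
 thus ?thesis unfolding KL_rec_def[of M] by (auto simp: KL_step_def fun_eq_iff)
qed

lemma KL_rec_closed:
 "equivariant_matroid M H a ==> KL_rec M H a i : carrier (VRep H)"
proof (induction "matroid_rank M" arbitrary: M H a i rule: less_induct)
 case less
 interpret eq_matroid M H a by unfold_locales (rule less.prems)
 interpret V: abelian_group "VRep H" by (rule group_VRep[OF group_H])
 have "at_flat KL_rec F j
   : carrier (VRep (H\<lparr>carrier := flat_stab M H a F\<rparr>))" if F: "F : flats M" "F ~= {}" for F j
  using less.hyps[OF _ equivariant_contraction[OF F(1)]] rank_contraction_flat[OF F(1)]
   rank_flat_pos[OF F] by simp
 hence "Z_rest KL_rec M H a j : carrier (VRep H)" for j by (rule Z_rest_closed(2))
 thus ?case unfolding KL_rec_step[OF less.prems] KL_step_def one_VRep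
  using vrep_class_closed[OF group_H trivial_rep_closed[OF group_H]] by (auto simp: V.minus_closed)
qed

lemma coeff_UP: "p : carrier (UP R) ==> coeff (UP R) p i = p i" by (simp add: UP_def)

lemma carrier_UP_iff: "p : carrier (UP R) <-> (ALL i. p i : carrier R) & (EX n. ALL m>n. p m = \<zero>\<^bsub>R\<^esub>)"
 by (auto simp: UP_def up_def bound_def)

lemma deg_le: "p : carrier (UP R) ==> (!!m. n < m ==> p m = \<zero>\<^bsub>R\<^esub>) ==> deg R p <= n"
 unfolding deg_def by (rule Least_le) (auto simp: bound_def coeff_UP)

lemma deg_aboveD:
 assumes "p : carrier (UP R)" "deg R p < m"
 shows "p m = \<zero>\<^bsub>R\<^esub>"
proof -
 have "EX n. bound \<zero>\<^bsub>R\<^esub> n (coeff (UP R) p)"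
  using assms(1) carrier_UP_iff[of p R] by (auto simp: bound_def coeff_UP)
 from LeastI_ex[OF this] show ?thesis
  using assms unfolding deg_def[symmetric] by (auto simp: bound_def coeff_UP)
qed

lemma KL_rec_above:
 "equivariant_matroid M H a ==> matroid_rank M <= 2 * i ==> 0 < i ==> KL_rec M H a i = \<zero>\<^bsub>VRep H\<^esub>"
 by (simp add: KL_rec_step KL_step_def)

section \<open>Degrees, palindromicity and uniqueness\<close>

context eq_matroid
begin

interpretation V: abelian_group "VRep H" by (rule group_VRep[OF group_H])

lemma KL_flat_closed:
 "F : flats M ==> at_flat KL_rec F j
   : carrier (VRep (H\<lparr>carrier := flat_stab M H a F\<rparr>))"
 by (rule KL_rec_closed[OF equivariant_contraction])

text \<open>A coefficient of positive index vanishes as soon as the index reaches half the rank of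
  the contraction. From degree \<open>matroid_rank M\<close> on, only the ground set in exactly this
  degree escapes, because there the index is zero.\<close>

lemma Z_term_KL_rec_zero:
 assumes X: "X : orbs" and i: "matroid_rank M < i | matroid_rank M = i & X ~= {ground M}"
 shows "Z_term KL_rec M H a i X = \<zero>\<^bsub>VRep H\<^esub>"
proof -
 let ?F = "SOME F. F : X"
 note F = orbs_some_flat[OF X]
 interpret S: finite_group_subgroup H "flat_stab M H a ?F" by (rule stab_locale[OF F])
 note r = rank_contraction_flat[OF F]
 have "rank_of M ?F < i"
 proof (cases "matroid_rank M < i")
  case True
  thus ?thesis using r by simp
 next
  case False
  hence i': "matroid_rank M = i" "X ~= {ground M}" using i by auto
  have "?F ~= ground M"
  proof
   assume "?F = ground M"
   hence "ground M : X" using orbs_some[OF X] by simp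
   thus False using orbs_disjoint[OF X ground_orbit] i'(2) by blast
  qed
  thus ?thesis using rank_flat_less[OF F] i' by simp
 qed
 hence "KL_rec (contraction M ?F) (H\<lparr>carrier := flat_stab M H a ?F\<rparr>) (contraction_action M H a ?F)
   (i - rank_of M ?F) = \<zero>\<^bsub>VRep (H\<lparr>carrier := flat_stab M H a ?F\<rparr>)\<^esub>"
  using r i by (intro KL_rec_above[OF equivariant_contraction[OF F]]) auto
 thus ?thesis unfolding Z_term_def Let_def by (simp add: S.Ind_zero)
qed

lemma Z_rest_KL_rec_above: "matroid_rank M < i ==> Z_rest KL_rec M H a i = \<zero>\<^bsub>VRep H\<^esub>"
proof -
 assume "matroid_rank M < i"
 thus ?thesis unfolding Z_rest_def using Z_term_KL_rec_zero by (intro V.add.finprod_one_eqI) auto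
qed

text \<open>Only the ground set contributes in top degree, where its contraction has rank zero. This
  makes the degree of the Z-polynomial equal to the rank.\<close>

lemma Z_rest_KL_rec_top:
 assumes "0 < matroid_rank M"
 shows "Z_rest KL_rec M H a (matroid_rank M) = \<one>\<^bsub>VRep H\<^esub>"
proof -
 let ?d = "matroid_rank M" and ?E = "ground M"
 have ne: "?E ~= {}" using assms rank_empty[OF M] by (auto simp: matroid_rank_def)
 note E = ground_flat
 have st: "flat_stab M H a ?E = carrier H" using flat_stab_iff[OF E] a_bij by (auto simp: bij_betw_def)
 have "matroid_rank (contraction M ?E) = 0" using rank_contraction_flat[OF E] by (simp add: matroid_rank_def)
 hence "KL_rec (contraction M ?E) H (contraction_action M H a ?E) 0 = \<one>\<^bsub>VRep H\<^esub>"
  using KL_rec_step[OF equivariant_contraction[OF E]] unfolding st by (simp add: KL_step_def)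
 moreover have oc: "\<one>\<^bsub>VRep H\<^esub> : carrier (VRep H)"
  unfolding one_VRep by (rule vrep_class_closed[OF group_H trivial_rep_closed[OF group_H]])
 ultimately have tE: "Z_term KL_rec M H a ?d {?E} = \<one>\<^bsub>VRep H\<^esub>"
  unfolding Z_term_def Let_def using st Ind_self[OF group_H finite_H oc] by (simp add: matroid_rank_def)
 have rt: "Z_rest KL_rec M H a ?d = (\<Oplus>\<^bsub>VRep H\<^esub> X \<in> orbs - {{{}}}. Z_term KL_rec M H a ?d X)"
  by (rule Z_rest_closed(3)) (rule KL_flat_closed)
 have "orbs - {{{}}} = insert {?E} (orbs - {{{}}, {?E}})" using ground_orbit ne by auto
 hence "Z_rest KL_rec M H a ?d = (\<Oplus>\<^bsub>VRep H\<^esub> X \<in> insert {?E} (orbs - {{{}}, {?E}}). Z_term KL_rec M H a ?d X)"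
  unfolding rt by simp
 also have "... = Z_term KL_rec M H a ?d {?E} \<oplus>\<^bsub>VRep H\<^esub> (\<Oplus>\<^bsub>VRep H\<^esub> X \<in> orbs - {{{}}, {?E}}. Z_term KL_rec M H a ?d X)"
  using finite_orbs Z_term_KL_rec_zero tE oc by (intro V.finsum_insert) auto
 also have "(\<Oplus>\<^bsub>VRep H\<^esub> X \<in> orbs - {{{}}, {?E}}. Z_term KL_rec M H a ?d X) = \<zero>\<^bsub>VRep H\<^esub>"
  using Z_term_KL_rec_zero by (intro V.add.finprod_one_eqI) auto
 finally show ?thesis using tE oc by simp
qed

lemma rank_zero_ground: "matroid_rank M = 0 ==> ground M = {}"
 using rank_flat_pos[OF ground_flat] by (auto simp: matroid_rank_def)

lemma Z_rest_rank_zero: "matroid_rank M = 0 ==> Z_rest P M H a i = \<zero>\<^bsub>VRep H\<^esub>"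
proof -
 assume "matroid_rank M = 0"
 hence "F = {}" if "F : flats M" for F using rank_zero_ground flat_ground[OF that] by simp
 hence "X = {{}}" if X: "X : orbs" for X
  using orbs_some[OF X] orbs_some_flat[OF X] orbs_empty_iff[OF X] by metis
 hence e: "orbs - {{{}}} = {}" by blast
 show ?thesis unfolding Z_rest_def e by simp
qed

lemma KL_rec_properties:
 "KL_rec M H a : carrier (UP (VRep H)) \<and>
  (matroid_rank M = 0 --> KL_rec M H a = \<one>\<^bsub>UP (VRep H)\<^esub>) \<and>
  (matroid_rank M > 0 --> 2 * deg (VRep H) (KL_rec M H a) < matroid_rank M) \<and>
  palindromic (VRep H) (matroid_rank M) (Z_of KL_rec M H a)"
proof -
 let ?d = "matroid_rank M" and ?P = "KL_rec M H a" and ?R = "Z_rest KL_rec M H a" and ?Z = "Z_of KL_rec M H a"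
 note st = KL_rec_step[OF equivariant]
 have Pc: "?P i : carrier (VRep H)" for i by (rule KL_rec_closed[OF equivariant])
 have Rc: "?R i : carrier (VRep H)" for i by (rule Z_rest_closed(2)) (rule KL_flat_closed)
 have Z: "?Z i = ?P i \<oplus>\<^bsub>VRep H\<^esub> ?R i" for i by (rule Z_of_split(2)) (rule KL_flat_closed)
 have P0: "?P i = \<zero>\<^bsub>VRep H\<^esub>" if "?d <= 2 * i" "0 < i" for i using KL_rec_above[OF equivariant that] .
 have Pup: "?P : carrier (UP (VRep H))"
  unfolding carrier_UP_iff using Pc P0 by (intro conjI allI exI[of _ ?d]) auto
 have one: "?P = \<one>\<^bsub>UP (VRep H)\<^esub>" if "?d = 0"
  using that by (auto simp: st KL_step_def UP_def fun_eq_iff)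
 have dg: "2 * deg (VRep H) ?P < ?d" if "?d > 0"
 proof -
  have "deg (VRep H) ?P <= (?d - 1) div 2" by (rule deg_le[OF Pup]) (rule P0, auto)
  thus ?thesis using that by linarith
 qed
 have Zup: "?Z : carrier (UP (VRep H))" unfolding carrier_UP_iff
 proof (intro conjI allI exI[of _ ?d] impI)
  show "?Z i : carrier (VRep H)" for i unfolding Z using Pc Rc by simp
  show "?Z i = \<zero>\<^bsub>VRep H\<^esub>" if "?d < i" for i
   unfolding Z using P0[of i] Z_rest_KL_rec_above[OF that] that by simp
 qed
 have Zd: "?Z ?d = \<one>\<^bsub>VRep H\<^esub>"
 proof (cases "?d = 0")
  case True
  thus ?thesis unfolding Z using Z_rest_rank_zero[OF True] Pc[of 0] by (simp add: st KL_step_def)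
 next
  case False
  thus ?thesis unfolding Z using P0[of ?d] Z_rest_KL_rec_top Rc[of ?d] by simp
 qed
 have "deg (VRep H) ?Z <= ?d" by (rule deg_le[OF Zup]) (use Z P0 Z_rest_KL_rec_above in simp)
 moreover have "\<not> deg (VRep H) ?Z < ?d"
  using deg_aboveD[OF Zup, of ?d] Zd VRep_one_not_zero[OF group_H] by auto
 ultimately have degZ: "deg (VRep H) ?Z = ?d" by simp
 \<comment> \<open>Below the middle, \<open>?P i\<close> was chosen to cancel \<open>?R i\<close>
   and leave \<open>?R (?d - i)\<close>; the degrees above the middle follow by symmetry.\<close>
 have half: "?Z i = ?Z (?d - i)" if i: "2 * i < ?d" for i
 proof -
  have "?P i = ?R (?d - i) \<ominus>\<^bsub>VRep H\<^esub> ?R i" using st i by (simp add: KL_step_def)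
  hence "?Z i = ?R (?d - i)"
   unfolding Z using Rc[of i] Rc[of "?d - i"] by (simp add: V.minus_eq V.a_assoc V.l_neg)
  moreover have "?P (?d - i) = \<zero>\<^bsub>VRep H\<^esub>" by (rule P0) (use i in auto)
  ultimately show ?thesis unfolding Z[of "?d - i"] using Rc by simp
 qed
 have "?Z i = ?Z (?d - i)" if i: "i <= ?d" for i
 proof -
  consider "2 * i < ?d" | "2 * i = ?d" | "2 * (?d - i) < ?d" using i by linarith
  thus ?thesis
  proof cases
   case 2
   hence "?d - i = i" by simp
   thus ?thesis by simp
  next
   case 3
   thus ?thesis using half[of "?d - i"] i by simp
  qed (use half in simp)
 qed
 hence "palindromic (VRep H) ?d ?Z" unfolding palindromic_def coeff_UP[OF Zup] using Zup degZ by blast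
 thus ?thesis using Pup one dg by blast
qed

text \<open>The defining conditions force the recursion: the degree bound removes \<open>P\<close>
  from the upper side of the palindromic equation, which can then be solved for
  \<open>P M H a i\<close>. Uniqueness follows by induction on the rank.\<close>

lemma KL_assignment_step:
 assumes P: "KL_assignment P"
 shows "P M H a i = KL_step P M H a i"
proof -
 let ?d = "matroid_rank M"
 have proper: "P N L b : carrier (UP (VRep L)) \<and>
   (matroid_rank N = 0 --> P N L b = \<one>\<^bsub>UP (VRep L)\<^esub>) \<and>
   (matroid_rank N > 0 --> 2 * deg (VRep L) (P N L b) < matroid_rank N) \<and>
   palindromic (VRep L) (matroid_rank N) (Z_of P N L b)" if "equivariant_matroid N L b" for N L b
  using P that unfolding KL_assignment_def equivariant_matroid_def by blast
 have pc: "at_flat P F j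
   : carrier (VRep (H\<lparr>carrier := flat_stab M H a F\<rparr>))" if "F : flats M" for F j
  using proper[OF equivariant_contraction[OF that]] by (simp add: carrier_UP_iff)
 have Z: "Z_of P M H a j = P M H a j \<oplus>\<^bsub>VRep H\<^esub> Z_rest P M H a j" for j
  by (rule Z_of_split(2)) (rule pc)
 have Pc: "P M H a j : carrier (VRep H)" for j by (rule Z_of_split(1)) (rule pc)
 have Rc: "Z_rest P M H a j : carrier (VRep H)" for j by (rule Z_rest_closed(2)) (rule pc)
 note pr = proper[OF equivariant]
 show ?thesis
 proof (cases "?d = 0")
  case True
  thus ?thesis using pr by (simp add: KL_step_def UP_def)
 next
  case False
  hence P0: "P M H a j = \<zero>\<^bsub>VRep H\<^esub>" if "?d <= 2 * j" for j
   using pr that by (intro deg_aboveD) auto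
  show ?thesis
  proof (cases "2 * i < ?d")
   case True
   have "Z_of P M H a i = Z_of P M H a (?d - i)"
   proof -
    have pal: "palindromic (VRep H) ?d (Z_of P M H a)" using pr by blast
    have Zup: "Z_of P M H a : carrier (UP (VRep H))" using pal unfolding palindromic_def by (elim conjE)
    have "ALL i<=?d. coeff (UP (VRep H)) (Z_of P M H a) i = coeff (UP (VRep H)) (Z_of P M H a) (?d - i)"
     using pal unfolding palindromic_def by (elim conjE)
    hence "coeff (UP (VRep H)) (Z_of P M H a) i = coeff (UP (VRep H)) (Z_of P M H a) (?d - i)"
     using True by (elim allE[of _ i] impE) auto
    thus ?thesis unfolding coeff_UP[OF Zup] .
   qed
   hence e: "P M H a i \<oplus>\<^bsub>VRep H\<^esub> Z_rest P M H a i = Z_rest P M H a (?d - i)"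
    unfolding Z using P0[of "?d - i"] True Rc by simp
   have "P M H a i = (P M H a i \<oplus>\<^bsub>VRep H\<^esub> Z_rest P M H a i) \<ominus>\<^bsub>VRep H\<^esub> Z_rest P M H a i"
    using Pc[of i] Rc[of i] by (simp add: V.minus_eq V.a_assoc V.r_neg)
   thus ?thesis unfolding e using False True by (simp add: KL_step_def)
  next
   case n: False
   thus ?thesis using P0[of i] False by (simp add: KL_step_def)
  qed
 qed
qed

end

lemma KL_assignment_KL_rec: "KL_assignment KL_rec" unfolding KL_assignment_def
 using eq_matroid.KL_rec_properties eq_matroid.intro unfolding equivariant_matroid_def by blast

lemma KL_assignment_unique:
 "KL_assignment P ==> equivariant_matroid M H a ==> P M H a = KL_rec M H a"
proof (induction "matroid_rank M" arbitrary: M H a rule: less_induct)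
 case less
 interpret eq_matroid M H a by unfold_locales (rule less.prems)
 have "P (contraction M F) (H\<lparr>carrier := flat_stab M H a F\<rparr>) (contraction_action M H a F) =
   KL_rec (contraction M F) (H\<lparr>carrier := flat_stab M H a F\<rparr>) (contraction_action M H a F)"
  if F: "F : flats M" "F ~= {}" for F using less.hyps[OF _ less.prems(1) equivariant_contraction[OF F(1)]]
   rank_contraction_flat[OF F(1)] rank_flat_pos[OF F] by simp
 hence "Z_rest P M H a i = Z_rest KL_rec M H a i" for i by (rule Z_rest_cong)
 thus ?case unfolding fun_eq_iff KL_assignment_step[OF less.prems(1)] KL_rec_step[OF less.prems(2)]
  by (simp add: KL_step_def)
qed

lemma equivariant_KL_eq:
 assumes "equivariant_matroid M H a"
 shows "equivariant_KL M H a = KL_rec M H a" unfolding equivariant_KL_def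
proof (rule the_equality)
 show "EX P. KL_assignment P & KL_rec M H a = P M H a" using KL_assignment_KL_rec by blast
qed (use KL_assignment_unique assms in blast)

lemma equivariant_Z_eq:
 assumes "equivariant_matroid M H a"
 shows "equivariant_Z M H a i = KL_rec M H a i \<oplus>\<^bsub>VRep H\<^esub> Z_rest KL_rec M H a i"
proof -
 interpret eq_matroid M H a by unfold_locales (rule assms)
 have e: "equivariant_KL (contraction M F) (H\<lparr>carrier := flat_stab M H a F\<rparr>) (contraction_action M H a F) =
   KL_rec (contraction M F) (H\<lparr>carrier := flat_stab M H a F\<rparr>) (contraction_action M H a F)"
  if "F : flats M" for F by (rule equivariant_KL_eq[OF equivariant_contraction[OF that]])
 have "Z_of equivariant_KL M H a i = equivariant_KL M H a i \<oplus>\<^bsub>VRep H\<^esub> Z_rest equivariant_KL M H a i"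
  by (rule Z_of_split(2)) (simp add: e KL_flat_closed)
 moreover have "Z_rest equivariant_KL M H a i = Z_rest KL_rec M H a i" by (rule Z_rest_cong) (rule e)
 ultimately show ?thesis unfolding equivariant_Z_def equivariant_KL_eq[OF assms] by simp
qed

section \<open>Matroids from graded families of flats\<close>

text \<open>Strict monotonicity turns equal rank under inclusion into equality, and the covering
  condition bounds the growth of rank by one per element; together they do the work of
  semimodularity. Independent sets are those whose closure has rank equal to their size.\<close>

lemma matroid_of_flats:
 fixes rho :: "'e set => nat"
 assumes fin: "finite E" and sub: "!!F. F : \<F> ==> F <= E" and top: "E : \<F>"
  and inter: "!!F F'. F : \<F> ==> F' : \<F> ==> F Int F' : \<F>"
  and mono: "!!F F'. F : \<F> ==> F' : \<F> ==> F < F' ==> rho F < rho F'"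
  and cover: "!!F e. F : \<F> ==> e : E ==> e ~: F ==> EX F':\<F>. insert e F <= F' & rho F' = Suc (rho F)"
  and bot: "{} : \<F>" "rho {} = 0"
 obtains M where "is_matroid M" "ground M = E" "flats M = \<F>" "!!F. F : \<F> ==> rank_of M F = rho F"
proof -
 define cl where "cl X = \<Inter>{F : \<F>. X <= F}" for X
 have finF: "finite \<F>" using fin sub by (meson PowI finite_Pow_iff finite_subset subsetI)
 have clF: "cl X : \<F>" if X: "X <= E" for X
 proof -
  have "finite \<G> ==> \<G> ~= {} ==> \<G> <= \<F> ==> \<Inter>\<G> : \<F>" for \<G>
   by (induction \<G> rule: finite_ne_induct) (auto intro: inter)
  moreover have "{F : \<F>. X <= F} ~= {}" using top X by blast
  ultimately show ?thesis unfolding cl_def using finF by auto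
 qed
 have cl_sup: "X <= cl X" for X unfolding cl_def by blast
 have cl_le: "cl X <= F" if "F : \<F>" "X <= F" for X F unfolding cl_def using that by blast
 have cl_mono: "cl X <= cl Y" if "X <= Y" "Y <= E" for X Y
  by (rule cl_le[OF clF[OF that(2)]]) (use that cl_sup[of Y] in blast)
 have rho_mono: "rho F <= rho F'" if "F : \<F>" "F' : \<F>" "F <= F'" for F F'
  using mono[OF that(1,2)] that(3) by (cases "F = F'") (auto simp: psubset_eq)
 have cl_F: "cl F = F" if "F : \<F>" for F using cl_le[OF that] cl_sup[of F] by blast
 have step: "rho (cl (insert e X)) <= Suc (rho (cl X))" if X: "X <= E" "e : E" for e X
 proof (cases "e : cl X")
  case True
  have "cl (insert e X) <= cl X" by (rule cl_le[OF clF[OF X(1)]]) (use True cl_sup[of X] in blast)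
  hence "rho (cl (insert e X)) <= rho (cl X)" using rho_mono clF X by simp
  thus ?thesis by simp
 next
  case False
  obtain F' where F': "F' : \<F>" "insert e (cl X) <= F'" "rho F' = Suc (rho (cl X))"
   using cover[OF clF[OF X(1)] X(2) False] by blast
  have "cl (insert e X) <= F'" by (rule cl_le[OF F'(1)]) (use F'(2) cl_sup[of X] in blast)
  hence "rho (cl (insert e X)) <= rho F'" using rho_mono clF[of "insert e X"] X F'(1) by simp
  thus ?thesis using F'(3) by simp
 qed
 have rho_card: "rho (cl X) <= card X" if X: "X <= E" for X
 proof -
  have "finite X" using X fin finite_subset by blast
  thus ?thesis using X
  proof (induction X rule: finite_induct)
   case empty
   thus ?case using cl_F[OF bot(1)] bot(2) by simp
  next
   case (insert e X)
   thus ?case using step[of X e] by simp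
  qed
 qed
 define M where "M = Matroid E {I. I <= E & rho (cl I) = card I}"
 have ind: "I : indeps M <-> I <= E & rho (cl I) = card I" for I by (simp add: M_def)
 have same: "cl (insert e X) = cl X" if X: "X <= E" "e : E" and le: "rho (cl (insert e X)) <= rho (cl X)" for e X
 by (metis clF cl_mono insert_subsetI le linorder_not_less mono psubset_eq subset_insertI that(1,2))
 have M: "is_matroid M"
 proof (rule is_matroidI)
  show "finite (ground M)" using fin by (simp add: M_def)
  show "{} : indeps M" using cl_F[OF bot(1)] bot(2) by (simp add: ind)
  fix I assume I: "I : indeps M"
  thus "I <= ground M" by (simp add: M_def)
  have fI: "finite I" using I fin finite_subset unfolding ind by blast
  show "J : indeps M" if J: "J <= I" for J
  proof -
   have "rho (cl (J Un Y)) <= rho (cl J) + card Y" if Y: "finite Y" "Y <= E" for Y using Y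
   proof (induction Y rule: finite_induct)
    case (insert e Y)
    have "rho (cl (J Un insert e Y)) <= Suc (rho (cl (J Un Y)))"
     using step[of "J Un Y" e] insert.prems J I unfolding ind by auto
    thus ?case using insert by simp
   qed simp
   from this[of "I - J"] have "rho (cl I) <= rho (cl J) + card (I - J)"
    using fI I J unfolding ind by (auto simp: Un_absorb1)
   moreover have "card I = card J + card (I - J)" using J fI by (metis card_Int_Diff Int_absorb1)
   moreover have "J <= E" using I J unfolding ind by blast
   ultimately show ?thesis using rho_card[of J] I unfolding ind by force
  qed
  fix J assume J: "J : indeps M" and less: "card I < card J"
  show "EX e:J - I. insert e I : indeps M"
  proof (rule ccontr)
   \<comment> \<open>If no element of \<open>J\<close> can be added, all of \<open>J\<close> lies in
     the closure of \<open>I\<close>, whose rank \<open>card I\<close> is smaller than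
     \<open>card J\<close>.\<close>
   assume n: "\<not> (EX e:J - I. insert e I : indeps M)"
   have "e : cl I" if e: "e : J" for e
   proof (cases "e : I")
    case True
    thus ?thesis using cl_sup[of I] by blast
   next
    case False
    have eE: "e : E" "I <= E" using e I J unfolding ind by auto
    have "insert e I ~: indeps M" using n e False by blast
    hence "rho (cl (insert e I)) ~= Suc (card I)" using eE fI False unfolding ind by simp
    moreover have "rho (cl (insert e I)) <= Suc (card I)" using step[OF eE(2,1)] I unfolding ind by simp
    ultimately have "cl (insert e I) = cl I" using same[OF eE(2,1)] I unfolding ind by simp
    thus ?thesis using cl_sup[of "insert e I"] by blast
   qed
   hence "cl J <= cl I" using cl_le[OF clF] I unfolding ind by blast
   moreover have "I <= E" "J <= E" using I J unfolding ind by auto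
   ultimately have "rho (cl J) <= rho (cl I)" using rho_mono[OF clF clF] by blast
   thus False using I J less unfolding ind by simp
  qed
 qed
 have gM: "ground M = E" by (simp add: M_def)
 have rk: "rank_of M X = rho (cl X)" if X: "X <= E" for X
 proof (rule antisym)
  obtain I where I: "I : indeps M" "I <= X" "card I = rank_of M X" using rank_attained[OF M] by blast
  have "rho (cl I) <= rho (cl X)" using rho_mono clF cl_mono[OF I(2) X] X I(2) by (meson subset_trans)
  thus "rank_of M X <= rho (cl X)" using I unfolding ind by simp
  have "X <= cl I"
  proof
   fix e assume e: "e : X"
   show "e : cl I"
   proof (cases "e : I")
    case False
    have fI: "finite I" using finite_indep[OF M I(1)] .
    have eE: "e : E" "I <= E" using e X I(2) by auto
    have "insert e I ~: indeps M"
    proof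
     assume "insert e I : indeps M"
     from indep_le_rank[OF M this, of X] show False using e I fI False by simp
    qed
    hence "rho (cl (insert e I)) ~= Suc (card I)" using eE fI False unfolding ind by simp
    moreover have "rho (cl (insert e I)) <= Suc (card I)" using step[OF eE(2,1)] I unfolding ind by simp
    ultimately have "cl (insert e I) = cl I" using same[OF eE(2,1)] I unfolding ind by simp
    thus ?thesis using cl_sup[of "insert e I"] by blast
   qed (use cl_sup[of I] in blast)
  qed
  hence "cl X <= cl I" using cl_le[OF clF] I X by (meson subset_trans)
  hence "rho (cl X) <= rho (cl I)" using rho_mono clF X I(2) by (meson subset_trans)
  thus "rho (cl X) <= rank_of M X" using I unfolding ind by simp
 qed
 have fl: "flats M = \<F>"
 proof (intro Set.set_eqI iffI)
  fix F assume F: "F : flats M"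
  hence FE: "F <= E" unfolding flats_def gM by blast
  have "cl F <= F"
  proof (rule ccontr)
   assume "\<not> cl F <= F"
   then obtain e where e: "e : cl F" "e ~: F" by blast
   have eE: "e : E" using e(1) sub[OF clF[OF FE]] by blast
   have "cl (insert e F) <= cl F" by (rule cl_le[OF clF[OF FE]]) (use e cl_sup[of F] in blast)
   hence "rho (cl (insert e F)) <= rho (cl F)" using rho_mono clF FE eE by simp
   hence "rank_of M (insert e F) <= rank_of M F" using rk FE eE by simp
   moreover have "rank_of M F < rank_of M (insert e F)" using F e(2) eE unfolding flats_def gM by blast
   ultimately show False by simp
  qed
  hence "F = cl F" using cl_sup[of F] by blast
  thus "F : \<F>" using clF[OF FE] by simp
 next
  fix F assume F: "F : \<F>"
  have "rank_of M F < rank_of M (insert e F)" if e: "e : E - F" for e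
  by (metis DiffE F cl_F cl_sup insert_subset linorder_not_less rk same sub that)
  thus "F : flats M" unfolding flats_def gM using sub[OF F] by blast
 qed
 have "rank_of M F = rho F" if "F : \<F>" for F using rk[OF sub[OF that]] cl_F[OF that] by simp
 thus ?thesis using that M gM fl by blast
qed

section \<open>Gain relations of partial partitions\<close>

type_synonym 'g gains = "(nat \<times> 'g \<times> nat) set"

locale dowling = group G for G :: "('g, 'b) monoid_scheme" (structure) +
 fixes n :: nat
 assumes finite_G: "finite (carrier G)"
begin

abbreviation "PP \<equiv> partial_partitions G n"

definition triples :: "'g gains" where
 "triples = {0..n} \<times> carrier G \<times> {0..n}"

lemma triples_eqI:
 assumes "A <= triples" "B <= triples"
  "!!i g j. (i, g, j) : triples ==> (i, g, j) : A <-> (i, g, j) : B"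
 shows "A = B" using assms(1,2,3) by auto

text \<open>
 The triple \<open>(i, g, j)\<close> says that \<open>i\<close> and \<open>j\<close> lie in the same block and that \<open>f i \<otimes> g = f j\<close>.
 The extra point \<open>0\<close> stands for the zero block, the complement of \<open>S\<close>.
\<close>

definition gains :: "'g partial_partition => 'g gains" where
 "gains = (%(S, f, P). {(i, g, j). (i, g, j) : triples \<and>
   (i ~: S & j ~: S | (EX A:P. i : A & j : A & f i \<otimes> g = f j))})"

text \<open>A subgroupoid of the complete groupoid of gains on \<open>{0..n}\<close>. A point with a
  nontrivial gain to itself is absorbed by the zero block, and the zero block carries every
  gain.\<close>

definition gain_closed :: "'g gains => bool" where
 "gain_closed D <-> D <= triples \<and>
   (ALL i:{0..n}. (i, \<one>, i) : D) \<and>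
   (ALL i g j. (i, g, j) : D --> (j, inv g, i) : D) \<and>
   (ALL i g j h k. (i, g, j) : D --> (j, h, k) : D --> (i, g \<otimes> h, k) : D) \<and>
   (ALL i g. (i, g, i) : D --> g ~= \<one> --> (i, \<one>, 0) : D) \<and>
   (ALL i g h. (i, g, 0) : D --> h : carrier G --> (i, h, 0) : D)"

definition supp :: "'g gains => nat set" where
 "supp D = {i : {1..n}. (i, \<one>, 0) ~: D}"

definition block :: "'g gains => nat => nat set" where
 "block D i = {j. EX g. (i, g, j) : D}"

text \<open>The corank of the flat: a class with k blocks has rank \<open>n - k\<close>.\<close>

definition nblocks :: "'g gains => nat" where
 "nblocks D = card (block D ` supp D)"

lemma gain_closedD:
 assumes "gain_closed D"
 shows "D <= triples" "i <= n ==> (i, \<one>, i) : D" "(i, g, j) : D ==> (j, inv g, i) : D"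
  "(i, g, j) : D ==> (j, h, k) : D ==> (i, g \<otimes> h, k) : D"
  "(i, g, i) : D ==> g ~= \<one> ==> (i, \<one>, 0) : D"
  "(i, g, 0) : D ==> h : carrier G ==> (i, h, 0) : D" using assms unfolding gain_closed_def by auto

lemma gain_triple:
 assumes "gain_closed D" "(i, g, j) : D"
 shows "i <= n" "g : carrier G" "j <= n"
 using gain_closedD(1)[OF assms(1)] assms(2) unfolding triples_def by auto

lemma gain_supp:
 assumes D: "gain_closed D" and t: "(i, g, j) : D"
 shows "i : supp D <-> j : supp D"
proof -
 have one: "(a, \<one>, 0) : D" if ab: "(a, g, b) : D" and b: "(b, \<one>, 0) : D" for a b g
 proof -
  have "(a, g \<otimes> \<one>, 0) : D" using gain_closedD(4)[OF D ab b] .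
  thus ?thesis using gain_closedD(6)[OF D] by blast
 qed
 have s: "(j, inv g, i) : D" using gain_closedD(3)[OF D t] .
 have z: "(0, \<one>, 0) : D" using gain_closedD(2)[OF D] by simp
 have "(i, \<one>, 0) : D <-> (j, \<one>, 0) : D" using one[OF t] one[OF s] by blast
 thus ?thesis unfolding supp_def using gain_triple[OF D t] z by (cases "i = 0"; cases "j = 0") auto
qed

lemma gain_unique:
 assumes D: "gain_closed D" and i: "i : supp D" and g: "(i, g, j) : D" "(i, h, j) : D"
 shows "g = h"
proof -
 have "(i, g \<otimes> inv h, i) : D" using gain_closedD(3,4)[OF D] g by blast
 moreover have "(i, \<one>, 0) ~: D" using i unfolding supp_def by blast
 ultimately have "g \<otimes> inv h = \<one>" using gain_closedD(5)[OF D] by blast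
 thus ?thesis using gain_triple(2)[OF D g(1)] gain_triple(2)[OF D g(2)]
  by (metis inv_equality inv_inv inv_closed)
qed

lemma not_supp_gain:
 assumes D: "gain_closed D" and "i <= n" "j <= n" "i ~: supp D" "j ~: supp D" "g : carrier G"
 shows "(i, g, j) : D"
proof -
 have z: "(0, \<one>, 0) : D" using gain_closedD(2)[OF D] by simp
 have o: "(a, \<one>, 0) : D" if "a <= n" "a ~: supp D" for a
  using that z unfolding supp_def by (cases "a = 0") auto
 have "(i, g, 0) : D" using gain_closedD(6)[OF D o[OF assms(2,4)] assms(6)] .
 moreover have "(0, \<one>, j) : D" using gain_closedD(3)[OF D o[OF assms(3,5)]] by simp
 ultimately show ?thesis using gain_closedD(4)[OF D] assms(6) by force
qed

lemma block_subset_supp: "gain_closed D ==> i : supp D ==> block D i <= supp D"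
 unfolding block_def using gain_supp by blast

lemma block_self: "gain_closed D ==> i : supp D ==> i : block D i"
 unfolding block_def supp_def using gain_closedD(2) by auto

lemma block_eq_iff:
 assumes D: "gain_closed D" and i: "i : supp D"
 shows "block D i = block D j <-> (EX g. (i, g, j) : D)"
proof
 assume "block D i = block D j"
 hence "i : block D j" using block_self[OF D i] by simp
 thus "EX g. (i, g, j) : D" unfolding block_def using gain_closedD(3)[OF D] by blast
next
 assume "EX g. (i, g, j) : D"
 then obtain g where g: "(i, g, j) : D" by blast
 note g' = gain_closedD(3)[OF D g]
 show "block D i = block D j"
  unfolding block_def using gain_closedD(4)[OF D g] gain_closedD(4)[OF D g'] by blast
qed

lemma supp_subset: "supp D <= {1..n}" and finite_supp: "finite (supp D)" unfolding supp_def by auto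

lemma gain_closed_Int:
 assumes "gain_closed D" "gain_closed D'"
 shows "gain_closed (D Int D')" unfolding gain_closed_def
 using gain_closedD[OF assms(1)] gain_closedD[OF assms(2)] by (intro conjI allI ballI impI) auto

section \<open>Gain sets of partial partitions\<close>

lemma PP_D:
 assumes "(S, f, P) : PP"
 shows "S <= {1..n}" "f : S \<rightarrow>\<^sub>E carrier G" "partition_on S P" "i : S ==> f i : carrier G"
  "A : P ==> A <= S" "A : P ==> B : P ==> i : A ==> i : B ==> A = B" "i : S ==> EX A:P. i : A"
proof -
 show *: "S <= {1..n}" "f : S \<rightarrow>\<^sub>E carrier G" "partition_on S P"
  using assms unfolding partial_partitions_def by auto
 show "i : S ==> f i : carrier G" using *(2) by auto
 show "A : P ==> A <= S" using *(3) unfolding partition_on_def by blast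
 show "A : P ==> B : P ==> i : A ==> i : B ==> A = B"
  using *(3) unfolding partition_on_def disjoint_def by blast
 show "i : S ==> EX A:P. i : A" using *(3) unfolding partition_on_def by blast
qed

lemma mem_gains_iff:
 assumes x: "(S, f, P) : PP" and "i <= n" "j <= n" "g : carrier G"
 shows "(i, g, j) : gains (S, f, P) <->
  i ~: S & j ~: S | (EX A:P. i : A & j : A & f i \<otimes> g = f j)"
 unfolding gains_def triples_def using assms by auto

lemma gains_closed:
 assumes x: "x : PP"
 shows "gain_closed (gains x)"
proof -
 obtain S f P where e: "x = (S, f, P)" by (metis surj_pair)
 note P = PP_D[OF x[unfolded e]]
 have z: "0 ~: S" using P(1) by auto
 have iS: "i : S" if "A : P" "i : A" for i A using P(5) that by blast
 have tr: "gains x <= triples" unfolding gains_def e by auto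
 have memD: "i ~: S & j ~: S | (EX A:P. i : A & j : A & f i \<otimes> g = f j)" "(i, g, j) : triples"
  if "(i, g, j) : gains x" for i g j using that unfolding gains_def e by auto
 have memI: "(i, g, j) : gains x"
  if "(i, g, j) : triples" "i ~: S & j ~: S | (EX A:P. i : A & j : A & f i \<otimes> g = f j)" for i g j
  using that unfolding gains_def e by auto
 show ?thesis unfolding gain_closed_def
 proof (intro conjI allI ballI impI)
  fix i assume i: "i : {0..n}"
  show "(i, \<one>, i) : gains x"
  proof (rule memI)
   show "(i, \<one>, i) : triples" using i by (simp add: triples_def)
   show "i ~: S & i ~: S | (EX A:P. i : A & i : A & f i \<otimes> \<one> = f i)"
    using P(4)[of i] P(7)[of i] by auto
  qed
 next
  fix i g j assume t: "(i, g, j) : gains x"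
  show "(j, inv g, i) : gains x"
  proof (rule memI)
   show "(j, inv g, i) : triples" using memD(2)[OF t] by (simp add: triples_def)
   have g: "g : carrier G" using memD(2)[OF t] by (simp add: triples_def)
   have "f j \<otimes> inv g = f i" if "A : P" "i : A" "j : A" "f i \<otimes> g = f j" for A
    using that(4)[symmetric] P(4)[OF iS[OF that(1,2)]] g by (simp add: m_assoc)
   thus "j ~: S & i ~: S | (EX A:P. j : A & i : A & f j \<otimes> inv g = f i)" using memD(1)[OF t] by blast
  qed
 next
  fix i g j h k assume t: "(i, g, j) : gains x" "(j, h, k) : gains x"
  show "(i, g \<otimes> h, k) : gains x"
  proof (rule memI)
   have gh: "g : carrier G" "h : carrier G" using memD(2)[OF t(1)] memD(2)[OF t(2)] by (auto simp: triples_def)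
   show "(i, g \<otimes> h, k) : triples" using memD(2)[OF t(1)] memD(2)[OF t(2)] by (simp add: triples_def)
   show "i ~: S & k ~: S | (EX A:P. i : A & k : A & f i \<otimes> (g \<otimes> h) = f k)"
   proof (cases "j : S")
    case True
    then obtain A B where A: "A : P" "i : A" "j : A" "f i \<otimes> g = f j"
     and B: "B : P" "j : B" "k : B" "f j \<otimes> h = f k" using memD(1)[OF t(1)] memD(1)[OF t(2)] by blast
    have "A = B" using P(6)[OF A(1) B(1) A(3) B(2)] .
    moreover have "f i \<otimes> (g \<otimes> h) = f k"
     using A(4) B(4) P(4)[OF iS[OF A(1,2)]] gh by (simp add: m_assoc[symmetric])
    ultimately show ?thesis using A B by blast
   next
    case False
    thus ?thesis using memD(1)[OF t(1)] memD(1)[OF t(2)] iS by blast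
   qed
  qed
 next
  fix i g assume t: "(i, g, i) : gains x" "g ~= \<one>"
  have g: "g : carrier G" "i <= n" using memD(2)[OF t(1)] by (auto simp: triples_def)
  have "i ~: S"
  proof
   assume i: "i : S"
   hence "f i \<otimes> g = f i" using memD(1)[OF t(1)] by blast
   thus False using t(2) P(4)[OF i] g by simp
  qed
  thus "(i, \<one>, 0) : gains x" using z g by (intro memI) (auto simp: triples_def)
 next
  fix i g h assume t: "(i, g, 0) : gains x" "h : carrier G"
  have "i ~: S" using memD(1)[OF t(1)] z iS by blast
  thus "(i, h, 0) : gains x" using z t(2) memD(2)[OF t(1)] by (intro memI) (auto simp: triples_def)
 qed (rule tr)
qed

lemma supp_gains: "(S, f, P) : PP ==> supp (gains (S, f, P)) = S"
proof -
 assume x: "(S, f, P) : PP"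
 note P = PP_D[OF x]
 have "(i, \<one>, 0) : gains (S, f, P) <-> i ~: S" if "i : {1..n}" for i
  using mem_gains_iff[OF x, of i 0 \<one>] that P(1) P(5) by fastforce
 thus ?thesis unfolding supp_def using P(1) by auto
qed

lemma block_gains:
 assumes x: "(S, f, P) : PP" and A: "A : P" "i : A"
 shows "block (gains (S, f, P)) i = A"
proof -
 note P = PP_D[OF x]
 have iS: "i : S" using P(5) A by blast
 show ?thesis
 proof (intro Set.set_eqI iffI)
  fix j assume "j : block (gains (S, f, P)) i"
  thus "j : A" unfolding block_def gains_def using iS P(6)[OF _ A(1) _ A(2)] by auto
 next
  fix j assume j: "j : A"
  hence jS: "j : S" using P(5) A by blast
  have c: "f i : carrier G" "f j : carrier G" using P(4) iS jS by auto
  have "f i \<otimes> (inv (f i) \<otimes> f j) = f j" using c by (simp add: m_assoc[symmetric])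
  moreover have "i <= n" "j <= n" using iS jS P(1) by auto
  ultimately have "(i, inv (f i) \<otimes> f j, j) : gains (S, f, P)"
   using mem_gains_iff[OF x _ _ m_closed[OF inv_closed[OF c(1)] c(2)]] A j by blast
  thus "j : block (gains (S, f, P)) i" unfolding block_def by blast
 qed
qed

lemma blocks_gains:
 assumes x: "(S, f, P) : PP"
 shows "block (gains (S, f, P)) ` supp (gains (S, f, P)) = P"
proof -
 note P = PP_D[OF x]
 show ?thesis unfolding supp_gains[OF x]
 proof (intro subset_antisym subsetI)
  fix A assume "A : block (gains (S, f, P)) ` S"
  then obtain i where i: "i : S" "A = block (gains (S, f, P)) i" by blast
  then obtain B where "B : P" "i : B" using P(7) by blast
  thus "A : P" using block_gains[OF x] i by metis
 next
  fix A assume A: "A : P"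
  then obtain i where "i : A" using P(3) unfolding partition_on_def by fastforce
  thus "A : block (gains (S, f, P)) ` S" using block_gains[OF x A] P(5)[OF A] by blast
 qed
qed

lemma nblocks_gains: "(S, f, P) : PP ==> nblocks (gains (S, f, P)) = card P"
 unfolding nblocks_def using blocks_gains by simp

lemma gain_label:
 assumes x: "(S, f, P) : PP" and i: "i : S" and t: "(i, g, j) : gains (S, f, P)"
 shows "f i \<otimes> g = f j" using t i unfolding gains_def by auto

text \<open>A root is chosen in every block, and each point is labeled by its gain from the root of
  its block. With \<open>gains_closed\<close>, this makes \<open>gain_closed\<close> a description
  of exactly the gain sets.\<close>

lemma gain_realizable:
 assumes D: "gain_closed D"
 obtains x where "x : PP" "gains x = D"
proof -
 let ?S = "supp D" and ?P = "block D ` supp D"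
 define r where "r B = (SOME k. k : supp D & block D k = B)" for B
 have r: "r B : supp D & block D (r B) = B" if B: "B : ?P" for B
 proof -
  obtain k where "k : supp D & block D k = B" using B by blast
  thus ?thesis unfolding r_def by (rule someI)
 qed
 define f where "f = (\<lambda>i\<in>?S. SOME g. (r (block D i), g, i) : D)"
 have f: "(r (block D i), f i, i) : D" if i: "i : ?S" for i
 proof -
  have "block D (r (block D i)) = block D i" "r (block D i) : supp D" using r i by auto
  hence "EX g. (r (block D i), g, i) : D" using block_eq_iff[OF D] by blast
  thus ?thesis unfolding f_def using i someI_ex[of "%g. (r (block D i), g, i) : D"] by simp
 qed
 have fc: "f i : carrier G" if "i : ?S" for i using gain_triple(2)[OF D f[OF that]] .
 have part: "partition_on ?S ?P" unfolding partition_on_def disjoint_def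
 proof (intro conjI ballI impI)
  show "\<Union>?P = ?S" using block_subset_supp[OF D] block_self[OF D] by blast
  fix A B assume "A : ?P" "B : ?P" "A ~= B"
  then obtain i j where ij: "i : ?S" "j : ?S" "A = block D i" "B = block D j" by blast
  show "A Int B = {}"
  proof (rule ccontr)
   assume "A Int B ~= {}"
   then obtain k where "k : A" "k : B" by blast
   hence "EX g. (i, g, k) : D" "EX g. (j, g, k) : D" unfolding ij block_def by auto
   hence "block D i = block D k" "block D j = block D k" using block_eq_iff[OF D] ij by auto
   thus False using \<open>A ~= B\<close> ij by simp
  qed
 next
  show "{} ~: ?P" using block_self[OF D] by fastforce
 qed
 have x: "(?S, f, ?P) : PP"
  unfolding partial_partitions_def using part supp_subset fc by (auto simp: f_def PiE_def Pi_def)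
 have "(i, g, j) : gains (?S, f, ?P) <-> (i, g, j) : D" if t: "(i, g, j) : triples" for i g j
 proof -
  have g: "i <= n" "j <= n" "g : carrier G" using t unfolding triples_def by auto
  show ?thesis
  proof
   assume "(i, g, j) : gains (?S, f, ?P)"
   then consider "i ~: ?S" "j ~: ?S" | A where "A : ?P" "i : A" "j : A" "f i \<otimes> g = f j"
    using mem_gains_iff[OF x g] by blast
   thus "(i, g, j) : D"
   proof cases
    case 1
    thus ?thesis using not_supp_gain[OF D g(1,2) _ _ g(3)] by blast
   next
    case 2
    have S: "i : ?S" "j : ?S" using 2 part unfolding partition_on_def by blast+
    obtain k where k: "k : ?S" "A = block D k" using 2(1) by blast
    have "block D k = block D i" "block D k = block D j"
     using 2(2,3) k block_eq_iff[OF D k(1)] unfolding k(2) block_def by auto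
    hence "(i, inv (f i), r (block D i)) : D" "(r (block D i), f j, j) : D"
     using f[OF S(1)] f[OF S(2)] gain_closedD(3)[OF D] by auto
    hence "(i, inv (f i) \<otimes> f j, j) : D" using gain_closedD(4)[OF D] by blast
    moreover have "inv (f i) \<otimes> f j = g" using 2(4) fc[OF S(1)] g(3) by (simp add: m_assoc[symmetric] 2(4)[symmetric])
    ultimately show ?thesis by simp
   qed
  next
   assume d: "(i, g, j) : D"
   show "(i, g, j) : gains (?S, f, ?P)"
   proof (cases "i : ?S")
    case True
    hence jS: "j : ?S" using gain_supp[OF D d] by blast
    have b: "block D i = block D j" using block_eq_iff[OF D True] d by blast
    have "(r (block D i), f i \<otimes> g, j) : D" using gain_closedD(4)[OF D f[OF True] d] .
    moreover have "(r (block D i), f j, j) : D" using f[OF jS] b by simp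
    moreover have "r (block D i) : supp D" using r True by blast
    ultimately have "f i \<otimes> g = f j" using gain_unique[OF D] by blast
    moreover have "i : block D i" "j : block D i" using block_self[OF D] True jS b by auto
    ultimately show ?thesis using mem_gains_iff[OF x g] True by blast
   next
    case False
    hence "j ~: ?S" using gain_supp[OF D d] by blast
    thus ?thesis using mem_gains_iff[OF x g] False by blast
   qed
  qed
 qed
 moreover have "gains (?S, f, ?P) <= triples" "D <= triples"
  using gains_closed[OF x] gain_closedD(1) D by auto
 ultimately have "gains (?S, f, ?P) = D" by (intro triples_eqI)
 thus ?thesis using that x by blast
qed

text \<open>Representatives of the blocks of \<open>D'\<close> lie in distinct blocks of
  \<open>D\<close>, which gives an injection of block sets. If it is onto, no support point and no
  block is lost, and uniqueness of gains inside a block forces equality.\<close>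

lemma nblocks_mono:
 assumes D: "gain_closed D" and D': "gain_closed D'" and sub: "D <= D'"
 shows "nblocks D' <= nblocks D" "nblocks D' = nblocks D ==> D = D'"
proof -
 have S: "supp D' <= supp D" unfolding supp_def using sub by blast
 have bs: "block D i <= block D' i" for i unfolding block_def using sub by blast
 define r where "r B = (SOME k. k : supp D' & block D' k = B)" for B
 have r: "r B : supp D' & block D' (r B) = B" if B: "B : block D' ` supp D'" for B
 proof -
  obtain k where "k : supp D' & block D' k = B" using B by blast
  thus ?thesis unfolding r_def by (rule someI)
 qed
 let ?h = "%B. block D (r B)"
 have inj: "inj_on ?h (block D' ` supp D')"
 proof (rule inj_onI)
  fix B C assume BC: "B : block D' ` supp D'" "C : block D' ` supp D'" and e: "?h B = ?h C"
  have "r B : supp D" using r[OF BC(1)] S by blast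
  hence "EX g. (r B, g, r C) : D" using block_eq_iff[OF D] e by blast
  hence "block D' (r B) = block D' (r C)" using block_eq_iff[OF D'] r[OF BC(1)] sub by blast
  thus "B = C" using r BC by simp
 qed
 have im: "?h ` (block D' ` supp D') <= block D ` supp D" using r S by blast
 have fin: "finite (block D ` supp D)" using finite_supp by simp
 show "nblocks D' <= nblocks D" unfolding nblocks_def by (rule card_inj_on_le[OF inj im fin])
 assume eq: "nblocks D' = nblocks D"
 have onto: "?h ` (block D' ` supp D') = block D ` supp D"
  by (rule card_subset_eq[OF fin im]) (use eq in \<open>simp add: card_image[OF inj] nblocks_def\<close>)
 have S_eq: "supp D' = supp D"
 proof (rule subset_antisym[OF S], rule subsetI)
  fix i assume i: "i : supp D"
  then obtain B where B: "B : block D' ` supp D'" "block D i = ?h B" using onto by (metis imageE imageI)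
  hence "EX g. (i, g, r B) : D" using block_eq_iff[OF D i] by blast
  thus "i : supp D'" using gain_supp[OF D'] sub r[OF B(1)] by blast
 qed
 have "(i, g, j) : D" if t: "(i, g, j) : D'" for i g j
 proof (cases "i : supp D'")
  case True
  hence ij: "i : supp D" "j : supp D" using S_eq gain_supp[OF D' t] by auto
  obtain B where B: "B : block D' ` supp D'" "block D i = ?h B" using onto ij by (metis imageE imageI)
  obtain C where C: "C : block D' ` supp D'" "block D j = ?h C" using onto ij by (metis imageE imageI)
  have "EX g. (i, g, r B) : D" "EX g. (j, g, r C) : D" using block_eq_iff[OF D] B C ij by auto
  hence "block D' i = B" "block D' j = C"
   using block_eq_iff[OF D'] sub True ij S_eq r[OF B(1)] r[OF C(1)] by blast+
  moreover have "block D' i = block D' j" using block_eq_iff[OF D' True] t by blast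
  ultimately have "block D i = block D j" using B C by simp
  then obtain h where h: "(i, h, j) : D" using block_eq_iff[OF D ij(1)] by blast
  hence "h = g" using gain_unique[OF D' True _ t] sub by blast
  thus ?thesis using h by simp
 next
  case False
  hence "i ~: supp D" "j ~: supp D" using S_eq gain_supp[OF D' t] by auto
  thus ?thesis using not_supp_gain[OF D] gain_triple[OF D' t] by blast
 qed
 thus "D = D'" using sub by auto
qed

end

section \<open>Coarsening steps and covers\<close>

lemma partition_on_merge:
 assumes P: "partition_on S P" and A: "A : P" and B: "B : P"
 shows "partition_on S (insert (A Un B) (P - {A, B}))" unfolding partition_on_def disjoint_def
proof (intro conjI ballI impI)
 have d: "C Int C' = {}" if "C : P" "C' : P" "C ~= C'" for C C'
  using P that unfolding partition_on_def disjoint_def by blast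
 show "\<Union>(insert (A Un B) (P - {A, B})) = S" using P A B unfolding partition_on_def by blast
 show "{} ~: insert (A Un B) (P - {A, B})" using P A unfolding partition_on_def by auto
 have m: "(A Un B) Int C = {}" if "C : P - {A, B}" for C using d[OF A, of C] d[OF B, of C] that by blast
 fix C C' assume "C : insert (A Un B) (P - {A, B})" "C' : insert (A Un B) (P - {A, B})" "C ~= C'"
 then consider "C = A Un B" "C' : P - {A, B}" | "C' = A Un B" "C : P - {A, B}"
  | "C : P" "C' : P" by blast
 thus "C Int C' = {}"
 proof cases
  case 1
  thus ?thesis using m[of C'] by simp
 next
  case 2
  thus ?thesis using m[of C] by blast
 next
  case 3
  thus ?thesis using d \<open>C ~= C'\<close> by simp
 qed
qed

lemma merge_coarser: "C : P ==> EX C':insert (A Un B) (P - {A, B}). C <= C'"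
proof (cases "C = A | C = B")
 case True
 thus ?thesis by (intro bexI[of _ "A Un B"]) auto
next
 case False
 assume "C : P"
 thus ?thesis using False by (intro bexI[of _ C]) auto
qed

context dowling
begin

lemma gains_coarser:
 assumes x: "(S, f, P) : PP" and y: "(S, f, P') : PP" and c: "!!C. C : P ==> EX C':P'. C <= C'"
 shows "gains (S, f, P) <= gains (S, f, P')"
proof (rule subsetI)
 fix u assume u: "u : gains (S, f, P)"
 obtain k h l where ue: "u = (k, h, l)" by (metis surj_pair)
 have kl: "k <= n" "l <= n" "h : carrier G" using gain_triple[OF gains_closed[OF x] u[unfolded ue]] by auto
 consider "k ~: S" "l ~: S" | C where "C : P" "k : C" "l : C" "f k \<otimes> h = f l"
  using u mem_gains_iff[OF x kl] unfolding ue by blast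
 thus "u : gains (S, f, P')"
 proof cases
  case 1
  thus ?thesis unfolding ue mem_gains_iff[OF y kl] by simp
 next
  case 2
  obtain C' where "C' : P'" "C <= C'" using c[OF 2(1)] by blast
  hence "C' : P'" "k : C'" "l : C'" using 2(2,3) by auto
  thus ?thesis unfolding ue mem_gains_iff[OF y kl] using 2(4) by blast
 qed
qed

text \<open>A missing triple is supplied by one coarsening step: if its ends lie in different
  blocks, one block is relabeled and the two are merged; otherwise a block is deleted. The last
  conclusion lifts the step to any representative of the coarser class, because
  \<open>dowling_le\<close> asks for a chain of actual partitions.\<close>

lemma gain_cover:
 assumes x: "x : PP" and t: "t : triples" "t ~: gains x"
 obtains z where "z : PP" "t : gains z" "gains x <= gains z"
  "Suc (nblocks (gains z)) = nblocks (gains x)"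
  "!!z'. z' : PP ==> gains z' = gains z ==> EX x':PP. gains x' = gains x & coarsen x' z'"
proof -
 obtain S f P where e: "x = (S, f, P)" by (metis surj_pair)
 obtain i g j where te: "t = (i, g, j)" by (metis surj_pair)
 note P = PP_D[OF x[unfolded e]]
 have ig: "i <= n" "j <= n" "g : carrier G" using t(1) unfolding te triples_def by auto
 note mem = mem_gains_iff[OF x[unfolded e]]
 have nt: "\<not> (i ~: S & j ~: S)" "!!A. A : P ==> i : A ==> j : A ==> f i \<otimes> g ~= f j"
  using t(2) mem[OF ig] unfolding te e by blast+
 have finP: "finite P" using P(1,3) finite_elements[OF finite_subset[OF P(1)]] by simp
 have ne: "A ~= {}" if "A : P" for A using P(3) that unfolding partition_on_def by blast
 have gx: "gains x <= triples" using gain_closedD(1)[OF gains_closed[OF x]] .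
 show ?thesis
 proof (cases "EX A B. A : P & B : P & A ~= B & i : A & j : B")
  case True
  then obtain A B where AB: "A : P" "B : P" "A ~= B" "i : A" "j : B" by blast
  have iS: "i : S" "j : S" using AB P(5) by blast+
  have disj: "A Int B = {}" using P(6)[OF AB(1,2)] AB(3) by blast
  \<comment> \<open>Multiplying the labels on \<open>B\<close> by \<open>c\<close> from the left
    keeps the class and turns the label of \<open>j\<close> into \<open>f i \<otimes> g\<close>, as
    the triple demands.\<close>
  define c where "c = f i \<otimes> g \<otimes> inv (f j)"
  have c: "c : carrier G" unfolding c_def using P(4) iS ig by simp
  define f' where "f' = (\<lambda>k\<in>S. if k : B then c \<otimes> f k else f k)"
  define P' where "P' = insert (A Un B) (P - {A, B})"
  have f'c: "f' : S \<rightarrow>\<^sub>E carrier G" unfolding f'_def using c P(4) by auto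
  have part': "partition_on S P'" unfolding P'_def by (rule partition_on_merge[OF P(3) AB(1,2)])
  define z where "z = (S, f', P')"
  have zP: "z : PP" unfolding z_def partial_partitions_def using P(1) f'c part' by simp
  have x'P: "(S, f', P) : PP" unfolding partial_partitions_def using P(1,3) f'c by simp
  note memz = mem_gains_iff[OF zP[unfolded z_def]] and memx' = mem_gains_iff[OF x'P]
  have lab: "f' k \<otimes> h = f' l <-> f k \<otimes> h = f l"
   if "C : P" "k : C" "l : C" "h : carrier G" for C k l h
  proof -
   have S: "k : S" "l : S" using P(5) that by blast+
   have "k : B <-> l : B" using P(6)[OF that(1) AB(2)] that by blast
   thus ?thesis unfolding f'_def using S P(4) c that(4) by (auto simp: m_assoc)
  qed
  have gx': "gains (S, f', P) = gains x"
  proof -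
   have "(k, h, l) : gains (S, f', P) <-> (k, h, l) : gains x" if "(k, h, l) : triples" for k h l
    using memx'[of k l h] mem[of k l h] lab that unfolding e triples_def by auto
   thus ?thesis by (rule triples_eqI[OF gain_closedD(1)[OF gains_closed[OF x'P]] gx])
  qed
  have tz: "t : gains z"
  proof -
   have "f' i = f i" unfolding f'_def using iS AB disj by auto
   moreover have "f' j = f i \<otimes> g" unfolding f'_def c_def using iS AB P(4) ig by (simp add: m_assoc)
   ultimately have "f' i \<otimes> g = f' j" by simp
   moreover have "A Un B : P'" unfolding P'_def by blast
   ultimately show ?thesis unfolding te z_def memz[OF ig] using AB by blast
  qed
  have sub: "gains x <= gains z" unfolding gx'[symmetric] z_def P'_def
   by (rule gains_coarser[OF x'P zP[unfolded z_def P'_def] merge_coarser])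
  have "card P' = Suc (card (P - {A, B}))"
  proof -
   have "A Un B ~: P"
   proof
    assume "A Un B : P"
    hence "A Un B = A" "A Un B = B" using P(6)[of "A Un B"] AB by blast+
    thus False using AB(3) by blast
   qed
   thus ?thesis unfolding P'_def using finP by (subst card_insert_disjoint) auto
  qed
  moreover have "card P = Suc (Suc (card (P - {A, B})))"
  proof -
   have "B : P - {A}" "finite (P - {A})" using AB(2,3) finP by auto
   hence "card (P - {A}) = Suc (card (P - {A} - {B}))" by (simp only: card_Suc_Diff1)
   moreover have "P - {A} - {B} = P - {A, B}" by blast
   ultimately show ?thesis using card_Suc_Diff1[OF finP AB(1)] by simp
  qed
  ultimately have card: "Suc (nblocks (gains z)) = nblocks (gains x)"
   using nblocks_gains[OF zP[unfolded z_def]] nblocks_gains[OF x[unfolded e]] unfolding z_def e by simp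
  \<comment> \<open>Splitting the merged block again, with the labels of \<open>z'\<close> itself,
    gives the finer representative.\<close>
  have "EX x':PP. gains x' = gains x & coarsen x' z'" if z': "z' : PP" "gains z' = gains z" for z'
  proof -
   obtain S2 f2 P2 where e2: "z' = (S2, f2, P2)" by (metis surj_pair)
   have S2: "S2 = S" "P2 = P'" using supp_gains[OF z'(1)[unfolded e2]] supp_gains[OF zP[unfolded z_def]]
     blocks_gains[OF z'(1)[unfolded e2]] blocks_gains[OF zP[unfolded z_def]] z'(2) unfolding e2 z_def by auto
   have xP: "(S, f2, P) : PP" using z'(1) P(1,3) unfolding e2 S2 partial_partitions_def by simp
   have "gains (S, f2, P) = gains x"
   proof -
    have "(k, h, l) : gains (S, f2, P) <-> (k, h, l) : gains x" if tr: "(k, h, l) : triples" for k h l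
    proof -
     have kl: "k <= n" "l <= n" "h : carrier G" using tr unfolding triples_def by auto
     have "f2 k \<otimes> h = f2 l <-> f k \<otimes> h = f l" if C: "C : P" "k : C" "l : C" for C
     proof -
      obtain C' where C': "C' : P'" "k : C'" "l : C'" using C unfolding P'_def by blast
      have same: "f'' k \<otimes> h = f'' l <-> (k, h, l) : gains (S, f'', P')" if "(S, f'', P') : PP" for f''
       using mem_gains_iff[OF that kl] PP_D(5,6)[OF that] C' by blast
      have "f2 k \<otimes> h = f2 l <-> f' k \<otimes> h = f' l"
       using same[of f2] same[of f'] z' zP unfolding e2 S2 z_def by simp
      thus ?thesis using lab[OF C kl(3)] by simp
     qed
     thus ?thesis using mem_gains_iff[OF xP kl] mem[OF kl] unfolding e by blast
    qed
    thus ?thesis by (rule triples_eqI[OF gain_closedD(1)[OF gains_closed[OF xP]] gx])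
   qed
   moreover have "coarsen (S, f2, P) z'" unfolding e2 S2 P'_def by (rule coarsen.merge[OF AB(1-3)])
   ultimately show ?thesis using xP by blast
  qed
  thus ?thesis using that[OF zP tz sub card] by blast
 next
  case False
  \<comment> \<open>Either both ends lie in one block with the wrong gain, or one end is already in
    the zero block; deleting \<open>A\<close> puts both there.\<close>
  obtain A where A: "A : P" "i : A & (j : A | j ~: S) | j : A & i ~: S" using nt(1) P(7) False by metis
  have ij: "i ~: S - A" "j ~: S - A" using A P(5)[OF A(1)] by auto
  define z where "z = (S - A, restrict f (S - A), P - {A})"
  have part': "partition_on (S - A) (P - {A})"
   using P(3) A(1) P(6)[OF _ A(1)] unfolding partition_on_def disjoint_def by blast
  have zP: "z : PP" unfolding z_def partial_partitions_def using P(1,4) part' by auto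
  note memz = mem_gains_iff[OF zP[unfolded z_def]]
  have tz: "t : gains z" unfolding te z_def memz[OF ig] using ij by blast
  have sub: "gains x <= gains z"
  proof (rule subsetI)
   fix u assume u: "u : gains x"
   obtain k h l where ue: "u = (k, h, l)" by (metis surj_pair)
   have kl: "k <= n" "l <= n" "h : carrier G" using u gx unfolding ue triples_def by auto
   consider "k ~: S" "l ~: S" | C where "C : P" "k : C" "l : C" "f k \<otimes> h = f l"
    using u mem[OF kl] unfolding ue e by blast
   thus "u : gains z"
   proof cases
    case 2
    show ?thesis
    proof (cases "C = A")
     case True
     thus ?thesis unfolding ue z_def memz[OF kl] using 2 by blast
    next
     case False
     hence "k : S - A" "l : S - A" using 2 P(5,6) A(1) by blast+
     thus ?thesis unfolding ue z_def memz[OF kl] using 2 False by auto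
    qed
   qed (unfold ue z_def memz[OF kl], blast)
  qed
  have card: "Suc (nblocks (gains z)) = nblocks (gains x)"
   using nblocks_gains[OF zP[unfolded z_def]] nblocks_gains[OF x[unfolded e]] card_Suc_Diff1[OF finP A(1)]
   unfolding z_def e by simp
  have "EX x':PP. gains x' = gains x & coarsen x' z'" if z': "z' : PP" "gains z' = gains z" for z'
  proof -
   obtain S2 f2 P2 where e2: "z' = (S2, f2, P2)" by (metis surj_pair)
   have S2: "S2 = S - A" "P2 = P - {A}"
    using supp_gains[OF z'(1)[unfolded e2]] supp_gains[OF zP[unfolded z_def]]
     blocks_gains[OF z'(1)[unfolded e2]] blocks_gains[OF zP[unfolded z_def]] z'(2) unfolding e2 z_def by auto
   note P2 = PP_D[OF z'(1)[unfolded e2 S2]]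
   \<comment> \<open>The labels of \<open>z'\<close> off \<open>A\<close> are kept; on the deleted
     block those of \<open>x\<close> are restored.\<close>
   define f3 where "f3 = (\<lambda>k\<in>S. if k : A then f k else f2 k)"
   have xP: "(S, f3, P) : PP" unfolding f3_def partial_partitions_def using P(1,3,4) P2(4) by auto
   have "gains (S, f3, P) = gains x"
   proof -
    have "(k, h, l) : gains (S, f3, P) <-> (k, h, l) : gains x" if tr: "(k, h, l) : triples" for k h l
    proof -
     have kl: "k <= n" "l <= n" "h : carrier G" using tr unfolding triples_def by auto
     have "f3 k \<otimes> h = f3 l <-> f k \<otimes> h = f l" if C: "C : P" "k : C" "l : C" for C
     proof (cases "C = A")
      case True
      thus ?thesis unfolding f3_def using C P(5)[OF C(1)] by auto
     next
      case False
      hence kS: "k : S - A" "l : S - A" using C P(5,6) A(1) by blast+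
      have C': "C : P - {A}" using C False by blast
      have same: "f'' k \<otimes> h = f'' l <-> (k, h, l) : gains (S - A, f'', P - {A})"
       if "(S - A, f'', P - {A}) : PP" for f''
       using mem_gains_iff[OF that kl] PP_D(5,6)[OF that] C' C by blast
      have "f2 k \<otimes> h = f2 l <-> restrict f (S - A) k \<otimes> h = restrict f (S - A) l"
       using same[of f2] same[of "restrict f (S - A)"] z' zP unfolding e2 S2 z_def by simp
      thus ?thesis unfolding f3_def using kS by simp
     qed
     thus ?thesis using mem_gains_iff[OF xP kl] mem[OF kl] unfolding e by blast
    qed
    thus ?thesis by (rule triples_eqI[OF gain_closedD(1)[OF gains_closed[OF xP]] gx])
   qed
   moreover have "restrict f3 (S - A) = f2"
    using P2(2) unfolding f3_def by (auto simp: PiE_def extensional_def fun_eq_iff)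
   hence "coarsen (S, f3, P) z'" unfolding e2 S2 using coarsen.delete[OF A(1), of S f3] by simp
   ultimately show ?thesis using xP by blast
  qed
  thus ?thesis using that[OF zP tz sub card] by blast
 qed
qed

section \<open>The Dowling lattice\<close>

text \<open>Within a block with base point \<open>i\<close>, the factor relating \<open>f\<close> to
  \<open>h\<close> can only be \<open>f i \<otimes> inv (h i)\<close>, and equal gains make it work
  for the whole block. So the gain set is a complete invariant of the class.\<close>

lemma partial_partition_rel_iff:
 "(x, y) : partial_partition_rel G n <-> x : PP & y : PP & gains x = gains y"
proof -
 obtain S f P where ex: "x = (S, f, P)" by (metis surj_pair)
 obtain T h Q where ey: "y = (T, h, Q)" by (metis surj_pair)
 show ?thesis
 proof
  assume "(x, y) : partial_partition_rel G n"
  hence xy: "(S, f, P) : PP" "(S, h, P) : PP" and eq: "S = T" "P = Q"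
   and lab: "ALL A:P. EX g:carrier G. ALL j:A. f j = g \<otimes> h j"
   unfolding partial_partition_rel_def ex ey by auto
  note P = PP_D[OF xy(1)] and P' = PP_D[OF xy(2)]
  have "(k, c, l) : gains (S, f, P) <-> (k, c, l) : gains (S, h, P)" if t: "(k, c, l) : triples" for k c l
  proof -
   have kl: "k <= n" "l <= n" "c : carrier G" using t unfolding triples_def by auto
   have "f k \<otimes> c = f l <-> h k \<otimes> c = h l" if A: "A : P" "k : A" "l : A" for A
   proof -
    obtain g where g: "g : carrier G" "ALL j:A. f j = g \<otimes> h j" using lab A by blast
    have "h k : carrier G" "h l : carrier G" using P'(4,5) A by blast+
    thus ?thesis using g A kl(3) by (simp add: m_assoc)
   qed
   thus ?thesis using mem_gains_iff[OF xy(1) kl] mem_gains_iff[OF xy(2) kl] by blast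
  qed
  hence "gains (S, f, P) = gains (S, h, P)"
   by (rule triples_eqI[OF gain_closedD(1)[OF gains_closed[OF xy(1)]] gain_closedD(1)[OF gains_closed[OF xy(2)]]])
  thus "x : PP & y : PP & gains x = gains y" using xy eq unfolding ex ey by simp
 next
  assume "x : PP & y : PP & gains x = gains y"
  hence x: "(S, f, P) : PP" and y: "(T, h, Q) : PP" and g: "gains (S, f, P) = gains (T, h, Q)"
   unfolding ex ey by auto
  have eq: "S = T" "P = Q"
   using supp_gains[OF x] supp_gains[OF y] blocks_gains[OF x] blocks_gains[OF y] g by auto
  note P = PP_D[OF x] and Q = PP_D[OF y]
  have "EX c:carrier G. ALL j:A. f j = c \<otimes> h j" if A: "A : P" for A
  proof -
   obtain i where i: "i : A" using P(3) A unfolding partition_on_def by fastforce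
   have iS: "i : S" using P(5) A i by blast
   have fi: "f i : carrier G" "h i : carrier G" using P(4) Q(4) iS eq by auto
   have "f j = f i \<otimes> inv (h i) \<otimes> h j" if j: "j : A" for j
   proof -
    have "j : block (gains (S, f, P)) i" using block_gains[OF x A i] j by simp
    then obtain c where c: "(i, c, j) : gains (S, f, P)" unfolding block_def by blast
    have cc: "c : carrier G" using gain_triple(2)[OF gains_closed[OF x] c] .
    have "f i \<otimes> c = f j" "h i \<otimes> c = h j"
     using gain_label[OF x iS c] gain_label[OF y _ c[unfolded g]] iS eq by auto
    moreover have "inv (h i) \<otimes> (h i \<otimes> c) = c" using fi cc by (simp add: m_assoc[symmetric])
    hence "f i \<otimes> inv (h i) \<otimes> (h i \<otimes> c) = f i \<otimes> c" using fi cc by (simp add: m_assoc)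
    ultimately show ?thesis by simp
   qed
   thus ?thesis using fi by blast
  qed
  thus "(x, y) : partial_partition_rel G n" unfolding partial_partition_rel_def ex ey using x y eq by auto
 qed
qed

definition cls :: "'g gains => 'g dowling_class" where
 "cls D = {x : PP. gains x = D}"

lemma rel_class: "x : PP ==> partial_partition_rel G n `` {x} = cls (gains x)" unfolding cls_def
 by (rule Set.set_eqI) (auto simp only: Image_singleton_iff partial_partition_rel_iff mem_Collect_eq)

lemma dowling_classes_eq: "dowling_classes G n = cls ` {D. gain_closed D}"
proof -
 have "dowling_classes G n = (%x. cls (gains x)) ` PP"
  unfolding dowling_classes_def quotient_def using rel_class by auto
 also have "... = cls ` gains ` PP" by auto
 also have "gains ` PP = {D. gain_closed D}"
  using gains_closed gain_realizable by (metis (no_types, lifting) imageE image_eqI mem_Collect_eq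
    subset_antisym subsetI)
 finally show ?thesis .
qed

lemma cls_inj: "gain_closed D ==> cls D = cls D' ==> D = D'"
proof -
 assume D: "gain_closed D" and e: "cls D = cls D'"
 obtain x where "x : PP" "gains x = D" using gain_realizable[OF D] .
 hence "x : cls D" unfolding cls_def by simp
 hence "x : cls D'" by (simp only: e)
 thus "D = D'" unfolding cls_def using \<open>gains x = D\<close> by simp
qed

lemma coarsen_gains:
 assumes "coarsen x y" "x : PP"
 shows "y : PP & gains x <= gains y" using assms
proof (induction rule: coarsen.induct)
 case (merge A P B S f)
 note P = PP_D[OF merge(4)]
 let ?P = "insert (A Un B) (P - {A, B})"
 have "partition_on S ?P" by (rule partition_on_merge[OF P(3) merge(1,2)])
 hence y: "(S, f, ?P) : PP" unfolding partial_partitions_def using P(1,2) by simp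
 from gains_coarser[OF merge(4) y merge_coarser]
 show ?case using y by blast
next
 case (delete A P S f)
 note P = PP_D[OF delete(2)]
 have "partition_on (S - A) (P - {A})"
  using P(3) delete(1) P(6)[OF _ delete(1)] unfolding partition_on_def disjoint_def by blast
 hence y: "(S - A, restrict f (S - A), P - {A}) : PP" unfolding partial_partitions_def using P(1,4) by auto
 have "u : gains (S - A, restrict f (S - A), P - {A})" if u: "u : gains (S, f, P)" for u
 proof -
  obtain k h l where ue: "u = (k, h, l)" by (metis surj_pair)
  have kl: "k <= n" "l <= n" "h : carrier G"
   using gain_triple[OF gains_closed[OF delete(2)] u[unfolded ue]] by auto
  consider "k ~: S" "l ~: S" | C where "C : P" "k : C" "l : C" "f k \<otimes> h = f l"
   using u mem_gains_iff[OF delete(2) kl] unfolding ue by blast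
  thus ?thesis
  proof cases
   case 1
   thus ?thesis unfolding ue mem_gains_iff[OF y kl] by blast
  next
   case 2
   show ?thesis
   proof (cases "C = A")
    case True
    thus ?thesis unfolding ue mem_gains_iff[OF y kl] using 2 by blast
   next
    case False
    hence "k : S - A" "l : S - A" using 2 P(5,6) delete(1) by blast+
    thus ?thesis unfolding ue mem_gains_iff[OF y kl] using 2 False by auto
   qed
  qed
 qed
 thus ?case using y by blast
qed

lemma coarsen_rtrancl_gains: "coarsen\<^sup>*\<^sup>* x y ==> x : PP ==> y : PP & gains x <= gains y"
 by (induction rule: rtranclp_induct) (auto dest: coarsen_gains)

text \<open>One covering step towards \<open>y\<close> is made at a time, and the chain from the
  cover is prolonged backwards by the lifting property. The start is therefore prescribed only up to
  equivalence.\<close>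

lemma coarsen_realizable:
 "x : PP ==> y : PP ==> gains x <= gains y ==> EX x':PP. gains x' = gains x & coarsen\<^sup>*\<^sup>* x' y"
proof (induction "nblocks (gains x)" arbitrary: x rule: less_induct)
 case less
 show ?case
 proof (cases "gains x = gains y")
  case True
  thus ?thesis using less.prems by auto
 next
  case False
  then obtain t where t: "t : gains y" "t ~: gains x" using less.prems(3) by blast
  have tt: "t : triples" using t(1) gain_closedD(1)[OF gains_closed[OF less.prems(2)]] by blast
  obtain z where z: "z : PP" "t : gains z" "gains x <= gains z" "Suc (nblocks (gains z)) = nblocks (gains x)"
   and lift: "!!z'. z' : PP ==> gains z' = gains z ==> EX x':PP. gains x' = gains x & coarsen x' z'"
   using gain_cover[OF less.prems(1) tt t(2)] by blast
  note gc = gains_closed[OF less.prems(1)] gains_closed[OF less.prems(2)] gains_closed[OF z(1)]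
  note ic = gain_closed_Int[OF gc(3,2)]
  \<comment> \<open>The intersection lies between \<open>gains x\<close> and its cover
    \<open>gains z\<close> and contains \<open>t\<close>; since the number of blocks drops by just
    one, it must be \<open>gains z\<close>.\<close>
  have "nblocks (gains z Int gains y) ~= nblocks (gains x)"
  proof
   assume "nblocks (gains z Int gains y) = nblocks (gains x)"
   from nblocks_mono(2)[OF gc(1) ic _ this] have "gains x = gains z Int gains y"
    using z(3) less.prems(3) by blast
   thus False using z(2) t by blast
  qed
  hence "nblocks (gains z Int gains y) < nblocks (gains x)"
   using nblocks_mono(1)[OF gc(1) ic Int_greatest[OF z(3) less.prems(3)]] by simp
  moreover have "nblocks (gains z) <= nblocks (gains z Int gains y)" by (rule nblocks_mono(1)[OF ic gc(3) Int_lower1])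
  ultimately have "nblocks (gains z) = nblocks (gains z Int gains y)" using z(4) by simp
  hence "gains z Int gains y = gains z" by (rule nblocks_mono(2)[OF ic gc(3) Int_lower1])
  hence "gains z <= gains y" by blast
  then obtain z' where z': "z' : PP" "gains z' = gains z" "coarsen\<^sup>*\<^sup>* z' y"
   using less.hyps[of z] z(1,4) less.prems(2) by auto
  then obtain x' where "x' : PP" "gains x' = gains x" "coarsen x' z'" using lift by blast
  thus ?thesis using converse_rtranclp_into_rtranclp[of coarsen x' z' y] z'(3) by blast
 qed
qed

lemma dowling_le_iff:
 assumes D: "gain_closed D" and D': "gain_closed D'"
 shows "dowling_le (cls D) (cls D') <-> D <= D'"
proof
 assume "dowling_le (cls D) (cls D')"
 then obtain x y where "x : cls D" "y : cls D'" "coarsen\<^sup>*\<^sup>* x y" unfolding dowling_le_def by blast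
 thus "D <= D'" using coarsen_rtrancl_gains[of x y] unfolding cls_def by auto
next
 assume s: "D <= D'"
 obtain x where x: "x : PP" "gains x = D" using gain_realizable[OF D] .
 obtain y where y: "y : PP" "gains y = D'" using gain_realizable[OF D'] .
 obtain x' where "x' : PP" "gains x' = gains x" "coarsen\<^sup>*\<^sup>* x' y"
  using coarsen_realizable[OF x(1) y(1)] s x y by auto
 moreover from this have "x' : cls D" "y : cls D'" using x y by (simp_all add: cls_def)
 ultimately show "dowling_le (cls D) (cls D')" unfolding dowling_le_def by blast
qed

end

section \<open>The Dowling geometry\<close>

context dowling
begin

lemma finite_triples: "finite triples" unfolding triples_def using finite_G by simp

text \<open>The class with \<open>n\<close> singleton blocks; only \<open>0\<close> is in the zero
  block.\<close>

definition bot_gains :: "'g gains" where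
 "bot_gains = {(i, \<one>, i) |i. i <= n} Un {(0, g, 0) |g. g : carrier G}"

lemma bot_gains_closed: "gain_closed bot_gains"
 unfolding gain_closed_def bot_gains_def triples_def by (intro conjI allI ballI impI) auto

lemma bot_gains_least: "gain_closed D ==> bot_gains <= D"
 unfolding bot_gains_def using gain_closedD(2) gain_closedD(6)[of D 0 \<one>] by auto

lemma nblocks_bot: "nblocks bot_gains = n"
proof -
 have "supp bot_gains = {1..n}" unfolding supp_def bot_gains_def by auto
 moreover have "block bot_gains i = {i}" if "i : {1..n}" for i
  unfolding block_def bot_gains_def using that by auto
 ultimately have "block bot_gains ` supp bot_gains = (%i. {i}) ` {1..n}" by auto
 thus ?thesis unfolding nblocks_def by (simp add: card_image)
qed

lemma triples_closed: "gain_closed triples" unfolding gain_closed_def triples_def by auto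

lemma nblocks_zero_iff:
 assumes D: "gain_closed D"
 shows "nblocks D = 0 <-> D = triples"
proof
 assume "nblocks D = 0"
 hence "supp D = {}" unfolding nblocks_def using finite_supp by simp
 hence "t : D" if "t : triples" for t using that not_supp_gain[OF D] unfolding triples_def by (cases t) auto
 thus "D = triples" using gain_closedD(1)[OF D] by blast
next
 assume "D = triples"
 hence "supp D = {}" unfolding supp_def triples_def by auto
 thus "nblocks D = 0" unfolding nblocks_def by simp
qed

lemma nblocks_le: "gain_closed D ==> nblocks D <= n"
 using nblocks_mono(1)[OF bot_gains_closed _ bot_gains_least] nblocks_bot by simp

lemma nblocks_n_iff: "gain_closed D ==> nblocks D = n ==> D = bot_gains"
 using nblocks_mono(2)[OF bot_gains_closed _ bot_gains_least] nblocks_bot by simp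

lemma gain_closed_cover:
 assumes D: "gain_closed D" and t: "t : triples" "t ~: D"
 obtains D' where "gain_closed D'" "D <= D'" "t : D'" "Suc (nblocks D') = nblocks D"
proof -
 obtain x where x: "x : PP" "gains x = D" using gain_realizable[OF D] .
 obtain z where "z : PP" "t : gains z" "gains x <= gains z" "Suc (nblocks (gains z)) = nblocks (gains x)"
  using gain_cover[OF x(1) t(1)] t(2) x(2) by metis
 thus ?thesis using that[of "gains z"] gains_closed[of z] x(2) by simp
qed

definition atomic :: "'g gains => bool" where
 "atomic D <-> gain_closed D & Suc (nblocks D) = n"

text \<open>The lattice is atomistic, even triple by triple. The cover of the bottom given by
  \<open>t\<close> is intersected with \<open>D\<close>; the intersection contains \<open>t\<close>,
  so it is not the bottom and must be the whole atom.\<close>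

lemma atomic_above:
 assumes D: "gain_closed D" and t: "t : D" "t ~: bot_gains"
 obtains B where "atomic B" "B <= D" "t : B"
proof -
 have "t : triples" using gain_closedD(1)[OF D] t(1) by blast
 then obtain B where B: "gain_closed B" "bot_gains <= B" "t : B" "Suc (nblocks B) = nblocks bot_gains"
  using gain_closed_cover[OF bot_gains_closed _ t(2)] by blast
 note ic = gain_closed_Int[OF B(1) D]
 have "nblocks (B Int D) ~= n" using nblocks_n_iff[OF ic] t B(3) by blast
 hence "nblocks (B Int D) < n" using nblocks_le[OF ic] by simp
 moreover have "nblocks B <= nblocks (B Int D)" by (rule nblocks_mono(1)[OF ic B(1) Int_lower1])
 ultimately have "nblocks B = nblocks (B Int D)" using B(4) nblocks_bot by simp
 hence "B Int D = B" by (rule nblocks_mono(2)[OF ic B(1) Int_lower1])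
 thus ?thesis using that[of B] B nblocks_bot unfolding atomic_def by auto
qed

lemma dowling_atoms_eq: "dowling_atoms G n = cls ` {D. atomic D}"
proof (intro Set.set_eqI iffI)
 fix X assume X: "X : dowling_atoms G n"
 then obtain Z where Zs: "X : dowling_classes G n" "Z : dowling_classes G n"
  "(ALL Y:dowling_classes G n. dowling_le Z Y) & X ~= Z \<and>
   (ALL Y:dowling_classes G n. dowling_le Y X --> Y = Z | Y = X)" unfolding dowling_atoms_def by blast
 have Z: "X : dowling_classes G n" "Z : dowling_classes G n"
  "!!Y. Y : dowling_classes G n ==> dowling_le Z Y" "X ~= Z"
  "!!Y. Y : dowling_classes G n ==> dowling_le Y X ==> Y = Z | Y = X" using Zs by simp_all
 obtain D where D: "gain_closed D" "X = cls D" using Z(1) unfolding dowling_classes_eq by blast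
 obtain D0 where D0: "gain_closed D0" "Z = cls D0" using Z(2) unfolding dowling_classes_eq by blast
 have "dowling_le Z (cls bot_gains)" using Z(3) bot_gains_closed unfolding dowling_classes_eq by blast
 hence "D0 <= bot_gains" using dowling_le_iff[OF D0(1) bot_gains_closed] D0(2) by simp
 hence D0b: "D0 = bot_gains" using bot_gains_least[OF D0(1)] by blast
 have "D ~= bot_gains" using Z(4) D D0 D0b by blast
 then obtain t where "t : D" "t ~: bot_gains" using bot_gains_least[OF D(1)] by blast
 then obtain B where B: "atomic B" "B <= D" "t : B" using atomic_above[OF D(1)] by blast
 have Bc: "gain_closed B" using B(1) unfolding atomic_def by blast
 have "dowling_le (cls B) X" using dowling_le_iff[OF Bc D(1)] B(2) D(2) by simp
 hence "cls B = Z | cls B = X" using Z(5) Bc unfolding dowling_classes_eq by blast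
 moreover have "cls B ~= Z"
 proof
  assume "cls B = Z"
  hence "B = bot_gains" using cls_inj[OF Bc] D0 D0b by simp
  thus False using B(3) \<open>t ~: bot_gains\<close> by simp
 qed
 ultimately show "X : cls ` {D. atomic D}" using B(1) by blast
next
 fix X assume "X : cls ` {D. atomic D}"
 then obtain D where D: "gain_closed D" "Suc (nblocks D) = n" "X = cls D" unfolding atomic_def by blast
 have "X ~= cls bot_gains" using cls_inj[OF D(1)] D nblocks_bot by fastforce
 moreover have "dowling_le (cls bot_gains) Y" if "Y : dowling_classes G n" for Y
  using that dowling_le_iff[OF bot_gains_closed] bot_gains_least unfolding dowling_classes_eq by auto
 moreover have "Y = cls bot_gains | Y = X" if Y: "Y : dowling_classes G n" "dowling_le Y X" for Y
 proof -
  obtain D' where D': "gain_closed D'" "Y = cls D'" using Y(1) unfolding dowling_classes_eq by blast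
  have s: "D' <= D" using dowling_le_iff[OF D'(1) D(1)] Y(2) D'(2) D(3) by simp
  show ?thesis
  proof (cases "nblocks D' = n")
   case True
   thus ?thesis using nblocks_n_iff[OF D'(1)] D'(2) by simp
  next
   case False
   hence "nblocks D = nblocks D'" using nblocks_le[OF D'(1)] nblocks_mono(1)[OF D'(1) D(1) s] D(2) by simp
   hence "D' = D" by (rule nblocks_mono(2)[OF D'(1) D(1) s])
   thus ?thesis using D D' by simp
  qed
 qed
 ultimately show "X : dowling_atoms G n"
  unfolding dowling_atoms_def using D(1,3) bot_gains_closed unfolding dowling_classes_eq by blast
qed

definition atset :: "'g gains => 'g dowling_class set" where
 "atset D = cls ` {B. atomic B & B <= D}"

lemma at_eq: "gain_closed D ==> {A : dowling_atoms G n. dowling_le A (cls D)} = atset D"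
 unfolding dowling_atoms_eq atset_def using dowling_le_iff unfolding atomic_def by auto

lemma at_subset_iff:
 assumes D: "gain_closed D" and D': "gain_closed D'"
 shows "atset D <= atset D' <-> D <= D'"
proof
 assume s: "atset D <= atset D'"
 show "D <= D'"
 proof
  fix t assume t: "t : D"
  show "t : D'"
  proof (cases "t : bot_gains")
   case False
   then obtain B where B: "atomic B" "B <= D" "t : B" using atomic_above[OF D t] by blast
   hence "cls B : atset D'" using s unfolding atset_def by blast
   then obtain B' where "atomic B'" "B' <= D'" "cls B = cls B'" unfolding atset_def by blast
   hence "B <= D'" using cls_inj[of B B'] B(1) unfolding atomic_def by blast
   thus ?thesis using B(3) by blast
  qed (use bot_gains_least[OF D'] in blast)
 qed
qed (auto simp: atset_def)

lemma at_inj: "gain_closed D ==> gain_closed D' ==> atset D = atset D' ==> D = D'"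
 using at_subset_iff by (metis subset_antisym order_refl)

lemma at_Int:
 assumes "gain_closed D" "gain_closed D'"
 shows "atset D Int atset D' = atset (D Int D')"
proof
 show "atset D Int atset D' <= atset (D Int D')"
 proof
  fix A assume "A : atset D Int atset D'"
  then obtain B B' where B: "atomic B" "B <= D" "A = cls B" "atomic B'" "B' <= D'" "A = cls B'"
   unfolding atset_def by blast
  hence "B = B'" using cls_inj[of B B'] unfolding atomic_def by simp
  thus "A : atset (D Int D')" unfolding atset_def using B by blast
 qed
qed (auto simp: atset_def)

lemma at_bot: "atset bot_gains = {}"
proof -
 have "False" if B: "atomic B" "B <= bot_gains" for B
 proof -
  have "B = bot_gains" using bot_gains_least B unfolding atomic_def by blast
  thus False using B(1) nblocks_bot unfolding atomic_def by simp
 qed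
 thus ?thesis unfolding atset_def by blast
qed

lemma at_atomic: "atomic B ==> atset B = {cls B}"
proof -
 assume B: "atomic B"
 have "B' = B" if "atomic B'" "B' <= B" for B'
  using nblocks_mono(2)[of B' B] that B unfolding atomic_def by auto
 thus ?thesis unfolding atset_def using B by blast
qed

lemma at_triples: "atset triples = dowling_atoms G n"
 unfolding atset_def dowling_atoms_eq atomic_def using gain_closedD(1) by blast

lemma finite_atoms: "finite (dowling_atoms G n)"
proof -
 have "{D. atomic D} <= Pow triples" unfolding atomic_def using gain_closedD(1) by blast
 thus ?thesis unfolding dowling_atoms_eq using finite_triples finite_subset by blast
qed

lemma at_cover:
 assumes D: "gain_closed D" and e: "e : dowling_atoms G n" "e ~: atset D"
 obtains D' where "gain_closed D'" "insert e (atset D) <= atset D'" "Suc (nblocks D') = nblocks D"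
proof -
 obtain B where B: "atomic B" "e = cls B" using e(1) unfolding dowling_atoms_eq by blast
 have Bc: "gain_closed B" using B(1) unfolding atomic_def by blast
 have "B ~= bot_gains" using B(1) nblocks_bot unfolding atomic_def by auto
 then obtain t where t: "t : B" "t ~: bot_gains" using bot_gains_least[OF Bc] by blast
 \<comment> \<open>An atom is generated by any of its triples beyond the bottom, so a cover of
   \<open>D\<close> containing \<open>t\<close> contains all of \<open>B\<close>.\<close>
 have least: "B <= D'" if D': "gain_closed D'" "t : D'" for D'
 proof -
  obtain B' where B': "atomic B'" "B' <= D' Int B" "t : B'"
   using atomic_above[OF gain_closed_Int[OF D'(1) Bc], of t] t D'(2) by blast
  hence "B' = B" using nblocks_mono(2)[of B' B] B(1) unfolding atomic_def by auto
  thus ?thesis using B'(2) by blast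
 qed
 have "t ~: D"
 proof
  assume "t : D"
  hence "B <= D" using least[OF D] by blast
  thus False using e(2) B unfolding atset_def by blast
 qed
 moreover have "t : triples" using t(1) gain_closedD(1)[OF Bc] by blast
 ultimately obtain D' where D': "gain_closed D'" "D <= D'" "t : D'" "Suc (nblocks D') = nblocks D"
  using gain_closed_cover[OF D] by blast
 have "insert e (atset D) <= atset D'"
  using at_subset_iff[OF D D'(1)] D'(2) least[OF D'(1,3)] B unfolding atset_def by blast
 thus ?thesis using that D' by blast
qed

abbreviation "Q \<equiv> dowling_geometry G n"

text \<open>\<open>matroid_of_flats\<close> is applied to the sets \<open>atset D\<close>, ranked by
  \<open>n\<close> minus the number of blocks; \<open>matroid_determined_by_flats\<close> identifies
  the result with the definite description.\<close>

lemma Q_spec: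
 "is_matroid Q" "simple_matroid Q" "ground Q = dowling_atoms G n" "flats Q = atset ` {D. gain_closed D}"
 "gain_closed D ==> rank_of Q (atset D) + nblocks D = n"
proof -
 let ?E = "dowling_atoms G n" and ?F = "atset ` {D. gain_closed D}"
 define rho where "rho F = n - nblocks (THE D. gain_closed D & atset D = F)" for F
 have rho: "rho (atset D) = n - nblocks D" if "gain_closed D" for D
 proof -
  have "(THE D'. gain_closed D' & atset D' = atset D) = D" using that at_inj by (intro the_equality) auto
  thus ?thesis unfolding rho_def by simp
 qed
 have fam: "(%X. {A : ?E. dowling_le A X}) ` dowling_classes G n = ?F"
  unfolding dowling_classes_eq image_image using at_eq by (intro image_cong) auto
 obtain M where M: "is_matroid M" "ground M = ?E" "flats M = ?F" "!!F. F : ?F ==> rank_of M F = rho F"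
 proof (rule matroid_of_flats[of ?E ?F rho])
  show "finite ?E" by (rule finite_atoms)
  show "F <= ?E" if "F : ?F" for F using that unfolding atset_def dowling_atoms_eq by auto
  show "?E : ?F" using at_triples triples_closed by blast
  show "F Int F' : ?F" if FF: "F : ?F" "F' : ?F" for F F'
  proof -
   obtain D D' where "gain_closed D" "gain_closed D'" "F = atset D" "F' = atset D'" using FF by blast
   thus ?thesis using at_Int[of D D'] gain_closed_Int[of D D'] by blast
  qed
  show "rho F < rho F'" if FF: "F : ?F" "F' : ?F" "F < F'" for F F'
  proof -
   obtain D D' where D: "gain_closed D" "gain_closed D'" "F = atset D" "F' = atset D'" using FF by blast
   hence s: "D <= D'" "D ~= D'" using at_subset_iff[OF D(1,2)] FF(3) by auto
   have "nblocks D' ~= nblocks D" using nblocks_mono(2)[OF D(1,2) s(1)] s(2) by blast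
   hence "nblocks D' < nblocks D" using nblocks_mono(1)[OF D(1,2) s(1)] by simp
   thus ?thesis unfolding D(3,4) rho[OF D(1)] rho[OF D(2)] using nblocks_le[OF D(1)] by simp
  qed
  show "EX F':?F. insert e F <= F' & rho F' = Suc (rho F)" if Fe: "F : ?F" "e : ?E" "e ~: F" for F e
  proof -
   obtain D where D: "gain_closed D" "F = atset D" using Fe(1) by blast
   obtain D' where D': "gain_closed D'" "insert e (atset D) <= atset D'" "Suc (nblocks D') = nblocks D"
    using at_cover[OF D(1) Fe(2)] Fe(3) D(2) by blast
   have "rho (atset D') = Suc (rho (atset D))" unfolding rho[OF D(1)] rho[OF D'(1)] using D'(3) nblocks_le[OF D(1)] by linarith
   thus ?thesis using D'(1,2) D(2) by blast
  qed
  show "{} : ?F" using at_bot bot_gains_closed by blast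
  show "rho {} = 0" using rho[OF bot_gains_closed] at_bot nblocks_bot by simp
 qed blast
 have rk: "rank_of M (atset D) = n - nblocks D" if "gain_closed D" for D
  using M(4)[of "atset D"] rho[OF that] that by auto
 have "{e, f} : indeps M" if ef: "e : ground M" "f : ground M" for e f
 proof -
  obtain B where B: "atomic B" "e = cls B" using ef(1) M(2) unfolding dowling_atoms_eq by blast
  have Bc: "gain_closed B" "Suc (nblocks B) = n" using B(1) unfolding atomic_def by auto
  have eF: "{e} : flats M" using at_atomic[OF B(1)] B(2) M(3) Bc(1) by (metis image_eqI mem_Collect_eq)
  have r1: "rank_of M {e} = 1" using rk[OF Bc(1)] at_atomic[OF B(1)] B(2) Bc(2) by simp
  show ?thesis
  proof (cases "e = f")
   case True
   thus ?thesis using r1 indep_iff_rank[OF M(1), of "{e}"] by simp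
  next
   case False
   hence "rank_of M {e} < rank_of M (insert f {e})" using eF ef(2) unfolding flats_def by blast
   hence "2 <= rank_of M {e, f}" using r1 by (simp add: insert_commute)
   hence "rank_of M {e, f} = card {e, f}" using rank_le_card[OF M(1), of "{e, f}"] False by simp
   thus ?thesis using indep_iff_rank[OF M(1), of "{e, f}"] by simp
  qed
 qed
 hence simple: "simple_matroid M" unfolding simple_matroid_iff[OF M(1)] by blast
 have QM: "Q = M" unfolding dowling_geometry_def
 proof (rule the_equality)
  show "is_matroid M & simple_matroid M & ground M = ?E \<and>
    flats M = (%X. {A : ?E. dowling_le A X}) ` dowling_classes G n" using M(1,2,3) simple fam by simp
 next
  fix N assume "is_matroid N & simple_matroid N & ground N = ?E \<and>
    flats N = (%X. {A : ?E. dowling_le A X}) ` dowling_classes G n"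
  thus "N = M" using matroid_determined_by_flats[of N M] M(1,2,3) fam by simp
 qed
 show "is_matroid Q" "simple_matroid Q" "ground Q = ?E" "flats Q = ?F" using M simple QM by auto
 show "gain_closed D ==> rank_of Q (atset D) + nblocks D = n" using rk[of D] nblocks_le[of D] QM by simp
qed

section \<open>The action of the wreath product\<close>

abbreviation "W \<equiv> W_group G n"

lemma W_iff: "(g, sg, phi) : carrier W <->
  g : {1..n} \<rightarrow>\<^sub>E carrier G & sg permutes {1..n} & phi : hom G G & phi : Bij (carrier G)"
 unfolding W_group_def AutoGroup_def auto_def by (auto simp: sym_group_def)

text \<open>Read off from labels: the new label at \<open>sg i\<close> is
  \<open>phi (f i) \<otimes> g i\<close>, so a gain \<open>a\<close> from \<open>i\<close> to
  \<open>j\<close> becomes \<open>inv (g i) \<otimes> phi a \<otimes> g j\<close>. The point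
  \<open>0\<close> has no entry in \<open>g\<close> and gets \<open>\<one>\<close>.\<close>

definition tact :: "'g wreath => nat \<times> 'g \<times> nat => nat \<times> 'g \<times> nat" where
 "tact = (%(g, sg, phi) (i, a, j).
   (sg i, inv (if i = 0 then \<one> else g i) \<otimes> phi a \<otimes> (if j = 0 then \<one> else g j), sg j))"

end

locale wreath_element = dowling G n for G :: "('g, 'b) monoid_scheme" (structure) and n +
 fixes g :: "nat => 'g" and sg :: "nat => nat" and phi :: "'g => 'g"
 assumes w: "(g, sg, phi) : carrier (W_group G n)"
begin

abbreviation "wr \<equiv> (g, sg, phi)"

definition gx :: "nat => 'g" where "gx i = (if i = 0 then \<one> else g i)"

lemma perm: "sg permutes {1..n}" and hom_phi: "phi : hom G G" and Bij_phi: "phi : Bij (carrier G)"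
 and g_fun: "g : {1..n} \<rightarrow>\<^sub>E carrier G" using w unfolding W_iff by auto

lemma g_closed: "i : {1..n} ==> g i : carrier G" using g_fun by auto

lemma gx_closed: "i <= n ==> gx i : carrier G" unfolding gx_def using g_closed[of i] by auto

lemma sigma_zero: "sg 0 = 0" using perm by (simp add: permutes_def)

lemma sigma_le: "i <= n ==> sg i <= n"
 using permutes_in_image[OF perm, of i] sigma_zero by (cases "i = 0") auto

lemma sigma_inj: "sg i = sg j <-> i = j" using permutes_inj[OF perm] by (auto dest: injD)

lemma sigma_inv: "inv_into UNIV sg (sg i) = i" using permutes_inverses(2)[OF perm] .

lemma phi_closed: "a : carrier G ==> phi a : carrier G"
 and phi_mult: "a : carrier G ==> b : carrier G ==> phi (a \<otimes> b) = phi a \<otimes> phi b"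
 using hom_phi by (auto simp: hom_def)

lemma phi_inj: "a : carrier G ==> b : carrier G ==> phi a = phi b <-> a = b"
 using Bij_phi by (auto simp: Bij_def bij_betw_def inj_on_eq_iff)

lemma phi_one: "phi \<one> = \<one>" using phi_mult[of \<one> \<one>] phi_closed[of \<one>] by simp

lemma tact_eq: "tact wr (i, a, j) = (sg i, inv (gx i) \<otimes> phi a \<otimes> gx j, sg j)"
 unfolding tact_def gx_def by simp

lemma tact_triples: "t : triples ==> tact wr t : triples"
 using sigma_le gx_closed phi_closed by (cases t) (auto simp: tact_eq triples_def)

lemma tact_inj: "inj_on (tact wr) triples"
proof (rule inj_onI)
 fix s t assume s: "s : triples" and t: "t : triples" and e: "tact wr s = tact wr t"
 obtain i a j where s': "s = (i, a, j)" by (metis surj_pair)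
 obtain k b l where t': "t = (k, b, l)" by (metis surj_pair)
 have ij: "k = i" "l = j" using e unfolding s' t' tact_eq by (auto simp: sigma_inj)
 have c: "a : carrier G" "b : carrier G" "i <= n" "j <= n" using s t unfolding s' t' triples_def by auto
 have "inv (gx i) \<otimes> phi a \<otimes> gx j = inv (gx i) \<otimes> phi b \<otimes> gx j" using e ij unfolding s' t' tact_eq by simp
 hence "phi a = phi b" using c gx_closed phi_closed by (simp add: m_assoc)
 thus "s = t" unfolding s' t' ij using phi_inj c by simp
qed

lemma tact_surj: "tact wr ` triples = triples"
 by (rule endo_inj_surj[OF finite_triples _ tact_inj]) (use tact_triples in blast)

lemma label_act_eq: "k : S ==> label_act G wr S f (sg k) = phi (f k) \<otimes> g k"
 unfolding label_act_def by (simp add: sigma_inv)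

lemma label_gain_iff:
 assumes "k : {1..n}" "l : {1..n}" "a : carrier G" "u : carrier G" "v : carrier G"
 shows "phi u \<otimes> g k \<otimes> (inv (gx k) \<otimes> phi a \<otimes> gx l) = phi v \<otimes> g l <-> u \<otimes> a = v"
proof -
 have e: "gx k = g k" "gx l = g l" unfolding gx_def using assms by auto
 have c: "g k : carrier G" "g l : carrier G" using g_closed assms by auto
 have "g k \<otimes> (inv (g k) \<otimes> (phi a \<otimes> g l)) = phi a \<otimes> g l"
  using c phi_closed[OF assms(3)] by (simp add: m_assoc[symmetric])
 hence "phi u \<otimes> g k \<otimes> (inv (g k) \<otimes> phi a \<otimes> g l) = phi (u \<otimes> a) \<otimes> g l"
  using c assms phi_closed phi_mult by (simp add: m_assoc)
 thus ?thesis unfolding e using c assms phi_closed phi_inj by simp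
qed

lemma label_act_closed:
 assumes "S <= {1..n}" "f : S \<rightarrow>\<^sub>E carrier G"
 shows "label_act G wr S f : sg ` S \<rightarrow>\<^sub>E carrier G"
proof
 fix i assume "i : sg ` S"
 then obtain k where k: "k : S" "i = sg k" by blast
 show "label_act G wr S f i : carrier G"
  unfolding k(2) label_act_eq[OF k(1)] using assms k(1) by (intro m_closed phi_closed g_closed) auto
qed (simp add: label_act_def)

lemma act_gains:
 assumes x: "x : PP"
 shows "partial_partition_act G wr x : PP" "gains (partial_partition_act G wr x) = tact wr ` gains x"
proof -
 obtain S f P where e: "x = (S, f, P)" by (metis surj_pair)
 note P = PP_D[OF x[unfolded e]]
 let ?f = "label_act G wr S f"
 have y: "partial_partition_act G wr x = (sg ` S, ?f, (`) sg ` P)"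
  unfolding partial_partition_act_def e by simp
 have inj: "inj_on sg S" using permutes_inj[OF perm] inj_on_subset by blast
 have "partition_on (sg ` S) ((`) sg ` P)" unfolding partition_on_def disjoint_def
 proof (intro conjI ballI impI)
  show "\<Union> ((`) sg ` P) = sg ` S" using P(3) unfolding partition_on_def by blast
  show "{} ~: (`) sg ` P" using P(3) unfolding partition_on_def by blast
  fix A B assume "A : (`) sg ` P" "B : (`) sg ` P" "A ~= B"
  then obtain A' B' where AB: "A' : P" "B' : P" "A = sg ` A'" "B = sg ` B'" "A' ~= B'" by blast
  have "A' Int B' = {}" using P(6)[OF AB(1,2)] AB(5) by blast
  thus "A Int B = {}" unfolding AB(3,4) by (auto simp: sigma_inj)
 qed
 moreover have "sg ` S <= {1..n}" using P(1) permutes_image[OF perm] by blast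
 ultimately have yP: "(sg ` S, ?f, (`) sg ` P) : PP"
  unfolding partial_partitions_def using label_act_closed[OF P(1,2)] by simp
 thus "partial_partition_act G wr x : PP" unfolding y .
 have "tact wr t : gains (sg ` S, ?f, (`) sg ` P) <-> t : gains x" if t: "t : triples" for t
 proof -
  obtain i a j where te: "t = (i, a, j)" by (metis surj_pair)
  have c: "i <= n" "j <= n" "a : carrier G" using t unfolding te triples_def by auto
  have tc: "sg i <= n" "sg j <= n" "inv (gx i) \<otimes> phi a \<otimes> gx j : carrier G"
   using sigma_le c gx_closed phi_closed by auto
  have im: "sg k : sg ` C <-> k : C" for k C by (auto simp: sigma_inj)
  have lab: "?f (sg i) \<otimes> (inv (gx i) \<otimes> phi a \<otimes> gx j) = ?f (sg j) <-> f i \<otimes> a = f j"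
   if A: "A : P" "i : A" "j : A" for A
  proof -
   have S: "i : S" "j : S" using P(5)[OF A(1)] A by auto
   show ?thesis unfolding label_act_eq[OF S(1)] label_act_eq[OF S(2)]
    using label_gain_iff[OF _ _ c(3) P(4)[OF S(1)] P(4)[OF S(2)]] P(1) S by blast
  qed
  have "(EX A:(`) sg ` P. sg i : A & sg j : A & ?f (sg i) \<otimes> (inv (gx i) \<otimes> phi a \<otimes> gx j) = ?f (sg j)) <->
    (EX A:P. i : A & j : A & f i \<otimes> a = f j)"
  proof
   assume "EX A:(`) sg ` P. sg i : A & sg j : A & ?f (sg i) \<otimes> (inv (gx i) \<otimes> phi a \<otimes> gx j) = ?f (sg j)"
   then obtain A where A: "A : P" "i : A" "j : A"
    "?f (sg i) \<otimes> (inv (gx i) \<otimes> phi a \<otimes> gx j) = ?f (sg j)" using im by auto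
   thus "EX A:P. i : A & j : A & f i \<otimes> a = f j" using lab[OF A(1-3)] by blast
  next
   assume "EX A:P. i : A & j : A & f i \<otimes> a = f j"
   then obtain A where A: "A : P" "i : A" "j : A" "f i \<otimes> a = f j" by blast
   thus "EX A:(`) sg ` P. sg i : A & sg j : A & ?f (sg i) \<otimes> (inv (gx i) \<otimes> phi a \<otimes> gx j) = ?f (sg j)"
    using lab[OF A(1-3)] im by blast
  qed
  thus ?thesis
   unfolding te tact_eq e mem_gains_iff[OF yP tc] mem_gains_iff[OF x[unfolded e] c] by (simp only: im)
 qed
 moreover have "gains (sg ` S, ?f, (`) sg ` P) <= tact wr ` triples"
  unfolding tact_surj using gain_closedD(1)[OF gains_closed[OF yP]] .
 moreover have "gains x <= triples" using gain_closedD(1)[OF gains_closed[OF x]] .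
 ultimately show "gains (partial_partition_act G wr x) = tact wr ` gains x" unfolding y by blast
qed

lemma tact_closed: "gain_closed D ==> gain_closed (tact wr ` D)"
 using gain_realizable[of D] act_gains gains_closed by metis

lemma tact_image_mono_iff:
 assumes "gain_closed D" "gain_closed D'"
 shows "tact wr ` D <= tact wr ` D' <-> D <= D'"
 by (rule inj_on_image_subset_iff[OF tact_inj gain_closedD(1)[OF assms(1)] gain_closedD(1)[OF assms(2)]])

lemma tact_image_inj: "gain_closed D ==> gain_closed D' ==> tact wr ` D = tact wr ` D' ==> D = D'"
 using tact_image_mono_iff by (metis subset_antisym order_refl)

lemma nblocks_tact: "gain_closed D ==> nblocks (tact wr ` D) = nblocks D"
proof -
 assume D: "gain_closed D"
 obtain x where x: "x : PP" "gains x = D" using gain_realizable[OF D] .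
 obtain S f P where e: "x = (S, f, P)" by (metis surj_pair)
 have "inj_on ((`) sg) P" using permutes_inj[OF perm] by (auto simp: inj_on_def inj_image_eq_iff)
 hence "card ((`) sg ` P) = card P" by (rule card_image)
 moreover have "partial_partition_act G wr x = (sg ` S, label_act G wr S f, (`) sg ` P)"
  unfolding partial_partition_act_def e by simp
 ultimately show ?thesis using act_gains[OF x(1)] nblocks_gains x unfolding e by metis
qed

lemma atomic_tact: "atomic D ==> atomic (tact wr ` D)"
 unfolding atomic_def using tact_closed nblocks_tact by simp

lemma finite_PP: "finite PP"
proof -
 have "PP <= (SIGMA S : Pow {1..n}. (S \<rightarrow>\<^sub>E carrier G) \<times> Pow (Pow S))"
  unfolding partial_partitions_def partition_on_def by auto
 moreover have "finite (SIGMA S : Pow {1..n}. (S \<rightarrow>\<^sub>E carrier G) \<times> Pow (Pow S))"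
  using finite_G by (intro finite_SigmaI finite_cartesian_product finite_PiE)
   (auto intro: finite_subset[OF _ finite_atLeastAtMost])
 ultimately show ?thesis by (rule finite_subset)
qed

lemma act_inj: "inj_on (partial_partition_act G wr) PP"
proof (rule inj_onI)
 fix x y assume x: "x : PP" and y: "y : PP" and e: "partial_partition_act G wr x = partial_partition_act G wr y"
 obtain S f P where ex: "x = (S, f, P)" by (metis surj_pair)
 obtain T h R where ey: "y = (T, h, R)" by (metis surj_pair)
 have inj: "inj sg" using permutes_inj[OF perm] .
 have eq: "sg ` S = sg ` T" "label_act G wr S f = label_act G wr T h" "(`) sg ` P = (`) sg ` R"
  using e unfolding ex ey partial_partition_act_def by auto
 have ST: "S = T" using eq(1) inj by (simp add: inj_image_eq_iff)
 have "inj ((`) sg)" using inj by (auto simp: inj_on_def inj_image_eq_iff)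
 hence PR: "P = R" using eq(3) by (simp add: inj_image_eq_iff)
 note P = PP_D[OF x[unfolded ex]] and R = PP_D[OF y[unfolded ey]]
 have "f k = h k" for k
 proof (cases "k : S")
  case True
  hence "phi (f k) \<otimes> g k = phi (h k) \<otimes> g k"
   using eq(2) label_act_eq[of k S f] label_act_eq[of k T h] ST by simp
  moreover have "g k : carrier G" "f k : carrier G" "h k : carrier G"
   using g_closed P(1,4) R(4) True ST by auto
  ultimately show ?thesis using phi_inj phi_closed by simp
 next
  case False
  thus ?thesis using P(2) R(2) ST by (simp add: PiE_def extensional_def)
 qed
 thus "x = y" unfolding ex ey ST PR by auto
qed

lemma act_cls:
 assumes D: "gain_closed D"
 shows "partial_partition_act G wr ` cls D = cls (tact wr ` D)"
proof (intro subset_antisym subsetI)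
 fix y assume "y : partial_partition_act G wr ` cls D"
 thus "y : cls (tact wr ` D)" using act_gains unfolding cls_def by blast
next
 fix y assume y: "y : cls (tact wr ` D)"
 \<comment> \<open>Finiteness turns injectivity into surjectivity, so no inverse in the wreath
   product has to be written down.\<close>
 have "partial_partition_act G wr ` PP = PP"
  by (rule endo_inj_surj[OF finite_PP _ act_inj]) (use act_gains in blast)
 moreover have "y : PP" using y unfolding cls_def by blast
 ultimately obtain x where x: "x : PP" "y = partial_partition_act G wr x" by blast
 have "tact wr ` gains x = tact wr ` D" using y act_gains[OF x(1)] x(2) unfolding cls_def by simp
 hence "gains x = D" using tact_image_inj[OF gains_closed[OF x(1)] D] by blast
 thus "y : partial_partition_act G wr ` cls D" using x unfolding cls_def by blast
qed

lemma dowling_hom_cls: "atomic D ==> dowling_hom G n wr (cls D) = cls (tact wr ` D)"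
 unfolding dowling_hom_def dowling_atoms_eq using act_cls by (auto simp: atomic_def)

lemma dowling_hom_at: "gain_closed D ==> dowling_hom G n wr ` atset D = atset (tact wr ` D)"
proof -
 assume D: "gain_closed D"
 have sub: "dowling_hom G n wr ` atset E <= atset (tact wr ` E)" if "gain_closed E" for E
 proof
  fix A assume "A : dowling_hom G n wr ` atset E"
  then obtain B where B: "atomic B" "B <= E" "A = dowling_hom G n wr (cls B)" unfolding atset_def by blast
  hence "A = cls (tact wr ` B)" "tact wr ` B <= tact wr ` E" using dowling_hom_cls by auto
  thus "A : atset (tact wr ` E)" unfolding atset_def using atomic_tact[OF B(1)] by blast
 qed
 have inj: "inj_on (dowling_hom G n wr) (dowling_atoms G n)"
 proof (rule inj_onI)
  fix A B assume "A : dowling_atoms G n" "B : dowling_atoms G n"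
  then obtain D E where DE: "atomic D" "A = cls D" "atomic E" "B = cls E" unfolding dowling_atoms_eq by blast
  assume "dowling_hom G n wr A = dowling_hom G n wr B"
  hence "tact wr ` D = tact wr ` E"
   using dowling_hom_cls cls_inj[of "tact wr ` D" "tact wr ` E"] atomic_tact[OF DE(1)] DE unfolding atomic_def by simp
  hence "D = E" using tact_image_inj[of D E] DE(1,3) unfolding atomic_def by metis
  thus "A = B" using DE by simp
 qed
 have surj: "dowling_hom G n wr ` dowling_atoms G n = dowling_atoms G n"
  by (rule endo_inj_surj[OF finite_atoms _ inj])
   (use sub[OF triples_closed] at_triples tact_surj in simp)
 show ?thesis
 proof (rule subset_antisym[OF sub[OF D]], rule subsetI)
  fix A assume A: "A : atset (tact wr ` D)"
  then obtain E where E: "atomic E" "E <= tact wr ` D" "A = cls E" unfolding atset_def by blast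
  hence "A : dowling_hom G n wr ` dowling_atoms G n" using surj unfolding dowling_atoms_eq by simp
  then obtain C where C: "atomic C" "A = dowling_hom G n wr (cls C)" unfolding dowling_atoms_eq by blast
  have "cls E = cls (tact wr ` C)" using E(3) C dowling_hom_cls by simp
  hence "E = tact wr ` C" using cls_inj[of E] E(1) unfolding atomic_def by blast
  hence "C <= D" using E(2) tact_image_mono_iff[of C D] C(1) D unfolding atomic_def by blast
  thus "A : dowling_hom G n wr ` atset D" unfolding atset_def using C by blast
 qed
qed

lemma dowling_hom_Bij: "dowling_hom G n wr : Bij (dowling_atoms G n)"
proof -
 have "dowling_hom G n wr ` dowling_atoms G n = dowling_atoms G n"
  using dowling_hom_at[OF triples_closed] at_triples tact_surj by simp
 moreover from this have "inj_on (dowling_hom G n wr) (dowling_atoms G n)"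
  by (simp add: eq_card_imp_inj_on finite_atoms)
 moreover have "dowling_hom G n wr : extensional (dowling_atoms G n)"
  unfolding dowling_hom_def by (rule restrict_extensional)
 ultimately show ?thesis unfolding Bij_def bij_betw_def by blast
qed

end

section \<open>The group \<open>Gamma\<close> and its action on flats\<close>

context dowling
begin

lemma wreath_elementI: "(g, sg, phi) : carrier W ==> wreath_element G n g sg phi" by unfold_locales

lemma W_cases:
 assumes "w : carrier W"
 obtains g sg phi where "w = (g, sg, phi)" "wreath_element G n g sg phi"
 using assms wreath_elementI by (metis surj_pair)

lemma W_mult_eq:
 assumes "(g, sg, phi) : carrier W" "(h, tau, psi) : carrier W"
 shows "(g, sg, phi) \<otimes>\<^bsub>W\<^esub> (h, tau, psi) =
  (\<lambda>j\<in>{1..n}. phi (h j) \<otimes> g (tau j), sg \<circ> tau, compose (carrier G) phi psi)"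
 using assms unfolding W_iff by (simp add: W_group_def sym_group_def AutoGroup_def BijGroup_def)

lemma W_mult_closed:
 assumes w: "(g, sg, phi) : carrier W" "(h, tau, psi) : carrier W"
 shows "(g, sg, phi) \<otimes>\<^bsub>W\<^esub> (h, tau, psi) : carrier W"
proof -
 interpret A: wreath_element G n g sg phi by (rule wreath_elementI[OF w(1)])
 interpret B: wreath_element G n h tau psi by (rule wreath_elementI[OF w(2)])
 have "tau j : {1..n}" if "j : {1..n}" for j using permutes_in_image[OF B.perm] that by blast
 hence "(\<lambda>j\<in>{1..n}. phi (h j) \<otimes> g (tau j)) : {1..n} \<rightarrow>\<^sub>E carrier G"
  using A.g_closed B.g_closed A.phi_closed by (intro PiE_I) auto
 moreover have "sg \<circ> tau permutes {1..n}" using permutes_compose[OF B.perm A.perm] .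
 moreover have "compose (carrier G) phi psi : hom G G"
  by (rule homI) (auto simp: compose_def A.phi_closed B.phi_closed A.phi_mult B.phi_mult)
 moreover have "compose (carrier G) phi psi : Bij (carrier G)" by (rule compose_Bij[OF A.Bij_phi B.Bij_phi])
 ultimately show ?thesis unfolding W_mult_eq[OF w] W_iff by blast
qed

text \<open>Here the order of factors in the product of \<open>W_group\<close> matters:
  \<open>phi (h j) \<otimes> g (tau j)\<close> is what two successive twists leave on the right of a
  label.\<close>

lemma tact_mult:
 assumes w: "(g, sg, phi) : carrier W" "(h, tau, psi) : carrier W" and t: "t : triples"
 shows "tact ((g, sg, phi) \<otimes>\<^bsub>W\<^esub> (h, tau, psi)) t = tact (g, sg, phi) (tact (h, tau, psi) t)"
proof -
 interpret A: wreath_element G n g sg phi by (rule wreath_elementI[OF w(1)])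
 interpret B: wreath_element G n h tau psi by (rule wreath_elementI[OF w(2)])
 obtain i a j where te: "t = (i, a, j)" by (metis surj_pair)
 have c: "i <= n" "j <= n" "a : carrier G" using t unfolding te triples_def by auto
 let ?k = "\<lambda>j\<in>{1..n}. phi (h j) \<otimes> g (tau j)"
 have ext: "(if l = 0 then \<one> else ?k l) = phi (B.gx l) \<otimes> A.gx (tau l)" if "l <= n" for l
 proof (cases "l = 0")
  case True
  thus ?thesis unfolding A.gx_def B.gx_def by (simp add: B.sigma_zero A.phi_one)
 next
  case False
  hence "tau l ~= 0" using B.sigma_inj[of l 0] B.sigma_zero by simp
  thus ?thesis using False that unfolding A.gx_def B.gx_def by simp
 qed
 have cl: "phi (B.gx l) : carrier G" "A.gx (tau l) : carrier G" "B.gx l : carrier G" if "l <= n" for l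
  using that A.gx_closed B.gx_closed A.phi_closed B.sigma_le by auto
 have pa: "psi a : carrier G" "phi (psi a) : carrier G" using c A.phi_closed B.phi_closed by auto
 have ig: "phi (inv (B.gx i)) = inv (phi (B.gx i))"
 proof -
  have "phi (inv (B.gx i)) \<otimes> phi (B.gx i) = \<one>"
   using A.phi_mult[of "inv (B.gx i)" "B.gx i"] cl(3)[OF c(1)] A.phi_one by simp
  thus ?thesis using cl(1,3)[OF c(1)] A.phi_closed by (simp add: inv_equality)
 qed
 have "tact (?k, sg \<circ> tau, compose (carrier G) phi psi) (i, a, j) =
   (sg (tau i), inv (phi (B.gx i) \<otimes> A.gx (tau i)) \<otimes> phi (psi a) \<otimes> (phi (B.gx j) \<otimes> A.gx (tau j)), sg (tau j))"
  unfolding tact_def prod.case ext[OF c(1)] ext[OF c(2)] using c(3) by (simp add: compose_def)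
 also have "... = tact (g, sg, phi) (tact (h, tau, psi) (i, a, j))" unfolding A.tact_eq B.tact_eq
  using cl[OF c(1)] cl[OF c(2)] pa A.phi_mult by (simp add: ig inv_mult_group m_assoc)
 finally show ?thesis unfolding te W_mult_eq[OF w] .
qed

definition W_one :: "'g wreath" where
 "W_one = (\<lambda>j\<in>{1..n}. \<one>, id, \<lambda>x\<in>carrier G. x)"

lemma W_one_closed: "W_one : carrier W"
 unfolding W_one_def W_iff using id_in_auto by (auto simp: auto_def permutes_id)

lemma tact_one: "t : triples ==> tact W_one t = t" unfolding W_one_def tact_def triples_def by (cases t) auto

lemma tact_image_mult:
 assumes "w : carrier W" "v : carrier W" "D <= triples"
 shows "tact (w \<otimes>\<^bsub>W\<^esub> v) ` D = tact w ` tact v ` D" "w \<otimes>\<^bsub>W\<^esub> v : carrier W"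
proof -
 obtain g sg phi h tau psi where e: "w = (g, sg, phi)" "v = (h, tau, psi)" by (metis surj_pair)
 show "w \<otimes>\<^bsub>W\<^esub> v : carrier W" using W_mult_closed assms(1,2) unfolding e by blast
 have "tact (w \<otimes>\<^bsub>W\<^esub> v) t = tact w (tact v t)" if "t : D" for t
  unfolding e using tact_mult assms that unfolding e by blast
 thus "tact (w \<otimes>\<^bsub>W\<^esub> v) ` D = tact w ` tact v ` D" by (simp add: image_image)
qed

lemma tact_image_one: "D <= triples ==> tact W_one ` D = D" using tact_one by (force simp: image_iff)

lemma tact_properties:
 assumes "w : carrier W"
 shows "gain_closed D ==> gain_closed (tact w ` D)" "gain_closed D ==> nblocks (tact w ` D) = nblocks D"
  "gain_closed D ==> dowling_hom G n w ` atset D = atset (tact w ` D)"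
  "dowling_hom G n w : Bij (dowling_atoms G n)" "atomic D ==> dowling_hom G n w (cls D) = cls (tact w ` D)"
  "inj_on (tact w) triples" "tact w ` triples = triples"
  "atomic D ==> atomic (tact w ` D)"
proof -
 obtain g sg phi where e: "w = (g, sg, phi)" "wreath_element G n g sg phi" using W_cases[OF assms] .
 interpret wreath_element G n g sg phi by (rule e(2))
 show "gain_closed D ==> gain_closed (tact w ` D)" "gain_closed D ==> nblocks (tact w ` D) = nblocks D"
  "gain_closed D ==> dowling_hom G n w ` atset D = atset (tact w ` D)"
  "dowling_hom G n w : Bij (dowling_atoms G n)" "atomic D ==> dowling_hom G n w (cls D) = cls (tact w ` D)"
  "inj_on (tact w) triples" "tact w ` triples = triples" "atomic D ==> atomic (tact w ` D)"
  unfolding e(1) by (rule tact_closed nblocks_tact dowling_hom_at dowling_hom_Bij dowling_hom_cls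
   tact_inj tact_surj atomic_tact; assumption)+
qed

lemma dowling_hom_mult:
 assumes "w : carrier W" "v : carrier W"
 shows "dowling_hom G n (w \<otimes>\<^bsub>W\<^esub> v) = compose (dowling_atoms G n) (dowling_hom G n w) (dowling_hom G n v)"
proof
 fix X
 note wv = tact_image_mult(2)[OF assms subset_refl]
 show "dowling_hom G n (w \<otimes>\<^bsub>W\<^esub> v) X = compose (dowling_atoms G n) (dowling_hom G n w) (dowling_hom G n v) X"
 proof (cases "X : dowling_atoms G n")
  case True
  then obtain D where D: "atomic D" "X = cls D" unfolding dowling_atoms_eq by blast
  have "D <= triples" using D(1) gain_closedD(1) unfolding atomic_def by blast
  thus ?thesis using True tact_properties(5)[OF wv D(1)] tact_properties(5)[OF assms(2) D(1)]
    tact_properties(5)[OF assms(1) tact_properties(8)[OF assms(2) D(1)]]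
    tact_image_mult(1)[OF assms] unfolding D(2) by (simp add: compose_def)
 qed (simp add: dowling_hom_def compose_def)
qed

lemma dowling_hom_one: "dowling_hom G n W_one = (\<lambda>X\<in>dowling_atoms G n. X)"
proof
 fix X
 show "dowling_hom G n W_one X = (\<lambda>X\<in>dowling_atoms G n. X) X"
 proof (cases "X : dowling_atoms G n")
  case True
  then obtain D where D: "atomic D" "X = cls D" unfolding dowling_atoms_eq by blast
  have "D <= triples" using D(1) gain_closedD(1) unfolding atomic_def by blast
  thus ?thesis using True tact_properties(5)[OF W_one_closed D(1)] tact_image_one D(2) by simp
 qed (simp add: dowling_hom_def)
qed

abbreviation "GG \<equiv> Gamma G n"

lemma carrier_Gamma: "carrier GG = dowling_hom G n ` carrier W"
 and one_Gamma: "\<one>\<^bsub>GG\<^esub> = (\<lambda>X\<in>dowling_atoms G n. X)"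
 by (simp_all add: Gamma_def BijGroup_def)

lemma mult_Gamma: "gm : carrier GG ==> dl : carrier GG ==> gm \<otimes>\<^bsub>GG\<^esub> dl = compose (dowling_atoms G n) gm dl"
 using tact_properties(4) by (auto simp: Gamma_def BijGroup_def)

lemma finite_Gamma: "finite (carrier GG)"
proof -
 have "carrier GG <= dowling_atoms G n \<rightarrow>\<^sub>E dowling_atoms G n" unfolding carrier_Gamma
 proof (rule image_subsetI)
  fix w assume "w : carrier W"
  from tact_properties(4)[OF this] show "dowling_hom G n w : dowling_atoms G n \<rightarrow>\<^sub>E dowling_atoms G n"
   by (auto simp: Bij_def bij_betw_def PiE_def)
 qed
 moreover have "finite (dowling_atoms G n \<rightarrow>\<^sub>E dowling_atoms G n)" by (rule finite_PiE[OF finite_atoms finite_atoms])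
 ultimately show ?thesis by (rule finite_subset)
qed

lemma subgroup_Gamma: "subgroup (carrier GG) (BijGroup (dowling_atoms G n))"
proof -
 interpret B: group "BijGroup (dowling_atoms G n)" by (rule group_BijGroup)
 have sub: "carrier GG <= carrier (BijGroup (dowling_atoms G n))"
  unfolding carrier_Gamma by (rule image_subsetI) (simp add: BijGroup_def tact_properties(4))
 have mult: "gm \<otimes>\<^bsub>BijGroup (dowling_atoms G n)\<^esub> dl : carrier GG" if gd: "gm : carrier GG" "dl : carrier GG" for gm dl
 proof -
  obtain w v where w: "w : carrier W" "v : carrier W" "gm = dowling_hom G n w" "dl = dowling_hom G n v"
   using gd unfolding carrier_Gamma by blast
  have "gm \<otimes>\<^bsub>BijGroup (dowling_atoms G n)\<^esub> dl = dowling_hom G n (w \<otimes>\<^bsub>W\<^esub> v)"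
   unfolding dowling_hom_mult[OF w(1,2)] using tact_properties(4) w by (simp add: BijGroup_def)
  thus ?thesis unfolding carrier_Gamma using tact_image_mult(2)[OF w(1,2) subset_refl] by blast
 qed
 have one: "\<one>\<^bsub>BijGroup (dowling_atoms G n)\<^esub> : carrier GG"
 proof -
  have "\<one>\<^bsub>BijGroup (dowling_atoms G n)\<^esub> = dowling_hom G n W_one" by (simp add: dowling_hom_one BijGroup_def)
  thus ?thesis unfolding carrier_Gamma using W_one_closed by blast
 qed
 show ?thesis
 proof (rule B.subgroupI[OF sub])
  show "carrier GG ~= {}" using one by blast
  fix gm assume g: "gm : carrier GG"
  let ?l = "%dl. gm \<otimes>\<^bsub>BijGroup (dowling_atoms G n)\<^esub> dl"
  have gB: "gm : carrier (BijGroup (dowling_atoms G n))" using g sub by blast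
  \<comment> \<open>Inverses come from finiteness: left multiplication by \<open>gm\<close> maps the
    carrier injectively, hence onto itself, and so attains the identity.\<close>
  have inj: "inj_on ?l (carrier GG)" using B.inj_on_cmult[OF gB] sub by (rule inj_on_subset)
  have "?l ` carrier GG = carrier GG" by (rule endo_inj_surj[OF finite_Gamma _ inj]) (use mult[OF g] in blast)
  hence "\<one>\<^bsub>BijGroup (dowling_atoms G n)\<^esub> : ?l ` carrier GG" using one by simp
  then obtain dl where d': "\<one>\<^bsub>BijGroup (dowling_atoms G n)\<^esub> = ?l dl" "dl : carrier GG" by (rule imageE)
  note d = d'(2) d'(1)[symmetric]
  have dB: "dl : carrier (BijGroup (dowling_atoms G n))" using d(1) sub by blast
  have "inv\<^bsub>BijGroup (dowling_atoms G n)\<^esub> gm = dl"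
   by (rule B.inv_equality[OF B.inv_comm[OF d(2) gB dB] gB dB])
  thus "inv\<^bsub>BijGroup (dowling_atoms G n)\<^esub> gm : carrier GG" using d by simp
 qed (rule mult)
qed

lemma group_Gamma: "group GG"
proof -
 interpret B: group "BijGroup (dowling_atoms G n)" by (rule group_BijGroup)
 have "GG = BijGroup (dowling_atoms G n)\<lparr>carrier := carrier GG\<rparr>" by (simp add: Gamma_def)
 thus ?thesis using B.subgroup_imp_group[OF subgroup_Gamma] by simp
qed

definition wrep :: "('g dowling_class => 'g dowling_class) => 'g wreath" where
 "wrep gm = inv_into (carrier W) (dowling_hom G n) gm"

lemma wrep:
 assumes "gm : carrier GG"
 shows "wrep gm : carrier W" "dowling_hom G n (wrep gm) = gm"
 using assms unfolding wrep_def carrier_Gamma by (auto intro: inv_into_into f_inv_into_f)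

definition gact :: "('g dowling_class => 'g dowling_class) => 'g gains => 'g gains" where
 "gact gm D = tact (wrep gm) ` D"

lemma gact_closed: "gm : carrier GG ==> gain_closed D ==> gain_closed (gact gm D)"
 and nblocks_gact: "gm : carrier GG ==> gain_closed D ==> nblocks (gact gm D) = nblocks D"
 unfolding gact_def using tact_properties(1,2)[OF wrep(1)] by auto

lemma atset_gact: "gm : carrier GG ==> gain_closed D ==> gm ` atset D = atset (gact gm D)"
 unfolding gact_def using tact_properties(3)[OF wrep(1), of gm D] wrep(2)[of gm] by simp

text \<open>A gain set is determined by its atoms, and on atoms only the image in
  \<open>Gamma\<close> matters; so \<open>gact\<close> is independent of the preimage chosen by
  \<open>wrep\<close>.\<close>

lemma tact_image_cong:
 assumes "w : carrier W" "v : carrier W" "dowling_hom G n w = dowling_hom G n v" "gain_closed D"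
 shows "tact w ` D = tact v ` D"
 using at_inj[OF tact_properties(1)[OF assms(1,4)] tact_properties(1)[OF assms(2,4)]]
  tact_properties(3)[OF assms(1,4)] tact_properties(3)[OF assms(2,4)] assms(3) by simp

lemma equivariant_dowling: "equivariant_matroid Q GG (Gamma_action G n)"
proof -
 note Qs = Q_spec
 have "Gamma_action G n : hom GG (BijGroup (ground Q))" unfolding Qs(3) Gamma_action_def
 proof (rule homI)
  fix gm assume g: "gm : carrier GG"
  show "(\<lambda>gm\<in>carrier GG. gm) gm : carrier (BijGroup (dowling_atoms G n))"
   using g subgroup.subset[OF subgroup_Gamma] by auto
  fix dl assume d: "dl : carrier GG"
  have "gm \<otimes>\<^bsub>GG\<^esub> dl : carrier GG" by (rule monoid.m_closed[OF group.is_monoid[OF group_Gamma] g d])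
  moreover have "gm \<otimes>\<^bsub>GG\<^esub> dl = gm \<otimes>\<^bsub>BijGroup (dowling_atoms G n)\<^esub> dl" by (simp add: Gamma_def)
  ultimately show "(\<lambda>gm\<in>carrier GG. gm) (gm \<otimes>\<^bsub>GG\<^esub> dl) =
    (\<lambda>gm\<in>carrier GG. gm) gm \<otimes>\<^bsub>BijGroup (dowling_atoms G n)\<^esub> (\<lambda>gm\<in>carrier GG. gm) dl"
   using g d by simp
 qed
 hence "group_action GG (ground Q) (Gamma_action G n)"
  unfolding group_action_def group_hom_def group_hom_axioms_def using group_Gamma group_BijGroup by blast
 moreover have "Gamma_action G n gm ` F : flats Q" if g: "gm : carrier GG" and F: "F : flats Q" for gm F
 proof -
  obtain D where D: "gain_closed D" "F = atset D" using F unfolding Qs(4) by blast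
  show ?thesis
   unfolding Qs(4) Gamma_action_def using g atset_gact[OF g D(1)] gact_closed[OF g D(1)] D(2) by simp
 qed
 moreover have "loopless Q" using Qs(2) unfolding simple_matroid_def by blast
 ultimately show ?thesis unfolding equivariant_matroid_def matroid_action_def
  using Qs(1) finite_Gamma by (simp add: Gamma_action_def)
qed

end

section \<open>Labeled matroids\<close>

context dowling
begin

definition LM :: "'g labeled_matroid set" where
 "LM = {(M, psi). quasi_series_parallel M & ground M = {1..n} & psi : {1..n} \<rightarrow>\<^sub>E carrier G}"

text \<open>Relative labels along connected pairs: for fixed \<open>M\<close>, a complete invariant
  of the class of a labeling. Loops stay ordinary points here; it is \<open>dgains\<close> that
  moves them to the zero block.\<close>

definition lgains :: "'g labeled_matroid => 'g gains" where
 "lgains = (%(M, psi). {(i, a, j). i : {1..n} & j : {1..n} & a : carrier G \<and>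
   (i, j) : connectivity_rel M & psi i \<otimes> a = psi j})"

definition lcls :: "'g labeled_matroid => 'g labeled_matroid set" where
 "lcls x = labeling_rel G `` {x}"

lemma LM_D:
 assumes "(M, psi) : LM"
 shows "quasi_series_parallel M" "is_matroid M" "ground M = {1..n}" "psi : {1..n} \<rightarrow>\<^sub>E carrier G"
  "i : {1..n} ==> psi i : carrier G" using assms unfolding LM_def quasi_series_parallel_def by auto

lemma lgains_triples: "lgains x <= triples" unfolding lgains_def triples_def by (cases x) auto

lemma labeling_rel_iff:
 assumes x: "(M, psi) : LM"
 shows "((M, psi), (N, chi)) : labeling_rel G <-> (N, chi) : LM & N = M & lgains (N, chi) = lgains (M, psi)"
proof -
 note X = LM_D[OF x]
 note M = X(2)
 have "(ALL C:components M. EX g:carrier G. ALL j:C. psi j = g \<otimes> chi j) <-> lgains (M, chi) = lgains (M, psi)"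
  if chi: "chi : {1..n} \<rightarrow>\<^sub>E carrier G" for chi
 proof
  have cc: "chi i : carrier G" if "i : {1..n}" for i using chi that by auto
  assume L: "ALL C:components M. EX g:carrier G. ALL j:C. psi j = g \<otimes> chi j"
  show "lgains (M, chi) = lgains (M, psi)"
  proof (rule triples_eqI[OF lgains_triples lgains_triples])
   fix i a j
   have "chi i \<otimes> a = chi j <-> psi i \<otimes> a = psi j"
    if t: "i : {1..n}" "j : {1..n}" "a : carrier G" "(i, j) : connectivity_rel M"
   proof -
    obtain C where C: "C : components M" "i : C" using component_cover[OF M] t(1) X(3) by blast
    hence "j : C" using in_component_iff[OF M C] t(4) by blast
    then obtain g where "g : carrier G" "psi i = g \<otimes> chi i" "psi j = g \<otimes> chi j" using L C by blast
    thus ?thesis using t cc by (simp add: m_assoc)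
   qed
   thus "(i, a, j) : lgains (M, chi) <-> (i, a, j) : lgains (M, psi)" unfolding lgains_def by auto
  qed
 next
  have cc: "chi i : carrier G" if "i : {1..n}" for i using chi that by auto
  assume e: "lgains (M, chi) = lgains (M, psi)"
  show "ALL C:components M. EX g:carrier G. ALL j:C. psi j = g \<otimes> chi j"
  proof
   fix C assume C: "C : components M"
   then obtain i where i: "i : C"
    using in_quotient_imp_non_empty[OF equiv_connectivity[OF M]] unfolding components_def by blast
   have CE: "C <= {1..n}" using component_ground[OF M C] X(3) by simp
   have ic: "psi i : carrier G" "chi i : carrier G" "i : {1..n}" using X(5) cc CE i by auto
   have "psi j = psi i \<otimes> inv (chi i) \<otimes> chi j" if j: "j : C" for j
   proof -
    have jc: "psi j : carrier G" "j : {1..n}" using X(5) CE j by auto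
    let ?a = "inv (psi i) \<otimes> psi j"
    have a: "?a : carrier G" "psi i \<otimes> ?a = psi j" using ic jc by (simp_all add: m_assoc[symmetric])
    have "(i, j) : connectivity_rel M" using in_component_iff[OF M C i] j by blast
    hence "(i, ?a, j) : lgains (M, psi)" unfolding lgains_def using ic jc a by simp
    hence "(i, ?a, j) : lgains (M, chi)" using e by simp
    hence ch: "chi i \<otimes> ?a = chi j" unfolding lgains_def by simp
    have "inv (chi i) \<otimes> (chi i \<otimes> ?a) = ?a" using ic a(1) by (simp add: m_assoc[symmetric])
    hence "psi i \<otimes> inv (chi i) \<otimes> (chi i \<otimes> ?a) = psi i \<otimes> ?a" using ic a(1) by (simp add: m_assoc)
    thus ?thesis unfolding ch a(2) by simp
   qed
   thus "EX g:carrier G. ALL j:C. psi j = g \<otimes> chi j" using ic by blast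
  qed
 qed
 thus ?thesis using X unfolding labeling_rel_def LM_def by auto
qed

lemma lcls_eq: "(M, psi) : LM ==> lcls (M, psi) = {(M, chi) |chi. (M, chi) : LM & lgains (M, chi) = lgains (M, psi)}"
 unfolding lcls_def using labeling_rel_iff by auto

lemma lcls_eq_iff:
 assumes "(M, psi) : LM" "(N, chi) : LM"
 shows "lcls (M, psi) = lcls (N, chi) <-> M = N & lgains (M, psi) = lgains (N, chi)"
proof
 assume "lcls (M, psi) = lcls (N, chi)"
 moreover have "(M, psi) : lcls (M, psi)" unfolding lcls_eq[OF assms(1)] using assms(1) by blast
 ultimately have "(M, psi) : lcls (N, chi)" by simp
 thus "M = N & lgains (M, psi) = lgains (N, chi)" unfolding lcls_eq[OF assms(2)] by blast
next
 assume "M = N & lgains (M, psi) = lgains (N, chi)"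
 hence e: "M = N" "lgains (N, psi) = lgains (N, chi)" by auto
 show "lcls (M, psi) = lcls (N, chi)"
  using lcls_eq[OF assms(1)] lcls_eq[OF assms(2)] unfolding e(1) e(2) by simp
qed

lemma A_set_eq: "A_set G n r = lcls ` {(M, psi) : LM. int (matroid_rank M) = r}"
 unfolding A_set_def quotient_def lcls_def LM_def by auto

lemma S_set_eq: "S_set G n r = lcls ` {(M, psi) : LM. simple_matroid M & int (matroid_rank M) = r}"
 unfolding S_set_def quotient_def lcls_def LM_def by auto

lemma finite_LM: "finite LM"
proof -
 have "LM <= (%(I, psi). (Matroid {1..n} I, psi)) ` (Pow (Pow {1..n}) \<times> ({1..n} \<rightarrow>\<^sub>E carrier G))"
 proof
  fix x assume x: "x : LM"
  obtain M psi where e: "x = (M, psi)" by (metis surj_pair)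
  note X = LM_D[OF x[unfolded e]]
  have "M = Matroid {1..n} (indeps M)" using X(3) by (cases M) simp
  moreover have "indeps M <= Pow {1..n}" using indep_ground[OF X(2)] X(3) by blast
  ultimately show "x : (%(I, psi). (Matroid {1..n} I, psi)) ` (Pow (Pow {1..n}) \<times> ({1..n} \<rightarrow>\<^sub>E carrier G))"
   unfolding e using X(4) by (intro image_eqI[of _ _ "(indeps M, psi)"]) auto
 qed
 moreover have "finite (Pow (Pow {1..n}) \<times> ({1..n} \<rightarrow>\<^sub>E carrier G))"
  using finite_G by (intro finite_cartesian_product finite_PiE) auto
 ultimately show ?thesis by (metis finite_imageI finite_subset)
qed

lemma finite_A_set: "finite (A_set G n r)"
 unfolding A_set_eq by (rule finite_imageI) (rule finite_subset[OF _ finite_LM], auto)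

end

section \<open>The wreath product acting on labeled matroids\<close>

context wreath_element
begin

lemma labeled_act_eq: "labeled_act G wr (M, psi) = (image_matroid sg M, label_act G wr (ground M) psi)"
 unfolding labeled_act_def by simp

lemma sigma_image: "sg ` {1..n} = {1..n}" by (rule permutes_image[OF perm])

lemma sigma_inj_on: "inj_on sg A" using permutes_inj[OF perm] inj_on_subset by blast

lemma labeled_act_LM:
 assumes "(M, psi) : LM"
 shows "labeled_act G wr (M, psi) : LM" "matroid_rank (fst (labeled_act G wr (M, psi))) = matroid_rank M"
proof -
 note X = LM_D[OF assms]
 have "label_act G wr (ground M) psi : {1..n} \<rightarrow>\<^sub>E carrier G"
  using label_act_closed[OF subset_refl X(4)] unfolding X(3) sigma_image .
 thus "labeled_act G wr (M, psi) : LM" unfolding labeled_act_eq LM_def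
  using quasi_series_parallel_image[OF X(1) sigma_inj_on] X(3) sigma_image by simp
 show "matroid_rank (fst (labeled_act G wr (M, psi))) = matroid_rank M"
  unfolding labeled_act_eq using matroid_rank_image[OF X(2) sigma_inj_on] by simp
qed

lemma label_equiv:
 assumes x: "(M, psi) : LM" and t: "i : {1..n}" "j : {1..n}" "a : carrier G"
 shows "label_act G wr (ground M) psi (sg i) \<otimes> (inv (gx i) \<otimes> phi a \<otimes> gx j) = label_act G wr (ground M) psi (sg j)
  <-> psi i \<otimes> a = psi j"
proof -
 note X = LM_D[OF x]
 show ?thesis unfolding X(3) label_act_eq[OF t(1)] label_act_eq[OF t(2)]
  by (rule label_gain_iff[OF t X(5)[OF t(1)] X(5)[OF t(2)]])
qed

lemma tact_image_eqI:
 assumes "A <= triples" "B <= triples"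
  "!!i a j. i <= n ==> j <= n ==> a : carrier G ==>
   (sg i, inv (gx i) \<otimes> phi a \<otimes> gx j, sg j) : B <-> (i, a, j) : A"
 shows "B = tact wr ` A"
proof -
 have iff: "tact wr t : B <-> t : A" if t: "t : triples" for t
 proof -
  obtain i a j where te: "t = (i, a, j)" by (metis surj_pair)
  show ?thesis unfolding te tact_eq by (rule assms(3)) (use t in \<open>simp_all add: te triples_def\<close>)
 qed
 show ?thesis
 proof (intro subset_antisym subsetI)
  fix u assume u: "u : B"
  hence "u : tact wr ` triples" using assms(2) tact_surj by (metis subsetD)
  then obtain t where t: "t : triples" "u = tact wr t" by blast
  hence "t : A" using iff[OF t(1)] u by simp
  thus "u : tact wr ` A" using t(2) by simp
 next
  fix u assume "u : tact wr ` A"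
  then obtain t where t: "t : A" "u = tact wr t" by blast
  thus "u : B" using iff[of t] assms(1) by (metis subsetD)
 qed
qed

lemma sigma_mem: "i : {1..n} <-> sg i : {1..n}" using permutes_in_image[OF perm] by simp

lemma lgains_act:
 assumes x: "(M, psi) : LM"
 shows "lgains (labeled_act G wr (M, psi)) = tact wr ` lgains (M, psi)"
proof (rule tact_image_eqI[OF lgains_triples lgains_triples])
 note X = LM_D[OF x]
 fix i a j assume c: "i <= n" "j <= n" "a : carrier G"
 have cl: "inv (gx i) \<otimes> phi a \<otimes> gx j : carrier G" using c gx_closed phi_closed by simp
 have "(sg i, sg j) : connectivity_rel (image_matroid sg M) <-> (i, j) : connectivity_rel M"
  if "i : {1..n}" "j : {1..n}" using connectivity_image[OF X(2) sigma_inj_on, of i j] that X(3) by simp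
 thus "(sg i, inv (gx i) \<otimes> phi a \<otimes> gx j, sg j) : lgains (labeled_act G wr (M, psi)) <->
   (i, a, j) : lgains (M, psi)" using label_equiv[OF x _ _ c(3), of i j] c cl sigma_mem[of i] sigma_mem[of j]
  unfolding labeled_act_eq lgains_def by auto
qed

lemma labeled_act_lcls:
 assumes x: "(M, psi) : LM"
 shows "labeled_act G wr ` lcls (M, psi) = lcls (labeled_act G wr (M, psi))"
proof (intro subset_antisym subsetI)
 note X = LM_D[OF x]
 have e: "labeled_act G wr (M, psi) = (image_matroid sg M, label_act G wr (ground M) psi)" by (rule labeled_act_eq)
 note yL = labeled_act_LM(1)[OF x, unfolded e]
 {
  fix y assume "y : labeled_act G wr ` lcls (M, psi)"
  then obtain chi where c: "(M, chi) : LM" "lgains (M, chi) = lgains (M, psi)" "y = labeled_act G wr (M, chi)"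
   unfolding lcls_eq[OF x] by blast
  have ye: "y = (image_matroid sg M, label_act G wr (ground M) chi)" using c(3) labeled_act_eq by simp
  show "y : lcls (labeled_act G wr (M, psi))" unfolding e lcls_eq[OF yL]
   using ye labeled_act_LM(1)[OF c(1)] lgains_act[OF c(1)] lgains_act[OF x] c(2,3) e by auto
 next
  fix y assume y: "y : lcls (labeled_act G wr (M, psi))"
  then obtain th where t: "y = (image_matroid sg M, th)" "(image_matroid sg M, th) : LM"
   "lgains (image_matroid sg M, th) = lgains (labeled_act G wr (M, psi))" unfolding e lcls_eq[OF yL] by blast
  note Y = LM_D[OF t(2)]
  \<comment> \<open>Solves \<open>phi (chi k) \<otimes> g k = th (sg k)\<close> pointwise; this is
    what makes the image of a class a whole class.\<close>
  define chi where "chi = (\<lambda>k\<in>{1..n}. inv_into (carrier G) phi (th (sg k) \<otimes> inv (g k)))"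
  have im: "phi ` carrier G = carrier G" using Bij_phi by (simp add: Bij_def bij_betw_def)
  have ck: "chi k : carrier G & phi (chi k) = th (sg k) \<otimes> inv (g k)" if k: "k : {1..n}" for k
  proof -
   have "th (sg k) \<otimes> inv (g k) : phi ` carrier G"
    unfolding im using Y(5) sigma_mem[of k] k g_closed[OF k] by simp
   thus ?thesis unfolding chi_def using k by (simp add: inv_into_into f_inv_into_f)
  qed
  have cL: "(M, chi) : LM" using X(1,3) ck unfolding LM_def by (auto simp: chi_def PiE_def)
  have "label_act G wr (ground M) chi = th"
  proof
   fix i
   show "label_act G wr (ground M) chi i = th i"
   proof (cases "i : {1..n}")
    case True
    then obtain k where k: "k : {1..n}" "i = sg k" using sigma_image by blast
    have "phi (chi k) \<otimes> g k = th (sg k)"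
     using ck[OF k(1)] g_closed[OF k(1)] Y(5)[of "sg k"] sigma_mem[of k] k(1) by (simp add: m_assoc)
    thus ?thesis unfolding k(2) X(3) label_act_eq[OF k(1)] .
   next
    case False
    hence "i ~: sg ` {1..n}" unfolding sigma_image .
    hence "label_act G wr (ground M) chi i = undefined" unfolding label_act_def X(3) by simp
    thus ?thesis using Y(4) False by (simp add: PiE_def extensional_def)
   qed
  qed
  hence ye: "y = labeled_act G wr (M, chi)" using t(1) labeled_act_eq by simp
  have "tact wr ` lgains (M, chi) = tact wr ` lgains (M, psi)"
   using lgains_act[OF cL] lgains_act[OF x] t(1,3) ye by simp
  hence "lgains (M, chi) = lgains (M, psi)"
   using inj_on_image_eq_iff[OF tact_inj lgains_triples lgains_triples] by blast
  thus "y : labeled_act G wr ` lcls (M, psi)" using ye cL unfolding lcls_eq[OF x] by blast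
 }
qed

end

section \<open>Independence of the preimage in the wreath product\<close>

context dowling
begin

lemma lgains_diagonal: "(M, psi) : LM ==> (i, a, i) : lgains (M, psi) ==> a = \<one>"
 using LM_D(5)[of M psi i] unfolding lgains_def by auto

lemma gain_closedI:
 assumes "D <= triples" "!!i. i : {0..n} ==> (i, \<one>, i) : D" "!!i g j. (i, g, j) : D ==> (j, inv g, i) : D"
  "!!i g j h k. (i, g, j) : D ==> (j, h, k) : D ==> (i, g \<otimes> h, k) : D"
  "!!i g. (i, g, i) : D ==> g ~= \<one> ==> (i, \<one>, 0) : D"
  "!!i g h. (i, g, 0) : D ==> h : carrier G ==> (i, h, 0) : D"
 shows "gain_closed D" unfolding gain_closed_def using assms by blast

lemma gain_closed_zero_block:
 assumes "0 : Z"
 shows "gain_closed {(k, a, l). k <= n & l <= n & a : carrier G & (k = l & a = \<one> | k : Z & l : Z)}"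
 unfolding gain_closed_def triples_def using assms by (intro conjI allI ballI impI) auto

text \<open>A flat for testing: its only nontrivial relation is the gain \<open>a\<close> between
  \<open>i\<close> and \<open>j\<close>, so its image shows where this triple goes.\<close>

lemma gain_closed_pair:
 assumes "i : {1..n}" "j : {1..n}" "i ~= j" "a : carrier G"
 shows "gain_closed {(k, b, l). k <= n & l <= n & b : carrier G \<and>
  (k = l & b = \<one> | k = 0 & l = 0 | k = i & l = j & b = a | k = j & l = i & b = inv a)}"
  (is "gain_closed ?D")
proof -
 have m: "(k, b, l) : ?D <-> k <= n & l <= n & b : carrier G \<and>
  (k = l & b = \<one> | k = 0 & l = 0 | k = i & l = j & b = a | k = j & l = i & b = inv a)" for k b l by simp
 have i: "i ~= 0" "j ~= 0" "i <= n" "j <= n" using assms by auto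
 have tr: "(k, g \<otimes> h, l) : ?D" if "(k, g, q) : ?D" "(q, h, l) : ?D" for k g q h l
  using that i assms(3,4) unfolding m by (elim conjE disjE) simp_all
 have sy: "(l, inv g, k) : ?D" if "(k, g, l) : ?D" for k g l
  using that i assms(3,4) unfolding m by (elim conjE disjE) simp_all
 have lo: "(k, \<one>, 0) : ?D" if "(k, g, k) : ?D" "g ~= \<one>" for k g
  using that i assms(3,4) unfolding m by (elim conjE disjE) simp_all
 have ze: "(k, h, 0) : ?D" if "(k, g, 0) : ?D" "h : carrier G" for k g h
  using that i unfolding m by (elim conjE disjE) simp_all
 have re: "(k, \<one>, k) : ?D" if "k : {0..n}" for k using that by simp
 have su: "?D <= triples" unfolding triples_def by auto
 show ?thesis by (rule gain_closedI[OF su re sy tr lo ze])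
qed

text \<open>Equal images in \<open>Gamma\<close> move all gain sets alike, and flats with a single
  nontrivial relation detect the permutation and the action on triples. Triples with equal ends are
  left out: for \<open>n = 1\<close> the two actions may differ there.\<close>

lemma dowling_hom_eq_imp:
 assumes w: "(g, sg, phi) : carrier W" and v: "(h, tau, psi) : carrier W"
  and e: "dowling_hom G n (g, sg, phi) = dowling_hom G n (h, tau, psi)"
 shows "sg = tau"
  "i : {1..n} ==> j : {1..n} ==> i ~= j ==> a : carrier G ==>
   tact (g, sg, phi) (i, a, j) = tact (h, tau, psi) (i, a, j)"
proof -
 interpret A: wreath_element G n g sg phi by (rule wreath_elementI[OF w])
 interpret B: wreath_element G n h tau psi by (rule wreath_elementI[OF v])
 note cong = tact_image_cong[OF w v e]
 show st: "sg = tau"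
 proof
  fix i
  show "sg i = tau i"
  proof (cases "i : {1..n}")
   case True
   \<comment> \<open>The flat with zero block \<open>{0, i}\<close> and singletons otherwise; its
     image has zero block \<open>{0, sg i}\<close>.\<close>
   let ?D = "{(k, a, l). k <= n & l <= n & a : carrier G & (k = l & a = \<one> | k : {0, i} & l : {0, i})}"
   have D: "gain_closed ?D" by (rule gain_closed_zero_block) simp
   have "tact (g, sg, phi) (i, \<one>, 0) : tact (h, tau, psi) ` ?D"
    unfolding cong[OF D, symmetric] by (rule imageI) (use True in simp)
   then obtain t where t: "tact (g, sg, phi) (i, \<one>, 0) = tact (h, tau, psi) t" "t : ?D" by (rule imageE)
   obtain k a l where te: "t = (k, a, l)" by (metis surj_pair)
   note kl = t(2,1)[unfolded te]
   from kl(2) have s: "sg i = tau k" "tau l = 0" unfolding A.tact_eq B.tact_eq using A.sigma_zero by auto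
   have l: "l = 0" using s(2) B.sigma_inj[of l 0] B.sigma_zero by simp
   have "k ~= 0" using s(1) A.sigma_inj[of i 0] A.sigma_zero B.sigma_zero True by (metis atLeastAtMost_iff not_one_le_zero)
   hence "k = i" using kl(1) l by simp
   thus ?thesis using s(1) by simp
  next
   case False
   thus ?thesis using A.perm B.perm by (simp add: permutes_def)
  qed
 qed
 assume ij: "i : {1..n}" "j : {1..n}" "i ~= j" "a : carrier G"
 let ?D = "{(k, b, l). k <= n & l <= n & b : carrier G \<and>
  (k = l & b = \<one> | k = 0 & l = 0 | k = i & l = j & b = a | k = j & l = i & b = inv a)}"
 have D: "gain_closed ?D" by (rule gain_closed_pair[OF ij])
 have "tact (g, sg, phi) (i, a, j) : tact (h, tau, psi) ` ?D"
  unfolding cong[OF D, symmetric] by (rule imageI) (use ij in simp)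
 then obtain t where t: "tact (g, sg, phi) (i, a, j) = tact (h, tau, psi) t" "t : ?D" by (rule imageE)
 obtain k b l where te: "t = (k, b, l)" by (metis surj_pair)
 note kl = t(2,1)[unfolded te]
 from kl(2) have "k = i" "l = j" unfolding A.tact_eq B.tact_eq using B.sigma_inj st by auto
 hence "b = a" using kl(1) ij by simp
 thus "tact (g, sg, phi) (i, a, j) = tact (h, tau, psi) (i, a, j)" using kl(2) \<open>k = i\<close> \<open>l = j\<close> by simp
qed

text \<open>Relative labels of distinct connected elements involve only triples on which the two
  preimages agree, and a triple of \<open>lgains\<close> with equal ends has gain
  \<open>\<one>\<close>.\<close>

lemma labeled_act_cong:
 assumes w: "w : carrier W" and v: "v : carrier W" and e: "dowling_hom G n w = dowling_hom G n v"
  and x: "(M, th) : LM"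
 shows "lcls (labeled_act G w (M, th)) = lcls (labeled_act G v (M, th))"
proof -
 obtain g sg phi where we: "w = (g, sg, phi)" "wreath_element G n g sg phi" using W_cases[OF w] .
 obtain h tau psi where ve: "v = (h, tau, psi)" "wreath_element G n h tau psi" using W_cases[OF v] .
 interpret A: wreath_element G n g sg phi by (rule we(2))
 interpret B: wreath_element G n h tau psi by (rule ve(2))
 note eq = dowling_hom_eq_imp[OF w[unfolded we(1)] v[unfolded ve(1)] e[unfolded we(1) ve(1)]]
 have "tact w t = tact v t" if t: "t : lgains (M, th)" for t
 proof -
  obtain i a j where te: "t = (i, a, j)" by (metis surj_pair)
  have c: "i : {1..n}" "j : {1..n}" "a : carrier G" using t unfolding te lgains_def by auto
  show ?thesis
  proof (cases "i = j")
   case True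
   hence "a = \<one>" using lgains_diagonal[OF x] t unfolding te by blast
   moreover have "tact w (j, \<one>, j) = (sg j, \<one>, sg j)"
    unfolding we(1) A.tact_eq using A.gx_closed[of j] c by (simp add: A.phi_one)
   moreover have "tact v (j, \<one>, j) = (tau j, \<one>, tau j)"
    unfolding ve(1) B.tact_eq using B.gx_closed[of j] c by (simp add: B.phi_one)
   ultimately show ?thesis unfolding te True eq(1) by simp
  next
   case False
   thus ?thesis unfolding te we(1) ve(1) using eq(2)[OF c(1,2) False c(3)] by simp
  qed
 qed
 hence "tact w ` lgains (M, th) = tact v ` lgains (M, th)" by (rule image_cong[OF refl])
 hence lg: "lgains (labeled_act G w (M, th)) = lgains (labeled_act G v (M, th))"
  using A.lgains_act[OF x] B.lgains_act[OF x] we(1) ve(1) by simp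
 have f: "fst (labeled_act G w (M, th)) = fst (labeled_act G v (M, th))"
  unfolding we(1) ve(1) A.labeled_act_eq B.labeled_act_eq using eq(1) by simp
 have L: "labeled_act G w (M, th) : LM" "labeled_act G v (M, th) : LM"
  using A.labeled_act_LM(1)[OF x] B.labeled_act_LM(1)[OF x] we(1) ve(1) by auto
 show ?thesis using L f lg lcls_eq_iff by (metis prod.collapse)
qed

abbreviation "lact \<equiv> Gamma_labeled_action G n"

lemma lact_lcls:
 assumes g: "gm : carrier GG" and w: "w : carrier W" "dowling_hom G n w = gm" and x: "(M, psi) : LM"
 shows "lact gm (lcls (M, psi)) = lcls (labeled_act G w (M, psi))"
proof -
 note r = wrep[OF g]
 obtain h sg phi where we: "wrep gm = (h, sg, phi)" "wreath_element G n h sg phi" using W_cases[OF r(1)] .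
 have "lact gm (lcls (M, psi)) = labeled_act G (wrep gm) ` lcls (M, psi)"
  unfolding Gamma_labeled_action_def wrep_def ..
 also have "... = lcls (labeled_act G (wrep gm) (M, psi))"
  unfolding we(1) by (rule wreath_element.labeled_act_lcls[OF we(2) x])
 also have "... = lcls (labeled_act G w (M, psi))"
  by (rule labeled_act_cong[OF r(1) w(1) _ x]) (use r(2) w(2) in simp)
 finally show ?thesis .
qed

lemma labeled_act_one:
 assumes x: "(M, psi) : LM"
 shows "lcls (labeled_act G W_one (M, psi)) = lcls (M, psi)"
proof -
 obtain g sg phi where we: "W_one = (g, sg, phi)" "wreath_element G n g sg phi" using W_cases[OF W_one_closed] .
 interpret A: wreath_element G n g sg phi by (rule we(2))
 have "sg = id" using we(1) unfolding W_one_def by simp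
 hence f: "fst (labeled_act G W_one (M, psi)) = M"
  unfolding we(1) A.labeled_act_eq using image_matroid_id[of M] by (simp add: id_def)
 moreover have "lgains (labeled_act G W_one (M, psi)) = lgains (M, psi)"
  using A.lgains_act[OF x] tact_image_one[OF lgains_triples] we(1) by simp
 moreover have "labeled_act G W_one (M, psi) : LM" using A.labeled_act_LM(1)[OF x] we(1) by simp
 ultimately show ?thesis using x lcls_eq_iff by (metis prod.collapse)
qed

lemma labeled_act_mult:
 assumes w: "w : carrier W" and v: "v : carrier W" and x: "(M, th) : LM"
 shows "lcls (labeled_act G (w \<otimes>\<^bsub>W\<^esub> v) (M, th)) = lcls (labeled_act G w (labeled_act G v (M, th)))"
proof -
 note wv = tact_image_mult(2)[OF w v subset_refl]
 obtain g sg phi where we: "w = (g, sg, phi)" "wreath_element G n g sg phi" using W_cases[OF w] .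
 obtain h tau psi where ve: "v = (h, tau, psi)" "wreath_element G n h tau psi" using W_cases[OF v] .
 obtain k rho eta where ue: "w \<otimes>\<^bsub>W\<^esub> v = (k, rho, eta)" "wreath_element G n k rho eta" using W_cases[OF wv] .
 interpret A: wreath_element G n g sg phi by (rule we(2))
 interpret B: wreath_element G n h tau psi by (rule ve(2))
 interpret C: wreath_element G n k rho eta by (rule ue(2))
 have rho: "rho = sg \<circ> tau" using ue(1) W_mult_eq[OF w[unfolded we(1)] v[unfolded ve(1)]] we(1) ve(1) by simp
 obtain N chi where y: "labeled_act G v (M, th) = (N, chi)" by (metis surj_pair)
 have yL: "(N, chi) : LM" using B.labeled_act_LM(1)[OF x] y ve(1) by simp
 have N: "N = image_matroid tau M" using y B.labeled_act_eq ve(1) by simp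
 have "fst (labeled_act G (w \<otimes>\<^bsub>W\<^esub> v) (M, th)) = fst (labeled_act G w (N, chi))"
 proof -
  have "fst (labeled_act G (w \<otimes>\<^bsub>W\<^esub> v) (M, th)) = image_matroid rho M" unfolding ue(1) C.labeled_act_eq by simp
  moreover have "fst (labeled_act G w (N, chi)) = image_matroid sg N" unfolding we(1) A.labeled_act_eq by simp
  ultimately show ?thesis unfolding N rho by (simp add: image_image_matroid)
 qed
 moreover have "lgains (labeled_act G (w \<otimes>\<^bsub>W\<^esub> v) (M, th)) = lgains (labeled_act G w (N, chi))"
  using C.lgains_act[OF x] A.lgains_act[OF yL] B.lgains_act[OF x] tact_image_mult(1)[OF w v lgains_triples]
   ue(1) we(1) ve(1) y by simp
 moreover have "labeled_act G (w \<otimes>\<^bsub>W\<^esub> v) (M, th) : LM" "labeled_act G w (N, chi) : LM"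
  using C.labeled_act_LM(1)[OF x] A.labeled_act_LM(1)[OF yL] ue(1) we(1) by auto
 ultimately show ?thesis unfolding y using lcls_eq_iff by (metis prod.collapse)
qed

lemma A_set_cases:
 assumes "X : A_set G n r"
 obtains M psi where "(M, psi) : LM" "int (matroid_rank M) = r" "X = lcls (M, psi)"
 using assms unfolding A_set_eq by auto

lemma lact_A_set:
 assumes g: "gm : carrier GG" and X: "X : A_set G n r"
 shows "lact gm X : A_set G n r"
proof -
 obtain M psi where x: "(M, psi) : LM" "int (matroid_rank M) = r" "X = lcls (M, psi)" using A_set_cases[OF X] .
 note r = wrep[OF g]
 obtain h sg phi where we: "wrep gm = (h, sg, phi)" "wreath_element G n h sg phi" using W_cases[OF r(1)] .
 note L = wreath_element.labeled_act_LM[OF we(2) x(1), folded we(1)]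
 obtain N chi where y: "labeled_act G (wrep gm) (M, psi) = (N, chi)" by (metis surj_pair)
 show ?thesis unfolding x(3) lact_lcls[OF g r x(1)] A_set_eq using L x(2) unfolding y by auto
qed

lemma acts_on_A_set: "acts_on GG (A_set G n r) lact" unfolding acts_on_def
proof (intro conjI ballI)
 show "finite (A_set G n r)" by (rule finite_A_set)
 fix X assume X: "X : A_set G n r"
 obtain M psi where x: "(M, psi) : LM" "X = lcls (M, psi)" using A_set_cases[OF X] by metis
 have "\<one>\<^bsub>GG\<^esub> : carrier GG" by (rule monoid.one_closed[OF group.is_monoid[OF group_Gamma]])
 from lact_lcls[OF this W_one_closed _ x(1)] show "lact \<one>\<^bsub>GG\<^esub> X = X"
  using labeled_act_one[OF x(1)] dowling_hom_one unfolding one_Gamma x(2) by simp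
 fix dl assume d: "dl : carrier GG"
 show "lact dl X : A_set G n r" by (rule lact_A_set[OF d X])
 fix gm assume g: "gm : carrier GG"
 note rg = wrep[OF g] and rd = wrep[OF d]
 have gd: "gm \<otimes>\<^bsub>GG\<^esub> dl : carrier GG" by (rule monoid.m_closed[OF group.is_monoid[OF group_Gamma] g d])
 have hm: "dowling_hom G n (wrep gm \<otimes>\<^bsub>W\<^esub> wrep dl) = gm \<otimes>\<^bsub>GG\<^esub> dl"
  unfolding dowling_hom_mult[OF rg(1) rd(1)] mult_Gamma[OF g d] rg(2) rd(2) ..
 obtain h sg phi where we: "wrep dl = (h, sg, phi)" "wreath_element G n h sg phi" using W_cases[OF rd(1)] .
 obtain N chi where y: "labeled_act G (wrep dl) (M, psi) = (N, chi)" by (metis surj_pair)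
 have yL: "(N, chi) : LM" using wreath_element.labeled_act_LM(1)[OF we(2) x(1)] y we(1) by simp
 have "lact (gm \<otimes>\<^bsub>GG\<^esub> dl) X = lcls (labeled_act G (wrep gm \<otimes>\<^bsub>W\<^esub> wrep dl) (M, psi))"
  unfolding x(2) by (rule lact_lcls[OF gd tact_image_mult(2)[OF rg(1) rd(1) subset_refl] hm x(1)])
 also have "... = lcls (labeled_act G (wrep gm) (N, chi))"
  using labeled_act_mult[OF rg(1) rd(1) x(1)] unfolding y .
 also have "... = lact gm (lcls (N, chi))" using lact_lcls[OF g rg yL] by simp
 also have "lcls (N, chi) = lact dl X" unfolding x(2) using lact_lcls[OF d rd x(1)] y by simp
 finally show "lact (gm \<otimes>\<^bsub>GG\<^esub> dl) X = lact gm (lact dl X)" .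
qed

end

section \<open>The flat below a labeled matroid\<close>

lemma nonloop_parallel_trans:
 assumes M: "is_matroid M" and "{j} : indeps M" "{i, j} ~: indeps M" "{j, k} ~: indeps M" "i ~= k"
 shows "{i, k} ~: indeps M"
proof
 assume ik: "{i, k} : indeps M"
 have "card {j} < card {i, k}" using assms(5) by simp
 hence "EX e:{i, k} - {j}. insert e {j} : indeps M" by (rule indep_augment[OF M assms(2) ik])
 thus False using assms(3,4) by (auto simp: insert_commute)
qed

lemma parallel_connected:
 assumes M: "is_matroid M" and ij: "{i} : indeps M" "{j} : indeps M" "{i, j} ~: indeps M"
 shows "(i, j) : connectivity_rel M"
proof -
 have "i : ground M" "j : ground M" using M ij unfolding is_matroid_def by auto
 moreover have "D : indeps M" if D: "D < {i, j}" for D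
 proof -
  have "D <= {i} | D <= {j}" using D by auto
  thus ?thesis using M ij unfolding is_matroid_def by blast
 qed
 ultimately have "{i, j} : circuits M" unfolding circuits_def using ij(3) by blast
 thus ?thesis unfolding connectivity_rel_def using \<open>i : ground M\<close> \<open>j : ground M\<close> by blast
qed

lemma loop_connected:
 assumes "{i} ~: indeps M" "(i, j) : connectivity_rel M"
 shows "i = j"
proof (rule ccontr)
 assume ne: "i ~= j"
 then obtain C where "C : circuits M" "i : C" "j : C" using assms(2) unfolding connectivity_rel_def by blast
 moreover from this ne have "{i} < C" by blast
 ultimately show False using assms(1) unfolding circuits_def by blast
qed

lemma push_image:
 assumes "sg ` S = S" "inj sg" "!!i. i : S ==> b (sg i) = tau (b i)"
 shows "push_matroid b S (image_matroid sg M) = image_matroid tau (push_matroid b S M)"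
proof (rule matroid_eqI)
 have bs: "b ` sg ` J = tau ` b ` J" if "J <= S" for J
  unfolding image_image by (rule image_cong[OF refl]) (use that assms(3) in blast)
 show "ground (push_matroid b S (image_matroid sg M)) = ground (image_matroid tau (push_matroid b S M))"
  using bs[of S] assms(1) by simp
 have sub: "sg ` J <= S <-> J <= S" for J using inj_image_subset_iff[OF assms(2), of J S] assms(1) by simp
 show "indeps (push_matroid b S (image_matroid sg M)) = indeps (image_matroid tau (push_matroid b S M))"
 proof (intro subset_antisym subsetI)
  fix K assume "K : indeps (push_matroid b S (image_matroid sg M))"
  then obtain J where J: "J : indeps M" "sg ` J <= S" "K = b ` sg ` J"
   unfolding indeps_push indeps_image by blast
  hence "J <= S" using sub by blast
  thus "K : indeps (image_matroid tau (push_matroid b S M))"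
   unfolding indeps_push indeps_image J(3) bs[OF \<open>J <= S\<close>] using J(1) by blast
 next
  fix K assume "K : indeps (image_matroid tau (push_matroid b S M))"
  then obtain J where J: "J : indeps M" "J <= S" "K = tau ` b ` J" unfolding indeps_push indeps_image by blast
  have "sg ` J <= S" using sub J(2) by blast
  thus "K : indeps (push_matroid b S (image_matroid sg M))"
   unfolding indeps_push indeps_image J(3) bs[OF J(2), symmetric] using J(1) by blast
 qed
qed

lemma pull_image:
 assumes "sg ` S = S" "sg ` U = U" "inj sg" "!!i. i : S ==> b (sg i) = tau (b i)"
  and t: "inj_on tau (b ` S)" and N: "is_matroid N" "b ` S = ground N"
 shows "pull_matroid b S U (image_matroid tau N) = image_matroid sg (pull_matroid b S U N)"
proof (rule matroid_eqI)
 show "ground (pull_matroid b S U (image_matroid tau N)) = ground (image_matroid sg (pull_matroid b S U N))"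
  using assms(2) by simp
 have bs: "b ` sg ` J = tau ` b ` J" if "J <= S" for J
  unfolding image_image by (rule image_cong[OF refl]) (use that assms(4) in blast)
 have inj: "inj_on b (sg ` J) <-> inj_on b J" if J: "J <= S" for J
 proof -
  have iff: "b (sg x) = b (sg y) <-> b x = b y" if xy: "x : J" "y : J" for x y
  proof -
   have "x : S" "y : S" using xy J by auto
   thus ?thesis using assms(4)[of x] assms(4)[of y] inj_on_eq_iff[OF t, of "b x" "b y"] by simp
  qed
  show ?thesis
  proof
   assume L: "inj_on b (sg ` J)"
   show "inj_on b J"
   proof (rule inj_onI)
    fix x y assume xy: "x : J" "y : J" "b x = b y"
    hence "sg x = sg y" using inj_onD[OF L, of "sg x" "sg y"] iff[OF xy(1,2)] by simp
    thus "x = y" by (rule injD[OF assms(3)])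
   qed
  next
   assume R: "inj_on b J"
   show "inj_on b (sg ` J)"
   proof (rule inj_onI, elim imageE)
    fix u v x y assume e: "b u = b v" "u = sg x" "v = sg y" and xy: "x : J" "y : J"
    hence "x = y" using inj_onD[OF R, of x y] iff[OF xy] by simp
    thus "u = v" using e by simp
   qed
  qed
 qed
 have ind: "tau ` b ` J : (`) tau ` indeps N <-> b ` J : indeps N" if J: "J <= S" for J
 proof
  assume "tau ` b ` J : (`) tau ` indeps N"
  then obtain K where K: "K : indeps N" "tau ` b ` J = tau ` K" by blast
  have "K <= b ` S" "b ` J <= b ` S" using K(1) N J unfolding is_matroid_def by auto
  from inj_on_image_eq_iff[OF t this(2,1)] K(2) have "b ` J = K" by simp
  thus "b ` J : indeps N" using K(1) by simp
 qed blast
 show "indeps (pull_matroid b S U (image_matroid tau N)) = indeps (image_matroid sg (pull_matroid b S U N))"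
 proof (intro subset_antisym subsetI)
  fix I assume I: "I : indeps (pull_matroid b S U (image_matroid tau N))"
  hence IS: "I <= S" unfolding indeps_pull by blast
  then obtain J where J: "J <= S" "I = sg ` J" using assms(1) by (metis subset_imageE)
  have "inj_on b I" "b ` I : (`) tau ` indeps N" using I unfolding indeps_pull indeps_image by auto
  hence "inj_on b J" "b ` J : indeps N" using ind[OF J(1)] inj[OF J(1)] bs[OF J(1)] unfolding J(2) by auto
  thus "I : indeps (image_matroid sg (pull_matroid b S U N))"
   unfolding J(2) indeps_pull indeps_image using J(1) by (intro imageI) simp
 next
  fix I assume "I : indeps (image_matroid sg (pull_matroid b S U N))"
  then obtain J where J: "J <= S" "I = sg ` J" "inj_on b J" "b ` J : indeps N"
   unfolding indeps_pull indeps_image by blast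
  have "sg ` J <= S" using J(1) assms(1) by blast
  moreover have "inj_on b I" using inj[OF J(1)] J(2,3) by simp
  moreover have "b ` I : (`) tau ` indeps N" unfolding J(2) bs[OF J(1)] using J(4) by (rule imageI)
  ultimately show "I : indeps (pull_matroid b S U (image_matroid tau N))"
   unfolding indeps_pull indeps_image using J(2) by simp
 qed
qed

context dowling
begin

text \<open>The gains forced by the loops and the parallel classes of a labeled matroid.\<close>

definition dgains :: "'g labeled_matroid => 'g gains" where
 "dgains = (%(M, psi). {(i, a, j). (i, a, j) : triples & ({i} : indeps M <-> {j} : indeps M) \<and>
   ({i} : indeps M --> (i = j | {i, j} ~: indeps M) & psi i \<otimes> a = psi j)})"

lemma mem_dgains: "(i, a, j) : dgains (M, psi) <-> i <= n & a : carrier G & j <= n \<and>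
  ({i} : indeps M <-> {j} : indeps M) \<and>
  ({i} : indeps M --> (i = j | {i, j} ~: indeps M) & psi i \<otimes> a = psi j)"
 unfolding dgains_def triples_def by auto

lemma dgains_triples: "dgains x <= triples" unfolding dgains_def by (cases x) auto

lemma LM_nonloop:
 assumes "(M, psi) : LM" "{i} : indeps M"
 shows "i : {1..n}" "psi i : carrier G"
proof -
 show "i : {1..n}" using LM_D(2,3)[OF assms(1)] assms(2) unfolding is_matroid_def by auto
 thus "psi i : carrier G" by (rule LM_D(5)[OF assms(1)])
qed

lemma LM_zero: "(M, psi) : LM ==> {0} ~: indeps M" using LM_nonloop(1)[of M psi 0] by auto

lemma gain_closed_dgains:
 assumes x: "(M, psi) : LM"
 shows "gain_closed (dgains (M, psi))"
proof -
 note nl = LM_nonloop[OF x]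
 have "(j, inv g, i) : dgains (M, psi)" if t: "(i, g, j) : dgains (M, psi)" for i g j
 proof -
  have "psi j \<otimes> inv g = psi i" if "{j} : indeps M"
  proof -
   have e: "psi j = psi i \<otimes> g" "{i} : indeps M" "g : carrier G" using t that unfolding mem_dgains by auto
   show ?thesis unfolding e(1) using nl(2)[OF e(2)] e(3) by (simp add: m_assoc)
  qed
  thus ?thesis using t unfolding mem_dgains by (auto simp: insert_commute)
 qed
 moreover have "(i, g \<otimes> h, k) : dgains (M, psi)" if t: "(i, g, j) : dgains (M, psi)" "(j, h, k) : dgains (M, psi)" for i g j h k
 proof -
  have "(i = k | {i, k} ~: indeps M) & psi i \<otimes> (g \<otimes> h) = psi k" if i: "{i} : indeps M"
  proof
   have j: "{j} : indeps M" and p: "i = j | {i, j} ~: indeps M" "j = k | {j, k} ~: indeps M"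
    and e: "psi i \<otimes> g = psi j" "psi j \<otimes> h = psi k" using t i unfolding mem_dgains by auto
   show "i = k | {i, k} ~: indeps M" using nonloop_parallel_trans[OF LM_D(2)[OF x] j, of i k] p by blast
   have "g : carrier G" "h : carrier G" using t unfolding mem_dgains by auto
   thus "psi i \<otimes> (g \<otimes> h) = psi k" using e nl(2)[OF i] m_assoc[of "psi i" g h] by simp
  qed
  thus ?thesis using t unfolding mem_dgains by auto
 qed
 moreover have "(i, \<one>, 0) : dgains (M, psi)" if t: "(i, g, i) : dgains (M, psi)" "g ~= \<one>" for i g
 proof -
  have "{i} ~: indeps M" using t nl(2)[of i] unfolding mem_dgains by auto
  thus ?thesis using t LM_zero[OF x] unfolding mem_dgains by auto
 qed
 moreover have "(i, \<one>, i) : dgains (M, psi)" if "i : {0..n}" for i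
  using that nl(2)[of i] unfolding mem_dgains by auto
 moreover have "(i, h, 0) : dgains (M, psi)" if "(i, g, 0) : dgains (M, psi)" "h : carrier G" for i g h
  using that LM_zero[OF x] unfolding mem_dgains by auto
 ultimately show ?thesis unfolding gain_closed_def using dgains_triples by blast
qed

lemma supp_dgains: "(M, psi) : LM ==> i : supp (dgains (M, psi)) <-> {i} : indeps M"
 using LM_zero[of M psi] LM_nonloop[of M psi i] unfolding supp_def mem_dgains by auto

text \<open>Among nonloops, only labels of equal or parallel elements are compared, and these lie in
  one component, where a class fixes the relative labels.\<close>

lemma dgains_cong:
 assumes x: "(M, psi) : LM" "(M, chi) : LM" and e: "lgains (M, psi) = lgains (M, chi)"
 shows "dgains (M, psi) = dgains (M, chi)"
proof (rule triples_eqI[OF dgains_triples dgains_triples])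
 fix i a j assume t: "(i, a, j) : triples"
 have "psi i \<otimes> a = psi j <-> chi i \<otimes> a = chi j"
  if "{i} : indeps M" "{j} : indeps M" "i = j | {i, j} ~: indeps M"
 proof -
  have ij: "i : {1..n}" "j : {1..n}" using that LM_nonloop(1)[OF x(1)] by auto
  have "(i, j) : connectivity_rel M"
   using parallel_connected[OF LM_D(2)[OF x(1)] that(1,2)] that(3) ij LM_D(3)[OF x(1)]
   by (auto simp: connectivity_rel_def)
  moreover have "(i, a, j) : lgains (M, psi) <-> (i, a, j) : lgains (M, chi)" using e by simp
  ultimately show ?thesis using ij t unfolding lgains_def triples_def by auto
 qed
 thus "(i, a, j) : dgains (M, psi) <-> (i, a, j) : dgains (M, chi)" unfolding mem_dgains by blast
qed

definition dgc :: "'g labeled_matroid set => 'g gains" where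
 "dgc X = dgains (SOME x. x : X)"

lemma lcls_self: "(M, psi) : LM ==> (M, psi) : lcls (M, psi)" using lcls_eq by blast

lemma dgc_lcls:
 assumes x: "(M, psi) : LM"
 shows "dgc (lcls (M, psi)) = dgains (M, psi)"
proof -
 have "(SOME x. x : lcls (M, psi)) : lcls (M, psi)" using lcls_self[OF x] by (rule someI)
 then obtain chi where c: "(SOME x. x : lcls (M, psi)) = (M, chi)" "(M, chi) : LM" "lgains (M, chi) = lgains (M, psi)"
  unfolding lcls_eq[OF x] by blast
 show ?thesis unfolding dgc_def c(1) by (rule dgains_cong[OF c(2) x c(3)])
qed

lemma gain_closed_dgc: "X : A_set G n r ==> gain_closed (dgc X)"
 using A_set_cases dgc_lcls gain_closed_dgains by metis

text \<open>A loop is a further point of the zero block and a parallel pair a nontrivial relation,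
  so simplicity means that no gain beyond the bottom is forced.\<close>

lemma simple_iff_dgains:
 assumes x: "(M, psi) : LM"
 shows "simple_matroid M <-> dgains (M, psi) = bot_gains"
proof
 note X = LM_D[OF x]
 assume s: "simple_matroid M"
 have nl: "{i} : indeps M" if "i : {1..n}" for i using s that X(3) unfolding simple_matroid_def loopless_def by blast
 have np: "{i, j} : indeps M" if ij: "i : {1..n}" "j : {1..n}" "i ~= j" for i j
 proof (rule ccontr)
  assume a: "{i, j} ~: indeps M"
  have "D : indeps M" if D: "D < {i, j}" for D
  proof -
   have "D <= {i} | D <= {j}" using D by auto
   thus ?thesis using X(2) nl[OF ij(1)] nl[OF ij(2)] unfolding is_matroid_def by blast
  qed
  hence "{i, j} : circuits M" using a ij X(3) unfolding circuits_def by blast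
  thus False using s ij(3) unfolding simple_matroid_def by auto
 qed
 show "dgains (M, psi) = bot_gains"
 proof (rule subset_antisym[OF _ bot_gains_least[OF gain_closed_dgains[OF x]]], rule subsetI)
  fix t assume t: "t : dgains (M, psi)"
  obtain i a j where te: "t = (i, a, j)" by (metis surj_pair)
  note T = t[unfolded te mem_dgains]
  show "t : bot_gains"
  proof (cases "i = 0")
   case True
   hence "{j} ~: indeps M" using T LM_zero[OF x] by auto
   hence "j = 0" using nl[of j] T by (cases j) auto
   thus ?thesis unfolding te bot_gains_def using True T by auto
  next
   case False
   hence i: "i : {1..n}" using T by auto
   hence "j : {1..n}" using T nl[of i] LM_nonloop(1)[OF x, of j] by blast
   hence "i = j" using np[OF i] T nl[OF i] by blast
   moreover have "a = \<one>" using T nl[OF i] X(5)[OF i] calculation by auto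
   ultimately show ?thesis unfolding te bot_gains_def using T by auto
  qed
 qed
next
 note X = LM_D[OF x]
 assume d: "dgains (M, psi) = bot_gains"
 have nl: "{i} : indeps M" if "i : {1..n}" for i
 proof (rule ccontr)
  assume "{i} ~: indeps M"
  hence "(i, \<one>, 0) : dgains (M, psi)" unfolding mem_dgains using that LM_zero[OF x] by auto
  thus False unfolding d bot_gains_def using that by auto
 qed
 have "card C ~= 2" if C: "C : circuits M" for C
 proof
  assume "card C = 2"
  then obtain i j where ij: "C = {i, j}" "i ~= j" by (auto simp: card_2_iff)
  have ijn: "i : {1..n}" "j : {1..n}" using C X(3) unfolding circuits_def ij(1) by auto
  have pc: "psi i : carrier G" "psi j : carrier G" using X(5) ijn by auto
  have "(i, inv (psi i) \<otimes> psi j, j) : dgains (M, psi)"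
   unfolding mem_dgains using ijn nl C pc unfolding circuits_def ij(1) by (auto simp: m_assoc[symmetric])
  thus False unfolding d bot_gains_def using ij(2) ijn by auto
 qed
 thus "simple_matroid M" unfolding simple_matroid_def loopless_def using nl X(3) by auto
qed

lemma S_set_dgc: "S_set G n r = {X : A_set G n r. dgc X = bot_gains}"
 unfolding S_set_eq A_set_eq using simple_iff_dgains dgc_lcls by (auto simp: image_iff)

subsection \<open>Relative duality\<close>

lemma block_compatible_dgains:
 assumes x: "(M, psi) : LM" and D: "gain_closed D" "D <= dgains (M, psi)"
 shows "block_compatible (block D) (supp D) M"
proof -
 have "supp D <= ground M" using supp_subset LM_D(3)[OF x] by simp
 moreover have "{i} ~: indeps M" if i: "i : ground M - supp D" for i
 proof -
  have "(i, \<one>, 0) : D" using i LM_D(3)[OF x] unfolding supp_def by auto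
  hence "(i, \<one>, 0) : dgains (M, psi)" using D(2) by blast
  thus ?thesis using LM_zero[OF x] unfolding mem_dgains by blast
 qed
 moreover have "({i} : indeps M <-> {j} : indeps M) & (i ~= j --> {i, j} ~: indeps M)"
  if ij: "i : supp D" "j : supp D" "block D i = block D j" for i j
 proof -
  obtain g where "(i, g, j) : D" using block_eq_iff[OF D(1) ij(1)] ij(3) by blast
  hence t: "(i, g, j) : dgains (M, psi)" using D(2) by blast
  have "{i, j} ~: indeps M" if "{i} ~: indeps M"
   using that LM_D(2)[OF x] unfolding is_matroid_def by (metis insert_subset empty_subsetI insertI1)
  thus ?thesis using t unfolding mem_dgains by blast
 qed
 ultimately show ?thesis unfolding block_compatible_def by blast
qed

text \<open>\<open>D <= dgains (M, psi)\<close> says nothing about labels at loops of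
  \<open>M\<close> inside \<open>supp D\<close>. Relative duality can make these nonloops, so their
  labels have to fit \<open>D\<close> as well.\<close>

definition compat :: "'g gains => (nat => 'g) => bool" where
 "compat D psi <-> (ALL i:supp D. ALL g j. (i, g, j) : D --> psi i \<otimes> g = psi j)"

lemma compat_dgains:
 assumes x: "(M, psi) : LM" and D: "gain_closed D" and c: "block_compatible (block D) (supp D) M" "compat D psi"
 shows "D <= dgains (M, psi)"
proof
 fix t assume t: "t : D"
 obtain i a j where te: "t = (i, a, j)" by (metis surj_pair)
 have tD: "(i, a, j) : D" using t te by simp
 note b = gain_triple[OF D tD]
 show "t : dgains (M, psi)"
 proof (cases "i : supp D")
  case True
  hence j: "j : supp D" using gain_supp[OF D tD] by simp
  have "block D i = block D j" using block_eq_iff[OF D True] tD by blast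
  hence "({i} : indeps M <-> {j} : indeps M) & (i ~= j --> {i, j} ~: indeps M)"
   using c(1) True j unfolding block_compatible_def by blast
  moreover have "psi i \<otimes> a = psi j" using c(2) True tD unfolding compat_def by blast
  ultimately show ?thesis unfolding te mem_dgains using b by blast
 next
  case False
  hence j: "j ~: supp D" using gain_supp[OF D tD] by simp
  have "{k} ~: indeps M" if k: "k ~: supp D" for k
  proof
   assume "{k} : indeps M"
   moreover from this have "k : ground M" using LM_nonloop(1)[OF x] LM_D(3)[OF x] by simp
   ultimately show False using c(1) k unfolding block_compatible_def by blast
  qed
  thus ?thesis unfolding te mem_dgains using b False j by blast
 qed
qed

text \<open>A loop is a component of its own, so its label can be changed freely within the class;
  on loops in \<open>supp D\<close> it is taken from a partial partition realizing
  \<open>D\<close>.\<close>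

lemma compat_exists:
 assumes x: "(M, psi) : LM" and D: "gain_closed D" "D <= dgains (M, psi)"
 obtains chi where "(M, chi) : LM" "lgains (M, chi) = lgains (M, psi)" "compat D chi"
proof -
 note X = LM_D[OF x]
 obtain y where y: "y : PP" "gains y = D" using gain_realizable[OF D(1)] .
 obtain S f P where ye: "y = (S, f, P)" by (metis surj_pair)
 note y' = y(1)[unfolded ye]
 have Dg: "gains (S, f, P) = D" using y(2) ye by simp
 have SD: "S = supp D" using supp_gains[OF y'] Dg by simp
 define chi where "chi i = (if i : supp D & {i} ~: indeps M then f i else psi i)" for i
 have "chi i : carrier G" if "i : {1..n}" for i
  using X(5)[OF that] PP_D(4)[OF y', of i] SD unfolding chi_def by simp
 moreover have "chi i = undefined" if "i ~: {1..n}" for i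
  using that X(4) supp_subset[of D] unfolding chi_def by (auto simp: PiE_def extensional_def)
 ultimately have "chi : {1..n} \<rightarrow>\<^sub>E carrier G" by (intro PiE_I) auto
 hence xc: "(M, chi) : LM" using X(1,3) unfolding LM_def by simp
 have "lgains (M, chi) = lgains (M, psi)"
 proof (rule triples_eqI[OF lgains_triples lgains_triples])
  fix i a j assume t: "(i, a, j) : triples"
  have "chi i \<otimes> a = chi j <-> psi i \<otimes> a = psi j" if c: "(i, j) : connectivity_rel M" "i : {1..n}"
  proof (cases "{i} : indeps M")
   case True
   hence "{j} : indeps M" using connectivity_nonloop[OF X(2) c(1)] by blast
   thus ?thesis using True unfolding chi_def by simp
  next
   case False
   hence ij: "i = j" using loop_connected[OF _ c(1)] by simp
   have "a : carrier G" using t unfolding triples_def by simp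
   moreover have "chi j : carrier G" "psi j : carrier G" using LM_D(5)[OF xc c(2)] X(5)[OF c(2)] ij by auto
   ultimately show ?thesis using ij by simp
  qed
  thus "(i, a, j) : lgains (M, chi) <-> (i, a, j) : lgains (M, psi)" unfolding lgains_def by auto
 qed
 moreover have "compat D chi" unfolding compat_def
 proof (intro ballI allI impI)
  fix i g j assume i: "i : supp D" and t: "(i, g, j) : D"
  have j: "j : supp D" using gain_supp[OF D(1) t] i by simp
  have d: "(i, g, j) : dgains (M, psi)" using t D(2) by blast
  show "chi i \<otimes> g = chi j"
  proof (cases "{i} : indeps M")
   case True
   thus ?thesis using d unfolding mem_dgains chi_def by simp
  next
   case False
   moreover have "f i \<otimes> g = f j"
    using t[folded Dg] mem_gains_iff[OF y' gain_triple(1)[OF D(1) t] gain_triple(3)[OF D(1) t] gain_triple(2)[OF D(1) t]]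
     i j SD by blast
   ultimately show ?thesis using d i j unfolding mem_dgains chi_def by simp
  qed
 qed
 ultimately show thesis by (rule that[OF xc])
qed

text \<open>Collapses the blocks of \<open>D\<close>, dualizes, and blows up again. Elements outside
  \<open>supp D\<close> stay loops; for \<open>D = bot_gains\<close> this is the ordinary dual of a
  matroid on \<open>{1..n}\<close>.\<close>

definition reldual :: "'g gains => nat matroid => nat matroid" where
 "reldual D M = pull_matroid (block D) (supp D) {1..n} (dual_matroid (push_matroid (block D) (supp D) M))"

context
 fixes D :: "'g gains" and M :: "nat matroid" and psi :: "nat => 'g"
 assumes D: "gain_closed D" and x: "(M, psi) : LM" and bc: "block_compatible (block D) (supp D) M"
begin

private abbreviation "N \<equiv> push_matroid (block D) (supp D) M"

lemma push_block_matroid: "is_matroid N" "is_matroid (dual_matroid N)"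
 using push_is_matroid[OF LM_D(2)[OF x] bc] dual_is_matroid by auto

lemma pull_push_block: "pull_matroid (block D) (supp D) {1..n} N = M"
 using pull_push[OF LM_D(2)[OF x] bc] LM_D(3)[OF x] by simp

lemma push_block_rank: "matroid_rank N = matroid_rank M"
 using matroid_rank_pull[OF push_block_matroid(1) finite_atLeastAtMost supp_subset[of D], of "block D"] pull_push_block by simp

lemma push_block_quasi: "quasi_series_parallel N"
 using quasi_series_parallel_pull[OF push_block_matroid(1) finite_atLeastAtMost supp_subset[of D], of "block D"]
  pull_push_block LM_D(1)[OF x] by simp

lemma reldual_LM: "(reldual D M, psi) : LM" unfolding LM_def reldual_def
 using quasi_series_parallel_pull[OF push_block_matroid(2) finite_atLeastAtMost supp_subset[of D], of "block D"]
  quasi_series_parallel_dual[OF push_block_quasi] LM_D(4)[OF x] by simp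

lemma reldual_rank: "matroid_rank (reldual D M) + matroid_rank M = nblocks D" unfolding reldual_def
 using matroid_rank_pull[OF push_block_matroid(2) finite_atLeastAtMost supp_subset[of D], of "block D"]
  matroid_rank_dual[OF push_block_matroid(1)] push_block_rank by (simp add: nblocks_def)

lemma rank_le_nblocks: "matroid_rank M <= nblocks D" using reldual_rank by simp

lemma block_compatible_reldual: "block_compatible (block D) (supp D) (reldual D M)"
 unfolding reldual_def by (rule block_compatible_pull[OF supp_subset])

lemma reldual_reldual: "reldual D (reldual D M) = M"
proof -
 have "push_matroid (block D) (supp D) (reldual D M) = dual_matroid N"
  unfolding reldual_def by (rule push_pull[OF push_block_matroid(2)]) simp
 thus ?thesis
  unfolding reldual_def[of D "reldual D M"] using dual_dual[OF push_block_matroid(1)] pull_push_block by simp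
qed

text \<open>Connectivity of single elements may change: loops of \<open>M\<close> in one block
  become connected. Within a block both labelings take their gain from \<open>D\<close> by
  \<open>compat\<close>; across blocks, connectivity is the same in \<open>N\<close> and its dual
  and lifts back to \<open>M\<close>.\<close>

lemma reldual_lgains_cong:
 assumes y: "(M, chi) : LM" and c: "compat D psi" "compat D chi" and e: "lgains (M, psi) = lgains (M, chi)"
 shows "lgains (reldual D M, psi) = lgains (reldual D M, chi)"
proof (rule triples_eqI[OF lgains_triples lgains_triples])
 fix i a j assume t: "(i, a, j) : triples"
 have "psi i \<otimes> a = psi j <-> chi i \<otimes> a = chi j"
  if r: "(i, j) : connectivity_rel (reldual D M)" and ij: "i : {1..n}" "j : {1..n}"
 proof -
  have ac: "a : carrier G" using t unfolding triples_def by simp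
  note pc = LM_D(5)[OF x ij(1)] LM_D(5)[OF y ij(1)]
  show ?thesis
  proof (cases "i = j")
   case True
   thus ?thesis using pc ac by simp
  next
   case ne: False
   hence S: "i : supp D" "j : supp D" "(block D i, block D j) : connectivity_rel N"
    using r connectivity_pull[OF push_block_matroid(2) finite_atLeastAtMost supp_subset[of D], of "block D" i j]
     connectivity_dual[OF push_block_matroid(1)] unfolding reldual_def by auto
   show ?thesis
   proof (cases "block D i = block D j")
    case True
    then obtain g where g: "(i, g, j) : D" using block_eq_iff[OF D S(1)] by blast
    hence "psi i \<otimes> g = psi j" "chi i \<otimes> g = chi j" using c S(1) unfolding compat_def by blast+
    moreover have "u \<otimes> a = u \<otimes> g <-> a = g" if "u : carrier G" for u
     using Units_l_cancel[of u a g] that ac gain_triple(2)[OF D g] by (simp add: Units_eq)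
    ultimately show ?thesis using pc by metis
   next
    case False
    have "{block D i} : indeps N" "{block D j} : indeps N"
    proof -
     show "{block D i} : indeps N" using loop_connected[of "block D i" N "block D j"] S(3) False by blast
     thus "{block D j} : indeps N" using connectivity_nonloop[OF push_block_matroid(1) S(3)] by blast
    qed
    hence "(i, j) : connectivity_rel M"
     using connectivity_pull[OF push_block_matroid(1) finite_atLeastAtMost supp_subset[of D], of "block D" i j]
      pull_push_block S ij by simp
    moreover have "(i, a, j) : lgains (M, psi) <-> (i, a, j) : lgains (M, chi)" using e by simp
    ultimately show ?thesis using ij ac unfolding lgains_def by auto
   qed
  qed
 qed
 thus "(i, a, j) : lgains (reldual D M, psi) <-> (i, a, j) : lgains (reldual D M, chi)"
  unfolding lgains_def by auto
qed

text \<open>When nothing beyond \<open>D\<close> is forced, the matroid on the blocks is simple: a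
  loop or a parallel pair among them would be a further gain. Then \<open>simple_bound\<close>
  applies.\<close>

lemma rank_bound:
 assumes d: "dgains (M, psi) = D" and pos: "0 < nblocks D"
 shows "nblocks D < 2 * matroid_rank M"
proof -
 have nl: "{block D i} : indeps N" if "i : supp D" for i
 proof -
  have "{i} : indeps M" using that supp_dgains[OF x] d by simp
  moreover have "{block D i} = block D ` {i}" by simp
  ultimately show ?thesis unfolding indeps_push using that by blast
 qed
 have "card C ~= 2" if C: "C : circuits N" for C
 proof
  assume "card C = 2"
  then obtain A B where AB: "C = {A, B}" "A ~= B" by (auto simp: card_2_iff)
  obtain i j where ij: "i : supp D" "j : supp D" "A = block D i" "B = block D j"
   using C unfolding circuits_def AB(1) by auto
  have nij: "{i} : indeps M" "{j} : indeps M" using ij supp_dgains[OF x] d by auto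
  have "{i, j} : indeps M"
  proof (rule ccontr)
   assume n: "{i, j} ~: indeps M"
   have ijn: "i : {1..n}" "j : {1..n}" using ij supp_subset[of D] by auto
   have "(i, inv (psi i) \<otimes> psi j, j) : dgains (M, psi)"
    unfolding mem_dgains using ijn nij n LM_D(5)[OF x] by (auto simp: m_assoc[symmetric])
   hence "block D i = block D j" using block_eq_iff[OF D ij(1)] d by blast
   thus False using AB(2) ij by simp
  qed
  moreover have "C = block D ` {i, j}" using AB(1) ij by simp
  ultimately have "C : indeps N" unfolding indeps_push using ij by blast
  thus False using C unfolding circuits_def by blast
 qed
 hence "simple_matroid N" unfolding simple_matroid_def loopless_def using nl by auto
 moreover have "ground N ~= {}" using pos unfolding nblocks_def by auto
 ultimately have "card (ground N) < 2 * matroid_rank N" using simple_bound[OF push_block_quasi] by blast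
 thus ?thesis using push_block_rank by (simp add: nblocks_def)
qed

end

end

section \<open>Compatibility of relative duality with the group action\<close>

context wreath_element
begin

lemma image_indep_singleton:
 assumes x: "(M, psi) : LM"
 shows "{sg i} : indeps (image_matroid sg M) <-> {i} : indeps M"
  "{sg i, sg j} : indeps (image_matroid sg M) <-> {i, j} : indeps M"
proof -
 have iff: "sg ` I : indeps (image_matroid sg M) <-> I : indeps M" for I
  unfolding indeps_image using sigma_inj_on[of UNIV] by (intro inj_image_mem_iff) (simp add: inj_def inj_image_eq_iff)
 show "{sg i} : indeps (image_matroid sg M) <-> {i} : indeps M" using iff[of "{i}"] by simp
 show "{sg i, sg j} : indeps (image_matroid sg M) <-> {i, j} : indeps M" using iff[of "{i, j}"] by simp
qed

lemma dgains_act: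
 assumes x: "(M, psi) : LM"
 shows "dgains (labeled_act G wr (M, psi)) = tact wr ` dgains (M, psi)"
proof (rule tact_image_eqI[OF dgains_triples dgains_triples])
 fix i a j assume c: "i <= n" "j <= n" "a : carrier G"
 have cl: "inv (gx i) \<otimes> phi a \<otimes> gx j : carrier G" using c gx_closed phi_closed by simp
 note s = image_indep_singleton[OF x]
 have "label_act G wr (ground M) psi (sg i) \<otimes> (inv (gx i) \<otimes> phi a \<otimes> gx j) = label_act G wr (ground M) psi (sg j)
  <-> psi i \<otimes> a = psi j" if "{i} : indeps M" "{j} : indeps M"
  by (rule label_equiv[OF x LM_nonloop(1)[OF x that(1)] LM_nonloop(1)[OF x that(2)] c(3)])
 thus "(sg i, inv (gx i) \<otimes> phi a \<otimes> gx j, sg j) : dgains (labeled_act G wr (M, psi)) <->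
   (i, a, j) : dgains (M, psi)"
  unfolding labeled_act_eq mem_dgains s sigma_inj using c cl sigma_le[OF c(1)] sigma_le[OF c(2)] by blast
qed

context
 fixes D assumes D: "gain_closed D" and stable: "tact wr ` D = D"
begin

lemma stable_mem: "(i, a, j) : D ==> (sg i, inv (gx i) \<otimes> phi a \<otimes> gx j, sg j) : D"
 using stable tact_eq[of i a j] by (metis imageI)

lemma stable_cases:
 assumes "(k, b, l) : D"
 obtains i a j where "(i, a, j) : D" "k = sg i" "b = inv (gx i) \<otimes> phi a \<otimes> gx j" "l = sg j"
proof -
 have "(k, b, l) : tact wr ` D" using assms stable by simp
 then obtain t where t: "(k, b, l) = tact wr t" "t : D" by (rule imageE)
 obtain i a j where te: "t = (i, a, j)" by (metis surj_pair)
 show thesis using that[of i a j] t unfolding te tact_eq by simp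
qed

lemma stable_zero: "i <= n ==> (sg i, \<one>, 0) : D <-> (i, \<one>, 0) : D"
proof
 assume i: "i <= n"
 have z: "(k, h, 0) : D" if "(k, g, 0) : D" "h : carrier G" for k g h
  using D that unfolding gain_closed_def by blast
 {
  assume "(sg i, \<one>, 0) : D"
  then obtain k a l where k: "(k, a, l) : D" "sg i = sg k" "0 = sg l" using stable_cases[of "sg i" \<one> 0] by metis
  have "l = 0" using k(3) sigma_zero sigma_inj[of l 0] by simp
  thus "(i, \<one>, 0) : D" using k(1,2) sigma_inj[of i k] z[of k a \<one>] by simp
 next
  assume "(i, \<one>, 0) : D"
  from stable_mem[OF this] show "(sg i, \<one>, 0) : D" unfolding sigma_zero by (rule z) simp
 }
qed

lemma stable_supp: "i : supp D <-> sg i : supp D"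
 unfolding supp_def using stable_zero[of i] sigma_mem[of i] by auto

lemma stable_supp_image: "sg ` supp D = supp D"
proof (rule card_subset_eq[OF finite_supp])
 show "sg ` supp D <= supp D" using stable_supp by blast
 show "card (sg ` supp D) = card (supp D)" by (rule card_image[OF sigma_inj_on])
qed

lemma stable_block: "block D (sg i) = sg ` block D i"
proof (intro subset_antisym subsetI)
 fix l assume "l : block D (sg i)"
 then obtain b where "(sg i, b, l) : D" unfolding block_def by blast
 then obtain k a j where k: "(k, a, j) : D" "sg i = sg k" "l = sg j" using stable_cases[of "sg i" b l] by metis
 hence "(i, a, j) : D" using sigma_inj[of i k] by simp
 thus "l : sg ` block D i" unfolding block_def k(3) by blast
next
 fix l assume "l : sg ` block D i"
 then obtain a j where "(i, a, j) : D" "l = sg j" unfolding block_def by blast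
 thus "l : block D (sg i)" unfolding block_def using stable_mem[of i a j] by blast
qed

lemma stable_compat:
 assumes x: "(M, psi) : LM" and c: "compat D psi"
 shows "compat D (label_act G wr (ground M) psi)" unfolding compat_def
proof (intro ballI allI impI)
 fix k b l assume k: "k : supp D" and t: "(k, b, l) : D"
 obtain i a j where i: "(i, a, j) : D" "k = sg i" "b = inv (gx i) \<otimes> phi a \<otimes> gx j" "l = sg j"
  using stable_cases[OF t] .
 have iS: "i : supp D" using k i(2) stable_supp by simp
 have jS: "j : supp D" using gain_supp[OF D i(1)] iS by simp
 have "i : {1..n}" "j : {1..n}" using iS jS supp_subset[of D] by auto
 from label_equiv[OF x this gain_triple(2)[OF D i(1)]]
 show "label_act G wr (ground M) psi k \<otimes> b = label_act G wr (ground M) psi l"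
  unfolding i(2,3,4) using c iS i(1) unfolding compat_def by blast
qed

text \<open>An element fixing \<open>D\<close> permutes its blocks, so it commutes with collapsing,
  dualizing and blowing up.\<close>

lemma reldual_image:
 assumes x: "(M, psi) : LM" and bc: "block_compatible (block D) (supp D) M"
 shows "reldual D (image_matroid sg M) = image_matroid sg (reldual D M)"
proof -
 let ?N = "push_matroid (block D) (supp D) M"
 have inj: "inj sg" by (rule sigma_inj_on)
 have injS: "inj_on ((`) sg) A" for A using inj by (simp add: inj_on_def inj_image_eq_iff)
 note N = push_block_matroid[OF D x bc]
 have "dual_matroid (push_matroid (block D) (supp D) (image_matroid sg M)) = image_matroid ((`) sg) (dual_matroid ?N)"
  unfolding push_image[where tau = "(`) sg" and b = "block D", OF stable_supp_image inj stable_block] by (rule dual_image[OF N(1) injS])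
 thus ?thesis unfolding reldual_def
  using pull_image[where tau = "(`) sg" and b = "block D", OF stable_supp_image sigma_image inj stable_block injS N(2)] by simp
qed

end

end

section \<open>The involution on classes above a flat\<close>

context dowling
begin

lemma dgc_lact:
 assumes g: "gm : carrier GG" and X: "X : A_set G n r"
 shows "dgc (lact gm X) = gact gm (dgc X)"
proof -
 obtain M psi where x: "(M, psi) : LM" "int (matroid_rank M) = r" "X = lcls (M, psi)" using A_set_cases[OF X] .
 note r = wrep[OF g]
 obtain h sg phi where we: "wrep gm = (h, sg, phi)" "wreath_element G n h sg phi" using W_cases[OF r(1)] .
 note L = wreath_element.labeled_act_LM(1)[OF we(2) x(1), folded we(1)]
 obtain N chi where y: "labeled_act G (wrep gm) (M, psi) = (N, chi)" by (metis surj_pair)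
 have "dgc (lact gm X) = dgains (labeled_act G (wrep gm) (M, psi))"
  unfolding x(3) lact_lcls[OF g r x(1)] using dgc_lcls L unfolding y by blast
 also have "... = gact gm (dgc X)"
  unfolding gact_def x(3) dgc_lcls[OF x(1)] using wreath_element.dgains_act[OF we(2) x(1)] we(1) by simp
 finally show ?thesis .
qed

text \<open>The representative has to satisfy \<open>compat\<close>; by
  \<open>reldual_lgains_cong\<close> the result does not depend on which one is chosen.\<close>

definition rdual :: "'g gains => 'g labeled_matroid set => 'g labeled_matroid set" where
 "rdual D X = (let x = SOME x. x : X & compat D (snd x) in lcls (reldual D (fst x), snd x))"

lemma rdual_lcls:
 assumes D: "gain_closed D" and x: "(M, psi) : LM" and bc: "block_compatible (block D) (supp D) M" and c: "compat D psi"
 shows "rdual D (lcls (M, psi)) = lcls (reldual D M, psi)"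
proof -
 define y where "y = (SOME x. x : lcls (M, psi) & compat D (snd x))"
 have "(M, psi) : lcls (M, psi) & compat D (snd (M, psi))" using lcls_self[OF x] c by simp
 hence "y : lcls (M, psi) & compat D (snd y)" unfolding y_def by (rule someI)
 then obtain chi where y: "y = (M, chi)" "(M, chi) : LM" "lgains (M, chi) = lgains (M, psi)" "compat D chi"
  unfolding lcls_eq[OF x] by auto
 have "rdual D (lcls (M, psi)) = lcls (reldual D M, chi)" unfolding rdual_def y_def[symmetric] y(1) by simp
 also have "... = lcls (reldual D M, psi)"
  using lcls_eq_iff[OF reldual_LM[OF D y(2) bc] reldual_LM[OF D x bc]]
   reldual_lgains_cong[OF D y(2) bc x y(4) c y(3)] by simp
 finally show ?thesis .
qed

definition above :: "'g gains => int => 'g labeled_matroid set set" where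
 "above D r = {X : A_set G n r. D <= dgc X}"

lemma above_cases:
 assumes D: "gain_closed D" and X: "X : above D r"
 obtains M psi where "(M, psi) : LM" "int (matroid_rank M) = r" "X = lcls (M, psi)" "D <= dgains (M, psi)"
  "compat D psi" "block_compatible (block D) (supp D) M"
proof -
 have XA: "X : A_set G n r" and XD: "D <= dgc X" using X unfolding above_def by auto
 obtain M psi where x: "(M, psi) : LM" "int (matroid_rank M) = r" "X = lcls (M, psi)" using A_set_cases[OF XA] .
 have DM: "D <= dgains (M, psi)" using XD dgc_lcls[OF x(1)] x(3) by simp
 obtain chi where c: "(M, chi) : LM" "lgains (M, chi) = lgains (M, psi)" "compat D chi" using compat_exists[OF x(1) D DM] .
 have "X = lcls (M, chi)" using lcls_eq_iff[OF x(1) c(1)] c(2) x(3) by simp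
 moreover have "D <= dgains (M, chi)" using dgains_cong[OF c(1) x(1) c(2)] DM by simp
 ultimately show thesis using that[of M chi] c x(2) block_compatible_dgains[OF x(1) D DM] by blast
qed

lemma above_mem:
 assumes D: "gain_closed D" and x: "(M, psi) : LM" "block_compatible (block D) (supp D) M" "compat D psi"
 shows "lcls (M, psi) : above D (int (matroid_rank M))"
proof -
 have "lcls (M, psi) : A_set G n (int (matroid_rank M))" unfolding A_set_eq using x(1) by auto
 thus ?thesis unfolding above_def using compat_dgains[OF x(1) D x(2,3)] dgc_lcls[OF x(1)] by simp
qed

lemma rdual_above:
 assumes D: "gain_closed D" and X: "X : above D r"
 shows "rdual D X : above D (int (nblocks D) - r)" "rdual D (rdual D X) = X"
proof -
 obtain M psi where x: "(M, psi) : LM" "int (matroid_rank M) = r" "X = lcls (M, psi)" "D <= dgains (M, psi)"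
  "compat D psi" "block_compatible (block D) (supp D) M" using above_cases[OF D X] .
 note L = reldual_LM[OF D x(1,6)] and bc = block_compatible_reldual[OF D x(1,6)]
 have e: "rdual D X = lcls (reldual D M, psi)" unfolding x(3) by (rule rdual_lcls[OF D x(1,6,5)])
 have "int (matroid_rank (reldual D M)) = int (nblocks D) - r" using reldual_rank[OF D x(1,6)] x(2) by linarith
 thus "rdual D X : above D (int (nblocks D) - r)" using above_mem[OF D L bc x(5)] e by simp
 show "rdual D (rdual D X) = X"
  unfolding e rdual_lcls[OF D L bc x(5)] reldual_reldual[OF D x(1,6)] using x(3) by simp
qed

lemma rdual_bij: "gain_closed D ==> bij_betw (rdual D) (above D r) (above D (int (nblocks D) - r))"
proof (rule bij_betw_byWitness[where f' = "rdual D"])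
 assume D: "gain_closed D"
 show "ALL X:above D r. rdual D (rdual D X) = X" using rdual_above(2)[OF D] by blast
 show "ALL X:above D (int (nblocks D) - r). rdual D (rdual D X) = X" using rdual_above(2)[OF D] by blast
 show "rdual D ` above D r <= above D (int (nblocks D) - r)" using rdual_above(1)[OF D] by blast
 have "rdual D X : above D r" if "X : above D (int (nblocks D) - r)" for X
  using rdual_above(1)[OF D that] by simp
 thus "rdual D ` above D (int (nblocks D) - r) <= above D r" by blast
qed

lemma rdual_lact:
 assumes D: "gain_closed D" and g: "gm : carrier GG" "gact gm D = D" and X: "X : above D r"
 shows "rdual D (lact gm X) = lact gm (rdual D X)"
proof -
 obtain M psi where x: "(M, psi) : LM" "int (matroid_rank M) = r" "X = lcls (M, psi)" "D <= dgains (M, psi)"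
  "compat D psi" "block_compatible (block D) (supp D) M" using above_cases[OF D X] .
 note r = wrep[OF g(1)]
 obtain h sg phi where we: "wrep gm = (h, sg, phi)" "wreath_element G n h sg phi" using W_cases[OF r(1)] .
 interpret A: wreath_element G n h sg phi by (rule we(2))
 have st: "tact A.wr ` D = D" using g(2) unfolding gact_def we(1) .
 note L = reldual_LM[OF D x(1,6)]
 let ?chi = "label_act G A.wr (ground M) psi"
 have e1: "lact gm X = lcls (image_matroid sg M, ?chi)"
  unfolding x(3) lact_lcls[OF g(1) r x(1)] unfolding we(1) A.labeled_act_eq by (rule refl)
 have e2: "lact gm (rdual D X) = lcls (image_matroid sg (reldual D M), ?chi)"
  unfolding x(3) rdual_lcls[OF D x(1,6,5)] lact_lcls[OF g(1) r L] unfolding we(1) A.labeled_act_eq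
  by (simp add: LM_D(3)[OF L] LM_D(3)[OF x(1)])
 have iL: "(image_matroid sg M, ?chi) : LM" using A.labeled_act_LM(1)[OF x(1)] unfolding A.labeled_act_eq .
 have c: "compat D ?chi" by (rule A.stable_compat[OF D st x(1,5)])
 have "dgains (image_matroid sg M, ?chi) = tact A.wr ` dgains (M, psi)"
  using A.dgains_act[OF x(1)] unfolding A.labeled_act_eq .
 moreover have "tact A.wr ` D <= tact A.wr ` dgains (M, psi)" by (rule image_mono[OF x(4)])
 ultimately have "D <= dgains (image_matroid sg M, ?chi)" using st by simp
 hence bc: "block_compatible (block D) (supp D) (image_matroid sg M)" by (rule block_compatible_dgains[OF iL D])
 show ?thesis unfolding e1 e2 rdual_lcls[OF D iL bc c] A.reldual_image[OF D st x(1,6)] by (rule refl)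
qed

end

lemma acts_on_subgroup:
 assumes "acts_on H Z a" "K <= carrier H" "Y <= Z" "!!h y. h : K ==> y : Y ==> a h y : Y"
 shows "acts_on (H\<lparr>carrier := K\<rparr>) Y a" unfolding acts_on_def
proof (intro conjI ballI)
 show "finite Y" using assms(1,3) finite_subset unfolding acts_on_def by blast
 fix y assume y: "y : Y"
 hence yZ: "y : Z" using assms(3) by blast
 show "a \<one>\<^bsub>H\<lparr>carrier := K\<rparr>\<^esub> y = y" using assms(1) yZ unfolding acts_on_def by simp
 fix h assume h: "h : carrier (H\<lparr>carrier := K\<rparr>)"
 show "a h y : Y" using assms(4) h y by simp
 fix g assume g: "g : carrier (H\<lparr>carrier := K\<rparr>)"
 have "h : carrier H" "g : carrier H" using g h assms(2) by auto
 thus "a (g \<otimes>\<^bsub>H\<lparr>carrier := K\<rparr>\<^esub> h) y = a g (a h y)" using assms(1) yZ unfolding acts_on_def by simp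
qed

section \<open>Classes exactly over a flat and strictly above it\<close>

context dowling
begin

definition exact :: "'g gains => int => 'g labeled_matroid set set" where
 "exact D r = {X : A_set G n r. dgc X = D}"

definition strict :: "'g gains => int => 'g labeled_matroid set set" where
 "strict D r = {X : A_set G n r. D < dgc X}"

lemma above_eq: "above D r = exact D r Un strict D r" and exact_strict_disjoint: "exact D r Int strict D r = {}"
 unfolding above_def exact_def strict_def by auto

text \<open>A matroid of rank \<open>r\<close> belongs to the coefficient of index
  \<open>nblocks D - r\<close>, so the last bound says that this index is less than half of
  \<open>nblocks D\<close>, the rank of the contraction.\<close>

lemma exact_bounds:
 assumes D: "gain_closed D" and X: "X : exact D r"
 shows "0 <= r" "r <= int (nblocks D)" "0 < nblocks D ==> int (nblocks D) < 2 * r"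
proof -
 have XA: "X : A_set G n r" and XD: "dgc X = D" using X unfolding exact_def by auto
 obtain M psi where x: "(M, psi) : LM" "int (matroid_rank M) = r" "X = lcls (M, psi)" using A_set_cases[OF XA] .
 have d: "dgains (M, psi) = D" using dgc_lcls[OF x(1)] XD x(3) by simp
 have bc: "block_compatible (block D) (supp D) M" using block_compatible_dgains[OF x(1) D] d by simp
 show "0 <= r" using x(2) by simp
 show "r <= int (nblocks D)" using rank_le_nblocks[OF D x(1) bc] x(2) by simp
 show "int (nblocks D) < 2 * r" if "0 < nblocks D" using rank_bound[OF D x(1) bc d that] x(2) by linarith
qed

lemma all_loops_LM: "(Matroid {1..n} {{}}, \<lambda>i\<in>{1..n}. \<one>) : LM"
proof -
 let ?E = "Matroid {} {{}} :: nat matroid" and ?b = "id :: nat => nat"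
 have E: "is_matroid ?E" by (simp add: is_matroid_def)
 have "quasi_series_parallel ?E" unfolding quasi_series_parallel_def components_def using E by (simp add: quotient_def)
 \<comment> \<open>The matroid consisting of loops is the blow-up of the empty matroid along the
   empty set.\<close>
 hence "quasi_series_parallel (pull_matroid ?b {} {1..n} ?E)"
  using quasi_series_parallel_pull[OF E, of "{1..n}" "{}" ?b] by simp
 moreover have "pull_matroid ?b {} {1..n} ?E = Matroid {1..n} {{}}"
  by (rule matroid_eqI) (auto simp: indeps_pull)
 ultimately show ?thesis unfolding LM_def by simp
qed

text \<open>The start of the induction: over the top flat every element is a loop, and labels of
  loops carry no information, so there is one class.\<close>

lemma exact_triples: "exact triples 0 = {lcls (Matroid {1..n} {{}}, \<lambda>i\<in>{1..n}. \<one>)}"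
proof (intro subset_antisym subsetI)
 let ?M = "Matroid {1..n} {{}}" and ?c = "\<lambda>i\<in>{1..n}. \<one>"
 note L = all_loops_LM
 have nl: "{i} ~: indeps ?M" for i :: nat by simp
 {
  fix X assume "X : exact triples 0"
  hence XA: "X : A_set G n 0" unfolding exact_def by simp
  obtain M psi where x: "(M, psi) : LM" "int (matroid_rank M) = 0" "X = lcls (M, psi)" using A_set_cases[OF XA] .
  note xM = LM_D[OF x(1)]
  have "I = {}" if I: "I : indeps M" for I
  proof -
   have "card I <= matroid_rank M"
    unfolding matroid_rank_def by (rule indep_le_rank[OF xM(2) I indep_ground[OF xM(2) I]])
   thus ?thesis using x(2) finite_indep[OF xM(2) I] by simp
  qed
  hence "indeps M = {{}}" using empty_indep[OF xM(2)] by blast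
  hence M: "M = ?M" using xM(3) by (intro matroid_eqI) simp_all
  have "lgains (?M, psi) = lgains (?M, ?c)"
  proof (rule triples_eqI[OF lgains_triples lgains_triples])
   fix i a j assume t: "(i, a, j) : triples"
   have "psi i \<otimes> a = psi j <-> ?c i \<otimes> a = ?c j" if "i : {1..n}" "(i, j) : connectivity_rel ?M"
   proof -
    have "i = j" by (rule loop_connected[OF nl that(2)])
    thus ?thesis using that(1) xM(5)[OF that(1)] t unfolding triples_def by simp
   qed
   thus "(i, a, j) : lgains (?M, psi) <-> (i, a, j) : lgains (?M, ?c)" unfolding lgains_def by auto
  qed
  thus "X : {lcls (?M, ?c)}" using lcls_eq_iff[OF x(1)[unfolded M] L] x(3) M by simp
 next
  fix X assume X: "X : {lcls (?M, ?c)}"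
  have "matroid_rank ?M = 0" unfolding matroid_rank_def rank_of_def by simp
  hence "lcls (?M, ?c) : A_set G n 0" unfolding A_set_eq using L by (intro imageI) simp
  moreover have "dgains (?M, ?c) = triples"
   by (rule triples_eqI[OF dgains_triples subset_refl]) (simp add: mem_dgains triples_def)
  ultimately show "X : exact triples 0" unfolding exact_def using X dgc_lcls[OF L] by simp
 }
qed

section \<open>Contractions of the Dowling geometry\<close>

lemma atset_subset: "gain_closed D ==> atset D <= ground Q"
 unfolding atset_def Q_spec(3) dowling_atoms_eq by blast

definition fl :: "'g gains => 'g gains => 'g dowling_class set" where
 "fl D E = atset E - atset D"

lemma fl_Un: "gain_closed D ==> gain_closed E ==> D <= E ==> fl D E Un atset D = atset E"
 unfolding fl_def using at_subset_iff[of D E] by auto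

lemma fl_inj:
 assumes D: "gain_closed D" and E: "gain_closed E" "D <= E" and F: "gain_closed F" "D <= F" and e: "fl D E = fl D F"
 shows "E = F" using at_inj[OF E(1) F(1)] fl_Un[OF D E] fl_Un[OF D F] e by simp

lemma fl_self: "fl D D = {}" by (simp add: fl_def)

lemma flats_dowling_contraction:
 assumes D: "gain_closed D"
 shows "F : flats (contraction Q (atset D)) <-> (EX E. gain_closed E & D <= E & F = fl D E)"
proof -
 note iff = flats_contraction[OF Q_spec(1) atset_subset[OF D], of F]
 show ?thesis
 proof
  assume F: "F : flats (contraction Q (atset D))"
  then obtain E where E: "gain_closed E" "F Un atset D = atset E" unfolding iff Q_spec(4) by blast
  have "D <= E" using at_subset_iff[OF D E(1)] E(2) by blast
  moreover have "F = fl D E" unfolding fl_def E(2)[symmetric] using F unfolding iff by blast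
  ultimately show "EX E. gain_closed E & D <= E & F = fl D E" using E(1) by blast
 next
  assume "EX E. gain_closed E & D <= E & F = fl D E"
  then obtain E where E: "gain_closed E" "D <= E" "F = fl D E" by blast
  have "F Un atset D = atset E" "F Int atset D = {}" using fl_Un[OF D E(1,2)] unfolding E(3) by (auto simp: fl_def)
  thus "F : flats (contraction Q (atset D))" unfolding iff Q_spec(4) using E(1) by blast
 qed
qed

lemma rank_fl:
 assumes D: "gain_closed D" and E: "gain_closed E" "D <= E"
 shows "rank_of (contraction Q (atset D)) (fl D E) + nblocks E = nblocks D"
proof -
 have "fl D E Int atset D = {}" unfolding fl_def by blast
 from rank_contraction[OF Q_spec(1) atset_subset[OF D] this]
 show ?thesis unfolding fl_Un[OF D E] using Q_spec(5)[OF D] Q_spec(5)[OF E(1)] by linarith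
qed

lemma rank_dowling_contraction:
 assumes D: "gain_closed D"
 shows "matroid_rank (contraction Q (atset D)) = nblocks D"
proof -
 have z: "nblocks triples = 0" using nblocks_zero_iff[OF triples_closed] by simp
 have "matroid_rank Q = n" unfolding matroid_rank_def Q_spec(3) at_triples[symmetric]
  using Q_spec(5)[OF triples_closed] z by simp
 thus ?thesis using matroid_rank_contraction[OF Q_spec(1) atset_subset[OF D]] Q_spec(5)[OF D] by simp
qed

text \<open>The action of \<open>K\<close> on the contraction by \<open>atset D\<close>, written as
  a restriction of the maps in \<open>Gamma\<close> themselves, so that contracting once more gives
  the same form again (\<open>contraction_fl\<close>).\<close>

definition qact :: "'g gains => ('g dowling_class => 'g dowling_class) set =>
  ('g dowling_class => 'g dowling_class) => 'g dowling_class => 'g dowling_class" where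
 "qact D K = (\<lambda>h\<in>K. restrict h (dowling_atoms G n - atset D))"

abbreviation "equivariant_flat D K \<equiv> equivariant_matroid (contraction Q (atset D)) (GG\<lparr>carrier := K\<rparr>) (qact D K)"

text \<open>The claim proved by induction. For \<open>D = bot_gains\<close> and the whole group it
  is the statement about the Kazhdan-Lusztig coefficients.\<close>

abbreviation "KL_flat D K i \<equiv> KL_rec (contraction Q (atset D)) (GG\<lparr>carrier := K\<rparr>) (qact D K) i =
 perm_class (GG\<lparr>carrier := K\<rparr>) (exact D (int (nblocks D) - int i)) lact"

lemma Gamma_inj_on: "gm : carrier GG ==> inj_on gm (dowling_atoms G n)"
 using tact_properties(4)[OF wrep(1), of gm] wrep(2)[of gm] by (simp add: Bij_def bij_betw_def)

lemma gact_mono: "D <= E ==> gact gm D <= gact gm E" unfolding gact_def by (rule image_mono)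

section \<open>The inductive step at a flat\<close>

context
 fixes D K
 assumes D: "gain_closed D" and K: "subgroup K GG" and stab: "!!gm. gm : K ==> gact gm D = D"
  and eqv: "equivariant_flat D K"
begin

private abbreviation "M \<equiv> contraction Q (atset D)"
private abbreviation "H \<equiv> GG\<lparr>carrier := K\<rparr>"

interpretation EM: eq_matroid M H "qact D K" by unfold_locales (rule eqv)

lemma K_Gamma: "gm : K ==> gm : carrier GG" using subgroup.subset[OF K] by blast

lemma act_fl:
 assumes g: "gm : K" and E: "gain_closed E" "D <= E"
 shows "qact D K gm ` fl D E = fl D (gact gm E)" "D <= gact gm E" "gain_closed (gact gm E)"
proof -
 note gG = K_Gamma[OF g]
 have sub: "atset E <= dowling_atoms G n" "atset D <= dowling_atoms G n"
  using atset_subset[OF E(1)] atset_subset[OF D] Q_spec(3) by auto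
 have "qact D K gm ` fl D E = gm ` (atset E - atset D)"
  unfolding qact_def fl_def using g sub by (intro image_cong) auto
 also have "... = gm ` atset E - gm ` atset D"
  using inj_on_image_set_diff[OF Gamma_inj_on[OF gG], of "atset E" "atset D"] sub by blast
 also have "... = fl D (gact gm E)" unfolding atset_gact[OF gG E(1)] atset_gact[OF gG D] stab[OF g] fl_def by (rule refl)
 finally show "qact D K gm ` fl D E = fl D (gact gm E)" .
 show "D <= gact gm E" using gact_mono[OF E(2), of gm] stab[OF g] by simp
 show "gain_closed (gact gm E)" by (rule gact_closed[OF gG E(1)])
qed

lemma fl_flat: "gain_closed E ==> D <= E ==> fl D E : flats M" using flats_dowling_contraction[OF D] by blast

lemma stab_fl:
 assumes E: "gain_closed E" "D <= E"
 shows "gm : flat_stab M H (qact D K) (fl D E) <-> gm : K & gact gm E = E"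
proof -
 have "qact D K gm ` fl D E = fl D E <-> gact gm E = E" if g: "gm : K"
  unfolding act_fl(1)[OF g E] using fl_inj[OF D act_fl(3)[OF g E] act_fl(2)[OF g E] E] by metis
 thus ?thesis unfolding EM.flat_stab_iff[OF fl_flat[OF E]] by (simp cong: conj_cong)
qed

text \<open>Contracting a second time gives the contraction of \<open>Q\<close> by the larger flat,
  with the stabilizer of \<open>E\<close> in \<open>K\<close> as group. This is why the induction
  ranges over all subgroups fixing a flat.\<close>

lemma contraction_fl:
 assumes E: "gain_closed E" "D <= E"
 shows "contraction M (fl D E) = contraction Q (atset E)"
  "contraction_action M H (qact D K) (fl D E) = qact E (flat_stab M H (qact D K) (fl D E))"
  "H\<lparr>carrier := flat_stab M H (qact D K) (fl D E)\<rparr> = GG\<lparr>carrier := flat_stab M H (qact D K) (fl D E)\<rparr>"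
  "subgroup (flat_stab M H (qact D K) (fl D E)) GG"
proof -
 let ?K = "flat_stab M H (qact D K) (fl D E)"
 show "contraction M (fl D E) = contraction Q (atset E)"
  unfolding contraction_contraction[OF Q_spec(1)] using fl_Un[OF D E] by (simp add: Un_commute)
 have "ground M - fl D E = dowling_atoms G n - atset E"
  unfolding ground_contraction Q_spec(3) using fl_Un[OF D E] by blast
 moreover have "restrict (qact D K h) (dowling_atoms G n - atset E) = restrict h (dowling_atoms G n - atset E)"
  if "h : ?K" for h
 proof -
  have "atset D <= atset E" using at_subset_iff[OF D E(1)] E(2) by simp
  moreover have "h : K" using stab_fl[OF E] that by simp
  ultimately show ?thesis unfolding qact_def by (intro restrict_ext) auto
 qed
 ultimately show "contraction_action M H (qact D K) (fl D E) = qact E ?K"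
  unfolding contraction_action_def qact_def[of E] by (intro restrict_ext) simp
 show "H\<lparr>carrier := ?K\<rparr> = GG\<lparr>carrier := ?K\<rparr>" by simp
 show "subgroup ?K GG" by (rule group.incl_subgroup[OF group_Gamma K EM.subgroup_stab[OF fl_flat[OF E]]])
qed

lemma acts_on_stable:
 assumes "Y <= A_set G n r" "!!h y. h : K ==> y : Y ==> lact h y : Y"
 shows "acts_on H Y lact" by (rule acts_on_subgroup[OF acts_on_A_set subgroup.subset[OF K] assms])

lemma acts_on_exact: "acts_on H (exact D r) lact"
 by (rule acts_on_stable[of _ r]) (use dgc_lact lact_A_set K_Gamma stab in \<open>auto simp: exact_def\<close>)

lemma acts_on_above: "acts_on H (above D r) lact"
proof (rule acts_on_stable[of _ r])
 show "above D r <= A_set G n r" unfolding above_def by blast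
 fix h y assume h: "h : K" and y: "y : above D r"
 hence "y : A_set G n r" "D <= gact h (dgc y)" using gact_mono[of D "dgc y" h] stab[OF h] unfolding above_def by auto
 thus "lact h y : above D r"
  unfolding above_def using lact_A_set[OF K_Gamma[OF h]] dgc_lact[OF K_Gamma[OF h]] by simp
qed

lemma acts_on_strict: "acts_on H (strict D r) lact"
proof (rule acts_on_stable[of _ r])
 show "strict D r <= A_set G n r" unfolding strict_def by blast
 fix h y assume h: "h : K" and y: "y : strict D r"
 hence yA: "y : A_set G n r" "D < dgc y" unfolding strict_def by auto
 note c = gain_closed_dgc[OF yA(1)] and hG = K_Gamma[OF h]
 have s: "D <= gact h (dgc y)" using gact_mono[of D "dgc y" h] stab[OF h] yA(2) by simp
 moreover have "D ~= gact h (dgc y)"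
 proof
  assume "D = gact h (dgc y)"
  hence "nblocks (dgc y) = nblocks D" using nblocks_gact[OF hG c] by simp
  thus False using nblocks_mono(2)[OF D c] yA(2) by blast
 qed
 ultimately show "lact h y : strict D r"
  unfolding strict_def using lact_A_set[OF hG yA(1)] dgc_lact[OF hG yA(1)] by blast
qed

lemma perm_class_above:
 "perm_class H (above D r) lact = perm_class H (exact D r) lact \<oplus>\<^bsub>VRep H\<^esub> perm_class H (strict D r) lact"
 unfolding above_eq by (rule perm_class_Un[OF EM.group_H acts_on_exact acts_on_strict exact_strict_disjoint])

lemma perm_class_above_dual: "perm_class H (above D r) lact = perm_class H (above D (int (nblocks D) - r)) lact"
 by (rule perm_class_bij[OF EM.group_H acts_on_above acts_on_above rdual_bij[OF D]])
  (simp add: rdual_lact[OF D K_Gamma stab])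

text \<open>The classes whose flat lies in one orbit. For the orbits other than \<open>{{}}\<close>
  these are the pieces of \<open>strict D r\<close> contributed by the single terms of
  \<open>Z_rest\<close>.\<close>

definition over :: "'g dowling_class set set => int => 'g labeled_matroid set set" where
 "over Ob r = {X : A_set G n r. D <= dgc X & fl D (dgc X) : Ob}"

lemma over_lact:
 assumes Ob: "Ob : EM.orbs" and h: "h : K" and X: "X : over Ob r"
 shows "lact h X : over Ob r" "fl D (dgc (lact h X)) = qact D K h ` fl D (dgc X)"
proof -
 have XA: "X : A_set G n r" "D <= dgc X" "fl D (dgc X) : Ob" using X unfolding over_def by auto
 note c = gain_closed_dgc[OF XA(1)] and e = dgc_lact[OF K_Gamma[OF h] XA(1)]
 note f = act_fl[OF h c XA(2)]
 show eq: "fl D (dgc (lact h X)) = qact D K h ` fl D (dgc X)" unfolding e f(1) by (rule refl)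
 have "qact D K h ` fl D (dgc X) : (%h. qact D K h ` fl D (dgc X)) ` carrier H" using h by simp
 hence "qact D K h ` fl D (dgc X) : Ob" using EM.orbs_transitive[OF Ob XA(3)] by simp
 thus "lact h X : over Ob r" unfolding over_def using lact_A_set[OF K_Gamma[OF h] XA(1)] f(2) e eq by simp
qed

lemma over_exact:
 assumes Ob: "Ob : EM.orbs" and E: "gain_closed E" "D <= E" "fl D E : Ob" and X: "X : over Ob r"
 obtains h where "h : K" "lact h X : exact E r"
proof -
 have XA: "X : A_set G n r" "D <= dgc X" "fl D (dgc X) : Ob" using X unfolding over_def by auto
 have "fl D E : (%h. qact D K h ` fl D (dgc X)) ` carrier H" using EM.orbs_transitive[OF Ob XA(3)] E(3) by simp
 then obtain h where h: "h : K" "fl D E = qact D K h ` fl D (dgc X)" by auto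
 note o = over_lact[OF Ob h(1) X]
 have oA: "lact h X : A_set G n r" "D <= dgc (lact h X)" using o(1) unfolding over_def by auto
 have "fl D (dgc (lact h X)) = fl D E" using o(2) h(2) by simp
 from fl_inj[OF D gain_closed_dgc[OF oA(1)] oA(2) E(1,2) this]
 have "lact h X : exact E r" unfolding exact_def using oA(1) by simp
 thus thesis using that h(1) by blast
qed

text \<open>The stabilizer of the chosen flat acts on the classes exactly over it, and the
  translates of this set fill the part over the orbit; so \<open>Ind_perm_class\<close> turns the
  inductive hypothesis into the claim.\<close>

lemma Z_term_dowling:
 assumes IH: "!!E L j. gain_closed E ==> D < E ==> subgroup L GG ==> (!!gm. gm : L ==> gact gm E = E) ==>
   equivariant_flat E L ==> KL_flat E L j"
  and Ob: "Ob : EM.orbs" "Ob ~= {{}}"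
 shows "Z_term KL_rec M H (qact D K) i Ob = perm_class H (over Ob (int (nblocks D) - int i)) lact"
  "acts_on H (over Ob (int (nblocks D) - int i)) lact"
proof -
 let ?r = "int (nblocks D) - int i"
 define F where "F = (SOME F. F : Ob)"
 have FO: "F : Ob" and Ff: "F : flats M" using EM.orbs_some[OF Ob(1)] EM.orbs_some_flat[OF Ob(1)] unfolding F_def by auto
 obtain E where E: "gain_closed E" "D <= E" "F = fl D E" using Ff flats_dowling_contraction[OF D] by blast
 have "F ~= {}" using EM.orbs_empty_iff[OF Ob(1)] Ob(2) FO by blast
 hence DE: "D < E" using E(2,3) fl_self by blast
 let ?K = "flat_stab M H (qact D K) (fl D E)"
 note cf = contraction_fl[OF E(1,2)] and rk = rank_fl[OF D E(1,2)]
 have flO: "fl D E : Ob" using FO E(3) by simp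
 show act: "acts_on H (over Ob ?r) lact"
  by (rule acts_on_stable[of _ ?r]) (use over_lact(1)[OF Ob(1)] in \<open>auto simp: over_def\<close>)
 show "Z_term KL_rec M H (qact D K) i Ob = perm_class H (over Ob ?r) lact"
 proof (cases "rank_of M F <= i")
  case True
  have "equivariant_matroid (contraction M (fl D E)) (H\<lparr>carrier := ?K\<rparr>) (contraction_action M H (qact D K) (fl D E))"
   by (rule EM.equivariant_contraction[OF fl_flat[OF E(1,2)]])
  hence eq: "equivariant_matroid (contraction Q (atset E)) (GG\<lparr>carrier := ?K\<rparr>) (qact E ?K)" unfolding cf(1,2,3) .
  \<comment> \<open>The rank of the flat plus \<open>nblocks E\<close> is \<open>nblocks D\<close>,
    so lowering the degree by the rank of the flat leaves the rank of the matroids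
    unchanged.\<close>
  have idx: "int (nblocks E) - int (i - rank_of M F) = ?r" using rk[folded E(3)] True by (simp add: of_nat_diff)
  have "KL_rec (contraction M F) (H\<lparr>carrier := ?K\<rparr>) (contraction_action M H (qact D K) F) (i - rank_of M F) =
    perm_class (H\<lparr>carrier := ?K\<rparr>) (exact E ?r) lact"
   using IH[OF E(1) DE cf(4) _ eq, of "i - rank_of M F"] stab_fl[OF E(1,2)] idx cf(1,2,3) E(3) by simp
  hence "Z_term KL_rec M H (qact D K) i Ob = Ind H ?K (perm_class (H\<lparr>carrier := ?K\<rparr>) (exact E ?r) lact)"
   unfolding Z_term_def F_def[symmetric] Let_def using True E(3) by simp
  also have "... = perm_class H (over Ob ?r) lact"
  proof (rule finite_group_subgroup.Ind_perm_class[OF EM.stab_locale[OF fl_flat[OF E(1,2)]] act])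
   show sub: "exact E ?r <= over Ob ?r" unfolding exact_def over_def using E(2) flO by auto
   fix h y assume h: "h : carrier H" and y: "y : exact E ?r"
   have yA: "y : A_set G n ?r" "dgc y = E" using y unfolding exact_def by auto
   have hK: "h : K" using h by simp
   show "lact h y : exact E ?r <-> h : ?K" unfolding stab_fl[OF E(1,2)] exact_def
    using lact_A_set[OF K_Gamma[OF hK] yA(1)] dgc_lact[OF K_Gamma[OF hK] yA(1)] yA(2) hK by simp
  next
   fix z assume z: "z : over Ob ?r"
   obtain h where h: "h : K" "lact h z : exact E ?r" using over_exact[OF Ob(1) E(1,2) flO z] .
   have hH: "h : carrier H" using h(1) by simp
   have a: "lact (x \<otimes>\<^bsub>H\<^esub> y) z = lact x (lact y z)" if "x : carrier H" "y : carrier H" for x y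
    using act z that unfolding acts_on_def by blast
   have "lact (inv\<^bsub>H\<^esub> h) (lact h z) = lact \<one>\<^bsub>H\<^esub> z"
    using a[OF group.inv_closed[OF EM.group_H hH] hH] unfolding group.l_inv[OF EM.group_H hH] by simp
   also have "... = z" using act z unfolding acts_on_def by blast
   finally have "z = lact (inv\<^bsub>H\<^esub> h) (lact h z)" by simp
   thus "EX h:carrier H. EX y:exact E ?r. z = lact h y" using h(2) group.inv_closed[OF EM.group_H hH] by blast
  qed
  finally show ?thesis .
 next
  case False
  \<comment> \<open>The term is zero by definition here; on the other side, a matroid exactly over
    \<open>E\<close> would need rank larger than \<open>nblocks E\<close>.\<close>
  have "over Ob ?r = {}"
  proof (rule equals0I)
   fix z assume z: "z : over Ob ?r"
   obtain h where h: "h : K" "lact h z : exact E ?r" using over_exact[OF Ob(1) E(1,2) flO z] .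
   show False using exact_bounds(2)[OF E(1) h(2)] rk[folded E(3)] False by linarith
  qed
  thus ?thesis
   unfolding Z_term_def F_def[symmetric] Let_def using False by (simp add: perm_class_empty[OF EM.group_H])
 qed
qed

text \<open>Lying strictly above \<open>D\<close> means giving a nonempty flat of the contraction,
  and the orbits of nonempty flats partition these classes.\<close>

lemma Z_rest_dowling:
 assumes IH: "!!E L j. gain_closed E ==> D < E ==> subgroup L GG ==> (!!gm. gm : L ==> gact gm E = E) ==>
   equivariant_flat E L ==> KL_flat E L j"
 shows "Z_rest KL_rec M H (qact D K) i = perm_class H (strict D (int (nblocks D) - int i)) lact"
proof -
 let ?r = "int (nblocks D) - int i" and ?I = "EM.orbs - {{{}}}"
 interpret V: abelian_group "VRep H" by (rule group_VRep[OF EM.group_H])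
 have act: "acts_on H (over Ob ?r) lact" if "Ob : ?I" for Ob using Z_term_dowling(2)[OF IH] that by blast
 have "Z_rest KL_rec M H (qact D K) i = (\<Oplus>\<^bsub>VRep H\<^esub> Ob \<in> ?I. Z_term KL_rec M H (qact D K) i Ob)"
  by (rule EM.Z_rest_closed(3)) (rule EM.KL_flat_closed)
 also have "... = (\<Oplus>\<^bsub>VRep H\<^esub> Ob \<in> ?I. perm_class H (over Ob ?r) lact)"
 proof (rule V.finsum_cong'[OF refl])
  show "(%Ob. perm_class H (over Ob ?r) lact) : ?I \<rightarrow> carrier (VRep H)"
   using perm_class_closed[OF EM.group_H act] by blast
  show "Z_term KL_rec M H (qact D K) i Ob = perm_class H (over Ob ?r) lact" if "Ob : ?I" for Ob
   by (rule Z_term_dowling(1)[OF IH]) (use that in auto)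
 qed
 also have "... = perm_class H (\<Union>Ob\<in>?I. over Ob ?r) lact"
 proof (rule perm_class_Union[symmetric, OF EM.group_H _ act])
  show "finite ?I" using EM.finite_orbs by simp
  fix Ob Ob' assume Ob: "Ob : ?I" "Ob' : ?I" "Ob ~= Ob'"
  show "over Ob ?r Int over Ob' ?r = {}"
  proof (rule equals0I)
   fix X assume "X : over Ob ?r Int over Ob' ?r"
   hence "fl D (dgc X) : Ob" "fl D (dgc X) : Ob'" unfolding over_def by auto
   thus False using EM.orbs_disjoint[of Ob Ob'] Ob by blast
  qed
 qed
 also have "(\<Union>Ob\<in>?I. over Ob ?r) = strict D ?r"
 proof (intro subset_antisym subsetI)
  fix X assume "X : (\<Union>Ob\<in>?I. over Ob ?r)"
  then obtain Ob where Ob: "Ob : EM.orbs" "Ob ~= {{}}" "X : over Ob ?r" by blast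
  hence X: "X : A_set G n ?r" "D <= dgc X" "fl D (dgc X) : Ob" unfolding over_def by auto
  have "fl D (dgc X) ~= {}" using EM.orbs_empty_iff[OF Ob(1)] Ob(2) X(3) by metis
  hence "D ~= dgc X" using fl_self by metis
  thus "X : strict D ?r" unfolding strict_def using X by blast
 next
  fix X assume "X : strict D ?r"
  hence X: "X : A_set G n ?r" "D <= dgc X" "D ~= dgc X" unfolding strict_def by auto
  note c = gain_closed_dgc[OF X(1)]
  obtain Ob where Ob: "Ob : EM.orbs" "fl D (dgc X) : Ob" using EM.orbs_cover[OF fl_flat[OF c X(2)]] by blast
  have "Ob ~= {{}}"
  proof
   assume "Ob = {{}}"
   hence "fl D D = fl D (dgc X)" using Ob(2) fl_self[of D] by simp
   thus False using fl_inj[OF D D subset_refl c X(2)] X(3) by blast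
  qed
  thus "X : (\<Union>Ob\<in>?I. over Ob ?r)" using Ob X unfolding over_def by blast
 qed
 finally show ?thesis .
qed

text \<open>With C and S for the classes exactly over and strictly above \<open>D\<close>, and
  \<open>d\<close> the number of blocks, duality gives
  \<open>C (d - i) + S (d - i) = C i + S i\<close>. For \<open>2 * i < d\<close> the rank bound
  makes \<open>C i\<close> vanish, and what remains is the recursion for the coefficient of index
  \<open>i\<close>.\<close>

lemma KL_rec_dowling_step:
 assumes R: "!!i. Z_rest KL_rec M H (qact D K) i = perm_class H (strict D (int (nblocks D) - int i)) lact"
 shows "KL_rec M H (qact D K) i = perm_class H (exact D (int (nblocks D) - int i)) lact"
proof -
 let ?d = "nblocks D" and ?C = "%r. perm_class H (exact D r) lact" and ?S = "%r. perm_class H (strict D r) lact"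
 interpret V: abelian_group "VRep H" by (rule group_VRep[OF EM.group_H])
 note rk = rank_dowling_contraction[OF D]
 have Cc: "?C r : carrier (VRep H)" and Sc: "?S r : carrier (VRep H)" for r
  using perm_class_closed[OF EM.group_H acts_on_exact] perm_class_closed[OF EM.group_H acts_on_strict] by auto
 have C0: "?C r = \<zero>\<^bsub>VRep H\<^esub>" if "exact D r = {}" for r
  unfolding that by (rule perm_class_empty[OF EM.group_H])
 have step: "KL_rec M H (qact D K) i = KL_step KL_rec M H (qact D K) i" by (rule KL_rec_step[OF eqv])
 consider (zero) "?d = 0" | (low) "?d > 0" "2 * i < ?d" | (high) "?d > 0" "\<not> 2 * i < ?d" by linarith
 thus ?thesis
 proof cases
  case zero
  hence DT: "D = triples" using nblocks_zero_iff[OF D] by simp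
  show ?thesis
  proof (cases "i = 0")
   case True
   have ex: "exact D 0 = {lcls (Matroid {1..n} {{}}, \<lambda>i\<in>{1..n}. \<one>)}" unfolding DT by (rule exact_triples)
   have "?C 0 = \<one>\<^bsub>VRep H\<^esub>"
    using acts_on_exact[of 0] unfolding ex by (rule perm_class_singleton[OF EM.group_H])
   thus ?thesis unfolding step KL_step_def rk using zero True by simp
  next
   case False
   have "exact D (int ?d - int i) = {}" using exact_bounds(1)[OF D] False zero by fastforce
   thus ?thesis unfolding step KL_step_def rk using zero False C0 by simp
  qed
 next
  case low
  have e: "exact D (int i) = {}"
  proof (rule equals0I)
   fix X assume "X : exact D (int i)"
   from exact_bounds(3)[OF D this low(1)] show False using low(2) by linarith
  qed
  have "?C (int ?d - int i) \<oplus>\<^bsub>VRep H\<^esub> ?S (int ?d - int i) = ?S (int i)"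
  proof -
   have "?C (int ?d - int i) \<oplus>\<^bsub>VRep H\<^esub> ?S (int ?d - int i) = perm_class H (above D (int ?d - int i)) lact"
    by (rule perm_class_above[symmetric])
   also have "... = perm_class H (above D (int i)) lact" using perm_class_above_dual[of "int i"] by simp
   also have "... = ?C (int i) \<oplus>\<^bsub>VRep H\<^esub> ?S (int i)" by (rule perm_class_above)
   also have "... = ?S (int i)" unfolding C0[OF e] using Sc by simp
   finally show ?thesis .
  qed
  hence "?C (int ?d - int i) = ?S (int i) \<ominus>\<^bsub>VRep H\<^esub> ?S (int ?d - int i)"
   using Cc[of "int ?d - int i"] Sc[of "int ?d - int i"] by (metis V.add.inv_solve_right' V.minus_eq Sc)
  \<comment> \<open>Degree and rank run in opposite directions: \<open>Z_rest\<close> in degree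
    \<open>?d - i\<close> is the class for rank \<open>i\<close>, and in degree \<open>i\<close> the
    class for rank \<open>?d - i\<close>.\<close>
  moreover have "int ?d - int (?d - i) = int i" using low by simp
  ultimately show ?thesis unfolding step KL_step_def rk R using low by simp
 next
  case high
  have "exact D (int ?d - int i) = {}"
  proof (rule equals0I)
   fix X assume "X : exact D (int ?d - int i)"
   from exact_bounds(3)[OF D this high(1)] have "2 * int i < int ?d" by simp
   hence "2 * i < ?d" by linarith
   thus False using high(2) by simp
  qed
  thus ?thesis unfolding step KL_step_def rk using high C0 by simp
 qed
qed

end

lemma KL_rec_dowling:
 assumes "gain_closed D" "subgroup K GG" "!!gm. gm : K ==> gact gm D = D"
  "equivariant_flat D K"
 shows "KL_flat D K i" using assms
proof (induction "nblocks D" arbitrary: D K i rule: less_induct)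
 case less
 note H = less.prems
 have IH: "KL_flat E L j"
  if h: "gain_closed E" "D < E" "subgroup L GG" "!!gm. gm : L ==> gact gm E = E"
   "equivariant_flat E L" for E L j
 proof -
  have "nblocks E <= nblocks D" "nblocks E ~= nblocks D" using nblocks_mono[OF H(1) h(1)] h(2) by auto
  hence "nblocks E < nblocks D" by simp
  from less.hyps[OF this h(1,3,4,5)] show ?thesis .
 qed
 have R: "Z_rest KL_rec (contraction Q (atset D)) (GG\<lparr>carrier := K\<rparr>) (qact D K) j =
   perm_class (GG\<lparr>carrier := K\<rparr>) (strict D (int (nblocks D) - int j)) lact" for j
  by (rule Z_rest_dowling[OF H IH])
 show ?case by (rule KL_rec_dowling_step[OF H R])
qed

text \<open>The case of the bottom flat and the full group. Every class lies above
  \<open>bot_gains\<close>, and exactly over it lie the simple ones, so exact plus strict is all of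
  \<open>A_set\<close>.\<close>

lemma dowling_KL_Z:
 shows "KL_rec Q GG (Gamma_action G n) i = perm_class GG (S_set G n (int n - int i)) lact"
  "KL_rec Q GG (Gamma_action G n) i \<oplus>\<^bsub>VRep GG\<^esub> Z_rest KL_rec Q GG (Gamma_action G n) i =
   perm_class GG (A_set G n (int n - int i)) lact"
proof -
 note B = bot_gains_closed
 have K: "subgroup (carrier GG) GG" by (rule group.subgroup_self[OF group_Gamma])
 have stab: "gact gm bot_gains = bot_gains" if "gm : carrier GG" for gm
  using nblocks_n_iff[OF gact_closed[OF that B]] nblocks_gact[OF that B] nblocks_bot by simp
 have Q: "contraction Q (atset bot_gains) = Q" unfolding at_bot by (rule contraction_empty[OF Q_spec(1)])
 have G: "GG\<lparr>carrier := carrier GG\<rparr> = GG" by simp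
 have a: "qact bot_gains (carrier GG) = Gamma_action G n" unfolding qact_def Gamma_action_def at_bot
 proof (rule restrict_ext)
  fix gm assume g: "gm : carrier GG"
  have "gm : extensional (dowling_atoms G n)"
   using tact_properties(4)[OF wrep(1)[OF g]] wrep(2)[OF g] by (simp add: Bij_def)
  thus "restrict gm (dowling_atoms G n - {}) = gm" by (simp add: extensional_restrict)
 qed
 have eqv: "equivariant_matroid (contraction Q (atset bot_gains)) (GG\<lparr>carrier := carrier GG\<rparr>) (qact bot_gains (carrier GG))"
  unfolding Q G a by (rule equivariant_dowling)
 note args = B K stab eqv
 have Kr: "KL_rec Q GG (Gamma_action G n) i = perm_class GG (exact bot_gains (int n - int i)) lact"
  using KL_rec_dowling[OF args, of i] unfolding Q G a nblocks_bot by simp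
 have "exact bot_gains r = S_set G n r" for r unfolding exact_def S_set_dgc by (rule refl)
 thus "KL_rec Q GG (Gamma_action G n) i = perm_class GG (S_set G n (int n - int i)) lact" using Kr by simp
 have Zr: "Z_rest KL_rec Q GG (Gamma_action G n) i = perm_class GG (strict bot_gains (int n - int i)) lact"
 proof -
  have "Z_rest KL_rec (contraction Q (atset bot_gains)) (GG\<lparr>carrier := carrier GG\<rparr>) (qact bot_gains (carrier GG)) i =
    perm_class (GG\<lparr>carrier := carrier GG\<rparr>) (strict bot_gains (int (nblocks bot_gains) - int i)) lact"
   by (rule Z_rest_dowling[OF args KL_rec_dowling])
  thus ?thesis unfolding Q G a nblocks_bot .
 qed
 have ab: "above bot_gains r = A_set G n r" for r
  unfolding above_def using bot_gains_least[OF gain_closed_dgc] by blast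
 show "KL_rec Q GG (Gamma_action G n) i \<oplus>\<^bsub>VRep GG\<^esub> Z_rest KL_rec Q GG (Gamma_action G n) i =
   perm_class GG (A_set G n (int n - int i)) lact"
  using perm_class_above[OF args, of "int n - int i"] unfolding Kr Zr ab G by simp
qed

end

theorem theorem1p1:
  fixes G :: "('g, 'b) monoid_scheme" and n i :: nat
  assumes "group G" and "finite (carrier G)"
  shows "coeff (UP (VRep (Gamma G n)))
           (equivariant_KL (dowling_geometry G n) (Gamma G n) (Gamma_action G n)) i =
         vrep_class (Gamma G n)
           (perm_rep (S_set G n (int n - int i)) (Gamma_labeled_action G n)) \<and>
         coeff (UP (VRep (Gamma G n)))
           (equivariant_Z (dowling_geometry G n) (Gamma G n) (Gamma_action G n)) i =
         vrep_class (Gamma G n)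
           (perm_rep (A_set G n (int n - int i)) (Gamma_labeled_action G n))"
proof -
 interpret dowling G n using assms by (simp add: dowling_def dowling_axioms_def)
 interpret EM: eq_matroid Q GG "Gamma_action G n" by unfold_locales (rule equivariant_dowling)
 have Z: "equivariant_Z Q GG (Gamma_action G n) = Z_of KL_rec Q GG (Gamma_action G n)"
 proof
  fix j
  show "equivariant_Z Q GG (Gamma_action G n) j = Z_of KL_rec Q GG (Gamma_action G n) j"
   unfolding equivariant_Z_eq[OF equivariant_dowling] using EM.Z_of_split(2)[OF EM.KL_flat_closed] by simp
 qed
 have c: "KL_rec Q GG (Gamma_action G n) : carrier (UP (VRep GG))"
  "equivariant_Z Q GG (Gamma_action G n) : carrier (UP (VRep GG))"
  using EM.KL_rec_properties unfolding Z palindromic_def by blast+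
 show ?thesis unfolding equivariant_KL_eq[OF equivariant_dowling] coeff_UP[OF c(1)] coeff_UP[OF c(2)]
   equivariant_Z_eq[OF equivariant_dowling] perm_class_def[symmetric] using dowling_KL_Z by blast
qed

end
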